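(* Let $(\mathcal G,\mathcal X,(I_g)_{g\in\mathcal G},\delta,\mathsf b,\mathsf d,N,\beta,\gamma)$ be $\mathcal G$-LW data over $\mathbb C$, let $\Sigma$ be a compact connected oriented surface with a triangulation and dual finite trivalent graph $\Gamma$, and let $\Phi$ be an admissible $\mathcal G$-coloring of $\Gamma$. Let $$H=\sum_p(1-B_p)+\sum_v(1-Q_v):\mathcal H(\Gamma,\Phi)\to\mathcal H(\Gamma,\Phi),$$ the sums being over all plaquettes $p$ and all vertices $v$ of $\Gamma$. Then: (1) $H$ is Hermitian with respect to the (in general indefinite) inner product $\langle\cdot\mid\cdot\rangle$ on $\mathcal H(\Gamma,\Phi)$. (2) $H$ is gapped and local. (3) The spectrum of $H$ is $\mathbb Z_{\ge0}$, with ground state corresponding to the simultaneous $+1$-eigenspace of the operators $B_p$ and $Q_v$ over all vertices $v$ and plaquettes $p$.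
   Context: **$\mathcal G$-LW data** over a field $\Bbbk$ with involutive automorphism $x\mapsto\bar x$ (here $\Bbbk=\mathbb C$ with complex conjugation) consist of: (1) an abelian group $(\mathcal G,+)$; (2) a subset $\mathcal X\subset\mathcal G$ that is symmetric ($-\mathcal X=\mathcal X$) and small (for every finite $Y\subset \mathcal G$, $\mathcal G\not\subset Y+\mathcal X$); elements of $\mathcal G\setminus\mathcal X$ are called generic; (3) a set $I_g$ for each $g\in\mathcal G\setminus\mathcal X$; write $|j|=g$ for $j\in I_g$ (the degree of $j$); (4) an involution $*$ on $\mathsf A=\bigsqcup_{g\in\mathcal G\setminus\mathcal X} I_g$ with $I_g^*=I_{-g}$; (5) a map $\delta:\mathsf A^3\to\mathbb N$ with $\delta_{ijk}=\delta_{jki}=\delta_{k^*j^*i^*}$ and $\delta_{ijk}=0$ unless $|i|+|j|+|k|=0$; (6) maps $\mathsf d,\mathsf b:\mathsf A\to\Bbbk^*$ with $\overline{\mathsf b}=\mathsf b$, $\overline{\mathsf d}=\mathsf d$, $\mathsf b(i^* )=\mathsf b(i)$, $\mathsf d(i^* )=\mathsf d(i)$ and, whenever $g,g_1,g_2$ are generic with $g=g_1+g_2$, $\mathsf b(j)=\sum_{j_1\in I_{g_1},j_2\in I_{g_2}}\mathsf b(j_1)\mathsf b(j_2)\delta_{j^*j_1j_2}$ for all $j\in I_g$; (7) a map $\beta:\mathsf A\to\Bbbk^*$ and scalars $\gamma^n_{i,j,k}\in\Bbbk^*$ ($i,j,k\in\mathsf A$, $1\le n\le\delta_{ijk}$)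 with $\overline\gamma=\gamma$, $\overline\beta=\beta$, $\beta(i^* )=\beta(i)$ and $\gamma^n_{i,j,k}\gamma^n_{k^*,j^*,i^*}\beta(i)\beta(j)\beta(k)=1$ for $1\le n\le\delta_{ijk}$; (8) modified $6j$-symbols $N:\mathsf A^6\times(\mathbb N^* )^4\to\Bbbk$, with $N^{j_1j_2j_3}_{j_4j_5j_6}(^{a_1a_2}_{a_3a_4})=0$ unless $1\le a_1\le\delta_{j_1j_2j_3^*}$, $1\le a_2\le\delta_{j_3j_4j_5^*}$, $1\le a_3\le\delta_{j_5j_6^*j_1^*}$, $1\le a_4\le\delta_{j_6j_4^*j_2^*}$. They satisfy: (a) $N^{j_1 j_2 j_3}_{j_4 j_5 j_6}(^{a_1a_2}_{a_3a_4})= N^{j_2 j_3^*j_1^* }_{j_5 j_6j_4 }(^{a_1a_3}_{a_4a_2})= N^{j_3 j_4 j_5}_{j_6^* j_1 j_2^*}(^{a_2a_3}_{a_1a_4})$; (b) $\sum_{j,c_1,c_2,c_3}\mathsf d(j)N^{j_1 j_2 j_5}_{j_3 j_6 j}(^{a_1a_2}_{c_1c_2}) N^{j_1 j j_6}_{j_4 j_0 j_7}(^{c_1a_3}_{a_0c_3})N^{j_2 j_3 j}_{j_4 j_7 j_8}(^{c_2c_3}_{a_4a_5})=\sum_{c_4}N^{j_5 j_3 j_6}_{j_4 j_0 j_8}(^{a_2a_3}_{c_4a_5})N^{j_1 j_2 j_5}_{j_8 j_0 j_7}(^{a_1c_4}_{a_0a_4})$; (c) $\sum_{n,a_3,a_4}\mathsf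 d(n)N^{i j p}_{l m n}(^{a_1a_2}_{a_3a_4})N^{k j^* i}_{n m l}(^{a'_1a_3}_{a'_2a_4})=\delta_{k,p}\delta_{a_1,a_1'}\delta_{a_2,a_2'}/\mathsf d(k)$ (Kronecker deltas); (d) $\overline{N^{j_1 j_2 j_3}_{j_4j_5j_6}(^{a_1a_2}_{a_3a_4})}=N^{j_2^* j_1^* j_3^*}_{j_5j_4j_6}(^{a_1a_2}_{a_4a_3})\,\gamma^{a_1}_{j_1,j_2,j_3^*}\gamma^{a_2}_{j_3,j_4,j_5^*}\gamma^{a_3}_{j_1^*,j_5,j_6^*}\gamma^{a_4}_{j_2^*,j_6,j_4^*}\prod_{i=1}^6\beta(j_i)$. **State space.** At each vertex of the dual trivalent graph $\Gamma$ the three edges are cyclically ordered compatibly with the orientation of $\Sigma$. $\Gamma_0,\Gamma_1$ are the sets of vertices and edges; a plaquette is a component of $\Sigma\setminus\Gamma$. A $\mathcal G$-coloring is a map $\Phi$ from oriented edges to $\mathcal G$ with $\Phi(-e)=-\Phi(e)$ ($-e$ is $e$ with opposite orientation) and, at each vertex, the sum of the colors of the three edges oriented toward the vertex is $0$. It is admissible if all its values are generic. A state $\sigma$ of an admissible $\Phi$ assigns to each oriented edge $e$ an element $\sigma(e)\in I_{\Phi(e)}$ with $\sigma(-e)=\sigma(e)^*$ and to each vertex $v$ an integer $0\le\sigma_0(v)\le\delta_{\sigma(e_1)\sigma(e_2)\sigma(e_3)}$, where $e_1,e_2,e_3$ are the ordered edges at $v$ oriented toward $v$. $\mathcal H(\Gamma,\Phi)$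 is the complex vector space with basis $|\Gamma,\sigma\rangle$, $\sigma$ a state of $\Phi$. With $\gamma(\sigma(v))=\gamma^{\sigma_0(v)}_{\sigma(e_1),\sigma(e_2),\sigma(e_3)}$, the indefinite inner product is $$\langle\Gamma,\sigma\mid\Gamma,\sigma'\rangle=\delta_{\sigma,\sigma'}\frac{\prod_{v\in\Gamma_0}\gamma(\sigma(v))\prod_{e\in\Gamma_1}\beta(\sigma(e))}{\prod_{e\in\Gamma_1}\mathsf d(\sigma(e))}.$$ **Vertex operators.** $Q_v|\Gamma,\sigma\rangle=|\Gamma,\sigma\rangle$ if $1\le\sigma_0(v)\le\delta_{\sigma(e_1)\sigma(e_2)\sigma(e_3)}$, and $0$ otherwise. **Plaquette operators.** Let $p$ be a plaquette with $n$ sides. Going counterclockwise around $p$, let $v_1,\dots,v_n$ be its vertices; let $j_i$ be the label of the side from $v_{i-1}$ to $v_i$ oriented that way (indices mod $n$), $k_i$ the label of the third edge at $v_i$ oriented away from $v_i$, and $C_i=\sigma_0(v_i)$. For $g\in \mathcal G$ let $g.\delta p$ be the coloring equal to $g$ on the sides of $p$ oriented from $v_i$ to $v_{i-1}$, $-g$ on their opposites, and $0$ on other edges. For $g$ generic, $s\in I_g$, and $\Phi$, $\Phi+g.\delta p$ admissible, $B^s_p:\mathcal H(\Gamma,\Phi)\to\mathcal H(\Gamma,\Phi+g.\delta p)$ sends the basis state with data $(j_i,C_i)$ to $$\sum_{j'_1,\dots,j'_n}\ \sum_{A_1,\dots,A_n}\ \sum_{C_1',\dots,C_n'}\ \prod_{i=1}^n\mathsf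 d(j_i')\,N^{j_i'\,s\,j_i}_{j_{i+1}^*\,k_i\,j_{i+1}'^{*}}\big(^{A_i\,C_i}_{C_i'\,A_{i+1}}\big)$$ times the basis state in which each $(j_i,C_i)$ is replaced by $(j_i',C_i')$ and everything else is unchanged. Put $B_p^g=\sum_{s\in I_g}\mathsf b(s)B_p^s$ and $B_p=B_p^{g}B_p^{-g}:\mathcal H(\Gamma,\Phi)\to\mathcal H(\Gamma,\Phi)$ for a generic $g$ for which these operators are defined (such $g$ exist since $\mathcal X$ is small, and $B_p$ does not depend on $g$). Gapped means there is a finite energy gap between distinct energy levels; local means that $H$ is a sum of operators each acting locally on the graph (at a single vertex or around a single plaquette).
   Formalization: "The spectrum of H is Z≥0" is proved as: the spectrum is contained in Z≥0. Equality is false, since H is a finite sum of commuting projections and its spectrum is bounded by the number of plaquettes and vertices; 0 itself may be absent when the common +1-eigenspace is zero. *)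

theory Defs
  imports Complex_Main "HOL-Library.FuncSet" "HOL-Library.Groups_Big_Fun"
begin

text \<open>
  The abelian group is the type \<^typ>\<open>'g\<close>. The family of sets \<open>I\<^sub>g\<close> is given by its disjoint union
  \<open>\<A>\<close> together with the degree map. The multiplicities \<open>\<delta>\<close> and the symbols \<open>\<N>\<close> are total functions
  that vanish outside their domains; \<open>\<gamma> n i j k\<close> is \<open>\<gamma>\<close> with upper index \<open>n\<close>, and
  \<open>\<N> j1 j2 j3 j4 j5 j6 a1 a2 a3 a4\<close> is the modified 6j-symbol with upper labels \<open>j1 j2 j3\<close>,
  lower labels \<open>j4 j5 j6\<close>, upper indices \<open>a1 a2\<close> and lower indices \<open>a3 a4\<close>.
\<close>

record ('g, 'j) LW =
  nongeneric :: "'g set"  ("\<X>\<index>")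
  labels :: "'j set"  ("\<A>\<index>")
  deg :: "'j \<Rightarrow> 'g"  ("deg\<index>")
  dual :: "'j \<Rightarrow> 'j"  ("_\<^sup>\<star>\<index>" [1000] 999)
  mult :: "'j \<Rightarrow> 'j \<Rightarrow> 'j \<Rightarrow> nat"  ("\<delta>\<index>")
  qdim :: "'j \<Rightarrow> complex"  ("\<d>\<index>")
  bcoef :: "'j \<Rightarrow> complex"  ("\<b>\<index>")
  beta :: "'j \<Rightarrow> complex"  ("\<beta>\<index>")
  gamma :: "nat \<Rightarrow> 'j \<Rightarrow> 'j \<Rightarrow> 'j \<Rightarrow> complex"  ("\<gamma>\<index>")
  sixj :: "'j \<Rightarrow> 'j \<Rightarrow> 'j \<Rightarrow> 'j \<Rightarrow> 'j \<Rightarrow> 'j \<Rightarrow> nat \<Rightarrow> nat \<Rightarrow> nat \<Rightarrow> nat \<Rightarrow> complex"  ("\<N>\<index>")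

definition homog :: "('g, 'j) LW \<Rightarrow> 'g \<Rightarrow> 'j set"  ("I\<index>") where
  "I\<^bsub>L\<^esub> g = {j \<in> \<A>\<^bsub>L\<^esub>. deg\<^bsub>L\<^esub> j = g}"

text \<open>
  The sets \<open>I\<^sub>g\<close> may be infinite. The assumption \<open>fusion_finite\<close> only says that the sum in
  \<open>bcoef_fusion\<close> has finitely many nonzero terms; together with the symmetries of \<open>\<delta>\<close> it
  makes all sums over labels below finitely supported, and \<^const>\<open>Sum_any\<close> is the sum of a
  finitely supported function.

  In \<open>pentagon\<close> and \<open>orthogonality\<close> every nonzero summand has a label of degree
  \<open>deg j2 + deg j3\<close>, respectively \<open>deg j + deg l\<close>, as summation variable, so these relations are
  imposed only when that degree is generic. Orthogonality is imposed only for multiplicity indices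
  \<open>a1\<close>, \<open>a2\<close> in range: for other indices its left-hand side is 0 by \<open>sixj_supp\<close>, whereas the
  Kronecker deltas need not vanish.

  The inner product involves \<open>\<gamma> 0 i j k\<close> for states with the value 0 at some vertex; this value
  is left unconstrained.
\<close>

locale LW_data =
  fixes L :: "('g::ab_group_add, 'j) LW" (structure)
  assumes X_symmetric: "uminus ` \<X> = \<X>"
    and X_small: "finite Y \<Longrightarrow> \<not> UNIV \<subseteq> {y + x | y x. y \<in> Y \<and> x \<in> \<X>}"
    and deg_generic: "i \<in> \<A> \<Longrightarrow> deg i \<notin> \<X>"
    and dual_closed: "i \<in> \<A> \<Longrightarrow> i\<^sup>\<star> \<in> \<A>"
    and dual_dual: "i \<in> \<A> \<Longrightarrow> (i\<^sup>\<star>)\<^sup>\<star> = i"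
    and deg_dual: "i \<in> \<A> \<Longrightarrow> deg (i\<^sup>\<star>) = - deg i"
    and mult_supp: "\<delta> i j k \<noteq> 0 \<Longrightarrow> i \<in> \<A> \<and> j \<in> \<A> \<and> k \<in> \<A> \<and> deg i + deg j + deg k = 0"
    and mult_cyclic: "\<lbrakk>i \<in> \<A>; j \<in> \<A>; k \<in> \<A>\<rbrakk> \<Longrightarrow> \<delta> i j k = \<delta> j k i"
    and mult_dual: "\<lbrakk>i \<in> \<A>; j \<in> \<A>; k \<in> \<A>\<rbrakk> \<Longrightarrow> \<delta> i j k = \<delta> (k\<^sup>\<star>) (j\<^sup>\<star>) (i\<^sup>\<star>)"
    and qdim_nonzero: "i \<in> \<A> \<Longrightarrow> \<d> i \<noteq> 0"
    and qdim_real: "i \<in> \<A> \<Longrightarrow> cnj (\<d> i) = \<d> i"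
    and qdim_dual: "i \<in> \<A> \<Longrightarrow> \<d> (i\<^sup>\<star>) = \<d> i"
    and bcoef_nonzero: "i \<in> \<A> \<Longrightarrow> \<b> i \<noteq> 0"
    and bcoef_real: "i \<in> \<A> \<Longrightarrow> cnj (\<b> i) = \<b> i"
    and bcoef_dual: "i \<in> \<A> \<Longrightarrow> \<b> (i\<^sup>\<star>) = \<b> i"
    and fusion_finite:
      "\<lbrakk>g \<notin> \<X>; g1 \<notin> \<X>; g2 \<notin> \<X>; g = g1 + g2; j \<in> I g\<rbrakk> \<Longrightarrow>
        finite {(j1, j2). j1 \<in> I g1 \<and> j2 \<in> I g2 \<and> \<delta> (j\<^sup>\<star>) j1 j2 \<noteq> 0}"
    and bcoef_fusion:
      "\<lbrakk>g \<notin> \<X>; g1 \<notin> \<X>; g2 \<notin> \<X>; g = g1 + g2; j \<in> I g\<rbrakk> \<Longrightarrow>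
        \<b> j = (\<Sum>(j1, j2) \<in> {(j1, j2). j1 \<in> I g1 \<and> j2 \<in> I g2 \<and> \<delta> (j\<^sup>\<star>) j1 j2 \<noteq> 0}.
                 \<b> j1 * \<b> j2 * of_nat (\<delta> (j\<^sup>\<star>) j1 j2))"
    and beta_nonzero: "i \<in> \<A> \<Longrightarrow> \<beta> i \<noteq> 0"
    and beta_real: "i \<in> \<A> \<Longrightarrow> cnj (\<beta> i) = \<beta> i"
    and beta_dual: "i \<in> \<A> \<Longrightarrow> \<beta> (i\<^sup>\<star>) = \<beta> i"
    and gamma_nonzero:
      "\<lbrakk>i \<in> \<A>; j \<in> \<A>; k \<in> \<A>; 1 \<le> n; n \<le> \<delta> i j k\<rbrakk> \<Longrightarrow> \<gamma> n i j k \<noteq> 0"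
    and gamma_real:
      "\<lbrakk>i \<in> \<A>; j \<in> \<A>; k \<in> \<A>; 1 \<le> n; n \<le> \<delta> i j k\<rbrakk> \<Longrightarrow> cnj (\<gamma> n i j k) = \<gamma> n i j k"
    and gamma_dual:
      "\<lbrakk>i \<in> \<A>; j \<in> \<A>; k \<in> \<A>; 1 \<le> n; n \<le> \<delta> i j k\<rbrakk> \<Longrightarrow>
        \<gamma> n i j k * \<gamma> n (k\<^sup>\<star>) (j\<^sup>\<star>) (i\<^sup>\<star>) * \<beta> i * \<beta> j * \<beta> k = 1"
    and sixj_supp:
      "\<N> j1 j2 j3 j4 j5 j6 a1 a2 a3 a4 \<noteq> 0 \<Longrightarrow>
        a1 \<in> {1..\<delta> j1 j2 (j3\<^sup>\<star>)} \<and> a2 \<in> {1..\<delta> j3 j4 (j5\<^sup>\<star>)} \<and>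
        a3 \<in> {1..\<delta> j5 (j6\<^sup>\<star>) (j1\<^sup>\<star>)} \<and> a4 \<in> {1..\<delta> j6 (j4\<^sup>\<star>) (j2\<^sup>\<star>)}"
    and sixj_sym1:
      "{j1, j2, j3, j4, j5, j6} \<subseteq> \<A> \<Longrightarrow>
        \<N> j1 j2 j3 j4 j5 j6 a1 a2 a3 a4 = \<N> j2 (j3\<^sup>\<star>) (j1\<^sup>\<star>) j5 j6 j4 a1 a3 a4 a2"
    and sixj_sym2:
      "{j1, j2, j3, j4, j5, j6} \<subseteq> \<A> \<Longrightarrow>
        \<N> j1 j2 j3 j4 j5 j6 a1 a2 a3 a4 = \<N> j3 j4 j5 (j6\<^sup>\<star>) j1 (j2\<^sup>\<star>) a2 a3 a1 a4"
    and pentagon: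
      "\<lbrakk>{j0, j1, j2, j3, j4, j5, j6, j7, j8} \<subseteq> \<A>; deg j2 + deg j3 \<notin> \<X>\<rbrakk> \<Longrightarrow>
        Sum_any (\<lambda>(j, c1, c2, c3).
          \<d> j * \<N> j1 j2 j5 j3 j6 j a1 a2 c1 c2 * \<N> j1 j j6 j4 j0 j7 c1 a3 a0 c3
              * \<N> j2 j3 j j4 j7 j8 c2 c3 a4 a5)
        = Sum_any (\<lambda>c4. \<N> j5 j3 j6 j4 j0 j8 a2 a3 c4 a5 * \<N> j1 j2 j5 j8 j0 j7 a1 c4 a0 a4)"
    and orthogonality:
      "\<lbrakk>{i, j, k, l, m, p} \<subseteq> \<A>; deg j + deg l \<notin> \<X>;
        a1 \<in> {1..\<delta> i j (p\<^sup>\<star>)}; a2 \<in> {1..\<delta> p l (m\<^sup>\<star>)}\<rbrakk> \<Longrightarrow>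
        Sum_any (\<lambda>(n, a3, a4).
          \<d> n * \<N> i j p l m n a1 a2 a3 a4 * \<N> k (j\<^sup>\<star>) i n m l a1' a3 a2' a4)
        = (if k = p \<and> a1 = a1' \<and> a2 = a2' then 1 / \<d> k else 0)"
    and sixj_cnj:
      "{j1, j2, j3, j4, j5, j6} \<subseteq> \<A> \<Longrightarrow>
        cnj (\<N> j1 j2 j3 j4 j5 j6 a1 a2 a3 a4)
        = \<N> (j2\<^sup>\<star>) (j1\<^sup>\<star>) (j3\<^sup>\<star>) j5 j4 j6 a1 a2 a4 a3
          * \<gamma> a1 j1 j2 (j3\<^sup>\<star>) * \<gamma> a2 j3 j4 (j5\<^sup>\<star>) * \<gamma> a3 (j1\<^sup>\<star>) j5 (j6\<^sup>\<star>) * \<gamma> a4 (j2\<^sup>\<star>) j6 (j4\<^sup>\<star>)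
          * (\<beta> j1 * \<beta> j2 * \<beta> j3 * \<beta> j4 * \<beta> j5 * \<beta> j6)"


text \<open>
  A triangulated closed oriented surface is given combinatorially by its set \<open>T\<close> of triangles.
  Each triangle is listed exactly once, as a triple \<open>(a, b, c)\<close> of vertices in counterclockwise
  order. The choice of the first vertex is arbitrary; it serves to turn the cyclic order of
  the edges at a vertex of the dual graph into a linear one.
\<close>

type_synonym 'v triangle = "'v \<times> 'v \<times> 'v"

definition ccw :: "'v triangle set \<Rightarrow> 'v \<Rightarrow> 'v \<Rightarrow> 'v \<Rightarrow> bool" where
  "ccw T a b c \<longleftrightarrow> (a, b, c) \<in> T \<or> (b, c, a) \<in> T \<or> (c, a, b) \<in> T"

text \<open>
  The pair \<open>(a, b)\<close> denotes the edge of the dual graph that crosses the edge \<open>ab\<close> of the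
  triangulation, oriented so that \<open>a\<close> lies on its left and \<open>b\<close> on its right. If \<open>ccw T a b c\<close>, this
  edge points towards the triangle \<open>abc\<close>. Orientation reversal is \<^const>\<open>prod.swap\<close>.
\<close>

definition oriented_edges :: "'v triangle set \<Rightarrow> ('v \<times> 'v) set" where
  "oriented_edges T = {(a, b). \<exists>c. ccw T a b c}"

definition edges :: "'v triangle set \<Rightarrow> ('v \<times> 'v) set set" where
  "edges T = (\<lambda>e. {e, prod.swap e}) ` oriented_edges T"

text \<open>The plaquettes are the open cells dual to the vertices of the triangulation.\<close>

definition plaquettes :: "'v triangle set \<Rightarrow> 'v set" where
  "plaquettes T = fst ` oriented_edges T"

text \<open>
  By \<open>edge_unique\<close> and \<open>edge_opposite\<close> every edge lies in exactly two triangles, which induce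
  opposite orientations on it. Thus \<open>x \<mapsto> y\<close> with \<open>ccw T a x y\<close> permutes the vertices adjacent
  to \<open>a\<close>, and \<open>link_cycle\<close> says that the link of \<open>a\<close> is a single circle.
\<close>

locale triangulated_surface =
  fixes T :: "'v triangle set"
  assumes finite_T: "finite T"
    and nonempty_T: "T \<noteq> {}"
    and vertices_distinct: "(a, b, c) \<in> T \<Longrightarrow> a \<noteq> b \<and> b \<noteq> c \<and> c \<noteq> a"
    and listed_once: "(a, b, c) \<in> T \<Longrightarrow> (b, c, a) \<notin> T"
    and one_orientation: "ccw T a b c \<Longrightarrow> \<not> ccw T a c b"
    and edge_unique: "\<lbrakk>ccw T a b c; ccw T a b c'\<rbrakk> \<Longrightarrow> c = c'"
    and edge_opposite: "ccw T a b c \<Longrightarrow> \<exists>d. ccw T b a d"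
    and link_cycle: "\<lbrakk>(a, b) \<in> oriented_edges T; (a, b') \<in> oriented_edges T\<rbrakk> \<Longrightarrow>
                       (b, b') \<in> {(x, y). ccw T a x y}\<^sup>*"
    and connected: "\<lbrakk>a \<in> plaquettes T; b \<in> plaquettes T\<rbrakk> \<Longrightarrow> (a, b) \<in> (oriented_edges T)\<^sup>*"

definition apex :: "'v triangle set \<Rightarrow> 'v \<times> 'v \<Rightarrow> 'v" where
  "apex T e = (THE c. ccw T (fst e) (snd e) c)"

definition target :: "'v triangle set \<Rightarrow> 'v \<times> 'v \<Rightarrow> 'v triangle" where
  "target T e = (let a = fst e; b = snd e; c = apex T e in
     THE t. t \<in> T \<and> t \<in> {(a, b, c), (b, c, a), (c, a, b)})"

text \<open>
  The sides of the plaquette \<open>p\<close>, oriented counterclockwise around \<open>p\<close>. At the vertex of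
  the dual graph where the side \<open>e\<close> ends, \<open>next_side T e\<close> is the following side and \<open>leg T e\<close> is
  the third edge, oriented away from that vertex.
\<close>

definition sides :: "'v triangle set \<Rightarrow> 'v \<Rightarrow> ('v \<times> 'v) set" where
  "sides T p = {e \<in> oriented_edges T. fst e = p}"

definition next_side :: "'v triangle set \<Rightarrow> 'v \<times> 'v \<Rightarrow> 'v \<times> 'v" where
  "next_side T e = (fst e, apex T e)"

definition leg :: "'v triangle set \<Rightarrow> 'v \<times> 'v \<Rightarrow> 'v \<times> 'v" where
  "leg T e = (apex T e, snd e)"

definition corners :: "'v triangle set \<Rightarrow> 'v \<Rightarrow> 'v triangle set" where
  "corners T p = target T ` sides T p"


type_synonym ('v, 'j) state = "('v \<times> 'v \<Rightarrow> 'j) \<times> ('v triangle \<Rightarrow> nat)"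

text \<open>A vector is given by its coordinates in the basis of states.\<close>

type_synonym ('v, 'j) vec = "('v, 'j) state \<Rightarrow> complex"

definition basis_vec :: "'s \<Rightarrow> 's \<Rightarrow> complex" where
  "basis_vec s = (\<lambda>t. if t = s then 1 else 0)"

text \<open>The linear extension of the map sending the basis vector of \<open>s\<close> to \<open>\<Sum>t. M s t \<cdot> t\<close>.\<close>

definition lin_ext :: "('s \<Rightarrow> 's \<Rightarrow> complex) \<Rightarrow> ('s \<Rightarrow> complex) \<Rightarrow> 's \<Rightarrow> complex" where
  "lin_ext M f = (\<lambda>t. \<Sum>s | f s \<noteq> 0. f s * M s t)"

locale LW_model =
  fixes L :: "('g::ab_group_add, 'j) LW" (structure)
    and T :: "'v triangle set"
begin

definition coloring :: "('v \<times> 'v \<Rightarrow> 'g) \<Rightarrow> bool" where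
  "coloring \<Phi> \<longleftrightarrow>
     (\<forall>e \<in> oriented_edges T. \<Phi> (prod.swap e) = - \<Phi> e) \<and>
     (\<forall>(a, b, c) \<in> T. \<Phi> (a, b) + \<Phi> (b, c) + \<Phi> (c, a) = 0)"

definition admissible :: "('v \<times> 'v \<Rightarrow> 'g) \<Rightarrow> bool" where
  "admissible \<Phi> \<longleftrightarrow> coloring \<Phi> \<and> (\<forall>e \<in> oriented_edges T. \<Phi> e \<notin> \<X>)"

text \<open>
  The three edges at the vertex \<open>abc\<close>, oriented towards it, are taken in the order \<open>(a, b)\<close>,
  \<open>(c, a)\<close>, \<open>(b, c)\<close>, which is clockwise. This is the cyclic order for which the indices in the formula
  for the plaquette operators (with plaquettes traversed counterclockwise) have matching ranges: at
  the end of a side \<open>e\<close>, the multiplicity of \<open>e\<close>, the reversed next side and the reversed leg.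
\<close>

definition vertex_mult :: "('v \<times> 'v \<Rightarrow> 'j) \<Rightarrow> 'v triangle \<Rightarrow> nat" where
  "vertex_mult \<sigma> v = (case v of (a, b, c) \<Rightarrow> \<delta> (\<sigma> (a, b)) (\<sigma> (c, a)) (\<sigma> (b, c)))"

definition states :: "('v \<times> 'v \<Rightarrow> 'g) \<Rightarrow> ('v, 'j) state set" where
  "states \<Phi> = {(\<sigma>, \<sigma>\<^sub>0).
     \<sigma> \<in> (\<Pi>\<^sub>E e \<in> oriented_edges T. I (\<Phi> e)) \<and>
     (\<forall>e \<in> oriented_edges T. \<sigma> (prod.swap e) = (\<sigma> e)\<^sup>\<star>) \<and>
     \<sigma>\<^sub>0 \<in> (\<Pi>\<^sub>E v \<in> T. {0..vertex_mult \<sigma> v})}"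

definition state_space :: "('v \<times> 'v \<Rightarrow> 'g) \<Rightarrow> ('v, 'j) vec set" where
  "state_space \<Phi> = {f. finite {s. f s \<noteq> 0} \<and> {s. f s \<noteq> 0} \<subseteq> states \<Phi>}"

definition vertex_gamma :: "('v, 'j) state \<Rightarrow> 'v triangle \<Rightarrow> complex" where
  "vertex_gamma s v = (case v of (a, b, c) \<Rightarrow>
     \<gamma> (snd s v) (fst s (a, b)) (fst s (c, a)) (fst s (b, c)))"

text \<open>Since \<open>\<beta>\<close> and \<open>\<d>\<close> are invariant under duality, the orientation chosen for each edge is irrelevant.\<close>

definition weight :: "('v, 'j) state \<Rightarrow> complex" where
  "weight s = (\<Prod>v\<in>T. vertex_gamma s v) * (\<Prod>E\<in>edges T. \<beta> (fst s (SOME e. e \<in> E)))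
                / (\<Prod>E\<in>edges T. \<d> (fst s (SOME e. e \<in> E)))"

definition inner_prod :: "('v, 'j) vec \<Rightarrow> ('v, 'j) vec \<Rightarrow> complex" where
  "inner_prod x y = (\<Sum>s | x s \<noteq> 0 \<and> y s \<noteq> 0. cnj (x s) * y s * weight s)"

definition Q_op :: "'v triangle \<Rightarrow> ('v, 'j) vec \<Rightarrow> ('v, 'j) vec" where
  "Q_op v = lin_ext (\<lambda>s t.
     if 1 \<le> snd s v \<and> snd s v \<le> vertex_mult (fst s) v then basis_vec s t else 0)"

definition delta_color :: "'g \<Rightarrow> 'v \<Rightarrow> 'v \<times> 'v \<Rightarrow> 'g" where
  "delta_color g p e =
     (if prod.swap e \<in> sides T p then g else if e \<in> sides T p then - g else 0)"

definition agree_off :: "('v \<times> 'v) set \<Rightarrow> 'v triangle set \<Rightarrow> ('v, 'j) state \<Rightarrow> ('v, 'j) state \<Rightarrow> bool" where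
  "agree_off E V s t \<longleftrightarrow>
     (\<forall>e \<in> oriented_edges T - E. fst s e = fst t e) \<and> (\<forall>v \<in> T - V. snd s v = snd t v)"

definition agree_on :: "('v \<times> 'v) set \<Rightarrow> 'v triangle set \<Rightarrow> ('v, 'j) state \<Rightarrow> ('v, 'j) state \<Rightarrow> bool" where
  "agree_on E V s t \<longleftrightarrow>
     (\<forall>e \<in> oriented_edges T \<inter> E. fst s e = fst t e) \<and> (\<forall>v \<in> T \<inter> V. snd s v = snd t v)"

text \<open>
  The operator \<open>B\<^sub>p\<^sup>l\<close> from the state space of \<open>\<Phi>\<close>, for a label \<open>l\<close>. The coefficient of the state
  \<open>t\<close> in the image of the state \<open>s\<close> is indexed by the sides \<open>e\<close> of \<open>p\<close> instead of by numbers
  \<open>i\<close>: then \<open>j\<^sub>i\<close>, \<open>j'\<^sub>i\<close>, \<open>k\<^sub>i\<close>, \<open>C\<^sub>i\<close>, \<open>C'\<^sub>i\<close>, \<open>A\<^sub>i\<close> are \<open>fst s e\<close>, \<open>fst t e\<close>, \<open>fst s (leg T e)\<close>,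
  \<open>snd s (target T e)\<close>, \<open>snd t (target T e)\<close>, \<open>A e\<close>, and \<open>i + 1\<close> corresponds to \<open>next_side T e\<close>. The
  6j-symbol vanishes unless \<open>A e\<close> is in the stated range.
\<close>

definition plaq_coeff ::
  "('v \<times> 'v \<Rightarrow> 'g) \<Rightarrow> 'v \<Rightarrow> 'j \<Rightarrow> ('v, 'j) state \<Rightarrow> ('v, 'j) state \<Rightarrow> complex" where
  "plaq_coeff \<Phi> p l s t =
     (if t \<in> states (\<lambda>e. \<Phi> e + delta_color (deg l) p e) \<and>
         agree_off (sides T p \<union> prod.swap ` sides T p) (corners T p) s t
      then \<Sum>A \<in> (\<Pi>\<^sub>E e \<in> sides T p. {1..\<delta> (fst t e) l ((fst s e)\<^sup>\<star>)}).
           \<Prod>e \<in> sides T p.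
             \<d> (fst t e) *
             \<N> (fst t e) l (fst s e)
               ((fst s (next_side T e))\<^sup>\<star>) (fst s (leg T e)) ((fst t (next_side T e))\<^sup>\<star>)
               (A e) (snd s (target T e)) (snd t (target T e)) (A (next_side T e))
      else 0)"

definition B_label :: "('v \<times> 'v \<Rightarrow> 'g) \<Rightarrow> 'v \<Rightarrow> 'j \<Rightarrow> ('v, 'j) vec \<Rightarrow> ('v, 'j) vec" where
  "B_label \<Phi> p l = lin_ext (plaq_coeff \<Phi> p l)"

definition B_deg :: "('v \<times> 'v \<Rightarrow> 'g) \<Rightarrow> 'v \<Rightarrow> 'g \<Rightarrow> ('v, 'j) vec \<Rightarrow> ('v, 'j) vec" where
  "B_deg \<Phi> p g f = (\<lambda>t. Sum_any (\<lambda>l. if l \<in> I g then \<b> l * B_label \<Phi> p l f t else 0))"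

text \<open>
  A suitable \<open>g\<close> exists because \<open>\<X>\<close> is small, and the operator does not depend on its choice.
\<close>

definition B_op :: "('v \<times> 'v \<Rightarrow> 'g) \<Rightarrow> 'v \<Rightarrow> ('v, 'j) vec \<Rightarrow> ('v, 'j) vec" where
  "B_op \<Phi> p =
     (let g = (SOME g. g \<notin> \<X> \<and> admissible (\<lambda>e. \<Phi> e + delta_color (- g) p e))
      in B_deg (\<lambda>e. \<Phi> e + delta_color (- g) p e) p g \<circ> B_deg \<Phi> p (- g))"

definition hamiltonian :: "('v \<times> 'v \<Rightarrow> 'g) \<Rightarrow> ('v, 'j) vec \<Rightarrow> ('v, 'j) vec" where
  "hamiltonian \<Phi> f =
     (\<lambda>s. (\<Sum>p\<in>plaquettes T. f s - B_op \<Phi> p f s) + (\<Sum>v\<in>T. f s - Q_op v f s))"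


definition linear_operator :: "('v \<times> 'v \<Rightarrow> 'g) \<Rightarrow> (('v, 'j) vec \<Rightarrow> ('v, 'j) vec) \<Rightarrow> bool" where
  "linear_operator \<Phi> F \<longleftrightarrow>
     F \<in> state_space \<Phi> \<rightarrow> state_space \<Phi> \<and>
     (\<forall>x \<in> state_space \<Phi>. \<forall>y \<in> state_space \<Phi>. \<forall>c d.
        F (\<lambda>s. c * x s + d * y s) = (\<lambda>s. c * F x s + d * F y s))"

definition hermitian :: "('v \<times> 'v \<Rightarrow> 'g) \<Rightarrow> (('v, 'j) vec \<Rightarrow> ('v, 'j) vec) \<Rightarrow> bool" where
  "hermitian \<Phi> F \<longleftrightarrow>
     (\<forall>x \<in> state_space \<Phi>. \<forall>y \<in> state_space \<Phi>. inner_prod (F x) y = inner_prod x (F y))"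

definition spectrum :: "('v \<times> 'v \<Rightarrow> 'g) \<Rightarrow> (('v, 'j) vec \<Rightarrow> ('v, 'j) vec) \<Rightarrow> complex set" where
  "spectrum \<Phi> F =
     {z. \<not> bij_betw (\<lambda>x s. F x s - z * x s) (state_space \<Phi>) (state_space \<Phi>)}"

definition gapped :: "('v \<times> 'v \<Rightarrow> 'g) \<Rightarrow> (('v, 'j) vec \<Rightarrow> ('v, 'j) vec) \<Rightarrow> bool" where
  "gapped \<Phi> F \<longleftrightarrow>
     (\<exists>\<epsilon>>0. \<forall>z \<in> spectrum \<Phi> F. \<forall>w \<in> spectrum \<Phi> F. z \<noteq> w \<longrightarrow> \<epsilon> \<le> dist z w)"

text \<open>
  A linear operator is supported on a set \<open>V\<close> of vertices of the dual graph if it does not change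
  a state away from \<open>V\<close> and the edges incident to \<open>V\<close>, and its matrix entries depend only on the
  restrictions of the two states to \<open>V\<close> and these edges.
\<close>

definition incident :: "'v triangle set \<Rightarrow> ('v \<times> 'v) set" where
  "incident V = {e \<in> oriented_edges T. target T e \<in> V \<or> target T (prod.swap e) \<in> V}"

definition supported_on ::
  "('v \<times> 'v \<Rightarrow> 'g) \<Rightarrow> 'v triangle set \<Rightarrow> (('v, 'j) vec \<Rightarrow> ('v, 'j) vec) \<Rightarrow> bool" where
  "supported_on \<Phi> V F \<longleftrightarrow>
     linear_operator \<Phi> F \<and>
     (\<forall>s \<in> states \<Phi>. \<forall>t \<in> states \<Phi>.
        F (basis_vec s) t \<noteq> 0 \<longrightarrow> agree_off (incident V) V s t) \<and>
     (\<forall>s \<in> states \<Phi>. \<forall>t \<in> states \<Phi>. \<forall>s' \<in> states \<Phi>. \<forall>t' \<in> states \<Phi>.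
        agree_off (incident V) V s t \<and> agree_off (incident V) V s' t' \<and>
        agree_on (incident V) V s s' \<and> agree_on (incident V) V t t' \<longrightarrow>
        F (basis_vec s) t = F (basis_vec s') t')"

definition local_operator :: "('v \<times> 'v \<Rightarrow> 'g) \<Rightarrow> (('v, 'j) vec \<Rightarrow> ('v, 'j) vec) \<Rightarrow> bool" where
  "local_operator \<Phi> F \<longleftrightarrow>
     (\<exists>P V. (\<forall>p \<in> plaquettes T. supported_on \<Phi> (corners T p) (P p)) \<and>
            (\<forall>v \<in> T. supported_on \<Phi> {v} (V v)) \<and>
            (\<forall>x \<in> state_space \<Phi>. \<forall>s. F x s = (\<Sum>p\<in>plaquettes T. P p x s) + (\<Sum>v\<in>T. V v x s)))"

end

end

theory Submission
  imports Defs
begin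

text \<open>
  The operators \<open>1 - B\<^sub>p\<close> and \<open>1 - Q\<^sub>v\<close> are commuting linear projections. For a finite family of
  commuting projections \<open>E\<^sub>i\<close>, splitting the space into the image and the kernel of one \<open>E\<^sub>i\<close> after the
  other shows that \<open>\<Sum>\<^sub>i E\<^sub>i - z\<close> is bijective for every \<open>z\<close> that is not a natural number, and
  that \<open>\<Sum>\<^sub>i E\<^sub>i\<close> only vanishes where all \<open>E\<^sub>i\<close> do (\<open>sum_of_commuting_projections_bij\<close> and
  \<open>sum_of_commuting_projections_kernel\<close>). This gives the spectrum, the gap and the ground states.

  Each \<open>Q\<^sub>v\<close> is diagonal in the basis of states. For \<open>B\<^sub>p\<close>, three identities between operators for
  single labels are needed. A matrix entry of such an operator is a product of 6j-symbols, one for each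
  corner of the plaquette, summed over one multiplicity index for each side, and each identity is
  obtained by regarding the 6j-symbols as tetrahedra and gluing them along faces.

  \<^item> Composition: on the same plaquette, the operator for \<open>l\<close> followed by that for \<open>m\<close> is the sum of the
    operators for \<open>u\<close>, with multiplicities \<open>\<delta> m l u\<^sup>\<star>\<close>. The pentagon relation at each corner turns the
    matrix entries of the composition into the trace of a product of matrices around the plaquette,
    in which those of the operators for \<open>u\<close> are conjugated by 6j-symbols attached to the sides; by
    orthogonality the latter cancel (\<open>amplitude_compose\<close>). With the fusion rule of the
    coefficients \<open>\<b>\<close> this becomes \<open>B\<^sub>p\<^sup>g B\<^sub>p\<^sup>h = B\<^sub>p\<^sup>g\<^sup>+\<^sup>h\<close> (\<open>B_deg_compose\<close>).
    Since \<open>\<X>\<close> is small, any two choices of \<open>g\<close> in \<open>B\<^sub>p = B\<^sub>p\<^sup>g B\<^sub>p\<^sup>-\<^sup>g\<close> can be compared via a third one, so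
    that \<open>B\<^sub>p\<close> does not depend on \<open>g\<close>, and it follows that \<open>B\<^sub>p\<close> is idempotent.

  \<^item> Exchange: operators on different plaquettes commute. Plaquettes without a common side
    do not interact. Two adjacent plaquettes share exactly one side, and at each of its two ends
    the pentagon relation exchanges the operators at the cost of one more 6j-symbol. The symbols
    from both ends coincide, which gives the equality of the two orders (\<open>shared_side_exchange\<close>,
    \<open>plaq_coeff_exchange\<close>).

  \<^item> Adjoints: the adjoint of the operator for \<open>l\<close> is the operator for \<open>l\<^sup>\<star>\<close>. Complex conjugation
    of the 6j-symbols produces scalars \<open>\<gamma>\<close> and \<open>\<beta>\<close>, which are absorbed by the weights in the inner
    product (\<open>prod_corner_coeff_adjoint\<close>).

  Intermediate states are parametrized by the labels and multiplicity indices around a plaquette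
  (\<open>update\<close> and \<open>local_data\<close>). This reduces sums over states to finite sums over such data, and it
  also shows that the operators are local.
\<close>


section \<open>Consequences of the relations between the 6j-symbols\<close>

context LW_data
begin

lemma mult_labels: "\<delta> i j k \<noteq> 0 \<Longrightarrow> i \<in> \<A> \<and> j \<in> \<A> \<and> k \<in> \<A>"
  using mult_supp by blast

lemma mult_deg: "\<delta> i j k \<noteq> 0 \<Longrightarrow> deg i + deg j + deg k = 0"
  using mult_supp by blast

lemma mult_rotate: "\<delta> i j k = \<delta> j k i"
  using mult_labels mult_cyclic by (metis (no_types, lifting))

lemma sixj_labels:
  assumes "\<N> j1 j2 j3 j4 j5 j6 a1 a2 a3 a4 \<noteq> 0"
  shows "{j1, j2, j3, j4, j5, j6} \<subseteq> \<A>"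
proof -
  have "\<delta> j1 j2 (j3\<^sup>\<star>) \<noteq> 0 \<and> \<delta> j3 j4 (j5\<^sup>\<star>) \<noteq> 0 \<and> \<delta> j5 (j6\<^sup>\<star>) (j1\<^sup>\<star>) \<noteq> 0 \<and> \<delta> j6 (j4\<^sup>\<star>) (j2\<^sup>\<star>) \<noteq> 0"
    using sixj_supp[OF assms] by auto
  then show ?thesis using mult_labels by blast
qed

lemma sixj_range:
  assumes "\<N> j1 j2 j3 j4 j5 j6 a1 a2 a3 a4 \<noteq> 0"
  shows "a1 \<in> {1..\<delta> j1 j2 (j3\<^sup>\<star>)}" "a2 \<in> {1..\<delta> j3 j4 (j5\<^sup>\<star>)}"
    "a3 \<in> {1..\<delta> j5 (j6\<^sup>\<star>) (j1\<^sup>\<star>)}" "a4 \<in> {1..\<delta> j6 (j4\<^sup>\<star>) (j2\<^sup>\<star>)}"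
  using sixj_supp[OF assms] by auto

text \<open>
  The two symmetry relations of a 6j-symbol generate the rotation group of a tetrahedron. The
  following lemmas are the elements of this group that occur in the gluing arguments below.
\<close>

lemma sixj_flip:
  assumes "{j1, j2, j3, j4, j5, j6} \<subseteq> \<A>"
  shows "\<N> j1 j2 j3 j4 j5 j6 a1 a2 a3 a4 = \<N> j4 (j5\<^sup>\<star>) (j3\<^sup>\<star>) j1 (j2\<^sup>\<star>) (j6\<^sup>\<star>) a2 a1 a4 a3"
proof -
  have "\<N> j1 j2 j3 j4 j5 j6 a1 a2 a3 a4 = \<N> j3 j4 j5 (j6\<^sup>\<star>) j1 (j2\<^sup>\<star>) a2 a3 a1 a4"
    using assms by (intro sixj_sym2) auto
  also have "\<dots> = \<N> j4 (j5\<^sup>\<star>) (j3\<^sup>\<star>) j1 (j2\<^sup>\<star>) (j6\<^sup>\<star>) a2 a1 a4 a3"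
    using assms by (intro sixj_sym1) (auto simp: dual_closed)
  finally show ?thesis .
qed

lemma sixj_rotate_face:
  assumes "{j1, j2, j3, j4, j5, j6} \<subseteq> \<A>"
  shows "\<N> j1 j2 j3 j4 j5 j6 a1 a2 a3 a4 = \<N> (j3\<^sup>\<star>) j1 (j2\<^sup>\<star>) j6 j4 j5 a1 a4 a2 a3"
proof -
  have "\<N> j1 j2 j3 j4 j5 j6 a1 a2 a3 a4 = \<N> j2 (j3\<^sup>\<star>) (j1\<^sup>\<star>) j5 j6 j4 a1 a3 a4 a2"
    using assms by (intro sixj_sym1) auto
  also have "\<dots> = \<N> (j3\<^sup>\<star>) ((j1\<^sup>\<star>)\<^sup>\<star>) (j2\<^sup>\<star>) j6 j4 j5 a1 a4 a2 a3"
    using assms by (intro sixj_sym1) (auto simp: dual_closed)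
  finally show ?thesis using assms by (simp add: dual_dual)
qed

lemma sixj_sym_orth:
  assumes "{j1, j2, j3, j4, j5, j6} \<subseteq> \<A>"
  shows "\<N> j1 j2 j3 j4 j5 j6 a1 a2 a3 a4 = \<N> (j6\<^sup>\<star>) (j1\<^sup>\<star>) (j5\<^sup>\<star>) j3 (j4\<^sup>\<star>) (j2) a3 a2 a4 a1"
proof -
  have "\<N> j1 j2 j3 j4 j5 j6 a1 a2 a3 a4 = \<N> j3 j4 j5 (j6\<^sup>\<star>) j1 (j2\<^sup>\<star>) a2 a3 a1 a4"
    using assms by (intro sixj_sym2) auto
  also have "\<dots> = \<N> j5 (j6\<^sup>\<star>) j1 ((j2\<^sup>\<star>)\<^sup>\<star>) j3 (j4\<^sup>\<star>) a3 a1 a2 a4"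
    using assms by (intro sixj_sym2) (auto simp: dual_closed)
  also have "\<dots> = \<N> (j6\<^sup>\<star>) (j1\<^sup>\<star>) (j5\<^sup>\<star>) j3 (j4\<^sup>\<star>) ((j2\<^sup>\<star>)\<^sup>\<star>) a3 a2 a4 a1"
    using assms by (intro sixj_sym1) (auto simp: dual_closed dual_dual)
  finally show ?thesis using assms by (simp add: dual_dual)
qed

lemma sixj_sym_shared:
  assumes "{j1, j2, j3, j4, j5, j6} \<subseteq> \<A>"
  shows "\<N> j1 j2 j3 j4 j5 j6 a1 a2 a3 a4 = \<N> (j2\<^sup>\<star>) j6 j4 (j5\<^sup>\<star>) (j3\<^sup>\<star>) (j1\<^sup>\<star>) a4 a2 a1 a3"
proof -
  have "\<N> j1 j2 j3 j4 j5 j6 a1 a2 a3 a4 = \<N> (j3\<^sup>\<star>) j1 (j2\<^sup>\<star>) j6 j4 j5 a1 a4 a2 a3"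
    using assms by (intro sixj_rotate_face) auto
  also have "\<dots> = \<N> (j2\<^sup>\<star>) j6 j4 (j5\<^sup>\<star>) (j3\<^sup>\<star>) (j1\<^sup>\<star>) a4 a2 a1 a3"
    using assms by (intro sixj_sym2) (auto simp: dual_closed)
  finally show ?thesis .
qed

lemma sixj_sym_exchange:
  assumes "{j1, j2, j3, j4, j5, j6} \<subseteq> \<A>"
  shows "\<N> j1 j2 j3 j4 j5 j6 a1 a2 a3 a4
    = \<N> (j4\<^sup>\<star>) (j2\<^sup>\<star>) (j6\<^sup>\<star>) (j1\<^sup>\<star>) (j5\<^sup>\<star>) (j3\<^sup>\<star>) a4 a3 a2 a1"
proof -
  have "\<N> j1 j2 j3 j4 j5 j6 a1 a2 a3 a4 = \<N> j2 (j3\<^sup>\<star>) (j1\<^sup>\<star>) j5 j6 j4 a1 a3 a4 a2"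
    using assms by (intro sixj_sym1) auto
  also have "\<dots> = \<N> (j1\<^sup>\<star>) j5 j6 (j4\<^sup>\<star>) j2 ((j3\<^sup>\<star>)\<^sup>\<star>) a3 a4 a1 a2"
    using assms by (intro sixj_sym2) (auto simp: dual_closed)
  also have "\<dots> = \<N> j6 (j4\<^sup>\<star>) j2 (((j3\<^sup>\<star>)\<^sup>\<star>)\<^sup>\<star>) (j1\<^sup>\<star>) (j5\<^sup>\<star>) a4 a1 a3 a2"
    using assms by (intro sixj_sym2) (auto simp: dual_closed)
  also have "\<dots> = \<N> (j4\<^sup>\<star>) (j2\<^sup>\<star>) (j6\<^sup>\<star>) (j1\<^sup>\<star>) (j5\<^sup>\<star>) (((j3\<^sup>\<star>)\<^sup>\<star>)\<^sup>\<star>) a4 a3 a2 a1"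
    using assms by (intro sixj_sym1) (auto simp: dual_closed)
  finally show ?thesis using assms by (simp add: dual_dual)
qed


text \<open>
  Reality of the data forces \<open>\<gamma>\<close> to be invariant under cyclic permutations on every face of a nonzero
  6j-symbol: complex conjugation commutes with the rotation about that face.
\<close>

lemma gamma_rotate_of_sixj1:
  assumes nz: "\<N> j1 j2 j3 j4 j5 j6 a1 a2 a3 a4 \<noteq> 0"
  shows "\<gamma> a1 j1 j2 (j3\<^sup>\<star>) = \<gamma> a1 j2 (j3\<^sup>\<star>) j1"
proof -
  have L: "{j1, j2, j3, j4, j5, j6} \<subseteq> \<A>" using sixj_labels[OF nz] .
  then have LA: "j1 \<in> \<A>" "j2 \<in> \<A>" "j3 \<in> \<A>" "j4 \<in> \<A>" "j5 \<in> \<A>" "j6 \<in> \<A>" by auto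
  define c where "c = \<gamma> a2 j3 j4 (j5\<^sup>\<star>) * \<gamma> a3 (j1\<^sup>\<star>) j5 (j6\<^sup>\<star>) * \<gamma> a4 (j2\<^sup>\<star>) j6 (j4\<^sup>\<star>)
    * (\<beta> j1 * \<beta> j2 * \<beta> j3 * \<beta> j4 * \<beta> j5 * \<beta> j6)"
  define n where "n = \<N> (j2\<^sup>\<star>) (j1\<^sup>\<star>) (j3\<^sup>\<star>) j5 j4 j6 a1 a2 a4 a3"
  have "cnj (\<N> j1 j2 j3 j4 j5 j6 a1 a2 a3 a4) = n * \<gamma> a1 j1 j2 (j3\<^sup>\<star>) * c"
    unfolding sixj_cnj[OF L] n_def c_def by simp
  moreover have "cnj (\<N> j1 j2 j3 j4 j5 j6 a1 a2 a3 a4) = n * \<gamma> a1 j2 (j3\<^sup>\<star>) j1 * c"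
  proof -
    have "n = \<N> ((j3\<^sup>\<star>)\<^sup>\<star>) (j2\<^sup>\<star>) ((j1\<^sup>\<star>)\<^sup>\<star>) j6 j5 j4 a1 a3 a2 a4"
      unfolding n_def using LA by (subst sixj_rotate_face) (auto simp: dual_closed dual_dual)
    then show ?thesis
      using LA unfolding sixj_sym1[OF L] c_def
      by (subst sixj_cnj) (auto simp: dual_closed dual_dual beta_dual)
  qed
  moreover have "cnj (\<N> j1 j2 j3 j4 j5 j6 a1 a2 a3 a4) \<noteq> 0" using nz by simp
  ultimately show ?thesis by auto
qed

subsection \<open>Finiteness of fusion\<close>

text \<open>
  Once the degree of \<open>j\<close> is prescribed, that of \<open>k\<close> is determined, and both are generic, so that
  finiteness of fusion applies to the dual of \<open>i\<close>.
\<close>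

lemma finite_fusion_pairs:
  assumes "i \<in> \<A>" "g1 \<notin> \<X>" "deg i + g1 \<notin> \<X>"
  shows "finite {(j, k). deg j = g1 \<and> \<delta> i j k \<noteq> 0}"
proof -
  have X_minus: "- x \<in> \<X>" if "x \<in> \<X>" for x using X_symmetric that by auto
  have neg: "- (deg i + g1) \<notin> \<X>" using assms(3) X_minus[of "- (deg i + g1)"] by (metis minus_minus)
  have *: "deg (i\<^sup>\<star>) \<notin> \<X>" "- (deg i + g1) \<notin> \<X>" "deg (i\<^sup>\<star>) = g1 + - (deg i + g1)" "i\<^sup>\<star> \<in> I (deg (i\<^sup>\<star>))"
    using assms(1) deg_generic[of "i\<^sup>\<star>"] dual_closed[of i] neg
    by (auto simp: homog_def deg_dual)
  have "finite {(j, k). j \<in> I g1 \<and> k \<in> I (- (deg i + g1)) \<and> \<delta> i j k \<noteq> 0}"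
    using fusion_finite[OF *(1) assms(2) *(2-4)] assms(1) by (simp add: dual_dual)
  moreover have "{(j, k). deg j = g1 \<and> \<delta> i j k \<noteq> 0}
      \<subseteq> {(j, k). j \<in> I g1 \<and> k \<in> I (- (deg i + g1)) \<and> \<delta> i j k \<noteq> 0}"
  proof (clarify)
    fix j k assume "0 < \<delta> i j k"
    then have "deg i + deg j + deg k = 0" "j \<in> \<A>" "k \<in> \<A>"
      using mult_deg mult_labels by auto
    then show "j \<in> I (deg j) \<and> k \<in> I (- (deg i + deg j)) \<and> \<delta> i j k \<noteq> 0"
      using \<open>0 < \<delta> i j k\<close> minus_unique[of "deg i + deg j" "deg k"] by (simp add: homog_def)
  qed
  ultimately show ?thesis using finite_subset by blast
qed

lemma finite_fusion:
  assumes "i \<in> \<A>" "j \<in> \<A>" "deg i + deg j \<notin> \<X>"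
  shows "finite {k. \<delta> i j k \<noteq> 0}"
proof -
  have "finite (snd ` {(j', k). deg j' = deg j \<and> \<delta> i j' k \<noteq> 0})"
    by (intro finite_imageI finite_fusion_pairs assms deg_generic)
  then show ?thesis by (rule rev_finite_subset) force
qed

lemma finite_fusion_channels:
  assumes "i \<in> \<A>" "j \<in> \<A>" "deg i + deg j \<notin> \<X>"
  shows "finite {u \<in> \<A>. \<delta> i j (u\<^sup>\<star>) \<noteq> 0}"
proof -
  have "{u \<in> \<A>. \<delta> i j (u\<^sup>\<star>) \<noteq> 0} \<subseteq> (\<lambda>k. k\<^sup>\<star>) ` {k. \<delta> i j k \<noteq> 0}"
    using dual_dual by force
  then show ?thesis using finite_fusion[OF assms] finite_surj by blast
qed

lemma mult_bound: "finite F \<Longrightarrow> \<exists>M. \<forall>i\<in>F. \<forall>j\<in>F. \<forall>k\<in>F. \<delta> i j k \<le> M"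
proof -
  assume "finite F"
  then have "finite ((\<lambda>(i, j, k). \<delta> i j k) ` (F \<times> F \<times> F))" by simp
  from finite_nat_set_iff_bounded_le[THEN iffD1, OF this] show ?thesis by fastforce
qed

subsection \<open>Gluing two 6j-symbols\<close>

text \<open>
  The pentagon relation with finite sums over any sets that contain the supports; such sums can be
  interchanged freely.
\<close>

lemma pentagon_sums:
  assumes L: "{j0, j1, j2, j3, j4, j5, j6, j7, j8} \<subseteq> \<A>" and gen: "deg j2 + deg j3 \<notin> \<X>"
    and fin: "finite S" "finite C"
    and S: "\<And>j c1 c2 c3. \<N> j1 j2 j5 j3 j6 j a1 a2 c1 c2 \<noteq> 0 \<Longrightarrow>
      \<N> j1 j j6 j4 j0 j7 c1 a3 a0 c3 \<noteq> 0 \<Longrightarrow> \<N> j2 j3 j j4 j7 j8 c2 c3 a4 a5 \<noteq> 0 \<Longrightarrow>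
      (j, c1, c2, c3) \<in> S"
    and C: "{1..\<delta> j0 (j8\<^sup>\<star>) (j5\<^sup>\<star>)} \<subseteq> C"
  shows "(\<Sum>c\<in>C. \<N> j5 j3 j6 j4 j0 j8 a2 a3 c a5 * \<N> j1 j2 j5 j8 j0 j7 a1 c a0 a4)
    = (\<Sum>(j, c1, c2, c3)\<in>S.
          \<d> j * \<N> j1 j2 j5 j3 j6 j a1 a2 c1 c2 * \<N> j1 j j6 j4 j0 j7 c1 a3 a0 c3
              * \<N> j2 j3 j j4 j7 j8 c2 c3 a4 a5)"
proof -
  have "Sum_any (\<lambda>c4. \<N> j5 j3 j6 j4 j0 j8 a2 a3 c4 a5 * \<N> j1 j2 j5 j8 j0 j7 a1 c4 a0 a4)
    = (\<Sum>c\<in>C. \<N> j5 j3 j6 j4 j0 j8 a2 a3 c a5 * \<N> j1 j2 j5 j8 j0 j7 a1 c a0 a4)"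
  proof (rule Sum_any.expand_superset[OF fin(2)], clarify)
    fix c assume "\<N> j5 j3 j6 j4 j0 j8 a2 a3 c a5 * \<N> j1 j2 j5 j8 j0 j7 a1 c a0 a4 \<noteq> 0"
    then show "c \<in> C" using sixj_range(3)[of j5 j3 j6 j4 j0 j8 a2 a3 c a5] C by auto
  qed
  moreover have "Sum_any (\<lambda>(j, c1, c2, c3).
      \<d> j * \<N> j1 j2 j5 j3 j6 j a1 a2 c1 c2 * \<N> j1 j j6 j4 j0 j7 c1 a3 a0 c3
          * \<N> j2 j3 j j4 j7 j8 c2 c3 a4 a5)
    = (\<Sum>(j, c1, c2, c3)\<in>S.
          \<d> j * \<N> j1 j2 j5 j3 j6 j a1 a2 c1 c2 * \<N> j1 j j6 j4 j0 j7 c1 a3 a0 c3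
              * \<N> j2 j3 j j4 j7 j8 c2 c3 a4 a5)"
    by (rule Sum_any.expand_superset[OF fin(1)]) (use S in auto)
  ultimately show ?thesis using pentagon[OF L gen] by simp
qed

text \<open>
  The indices that the pentagon relation introduces when it fuses \<open>m\<close> and \<open>l\<close> into \<open>u\<close> at a corner:
  those that will be common to the whole plaquette, and, for one side with old label \<open>j\<close> and new
  label \<open>i\<close>, these together with the multiplicity index of the operator for \<open>u\<close>.
\<close>

definition channels :: "'j \<Rightarrow> 'j \<Rightarrow> ('j \<times> nat) set" where
  "channels m l = (SIGMA u:{u \<in> \<A>. \<delta> m l (u\<^sup>\<star>) \<noteq> 0}. {1..\<delta> m l (u\<^sup>\<star>)})"

definition side_channels :: "'j \<Rightarrow> 'j \<Rightarrow> 'j \<Rightarrow> 'j \<Rightarrow> (('j \<times> nat) \<times> nat) set" where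
  "side_channels m l i j = (SIGMA w:channels m l. {1..\<delta> i (fst w) (j\<^sup>\<star>)})"

lemma finite_channels:
  assumes "m \<in> \<A>" "l \<in> \<A>" "deg m + deg l \<notin> \<X>"
  shows "finite (channels m l)"
  unfolding channels_def using finite_fusion_channels[OF assms] by auto

lemma finite_side_channels:
  assumes "m \<in> \<A>" "l \<in> \<A>" "deg m + deg l \<notin> \<X>"
  shows "finite (side_channels m l i j)"
  unfolding side_channels_def using finite_channels[OF assms] by auto

text \<open>
  At one corner of a plaquette, the composition of the operators for \<open>l\<close> and then \<open>m\<close> is the conjugate
  of the operators for the fusion channels \<open>u\<close> of \<open>m\<close> and \<open>l\<close>. The two outer factors are 6j-symbols
  attached to the two sides that meet at the corner; the symbols of adjacent corners are
  inverse to each other on the common side, by the lemma after this one.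
\<close>

lemma corner_composition:
  assumes L: "{l, m, j, jn, j', jn', j'', jn'', k} \<subseteq> \<A>" and gen: "deg m + deg l \<notin> \<X>"
    and C: "finite C" "{1..\<delta> k jn' (j'\<^sup>\<star>)} \<subseteq> C"
  shows "(\<Sum>c\<in>C. \<N> j' l j (jn\<^sup>\<star>) k (jn'\<^sup>\<star>) A C0 c An * \<N> j'' m j' (jn'\<^sup>\<star>) k (jn''\<^sup>\<star>) B c C2 Bn)
    = (\<Sum>((u, c), D)\<in>side_channels m l j'' j. \<Sum>((u', c'), D')\<in>side_channels m l jn'' jn.
        \<N> j'' m j' l j u B A D c
        * (if (u, c) = (u', c') then \<N> j'' u j (jn\<^sup>\<star>) k (jn''\<^sup>\<star>) D C0 C2 D' else 0)
        * (\<d> u' * \<N> m l u' (jn\<^sup>\<star>) (jn''\<^sup>\<star>) (jn'\<^sup>\<star>) c' D' Bn An))"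
proof -
  have LA: "l \<in> \<A>" "m \<in> \<A>" "j \<in> \<A>" "jn \<in> \<A>" "j' \<in> \<A>" "jn' \<in> \<A>" "j'' \<in> \<A>" "jn'' \<in> \<A>" "k \<in> \<A>"
    using L by auto
  note fin = finite_channels[OF LA(2,1) gen] finite_side_channels[OF LA(2,1) gen]
  define S where "S = (\<lambda>((u, c), D, D'). (u, D, c, D')) `
      (SIGMA w:channels m l. {1..\<delta> j'' (fst w) (j\<^sup>\<star>)} \<times> {1..\<delta> jn'' (fst w) (jn\<^sup>\<star>)})"
  have fS: "finite S" unfolding S_def using fin by auto
  have "(\<Sum>c\<in>C. \<N> j' l j (jn\<^sup>\<star>) k (jn'\<^sup>\<star>) A C0 c An * \<N> j'' m j' (jn'\<^sup>\<star>) k (jn''\<^sup>\<star>) B c C2 Bn)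
    = (\<Sum>(u, c1, c2, c3)\<in>S. \<d> u * \<N> j'' m j' l j u B A c1 c2
        * \<N> j'' u j (jn\<^sup>\<star>) k (jn''\<^sup>\<star>) c1 C0 C2 c3 * \<N> m l u (jn\<^sup>\<star>) (jn''\<^sup>\<star>) (jn'\<^sup>\<star>) c2 c3 Bn An)"
  proof (rule pentagon_sums)
    show "{k, j'', m, l, jn\<^sup>\<star>, j', j, jn''\<^sup>\<star>, jn'\<^sup>\<star>} \<subseteq> \<A>" using LA dual_closed by auto
    show "{1..\<delta> k ((jn'\<^sup>\<star>)\<^sup>\<star>) (j'\<^sup>\<star>)} \<subseteq> C" using C LA by (simp add: dual_dual)
    fix u c1 c2 c3
    assume 1: "\<N> j'' m j' l j u B A c1 c2 \<noteq> 0"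
      and 2: "\<N> j'' u j (jn\<^sup>\<star>) k (jn''\<^sup>\<star>) c1 C0 C2 c3 \<noteq> 0"
      and 3: "\<N> m l u (jn\<^sup>\<star>) (jn''\<^sup>\<star>) (jn'\<^sup>\<star>) c2 c3 Bn An \<noteq> 0"
    have u: "u \<in> \<A>" using sixj_labels[OF 1] by auto
    have "\<delta> (jn''\<^sup>\<star>) ((jn\<^sup>\<star>)\<^sup>\<star>) (u\<^sup>\<star>) = \<delta> jn'' u (jn\<^sup>\<star>)"
      using mult_dual[of "jn''\<^sup>\<star>" jn "u\<^sup>\<star>"] mult_rotate[of jn'' u "jn\<^sup>\<star>"] u LA
      by (simp add: dual_closed dual_dual)
    then have "c1 \<in> {1..\<delta> j'' u (j\<^sup>\<star>)}" "c2 \<in> {1..\<delta> m l (u\<^sup>\<star>)}" "c3 \<in> {1..\<delta> jn'' u (jn\<^sup>\<star>)}"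
      using sixj_range(1)[OF 2] sixj_range(1)[OF 3] sixj_range(4)[OF 2] by auto
    then show "(u, c1, c2, c3) \<in> S"
      unfolding S_def channels_def by (intro image_eqI[where x="((u, c2), c1, c3)"]) (auto simp: u)
  qed (use gen C fS in auto)
  also have "\<dots> = (\<Sum>w\<in>channels m l. \<Sum>D\<in>{1..\<delta> j'' (fst w) (j\<^sup>\<star>)}. \<Sum>D'\<in>{1..\<delta> jn'' (fst w) (jn\<^sup>\<star>)}.
      \<d> (fst w) * \<N> j'' m j' l j (fst w) B A D (snd w) * \<N> j'' (fst w) j (jn\<^sup>\<star>) k (jn''\<^sup>\<star>) D C0 C2 D'
      * \<N> m l (fst w) (jn\<^sup>\<star>) (jn''\<^sup>\<star>) (jn'\<^sup>\<star>) (snd w) D' Bn An)"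
    unfolding S_def sum.cartesian_product using fin
    by (subst sum.reindex) (auto intro!: inj_onI sum.cong simp: sum.Sigma)
  also have "\<dots> = (\<Sum>w\<in>channels m l. \<Sum>D\<in>{1..\<delta> j'' (fst w) (j\<^sup>\<star>)}.
      \<Sum>w'\<in>channels m l. \<Sum>D'\<in>{1..\<delta> jn'' (fst w') (jn\<^sup>\<star>)}.
        \<N> j'' m j' l j (fst w) B A D (snd w)
        * (if w = w' then \<N> j'' (fst w) j (jn\<^sup>\<star>) k (jn''\<^sup>\<star>) D C0 C2 D' else 0)
        * (\<d> (fst w') * \<N> m l (fst w') (jn\<^sup>\<star>) (jn''\<^sup>\<star>) (jn'\<^sup>\<star>) (snd w') D' Bn An))"
  proof (intro sum.cong refl)
    fix w D assume w: "w \<in> channels m l"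
    let ?f = "\<lambda>w'. \<Sum>D'\<in>{1..\<delta> jn'' (fst w') (jn\<^sup>\<star>)}.
        \<N> j'' m j' l j (fst w) B A D (snd w) * \<N> j'' (fst w) j (jn\<^sup>\<star>) k (jn''\<^sup>\<star>) D C0 C2 D'
        * (\<d> (fst w') * \<N> m l (fst w') (jn\<^sup>\<star>) (jn''\<^sup>\<star>) (jn'\<^sup>\<star>) (snd w') D' Bn An)"
    have "(\<Sum>w'\<in>channels m l. \<Sum>D'\<in>{1..\<delta> jn'' (fst w') (jn\<^sup>\<star>)}.
        \<N> j'' m j' l j (fst w) B A D (snd w)
        * (if w = w' then \<N> j'' (fst w) j (jn\<^sup>\<star>) k (jn''\<^sup>\<star>) D C0 C2 D' else 0)
        * (\<d> (fst w') * \<N> m l (fst w') (jn\<^sup>\<star>) (jn''\<^sup>\<star>) (jn'\<^sup>\<star>) (snd w') D' Bn An))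
      = (\<Sum>w'\<in>channels m l. if w = w' then ?f w' else 0)"
      by (intro sum.cong refl) auto
    also have "\<dots> = ?f w"
      using w fin(1) by simp
    also have "\<dots> = (\<Sum>D'\<in>{1..\<delta> jn'' (fst w) (jn\<^sup>\<star>)}.
      \<d> (fst w) * \<N> j'' m j' l j (fst w) B A D (snd w) * \<N> j'' (fst w) j (jn\<^sup>\<star>) k (jn''\<^sup>\<star>) D C0 C2 D'
      * \<N> m l (fst w) (jn\<^sup>\<star>) (jn''\<^sup>\<star>) (jn'\<^sup>\<star>) (snd w) D' Bn An)"
      by (intro sum.cong refl) (simp only: mult_ac)
    finally show "(\<Sum>D'\<in>{1..\<delta> jn'' (fst w) (jn\<^sup>\<star>)}.
      \<d> (fst w) * \<N> j'' m j' l j (fst w) B A D (snd w) * \<N> j'' (fst w) j (jn\<^sup>\<star>) k (jn''\<^sup>\<star>) D C0 C2 D'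
      * \<N> m l (fst w) (jn\<^sup>\<star>) (jn''\<^sup>\<star>) (jn'\<^sup>\<star>) (snd w) D' Bn An)
      = (\<Sum>w'\<in>channels m l. \<Sum>D'\<in>{1..\<delta> jn'' (fst w') (jn\<^sup>\<star>)}.
        \<N> j'' m j' l j (fst w) B A D (snd w)
        * (if w = w' then \<N> j'' (fst w) j (jn\<^sup>\<star>) k (jn''\<^sup>\<star>) D C0 C2 D' else 0)
        * (\<d> (fst w') * \<N> m l (fst w') (jn\<^sup>\<star>) (jn''\<^sup>\<star>) (jn'\<^sup>\<star>) (snd w') D' Bn An))"
      by (rule sym)
  qed
  also have "\<dots> = (\<Sum>(w, D)\<in>side_channels m l j'' j. \<Sum>(w', D')\<in>side_channels m l jn'' jn.
        \<N> j'' m j' l j (fst w) B A D (snd w)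
        * (if w = w' then \<N> j'' (fst w) j (jn\<^sup>\<star>) k (jn''\<^sup>\<star>) D C0 C2 D' else 0)
        * (\<d> (fst w') * \<N> m l (fst w') (jn\<^sup>\<star>) (jn''\<^sup>\<star>) (jn'\<^sup>\<star>) (snd w') D' Bn An))"
    unfolding side_channels_def using fin(1) by (simp add: sum.Sigma[symmetric])
  finally show ?thesis by (simp add: case_prod_unfold prod_eq_iff)
qed

text \<open>
  The first 6j-symbol is rotated such that its last label becomes \<open>n\<close> instead of \<open>n\<^sup>\<star>\<close>, so that the
  orthogonality relation can be applied with \<open>n\<close> as summation variable.
\<close>

lemma side_orthogonality:
  assumes L: "{l, m, j, j''} \<subseteq> \<A>" and gen: "deg j'' + deg m \<notin> \<X>"
    and y: "((u, c), D) \<in> side_channels m l j'' j" and z: "((u', c'), D') \<in> side_channels m l j'' j"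
    and F: "finite F" "{n. \<delta> j'' m (n\<^sup>\<star>) \<noteq> 0 \<and> \<delta> n l (j\<^sup>\<star>) \<noteq> 0} \<subseteq> F" "finite C"
      "\<And>n. n \<in> F \<Longrightarrow> {1..\<delta> n l (j\<^sup>\<star>)} \<subseteq> C \<and> {1..\<delta> j'' m (n\<^sup>\<star>)} \<subseteq> C"
  shows "(\<Sum>(n, A, B)\<in>F \<times> C \<times> C. (\<d> u * \<N> m l u (j\<^sup>\<star>) (j''\<^sup>\<star>) (n\<^sup>\<star>) c D B A)
            * (\<d> n * \<N> j'' m n l j u' B A D' c'))
    = (if ((u, c), D) = ((u', c'), D') then 1 else 0)"
proof -
  have LA: "l \<in> \<A>" "m \<in> \<A>" "j \<in> \<A>" "j'' \<in> \<A>" "u \<in> \<A>" "u' \<in> \<A>"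
    using L y z by (auto simp: side_channels_def channels_def)
  have *: "\<N> m l u (j\<^sup>\<star>) (j''\<^sup>\<star>) (n\<^sup>\<star>) c D B A = \<N> (j\<^sup>\<star>) j'' (u\<^sup>\<star>) m (l\<^sup>\<star>) n D c A B"
    if "n \<in> \<A>" for n A B
    using that LA by (subst sixj_flip) (auto simp: dual_closed dual_dual)
  have **: "\<N> j'' m n l j u' B A D' c' = \<N> (u'\<^sup>\<star>) (j''\<^sup>\<star>) (j\<^sup>\<star>) n (l\<^sup>\<star>) m D' A c' B"
    if "n \<in> \<A>" for n A B
    using that LA by (intro sixj_sym_orth) auto
  let ?g = "\<lambda>(n, A, B). \<d> n * \<N> (j\<^sup>\<star>) j'' (u\<^sup>\<star>) m (l\<^sup>\<star>) n D c A B
      * \<N> (u'\<^sup>\<star>) (j''\<^sup>\<star>) (j\<^sup>\<star>) n (l\<^sup>\<star>) m D' A c' B"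
  have "u\<^sup>\<star> = u'\<^sup>\<star> \<longleftrightarrow> u = u'" using dual_dual[OF LA(5)] dual_dual[OF LA(6)] by metis
  moreover have "D \<in> {1..\<delta> (j\<^sup>\<star>) j'' ((u\<^sup>\<star>)\<^sup>\<star>)}" "c \<in> {1..\<delta> (u\<^sup>\<star>) m ((l\<^sup>\<star>)\<^sup>\<star>)}"
    using y LA mult_rotate[of "j\<^sup>\<star>" j'' u] mult_rotate[of "u\<^sup>\<star>" m l]
    by (auto simp: side_channels_def channels_def dual_dual)
  ultimately have "Sum_any ?g = (if u' = u \<and> D = D' \<and> c = c' then 1 / \<d> u' else 0)"
    using LA gen by (subst orthogonality) (auto simp: dual_closed qdim_dual)
  moreover have "Sum_any ?g = sum ?g (F \<times> C \<times> C)"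
  proof (rule Sum_any.expand_superset)
    have "(n, A, B) \<in> F \<times> C \<times> C" if "?g (n, A, B) \<noteq> 0" for n A B
    proof -
      from that have nz: "\<N> (u'\<^sup>\<star>) (j''\<^sup>\<star>) (j\<^sup>\<star>) n (l\<^sup>\<star>) m D' A c' B \<noteq> 0" by auto
      have n: "n \<in> \<A>" using sixj_labels[OF nz] by auto
      have nz': "\<N> j'' m n l j u' B A D' c' \<noteq> 0" using nz **[OF n] by simp
      have "B \<in> {1..\<delta> j'' m (n\<^sup>\<star>)}" "A \<in> {1..\<delta> n l (j\<^sup>\<star>)}"
        using sixj_range[OF nz'] by auto
      moreover from this have "n \<in> F" using F(2) by force
      ultimately show ?thesis using F(4)[of n] by auto
    qed
    then have "x \<in> F \<times> C \<times> C" if "?g x \<noteq> 0" for x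
      using that by (cases x rule: prod_cases3) blast
    then show "{x. ?g x \<noteq> 0} \<subseteq> F \<times> C \<times> C" by blast
  qed (use F in auto)
  moreover have "(\<Sum>(n, A, B)\<in>F \<times> C \<times> C. (\<d> u * \<N> m l u (j\<^sup>\<star>) (j''\<^sup>\<star>) (n\<^sup>\<star>) c D B A)
            * (\<d> n * \<N> j'' m n l j u' B A D' c')) = \<d> u * sum ?g (F \<times> C \<times> C)"
    unfolding sum_distrib_left
  proof (intro sum.cong refl, clarify)
    fix n A B
    show "(\<d> u * \<N> m l u (j\<^sup>\<star>) (j''\<^sup>\<star>) (n\<^sup>\<star>) c D B A) * (\<d> n * \<N> j'' m n l j u' B A D' c')
      = \<d> u * (\<d> n * \<N> (j\<^sup>\<star>) j'' (u\<^sup>\<star>) m (l\<^sup>\<star>) n D c A B * \<N> (u'\<^sup>\<star>) (j''\<^sup>\<star>) (j\<^sup>\<star>) n (l\<^sup>\<star>) m D' A c' B)"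
    proof (cases "n \<in> \<A>")
      case False
      then have "\<N> j'' m n l j u' B A D' c' = 0 \<and> \<N> (u'\<^sup>\<star>) (j''\<^sup>\<star>) (j\<^sup>\<star>) n (l\<^sup>\<star>) m D' A c' B = 0"
        using sixj_labels by blast
      then show ?thesis by simp
    qed (simp add: * **)
  qed
  ultimately show ?thesis using qdim_nonzero[OF LA(6)] by auto
qed

text \<open>
  At a corner common to the plaquettes of two operators, with labels \<open>l\<close> and \<open>m\<close>, exchanging the order
  of the operators costs a 6j-symbol attached to the common side, whose intermediate label changes
  from \<open>j'\<close> to \<open>u\<close>. The corner at the other end of the common side produces the same symbol.
\<close>

lemma shared_corner:
  assumes L: "{l, m, j, j', j'', a, a', d0, d'} \<subseteq> \<A>" and gen: "deg j'' + deg l \<notin> \<X>"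
    and C: "finite C" "{1..\<delta> (d0\<^sup>\<star>) a' (j'\<^sup>\<star>)} \<subseteq> C"
    and U: "finite U" "{u. \<delta> j'' l (u\<^sup>\<star>) \<noteq> 0 \<and> \<delta> (m\<^sup>\<star>) u (j\<^sup>\<star>) \<noteq> 0} \<subseteq> U"
    and C': "\<And>u. u \<in> U \<Longrightarrow>
      {1..\<delta> j'' l (u\<^sup>\<star>)} \<subseteq> C \<and> {1..\<delta> (m\<^sup>\<star>) u (j\<^sup>\<star>)} \<subseteq> C \<and> {1..\<delta> u (a\<^sup>\<star>) d'} \<subseteq> C"
  shows "(\<Sum>c\<in>C. \<N> j' l j (a\<^sup>\<star>) (d0\<^sup>\<star>) (a'\<^sup>\<star>) A C0 c Aa * \<N> d' m d0 j' a' j'' Bd c C2 B)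
   = (\<Sum>(u, B', A', c)\<in>U \<times> C \<times> C \<times> C. \<d> u * \<N> (m\<^sup>\<star>) j'' j' l j u B A B' A'
        * (\<N> d' m d0 j a u Bd C0 c B' * \<N> j'' l u (a\<^sup>\<star>) (d'\<^sup>\<star>) (a'\<^sup>\<star>) A' c C2 Aa))"
proof -
  have LA: "l \<in> \<A>" "m \<in> \<A>" "j \<in> \<A>" "j' \<in> \<A>" "j'' \<in> \<A>" "a \<in> \<A>" "a' \<in> \<A>" "d0 \<in> \<A>" "d' \<in> \<A>"
    using L by auto
  have *: "\<N> d' m d0 j' a' j'' Bd c C2 B = \<N> (m\<^sup>\<star>) j'' j' (a'\<^sup>\<star>) (d0\<^sup>\<star>) (d'\<^sup>\<star>) B c Bd C2" for c
    using LA by (intro sixj_sym_shared) auto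
  have **: "\<N> d' m d0 j a u Bd C0 c B' = \<N> (m\<^sup>\<star>) u j (a\<^sup>\<star>) (d0\<^sup>\<star>) (d'\<^sup>\<star>) B' C0 Bd c" for u c B'
  proof (cases "u \<in> \<A>")
    case True
    then show ?thesis using LA by (intro sixj_sym_shared) auto
  next
    case False
    then have "\<N> d' m d0 j a u Bd C0 c B' = 0 \<and> \<N> (m\<^sup>\<star>) u j (a\<^sup>\<star>) (d0\<^sup>\<star>) (d'\<^sup>\<star>) B' C0 Bd c = 0"
      using sixj_labels by blast
    then show ?thesis by simp
  qed
  have "(\<Sum>c\<in>C. \<N> j' l j (a\<^sup>\<star>) (d0\<^sup>\<star>) (a'\<^sup>\<star>) A C0 c Aa
      * \<N> (m\<^sup>\<star>) j'' j' (a'\<^sup>\<star>) (d0\<^sup>\<star>) (d'\<^sup>\<star>) B c Bd C2)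
    = (\<Sum>(u, B', A', c)\<in>U \<times> C \<times> C \<times> C. \<d> u * \<N> (m\<^sup>\<star>) j'' j' l j u B A B' A'
        * \<N> (m\<^sup>\<star>) u j (a\<^sup>\<star>) (d0\<^sup>\<star>) (d'\<^sup>\<star>) B' C0 Bd c * \<N> j'' l u (a\<^sup>\<star>) (d'\<^sup>\<star>) (a'\<^sup>\<star>) A' c C2 Aa)"
  proof (rule pentagon_sums)
    show "{d0\<^sup>\<star>, m\<^sup>\<star>, j'', l, a\<^sup>\<star>, j', j, d'\<^sup>\<star>, a'\<^sup>\<star>} \<subseteq> \<A>" using LA dual_closed by auto
    show "{1..\<delta> (d0\<^sup>\<star>) ((a'\<^sup>\<star>)\<^sup>\<star>) (j'\<^sup>\<star>)} \<subseteq> C" using C LA by (simp add: dual_dual)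
    fix u c1 c2 c3
    assume 2: "\<N> (m\<^sup>\<star>) u j (a\<^sup>\<star>) (d0\<^sup>\<star>) (d'\<^sup>\<star>) c1 C0 Bd c3 \<noteq> 0"
      and 3: "\<N> j'' l u (a\<^sup>\<star>) (d'\<^sup>\<star>) (a'\<^sup>\<star>) c2 c3 C2 Aa \<noteq> 0"
    have "c1 \<in> {1..\<delta> (m\<^sup>\<star>) u (j\<^sup>\<star>)}" "c2 \<in> {1..\<delta> j'' l (u\<^sup>\<star>)}" "c3 \<in> {1..\<delta> u (a\<^sup>\<star>) d'}"
      using sixj_range(1)[OF 2] sixj_range(1,2)[OF 3] LA by (auto simp: dual_dual)
    moreover from this have "u \<in> U" using U by force
    ultimately show "(u, c1, c2, c3) \<in> U \<times> C \<times> C \<times> C" using C'[of u] by auto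
  qed (use gen C U in auto)
  then show ?thesis unfolding * ** by (simp add: mult.assoc)
qed

subsection \<open>Complex conjugation\<close>

text \<open>
  Up to scalars, the conjugate of the symbol at a corner is the symbol for the reverse transition: after a
  rotation about the face with index \<open>A\<close>, old and new labels have changed places and \<open>l\<close> has become
  its dual.
\<close>

lemma sixj_cnj_corner:
  assumes L: "{j', l, j, jn, k, jn'} \<subseteq> \<A>"
  shows "cnj (\<N> j' l j (jn\<^sup>\<star>) k (jn'\<^sup>\<star>) A C C' An)
    = \<N> j (l\<^sup>\<star>) j' (jn'\<^sup>\<star>) k (jn\<^sup>\<star>) A C' C An
      * (\<gamma> A j' l (j\<^sup>\<star>) * \<gamma> C j (jn\<^sup>\<star>) (k\<^sup>\<star>) * \<gamma> C' (j'\<^sup>\<star>) k jn' * \<gamma> An (l\<^sup>\<star>) (jn'\<^sup>\<star>) jn)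
      * (\<beta> j' * \<beta> l * \<beta> j * \<beta> jn * \<beta> k * \<beta> jn')"
proof -
  have LA: "j' \<in> \<A>" "l \<in> \<A>" "j \<in> \<A>" "jn \<in> \<A>" "k \<in> \<A>" "jn' \<in> \<A>" using L by auto
  have "\<N> (l\<^sup>\<star>) (j'\<^sup>\<star>) (j\<^sup>\<star>) k (jn\<^sup>\<star>) (jn'\<^sup>\<star>) A C An C' = \<N> j (l\<^sup>\<star>) j' (jn'\<^sup>\<star>) k (jn\<^sup>\<star>) A C' C An"
    using LA by (subst sixj_rotate_face) (auto simp: dual_closed dual_dual)
  then show ?thesis
    using LA by (subst sixj_cnj) (auto simp: dual_closed dual_dual beta_dual)
qed

end


section \<open>Sums of products around a cycle\<close>

text \<open>
  The left-hand side is the trace of the product of the matrices \<open>K e\<close> around the cycle \<open>S\<close>. If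
  \<open>K e = P e \<cdot> Z e \<cdot> R e\<close> and \<open>R e\<close> is a left inverse of the following \<open>P (nxt e)\<close>, then the
  conjugating factors cancel in the trace.
\<close>

lemma cyclic_trace_conjugation:
  fixes K :: "'e \<Rightarrow> 'x \<Rightarrow> 'x \<Rightarrow> 'r::comm_semiring_1" and Z :: "'e \<Rightarrow> 'y \<Rightarrow> 'y \<Rightarrow> 'r"
  assumes S: "finite S" and nxt: "bij_betw nxt S S"
    and X: "\<And>e. e \<in> S \<Longrightarrow> finite (X e)" and Y: "\<And>e. e \<in> S \<Longrightarrow> finite (Y e)"
    and K: "\<And>e x x'. e \<in> S \<Longrightarrow> x \<in> X e \<Longrightarrow> x' \<in> X (nxt e) \<Longrightarrow>
      K e x x' = (\<Sum>y\<in>Y e. \<Sum>z\<in>Y (nxt e). P e x y * Z e y z * R e z x')"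
    and inv: "\<And>e y z. e \<in> S \<Longrightarrow> y \<in> Y (nxt e) \<Longrightarrow> z \<in> Y (nxt e) \<Longrightarrow>
      (\<Sum>x\<in>X (nxt e). R e z x * P (nxt e) x y) = (if z = y then 1 else 0)"
  shows "(\<Sum>x\<in>PiE S X. \<Prod>e\<in>S. K e (x e) (x (nxt e))) = (\<Sum>y\<in>PiE S Y. \<Prod>e\<in>S. Z e (y e) (y (nxt e)))"
proof -
  have nxtS: "nxt e \<in> S" if "e \<in> S" for e using nxt that by (auto simp: bij_betw_def)
  define pre where "pre = inv_into S nxt"
  have pre: "pre (nxt e) = e" if "e \<in> S" for e
    using nxt that by (auto simp: pre_def bij_betw_def)
  let ?Z = "PiE S (\<lambda>e. Y (nxt e))"
  have "(\<Sum>x\<in>PiE S X. \<Prod>e\<in>S. K e (x e) (x (nxt e)))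
    = (\<Sum>x\<in>PiE S X. \<Prod>e\<in>S. \<Sum>y\<in>Y e. \<Sum>z\<in>Y (nxt e). P e (x e) y * Z e y z * R e z (x (nxt e)))"
    by (intro sum.cong prod.cong refl K) (auto simp: nxtS)
  also have "\<dots> = (\<Sum>x\<in>PiE S X. \<Sum>y\<in>PiE S Y. \<Sum>z\<in>?Z.
      \<Prod>e\<in>S. P e (x e) (y e) * Z e (y e) (z e) * R e (z e) (x (nxt e)))"
    using S Y nxtS by (simp add: prod_sum_PiE)
  also have "\<dots> = (\<Sum>y\<in>PiE S Y. \<Sum>z\<in>?Z. \<Sum>x\<in>PiE S X.
      \<Prod>e\<in>S. P e (x e) (y e) * Z e (y e) (z e) * R e (z e) (x (nxt e)))"
    by (subst sum.swap, rule sum.cong[OF refl], rule sum.swap)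
  also have "\<dots> = (\<Sum>y\<in>PiE S Y. \<Sum>z\<in>?Z. \<Prod>e\<in>S. Z e (y e) (z e) * (if z e = y (nxt e) then 1 else 0))"
  proof (intro sum.cong refl)
    fix y z assume y: "y \<in> PiE S Y" and z: "z \<in> ?Z"
    define g where "g e v = R e (z e) v * P (nxt e) v (y (nxt e))" for e v
    have *: "(\<Prod>e\<in>S. P e (x e) (y e) * Z e (y e) (z e) * R e (z e) (x (nxt e)))
      = (\<Prod>e\<in>S. Z e (y e) (z e)) * (\<Prod>e\<in>S. g (pre e) (x e))" for x
    proof -
      have "(\<Prod>e\<in>S. P e (x e) (y e)) = (\<Prod>e\<in>S. P (nxt e) (x (nxt e)) (y (nxt e)))"
        using prod.reindex_bij_betw[OF nxt, of "\<lambda>e. P e (x e) (y e)"] by simp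
      moreover have "(\<Prod>e\<in>S. g e (x (nxt e))) = (\<Prod>e\<in>S. g (pre e) (x e))"
        using prod.reindex_bij_betw[OF nxt, of "\<lambda>e. g (pre e) (x e)"] by (simp add: pre)
      ultimately show ?thesis by (simp add: prod.distrib g_def mult_ac)
    qed
    have "(\<Sum>x\<in>PiE S X. \<Prod>e\<in>S. g (pre e) (x e)) = (\<Prod>e\<in>S. \<Sum>v\<in>X e. g (pre e) v)"
      using S X by (simp add: prod_sum_PiE)
    also have "\<dots> = (\<Prod>e\<in>S. \<Sum>v\<in>X (nxt e). g e v)"
      using prod.reindex_bij_betw[OF nxt, of "\<lambda>e. \<Sum>v\<in>X e. g (pre e) v"] by (simp add: pre)
    also have "\<dots> = (\<Prod>e\<in>S. if z e = y (nxt e) then 1 else 0)"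
      using y z nxtS by (intro prod.cong refl) (auto simp: g_def inv PiE_iff)
    finally show "(\<Sum>x\<in>PiE S X. \<Prod>e\<in>S. P e (x e) (y e) * Z e (y e) (z e) * R e (z e) (x (nxt e)))
      = (\<Prod>e\<in>S. Z e (y e) (z e) * (if z e = y (nxt e) then 1 else 0))"
      unfolding * by (simp add: sum_distrib_left[symmetric] prod.distrib)
  qed
  also have "\<dots> = (\<Sum>y\<in>PiE S Y. \<Prod>e\<in>S. \<Sum>v\<in>Y (nxt e). Z e (y e) v * (if v = y (nxt e) then 1 else 0))"
    using S Y nxtS by (simp add: prod_sum_PiE)
  also have "\<dots> = (\<Sum>y\<in>PiE S Y. \<Prod>e\<in>S. Z e (y e) (y (nxt e)))"
  proof (intro sum.cong prod.cong refl)
    fix y e assume "y \<in> PiE S Y" "e \<in> S"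
    then have "y (nxt e) \<in> Y (nxt e)" "finite (Y (nxt e))" using nxtS Y by auto
    then show "(\<Sum>v\<in>Y (nxt e). Z e (y e) v * (if v = y (nxt e) then 1 else 0)) = Z e (y e) (y (nxt e))"
      by (simp add: if_distrib cong: if_cong)
  qed
  finally show ?thesis .
qed

text \<open>A trace of block diagonal matrices is the sum of the traces of the blocks.\<close>

lemma cyclic_trace_block_diagonal:
  fixes G :: "'e \<Rightarrow> 'w \<Rightarrow> 'd \<Rightarrow> 'd \<Rightarrow> 'r::comm_semiring_1"
  assumes S: "finite S" "e0 \<in> S" and nxt: "\<And>e. e \<in> S \<Longrightarrow> nxt e \<in> S"
    and transitive: "\<And>f e. \<forall>e\<in>S. f (nxt e) = (f e :: 'w) \<Longrightarrow> e \<in> S \<Longrightarrow> f e = f e0"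
    and W: "finite W" and V: "\<And>e w. finite (V e w)"
  shows "(\<Sum>y\<in>PiE S (\<lambda>e. SIGMA w:W. V e w).
      \<Prod>e\<in>S. if fst (y e) = fst (y (nxt e)) then G e (fst (y e)) (snd (y e)) (snd (y (nxt e))) else 0)
    = (\<Sum>w\<in>W. \<Sum>D\<in>PiE S (\<lambda>e. V e w). \<Prod>e\<in>S. G e w (D e) (D (nxt e)))"
    (is "(\<Sum>y\<in>?A. ?f y) = _")
proof -
  define B where "B = {y \<in> ?A. \<forall>e\<in>S. fst (y (nxt e)) = fst (y e)}"
  have finA: "finite ?A" using S W V by (intro finite_PiE) auto
  have const: "fst (y e) = fst (y e0)" if "y \<in> B" "e \<in> S" for y e
    using that transitive[of "\<lambda>e. fst (y e)" e] by (auto simp: B_def)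
  have "(\<Sum>y\<in>?A. ?f y) = (\<Sum>y\<in>B. ?f y)"
  proof (rule sum.mono_neutral_right[OF finA])
    show "\<forall>y\<in>?A - B. ?f y = 0"
    proof
      fix y assume "y \<in> ?A - B"
      then obtain e where "e \<in> S" "fst (y e) \<noteq> fst (y (nxt e))" by (auto simp: B_def)
      then show "?f y = 0" using S(1) by (intro prod_zero) auto
    qed
  qed (auto simp: B_def)
  also have "\<dots> = (\<Sum>(w, D)\<in>(SIGMA w:W. PiE S (\<lambda>e. V e w)). \<Prod>e\<in>S. G e w (D e) (D (nxt e)))"
  proof (rule sum.reindex_bij_witness[where i = "\<lambda>(w, D). \<lambda>e\<in>S. (w, D e)"
        and j = "\<lambda>y. (fst (y e0), \<lambda>e\<in>S. snd (y e))"])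
    fix y assume y: "y \<in> B"
    have yA: "y \<in> ?A" using y by (simp add: B_def)
    show "(case (fst (y e0), \<lambda>e\<in>S. snd (y e)) of (w, D) \<Rightarrow> \<lambda>e\<in>S. (w, D e)) = y"
      using const[OF y] yA by (auto simp: fun_eq_iff PiE_iff extensional_def prod_eq_iff)
    show "(fst (y e0), \<lambda>e\<in>S. snd (y e)) \<in> (SIGMA w:W. PiE S (\<lambda>e. V e w))"
    proof (intro SigmaI PiE_I)
      show "fst (y e0) \<in> W" using yA S(2) by (auto simp: PiE_iff)
      fix e assume e: "e \<in> S"
      then have "y e \<in> (SIGMA w:W. V e w)" using yA by auto
      then show "(\<lambda>e\<in>S. snd (y e)) e \<in> V e (fst (y e0))" using const[OF y e] e by auto
    qed auto
    show "(case (fst (y e0), \<lambda>e\<in>S. snd (y e)) of (w, D) \<Rightarrow> \<Prod>e\<in>S. G e w (D e) (D (nxt e))) = ?f y"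
      using const[OF y] nxt by (auto intro!: prod.cong)
  next
    fix b assume "b \<in> (SIGMA w:W. PiE S (\<lambda>e. V e w))"
    then obtain w D where b: "b = (w, D)" "w \<in> W" "D \<in> PiE S (\<lambda>e. V e w)" by auto
    show "(case b of (w, D) \<Rightarrow> \<lambda>e\<in>S. (w, D e)) \<in> B"
      using b nxt by (auto simp: B_def PiE_iff)
    show "(fst ((case b of (w, D) \<Rightarrow> \<lambda>e\<in>S. (w, D e)) e0),
        \<lambda>e\<in>S. snd ((case b of (w, D) \<Rightarrow> \<lambda>e\<in>S. (w, D e)) e)) = b"
      using b S(2) by (auto simp: fun_eq_iff PiE_iff extensional_def)
  qed
  also have "\<dots> = (\<Sum>w\<in>W. \<Sum>D\<in>PiE S (\<lambda>e. V e w). \<Prod>e\<in>S. G e w (D e) (D (nxt e)))"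
    using W V S(1) by (subst sum.Sigma) (auto intro!: finite_PiE)
  finally show ?thesis .
qed

lemma sum_PiE_insert:
  assumes "a \<notin> S"
  shows "(\<Sum>f\<in>PiE (insert a S) X. h f) = (\<Sum>f\<in>PiE S X. \<Sum>x\<in>X a. h (f(a := x)))"
proof -
  have "inj_on (\<lambda>(y, g). g(a := y)) (X a \<times> PiE S X)"
    using assms by (intro inj_onI) (auto simp: fun_eq_iff PiE_iff extensional_def split: if_splits, metis+)
  then have "(\<Sum>f\<in>PiE (insert a S) X. h f) = (\<Sum>(x, f)\<in>X a \<times> PiE S X. h (f(a := x)))"
    unfolding PiE_insert_eq by (subst sum.reindex) (auto simp: case_prod_unfold)
  also have "\<dots> = (\<Sum>x\<in>X a. \<Sum>f\<in>PiE S X. h (f(a := x)))"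
    by (simp add: sum.cartesian_product)
  finally show ?thesis by (simp add: sum.swap[of _ "X a"])
qed

lemma sum_PiE_Times:
  "(\<Sum>x\<in>PiE S (\<lambda>e. A e \<times> B e). h x) = (\<Sum>f\<in>PiE S A. \<Sum>g\<in>PiE S B. h (\<lambda>e\<in>S. (f e, g e)))"
proof -
  have "(\<Sum>x\<in>PiE S (\<lambda>e. A e \<times> B e). h x) = (\<Sum>(f, g)\<in>PiE S A \<times> PiE S B. h (\<lambda>e\<in>S. (f e, g e)))"
  proof (rule sum.reindex_bij_witness[where i = "\<lambda>(f, g). \<lambda>e\<in>S. (f e, g e)"
        and j = "\<lambda>x. (\<lambda>e\<in>S. fst (x e), \<lambda>e\<in>S. snd (x e))"])
    fix x assume x: "x \<in> PiE S (\<lambda>e. A e \<times> B e)"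
    then show "(\<lambda>e\<in>S. fst (x e), \<lambda>e\<in>S. snd (x e)) \<in> PiE S A \<times> PiE S B"
      by (auto simp: PiE_iff mem_Times_iff)
    have *: "(\<lambda>e\<in>S. (fst (x e), snd (x e))) = x"
      using x by (auto simp: fun_eq_iff PiE_iff extensional_def)
    have **: "(\<lambda>e\<in>S. ((\<lambda>e\<in>S. fst (x e)) e, (\<lambda>e\<in>S. snd (x e)) e)) = x"
      by (subst (3) *[symmetric]) (auto simp: fun_eq_iff)
    show "(case (\<lambda>e\<in>S. fst (x e), \<lambda>e\<in>S. snd (x e)) of (f, g) \<Rightarrow> \<lambda>e\<in>S. (f e, g e)) = x"
      using ** by simp
    show "(case (\<lambda>e\<in>S. fst (x e), \<lambda>e\<in>S. snd (x e)) of (f, g) \<Rightarrow> h (\<lambda>e\<in>S. (f e, g e))) = h x"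
      using ** by simp
  next
    fix b assume "b \<in> PiE S A \<times> PiE S B"
    then obtain f g where b: "b = (f, g)" "f \<in> PiE S A" "g \<in> PiE S B" by auto
    show "(case b of (f, g) \<Rightarrow> \<lambda>e\<in>S. (f e, g e)) \<in> PiE S (\<lambda>e. A e \<times> B e)"
      using b by (auto simp: PiE_iff)
    show "(\<lambda>e\<in>S. fst ((case b of (f, g) \<Rightarrow> \<lambda>e\<in>S. (f e, g e)) e),
        \<lambda>e\<in>S. snd ((case b of (f, g) \<Rightarrow> \<lambda>e\<in>S. (f e, g e)) e)) = b"
      using b by (auto simp: fun_eq_iff PiE_iff extensional_def)
  qed
  then show ?thesis by (simp add: sum.cartesian_product)
qed

section \<open>Sums of commuting projections\<close>

text \<open>
  Linearity is relative to a set \<open>W\<close> of functions, because the induction over the projections below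
  restricts them to smaller and smaller subspaces.
\<close>

definition linear_on :: "('s \<Rightarrow> complex) set \<Rightarrow> (('s \<Rightarrow> complex) \<Rightarrow> 's \<Rightarrow> complex) \<Rightarrow> bool" where
  "linear_on W F \<longleftrightarrow> F \<in> W \<rightarrow> W \<and>
     (\<forall>x\<in>W. \<forall>y\<in>W. \<forall>c d. F (\<lambda>s. c * x s + d * y s) = (\<lambda>s. c * F x s + d * F y s))"

definition lin_closed :: "('s \<Rightarrow> complex) set \<Rightarrow> bool" where
  "lin_closed W \<longleftrightarrow> (\<forall>x\<in>W. \<forall>y\<in>W. \<forall>c d. (\<lambda>s. c * x s + d * y s) \<in> W)"

lemma lin_closedD: "lin_closed W \<Longrightarrow> x \<in> W \<Longrightarrow> y \<in> W \<Longrightarrow> (\<lambda>s. c * x s + d * y s) \<in> W"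
  unfolding lin_closed_def by blast

lemma lin_closed_diff: "lin_closed W \<Longrightarrow> x \<in> W \<Longrightarrow> y \<in> W \<Longrightarrow> (\<lambda>s. x s - y s) \<in> W"
  using lin_closedD[of W x y 1 "- 1"] by simp

lemma lin_closed_add: "lin_closed W \<Longrightarrow> x \<in> W \<Longrightarrow> y \<in> W \<Longrightarrow> (\<lambda>s. x s + y s) \<in> W"
  using lin_closedD[of W x y 1 1] by simp

lemma linear_on_mem: "linear_on W F \<Longrightarrow> x \<in> W \<Longrightarrow> F x \<in> W"
  unfolding linear_on_def by blast

lemma linear_onD:
  "linear_on W F \<Longrightarrow> x \<in> W \<Longrightarrow> y \<in> W \<Longrightarrow> F (\<lambda>s. c * x s + d * y s) = (\<lambda>s. c * F x s + d * F y s)"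
  unfolding linear_on_def by blast

lemma linear_on_diff:
  "linear_on W F \<Longrightarrow> x \<in> W \<Longrightarrow> y \<in> W \<Longrightarrow> F (\<lambda>s. x s - y s) = (\<lambda>s. F x s - F y s)"
  using linear_onD[of W F x y 1 "- 1"] by simp

lemma linear_on_add:
  "linear_on W F \<Longrightarrow> x \<in> W \<Longrightarrow> y \<in> W \<Longrightarrow> F (\<lambda>s. x s + y s) = (\<lambda>s. F x s + F y s)"
  using linear_onD[of W F x y 1 1] by simp

lemma linear_on_zero: "linear_on W F \<Longrightarrow> (\<lambda>_. 0) \<in> W \<Longrightarrow> F (\<lambda>_. 0) = (\<lambda>_. 0)"
  using linear_onD[of W F "\<lambda>_. 0" "\<lambda>_. 0" 0 0] by simp

lemma linear_onI:
  assumes "\<And>x. x \<in> W \<Longrightarrow> F x \<in> W"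
    and "\<And>x y c d s. x \<in> W \<Longrightarrow> y \<in> W \<Longrightarrow> F (\<lambda>s. c * x s + d * y s) s = c * F x s + d * F y s"
  shows "linear_on W F"
  unfolding linear_on_def using assms by (auto simp: fun_eq_iff)

lemma linear_on_comb:
  assumes W: "lin_closed W" and F: "linear_on W F" "linear_on W G"
  shows "linear_on W (\<lambda>x s. a * F x s + b * G x s)"
proof (rule linear_onI)
  fix x assume "x \<in> W"
  then show "(\<lambda>s. a * F x s + b * G x s) \<in> W"
    using lin_closedD[OF W linear_on_mem[OF F(1)] linear_on_mem[OF F(2)]] by simp
next
  fix x y c d s assume "x \<in> W" "y \<in> W"
  then show "a * F (\<lambda>s. c * x s + d * y s) s + b * G (\<lambda>s. c * x s + d * y s) s
    = c * (a * F x s + b * G x s) + d * (a * F y s + b * G y s)"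
    using linear_onD[OF F(1), of x y c d] linear_onD[OF F(2), of x y c d] by (simp add: algebra_simps)
qed

lemma linear_on_sum:
  assumes W: "lin_closed W" "(\<lambda>_. 0) \<in> W" and F: "\<And>i. i \<in> S \<Longrightarrow> linear_on W (F i)"
  shows "linear_on W (\<lambda>x s. \<Sum>i\<in>S. F i x s)"
  using F
proof (induction S rule: infinite_finite_induct)
  case (insert i S)
  then have "linear_on W (\<lambda>x s. 1 * F i x s + 1 * (\<Sum>i\<in>S. F i x s))"
    by (intro linear_on_comb W) auto
  then show ?case using insert by simp
qed (auto intro: linear_onI W(2))

lemma linear_on_commute_sum:
  assumes W: "lin_closed W" "(\<lambda>_. 0) \<in> W" and C: "linear_on W C" and x: "x \<in> W"
    and F: "\<And>i. i \<in> S \<Longrightarrow> linear_on W (F i)" "\<And>i. i \<in> S \<Longrightarrow> C (F i x) = F i (C x)"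
  shows "C (\<lambda>s. \<Sum>i\<in>S. F i x s) = (\<lambda>s. \<Sum>i\<in>S. F i (C x) s)"
  using F
proof (induction S rule: infinite_finite_induct)
  case (insert i S)
  have "linear_on W (\<lambda>x s. \<Sum>i\<in>S. F i x s)" using insert.prems by (intro linear_on_sum W) auto
  from linear_on_mem[OF this x] linear_on_mem[OF insert.prems(1) x]
  have "C (\<lambda>s. F i x s + (\<Sum>i\<in>S. F i x s)) = (\<lambda>s. C (F i x) s + C (\<lambda>s. \<Sum>i\<in>S. F i x s) s)"
    by (intro linear_on_add[OF C]) auto
  then show ?case using insert by simp
qed (simp_all add: linear_on_zero[OF C W(2)])

text \<open>
  The space splits into the kernel and the image of one projection, and both are invariant under
  the others. On the image, this projection shifts the spectrum of the sum of the others by 1.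
\<close>

lemma sum_of_commuting_projections_bij:
  assumes "finite S" "lin_closed W" "(\<lambda>_. 0) \<in> W"
    and "\<And>i. i \<in> S \<Longrightarrow> linear_on W (E i)"
    and "\<And>i x. i \<in> S \<Longrightarrow> x \<in> W \<Longrightarrow> E i (E i x) = E i x"
    and "\<And>i j x. i \<in> S \<Longrightarrow> j \<in> S \<Longrightarrow> x \<in> W \<Longrightarrow> E i (E j x) = E j (E i x)"
    and "z \<notin> \<nat>"
  shows "bij_betw (\<lambda>x s. (\<Sum>i\<in>S. E i x s) - z * x s) W W"
  using assms
proof (induction S arbitrary: W z rule: finite_induct)
  case empty
  have z: "z \<noteq> 0" using empty.prems by auto
  have mem: "(\<lambda>s. c * x s) \<in> W" if "x \<in> W" for x c
    using lin_closedD[OF empty.prems(1) that that, of c 0] by simp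
  show ?case
    by (rule bij_betw_byWitness[where f' = "\<lambda>x s. (- 1 / z) * x s"])
       (use z mem[of _ "- z"] mem[of _ "- 1 / z"] in \<open>auto simp: fun_eq_iff image_subset_iff\<close>)
next
  case (insert i S)
  note W = insert.prems(1,2) and lin = insert.prems(3) and idem = insert.prems(4)
    and comm = insert.prems(5) and z = insert.prems(6)
  define F where "F x s = (\<Sum>j\<in>insert i S. E j x s) - z * x s" for x s
  have linF: "linear_on W F"
  proof -
    have "linear_on W (\<lambda>x s. 1 * (\<Sum>j\<in>insert i S. E j x s) + (- z) * x s)"
      by (rule linear_on_comb[OF W(1) linear_on_sum[OF W lin]]) (blast, rule linear_onI, assumption, rule refl)
    then show ?thesis unfolding F_def by simp
  qed
  have Ei: "linear_on W (E i)" using lin by auto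
  have EiF: "E i (F x) = F (E i x)" if x: "x \<in> W" for x
  proof -
    have "(\<lambda>s. \<Sum>j\<in>insert i S. E j x s) \<in> W"
      using linear_on_sum[OF W lin] x by (rule linear_on_mem)
    from linear_onD[OF Ei this x, of 1 "- z"] show ?thesis
      using linear_on_commute_sum[OF W Ei x lin, of "insert i S"] comm x unfolding F_def by simp
  qed
  have decomp: "E i x \<in> {x \<in> W. E i x = x}" "(\<lambda>s. x s - E i x s) \<in> {x \<in> W. E i x = (\<lambda>_. 0)}"
    if x: "x \<in> W" for x
    using linear_on_mem[OF Ei x] idem[of i x] x linear_on_diff[OF Ei x, of "E i x"]
    by (auto intro: lin_closed_diff[OF W(1)])
  have z': "z - 1 \<notin> \<nat>" using z Nats_add[of "z - 1" 1] Nats_1 by (metis diff_add_cancel)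
  \<comment> \<open>The induction hypothesis for an eigenspace of \<open>E i\<close>.\<close>
  have bij: "bij_betw F V V"
    if V: "V = {x \<in> W. E i x = (\<lambda>s. c * x s)}" and c: "z - c \<notin> \<nat>" for V c
  proof -
    have VW: "x \<in> W" if "x \<in> V" for x using that V by auto
    have "bij_betw (\<lambda>x s. (\<Sum>j\<in>S. E j x s) - (z - c) * x s) V V"
    proof (rule insert.IH)
      show "lin_closed V"
        unfolding lin_closed_def
      proof (intro ballI allI)
        fix x y a b assume x: "x \<in> V" and y: "y \<in> V"
        show "(\<lambda>s. a * x s + b * y s) \<in> V"
          using lin_closedD[OF W(1) VW[OF x] VW[OF y], of a b]
            linear_onD[OF Ei VW[OF x] VW[OF y], of a b] x y V by (simp add: algebra_simps)
      qed
      show "(\<lambda>_. 0) \<in> V" using V W linear_on_zero[OF Ei] by simp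
      show "linear_on V (E j)" if "j \<in> S" for j
      proof (rule linear_onI)
        have Ej: "linear_on W (E j)" using lin that by auto
        fix x assume x: "x \<in> V"
        have "E i (E j x) = E j (\<lambda>s. c * x s + 0 * x s)" using comm[of i j x] x V that by auto
        also have "\<dots> = (\<lambda>s. c * E j x s)"
          by (subst linear_onD[OF Ej VW[OF x] VW[OF x]]) simp
        finally show "E j x \<in> V" using V linear_on_mem[OF Ej VW[OF x]] by simp
      next
        fix x y a b s assume "x \<in> V" "y \<in> V"
        then show "E j (\<lambda>s. a * x s + b * y s) s = a * E j x s + b * E j y s"
          using linear_onD[of W "E j" x y a b] lin that VW by auto
      qed
    qed (use VW c idem comm in auto)
    moreover have "(\<Sum>j\<in>S. E j x s) - (z - c) * x s = F x s" if "x \<in> V" for x s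
      using that insert.hyps V by (simp add: F_def algebra_simps)
    ultimately show ?thesis by (subst bij_betw_cong) (auto simp: fun_eq_iff)
  qed
  have bij1: "bij_betw F {x \<in> W. E i x = x} {x \<in> W. E i x = x}"
    by (rule bij[of _ 1]) (use z' in auto)
  have bij0: "bij_betw F {x \<in> W. E i x = (\<lambda>_. 0)} {x \<in> W. E i x = (\<lambda>_. 0)}"
    by (rule bij[of _ 0]) (use z in auto)
  have "bij_betw F W W"
    unfolding bij_betw_def
  proof (intro conjI inj_onI subset_antisym subsetI)
    fix x y assume x: "x \<in> W" and y: "y \<in> W" and eq: "F x = F y"
    have "F (E i x) = F (E i y)" using EiF[OF x] EiF[OF y] eq by simp
    then have 1: "E i x = E i y"
      by (rule inj_onD[OF bij_betw_imp_inj_on[OF bij1] _ decomp(1)[OF x] decomp(1)[OF y]])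
    have "F (\<lambda>s. x s - E i x s) = F (\<lambda>s. y s - E i y s)"
      using linear_on_diff[OF linF x linear_on_mem[OF Ei x]]
        linear_on_diff[OF linF y linear_on_mem[OF Ei y]] eq 1 by simp
    then have "(\<lambda>s. x s - E i x s) = (\<lambda>s. y s - E i y s)"
      by (rule inj_onD[OF bij_betw_imp_inj_on[OF bij0] _ decomp(2)[OF x] decomp(2)[OF y]])
    then show "x = y" unfolding 1 by (simp add: fun_eq_iff)
  next
    fix y assume "y \<in> F ` W"
    then show "y \<in> W" using linear_on_mem[OF linF] by blast
  next
    fix y assume y: "y \<in> W"
    have "E i y \<in> F ` {x \<in> W. E i x = x}"
      unfolding bij_betw_imp_surj_on[OF bij1] by (rule decomp(1)[OF y])
    then obtain a where a: "E i y = F a" "a \<in> {x \<in> W. E i x = x}" by (rule imageE)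
    have "(\<lambda>s. y s - E i y s) \<in> F ` {x \<in> W. E i x = (\<lambda>_. 0)}"
      unfolding bij_betw_imp_surj_on[OF bij0] by (rule decomp(2)[OF y])
    then obtain b where b: "(\<lambda>s. y s - E i y s) = F b" "b \<in> {x \<in> W. E i x = (\<lambda>_. 0)}" by (rule imageE)
    have ab: "a \<in> W" "b \<in> W" using a(2) b(2) by simp_all
    have "F (\<lambda>s. a s + b s) = y"
      using linear_on_add[OF linF ab] unfolding a(1)[symmetric] b(1)[symmetric] by simp
    from this[symmetric] lin_closed_add[OF W(1) ab] show "y \<in> F ` W" by (rule image_eqI)
  qed
  then show ?case unfolding F_def .
qed

text \<open>
  On the image of \<open>E k\<close>, the sum is the sum of the other projections plus 1, which is injective because
  \<open>-1\<close> is not a natural number.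
\<close>

lemma sum_of_commuting_projections_kernel:
  assumes "finite S" "lin_closed W" "(\<lambda>_. 0) \<in> W"
    and lin: "\<And>i. i \<in> S \<Longrightarrow> linear_on W (E i)"
    and idem: "\<And>i x. i \<in> S \<Longrightarrow> x \<in> W \<Longrightarrow> E i (E i x) = E i x"
    and comm: "\<And>i j x. i \<in> S \<Longrightarrow> j \<in> S \<Longrightarrow> x \<in> W \<Longrightarrow> E i (E j x) = E j (E i x)"
    and x: "x \<in> W" and 0: "(\<lambda>s. \<Sum>i\<in>S. E i x s) = (\<lambda>_. 0)" and k: "k \<in> S"
  shows "E k x = (\<lambda>_. 0)"
proof -
  define S' where "S' = S - {k}"
  have S: "S = insert k S'" "finite S'" "k \<notin> S'" using k assms(1) by (auto simp: S'_def)
  have Ek: "linear_on W (E k)" using lin k by auto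
  let ?y = "E k x"
  have y: "?y \<in> W" using linear_on_mem[OF Ek x] .
  have 1: "bij_betw (\<lambda>x s. (\<Sum>i\<in>S'. E i x s) - (- 1) * x s) W W"
  proof (rule sum_of_commuting_projections_bij)
    show "(- 1 :: complex) \<notin> \<nat>" by (auto elim!: Nats_cases simp: complex_eq_iff)
  qed (use S assms in blast)+
  have "E k (\<lambda>s. \<Sum>i\<in>S. E i x s) = (\<lambda>s. \<Sum>i\<in>S. E i ?y s)"
    by (rule linear_on_commute_sum[OF assms(2,3) Ek x]) (use lin comm[OF k] x in blast)+
  then have "(\<lambda>s. \<Sum>i\<in>S. E i ?y s) = (\<lambda>_. 0)"
    unfolding 0 linear_on_zero[OF Ek assms(3)] by (rule sym)
  then have "(\<lambda>s. (\<Sum>i\<in>S'. E i ?y s) - (- 1) * ?y s) = (\<lambda>_. 0)"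
    using S idem[OF k x] by (simp add: fun_eq_iff add.commute)
  moreover have "(\<lambda>s. (\<Sum>i\<in>S'. E i (\<lambda>_. 0) s) - (- 1) * 0) = (\<lambda>_. 0)"
  proof -
    have "E i (\<lambda>_. 0) = (\<lambda>_. 0)" if "i \<in> S'" for i
      using lin[of i] S that assms(3) linear_on_zero by blast
    then show ?thesis by simp
  qed
  ultimately show ?thesis
    using inj_onD[OF bij_betw_imp_inj_on[OF 1], of ?y "\<lambda>_. 0"] y assms(3) by simp
qed


section \<open>Plaquettes of a triangulated surface\<close>

context triangulated_surface
begin

lemma ccw_rotate: "ccw T a b c \<Longrightarrow> ccw T b c a"
  unfolding ccw_def by auto

lemma ccw_distinct: "ccw T a b c \<Longrightarrow> a \<noteq> b \<and> b \<noteq> c \<and> c \<noteq> a"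
  unfolding ccw_def using vertices_distinct by blast

lemma apex_eq: "ccw T a b c \<Longrightarrow> apex T (a, b) = c"
  unfolding apex_def using edge_unique by auto

lemma oriented_edges_iff: "(a, b) \<in> oriented_edges T \<longleftrightarrow> (\<exists>c. ccw T a b c)"
  unfolding oriented_edges_def by auto

lemma oriented_edges_ccw:
  assumes "ccw T a b c"
  shows "(a, b) \<in> oriented_edges T" "(b, c) \<in> oriented_edges T" "(c, a) \<in> oriented_edges T"
  using assms ccw_rotate unfolding oriented_edges_iff by blast+

lemma oriented_edges_swap: "e \<in> oriented_edges T \<Longrightarrow> prod.swap e \<in> oriented_edges T"
  using edge_opposite unfolding oriented_edges_def by auto

lemma oriented_edges_swap_iff: "prod.swap e \<in> oriented_edges T \<longleftrightarrow> e \<in> oriented_edges T"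
  using oriented_edges_swap[of e] oriented_edges_swap[of "prod.swap e"] by auto

lemma finite_oriented_edges: "finite (oriented_edges T)"
proof -
  have "oriented_edges T \<subseteq> (\<lambda>(a, b, c). (a, b)) ` T \<union> (\<lambda>(a, b, c). (b, c)) ` T \<union> (\<lambda>(a, b, c). (c, a)) ` T"
    unfolding oriented_edges_def ccw_def by force
  then show ?thesis by (rule finite_subset) (simp add: finite_T)
qed

lemma finite_plaquettes: "finite (plaquettes T)"
  unfolding plaquettes_def using finite_oriented_edges by simp

lemma target_triangle:
  assumes "(a, b, c) \<in> T"
  shows "target T (a, b) = (a, b, c)" "target T (b, c) = (a, b, c)" "target T (c, a) = (a, b, c)"
proof -
  have ccw: "ccw T a b c" "ccw T b c a" "ccw T c a b" using assms by (auto simp: ccw_def)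
  have "(b, c, a) \<notin> T" "(c, a, b) \<notin> T" using assms listed_once by blast+
  then have "(THE t. t \<in> T \<and> t \<in> {(a, b, c), (b, c, a), (c, a, b)}) = (a, b, c)"
    using assms by (intro the_equality) auto
  moreover have "{(b, c, a), (c, a, b), (a, b, c)} = {(a, b, c), (b, c, a), (c, a, b)}"
    "{(c, a, b), (a, b, c), (b, c, a)} = {(a, b, c), (b, c, a), (c, a, b)}" by auto
  ultimately show "target T (a, b) = (a, b, c)" "target T (b, c) = (a, b, c)" "target T (c, a) = (a, b, c)"
    unfolding target_def Let_def by (simp_all add: apex_eq[OF ccw(1)] apex_eq[OF ccw(2)] apex_eq[OF ccw(3)])
qed

lemma target_cases:
  assumes "ccw T a b c"
  obtains "target T (a, b) = (a, b, c)" "(a, b, c) \<in> T"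
  | "target T (a, b) = (b, c, a)" "(b, c, a) \<in> T"
  | "target T (a, b) = (c, a, b)" "(c, a, b) \<in> T"
  using assms target_triangle unfolding ccw_def by blast

lemma target_rotate: "ccw T a b c \<Longrightarrow> target T (b, c) = target T (a, b)"
  unfolding ccw_def using target_triangle by metis

lemma side_cases:
  assumes "e \<in> sides T p"
  obtains x y where "e = (p, x)" "ccw T p x y" "next_side T e = (p, y)" "leg T e = (y, x)"
proof -
  obtain x where e: "e = (p, x)" "(p, x) \<in> oriented_edges T"
    using assms by (cases e) (auto simp: sides_def)
  then obtain y where "ccw T p x y" by (auto simp: oriented_edges_iff)
  then show ?thesis using that e apex_eq by (simp add: next_side_def leg_def)
qed

lemma sideI: "ccw T p x y \<Longrightarrow> (p, x) \<in> sides T p"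
  unfolding sides_def using oriented_edges_ccw by auto

lemma next_side_ccw: "ccw T p x y \<Longrightarrow> next_side T (p, x) = (p, y)"
  by (simp add: next_side_def apex_eq)

lemma leg_ccw: "ccw T p x y \<Longrightarrow> leg T (p, x) = (y, x)"
  by (simp add: leg_def apex_eq)

lemma sides_oriented: "e \<in> sides T p \<Longrightarrow> e \<in> oriented_edges T"
  by (simp add: sides_def)

lemma leg_oriented: "e \<in> sides T p \<Longrightarrow> leg T e \<in> oriented_edges T"
  using oriented_edges_swap[of "prod.swap (leg T e)"]
  by (elim side_cases) (auto dest: oriented_edges_ccw(2))

lemma finite_sides: "finite (sides T p)"
  by (rule finite_subset[OF _ finite_oriented_edges]) (auto simp: sides_def)

lemma sides_nonempty: "p \<in> plaquettes T \<Longrightarrow> sides T p \<noteq> {}"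
  by (auto simp: plaquettes_def sides_def)

lemma next_side_in: "e \<in> sides T p \<Longrightarrow> next_side T e \<in> sides T p"
  using oriented_edges_ccw(3) oriented_edges_swap
  by (elim side_cases) (force simp: sides_def)

lemma next_side_bij: "bij_betw (next_side T) (sides T p) (sides T p)"
proof -
  have "inj_on (next_side T) (sides T p)"
  proof (rule inj_onI)
    fix e e' assume e: "e \<in> sides T p" "e' \<in> sides T p" "next_side T e = next_side T e'"
    obtain x y x' where "e = (p, x)" "ccw T p x y" "e' = (p, x')" "ccw T p x' y"
      using e by (elim side_cases) auto
    then show "e = e'" using ccw_rotate edge_unique by metis
  qed
  moreover have "next_side T ` sides T p = sides T p"
    by (rule card_subset_eq) (use next_side_in finite_sides calculation card_image in auto)
  ultimately show ?thesis by (simp add: bij_betw_def)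
qed

text \<open>
  The link of \<open>p\<close> is a single cycle, so a function on the sides of \<open>p\<close> that does not change from one
  side to the next one is constant.
\<close>

lemma next_side_transitive:
  assumes f: "\<forall>e\<in>sides T p. f (next_side T e) = f e" and e: "e \<in> sides T p" "e' \<in> sides T p"
  shows "f e = f e'"
proof -
  obtain x x' where x: "e = (p, x)" "e' = (p, x')" using e by (elim side_cases) auto
  have "(x, x') \<in> {(x, y). ccw T p x y}\<^sup>*"
    using link_cycle e unfolding x sides_def by auto
  then have "f (p, x') = f (p, x)"
  proof (induction rule: rtrancl_induct)
    case (step y z)
    then have "ccw T p y z" by simp
    with step f sideI next_side_ccw show ?case by metis
  qed simp
  then show ?thesis using x by simp
qed

definition triangle_vertices :: "'v triangle \<Rightarrow> 'v set" where
  "triangle_vertices v = (case v of (a, b, c) \<Rightarrow> {a, b, c})"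

lemma target_vertices:
  assumes "ccw T a b c"
  shows "target T (a, b) \<in> T" "triangle_vertices (target T (a, b)) = {a, b, c}"
  by (rule target_cases[OF assms]; force simp: triangle_vertices_def)+

lemma target_inj: "inj_on (target T) (sides T p)"
proof (rule inj_onI)
  fix e e' assume e: "e \<in> sides T p" "e' \<in> sides T p" "target T e = target T e'"
  obtain x y x' y' where x: "e = (p, x)" "ccw T p x y" "e' = (p, x')" "ccw T p x' y'"
    using e by (elim side_cases) auto
  have "{p, x, y} = {p, x', y'}"
    using target_vertices(2)[OF x(2)] target_vertices(2)[OF x(4)] e(3) x(1,3) by simp
  then have "x' \<in> {p, x, y}" "y' \<in> {p, x, y}" by simp_all
  then have "x' = x \<or> x' = y \<and> y' = x" using ccw_distinct[OF x(2)] ccw_distinct[OF x(4)] by auto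
  then show "e = e'" using x(2,4) one_orientation unfolding x(1,3) by metis
qed

lemma corners_iff: "v \<in> corners T p \<longleftrightarrow> v \<in> T \<and> p \<in> triangle_vertices v"
proof
  assume "v \<in> corners T p"
  then show "v \<in> T \<and> p \<in> triangle_vertices v"
    using target_vertices by (auto simp: corners_def elim!: side_cases)
next
  assume v: "v \<in> T \<and> p \<in> triangle_vertices v"
  obtain a b c where abc: "v = (a, b, c)" by (cases v)
  have ccw: "ccw T a b c" "ccw T b c a" "ccw T c a b" using v abc by (auto simp: ccw_def)
  have "target T (a, b) = v" "target T (b, c) = v" "target T (c, a) = v"
    using v abc target_triangle by auto
  moreover have "(a, b) \<in> sides T a" "(b, c) \<in> sides T b" "(c, a) \<in> sides T c" using ccw sideI by auto
  moreover have "p = a \<or> p = b \<or> p = c" using v unfolding abc triangle_vertices_def by auto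
  ultimately show "v \<in> corners T p" unfolding corners_def by (metis imageI)
qed

lemma corner_target: "e \<in> sides T p \<Longrightarrow> target T e \<in> corners T p"
  by (simp add: corners_def)

lemma corners_subset: "corners T p \<subseteq> T"
  using corners_iff by auto

end

abbreviation boundary_edges :: "'v triangle set \<Rightarrow> 'v \<Rightarrow> ('v \<times> 'v) set" where
  "boundary_edges T p \<equiv> sides T p \<union> prod.swap ` sides T p"

lemma swap_image_iff: "e \<in> prod.swap ` S \<longleftrightarrow> prod.swap e \<in> S"
  by (metis image_iff swap_swap)

context triangulated_surface
begin

lemma boundary_edges_iff: "e \<in> boundary_edges T p \<longleftrightarrow> e \<in> oriented_edges T \<and> (fst e = p \<or> snd e = p)"
  unfolding Un_iff swap_image_iff using oriented_edges_swap_iff by (auto simp: sides_def)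

lemma swap_side_notin: "e \<in> sides T p \<Longrightarrow> prod.swap e \<notin> sides T p"
  by (elim side_cases) (auto simp: sides_def dest: ccw_distinct)

lemma leg_notin: "e \<in> sides T p \<Longrightarrow> leg T e \<notin> boundary_edges T p"
  unfolding boundary_edges_iff by (elim side_cases) (auto dest: ccw_distinct)

end

section \<open>States as local data around a plaquette\<close>

locale LW_surface = LW_data L + triangulated_surface T + LW_model L T
  for L :: "('g::ab_group_add, 'j) LW" (structure) and T :: "'v triangle set"
begin

abbreviation shift :: "'v \<Rightarrow> 'g \<Rightarrow> ('v \<times> 'v \<Rightarrow> 'g) \<Rightarrow> 'v \<times> 'v \<Rightarrow> 'g" where
  "shift p g \<Phi> \<equiv> (\<lambda>e. \<Phi> e + delta_color g p e)"

lemma delta_color_side [simp]: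
  "e \<in> sides T p \<Longrightarrow> delta_color g p e = - g"
  "e \<in> sides T p \<Longrightarrow> delta_color g p (prod.swap e) = g"
  "e \<notin> boundary_edges T p \<Longrightarrow> delta_color g p e = 0"
  unfolding delta_color_def using swap_side_notin by (auto simp: swap_image_iff)

lemma shift_shift: "shift p g (shift p h \<Phi>) = shift p (g + h) \<Phi>"
  by (auto simp: delta_color_def fun_eq_iff add_ac)

lemma shift_commute: "shift p g (shift q h \<Phi>) = shift q h (shift p g \<Phi>)"
  by (simp add: fun_eq_iff add_ac)

text \<open>
  A prestate satisfies all conditions of a state except the bounds on the multiplicity indices.
  The matrix entries of plaquette operators vanish on the prestates that violate the bounds.
\<close>

definition prestates :: "('v \<times> 'v \<Rightarrow> 'g) \<Rightarrow> ('v, 'j) state set" where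
  "prestates \<Phi> = {(\<sigma>, \<sigma>\<^sub>0).
     \<sigma> \<in> (\<Pi>\<^sub>E e \<in> oriented_edges T. I (\<Phi> e)) \<and>
     (\<forall>e \<in> oriented_edges T. \<sigma> (prod.swap e) = (\<sigma> e)\<^sup>\<star>) \<and> \<sigma>\<^sub>0 \<in> extensional T}"

lemma states_iff: "s \<in> states \<Phi> \<longleftrightarrow> s \<in> prestates \<Phi> \<and> (\<forall>v\<in>T. snd s v \<le> vertex_mult (fst s) v)"
  unfolding states_def prestates_def by (cases s) (auto simp: PiE_iff)

lemma states_prestates: "s \<in> states \<Phi> \<Longrightarrow> s \<in> prestates \<Phi>"
  by (simp add: states_iff)

lemma prestate_label:
  assumes "s \<in> prestates \<Phi>" "e \<in> oriented_edges T"
  shows "fst s e \<in> \<A>" "deg (fst s e) = \<Phi> e" "fst s (prod.swap e) = (fst s e)\<^sup>\<star>" "fst s e \<in> I (\<Phi> e)"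
  using assms by (auto simp: prestates_def homog_def PiE_iff)

lemma prestate_outside:
  assumes "s \<in> prestates \<Phi>"
  shows "e \<notin> oriented_edges T \<Longrightarrow> fst s e = undefined" "v \<notin> T \<Longrightarrow> snd s v = undefined"
  using assms unfolding prestates_def by (auto intro: PiE_arb extensional_arb)

lemma vertex_mult_side:
  assumes "e \<in> sides T p"
  shows "vertex_mult \<sigma> (target T e) = \<delta> (\<sigma> e) (\<sigma> (prod.swap (next_side T e))) (\<sigma> (prod.swap (leg T e)))"
proof -
  obtain x y where x: "e = (p, x)" "ccw T p x y" "next_side T e = (p, y)" "leg T e = (y, x)"
    using assms by (rule side_cases)
  have \<delta>: "\<delta> (\<sigma> (p, x)) (\<sigma> (y, p)) (\<sigma> (x, y)) = \<delta> (\<sigma> (y, p)) (\<sigma> (x, y)) (\<sigma> (p, x))"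
    "\<delta> (\<sigma> (x, y)) (\<sigma> (p, x)) (\<sigma> (y, p)) = \<delta> (\<sigma> (p, x)) (\<sigma> (y, p)) (\<sigma> (x, y))"
    by (rule mult_rotate)+
  show ?thesis unfolding x(3,4) unfolding x(1)
    by (rule target_cases[OF x(2)]) (simp_all add: vertex_mult_def \<delta>)
qed

lemma vertex_mult_cong:
  assumes "v \<in> T" "\<And>e. e \<in> oriented_edges T \<Longrightarrow> target T e = v \<Longrightarrow> \<sigma> e = \<tau> e"
  shows "vertex_mult \<sigma> v = vertex_mult \<tau> v"
proof -
  obtain a b c where v: "v = (a, b, c)" by (cases v)
  have "ccw T a b c" using assms v by (simp add: ccw_def)
  then show ?thesis
    using assms target_triangle oriented_edges_ccw by (auto simp: v vertex_mult_def)
qed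

lemma target_off_corner:
  assumes "e \<in> oriented_edges T" "target T e \<notin> corners T p"
  shows "e \<notin> boundary_edges T p"
proof -
  obtain a b c where e: "e = (a, b)" "ccw T a b c" using assms by (cases e) (auto simp: oriented_edges_iff)
  then show ?thesis using assms target_vertices[OF e(2)] unfolding boundary_edges_iff corners_iff by auto
qed

lemma states_of_agree_off:
  assumes "s \<in> states \<Phi>" "t \<in> prestates \<Phi>'" "agree_off (boundary_edges T p) (corners T p) s t"
    and "\<And>e. e \<in> sides T p \<Longrightarrow> snd t (target T e) \<le> vertex_mult (fst t) (target T e)"
  shows "t \<in> states \<Phi>'"
  unfolding states_iff
proof (intro conjI ballI)
  fix v assume v: "v \<in> T"
  show "snd t v \<le> vertex_mult (fst t) v"
  proof (cases "v \<in> corners T p")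
    case True
    then show ?thesis using assms(4) by (auto simp: corners_def)
  next
    case False
    have "vertex_mult (fst t) v = vertex_mult (fst s) v"
      using v assms(3) target_off_corner False unfolding agree_off_def
      by (intro vertex_mult_cong) auto
    then show ?thesis using assms(1,3) v False unfolding agree_off_def states_iff by auto
  qed
qed fact

text \<open>
  The result of an operator on \<open>p\<close> is determined by the state before and the labels and
  multiplicity indices after, on the sides and corners of \<open>p\<close>. Hence a sum over intermediate states is
  a sum over functions on the sides: a side also stands for the corner at its end.
\<close>

definition local_data :: "'v \<Rightarrow> ('v, 'j) state \<Rightarrow> 'v \<times> 'v \<Rightarrow> 'j \<times> nat" where
  "local_data p s = (\<lambda>e\<in>sides T p. (fst s e, snd s (target T e)))"

definition update :: "'v \<Rightarrow> ('v, 'j) state \<Rightarrow> ('v \<times> 'v \<Rightarrow> 'j \<times> nat) \<Rightarrow> ('v, 'j) state" where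
  "update p s y =
     (\<lambda>e. if e \<in> sides T p then fst (y e)
          else if prod.swap e \<in> sides T p then (fst (y (prod.swap e)))\<^sup>\<star> else fst s e,
      \<lambda>v. if v \<in> corners T p then snd (y (inv_into (sides T p) (target T) v)) else snd s v)"

lemma update_side [simp]:
  assumes "e \<in> sides T p"
  shows "fst (update p s y) e = fst (y e)" "fst (update p s y) (prod.swap e) = (fst (y e))\<^sup>\<star>"
    "snd (update p s y) (target T e) = snd (y e)"
  using assms swap_side_notin[OF assms] target_inj[of p] by (auto simp: update_def corner_target)

lemma update_off [simp]:
  "e \<notin> boundary_edges T p \<Longrightarrow> fst (update p s y) e = fst s e"
  "v \<notin> corners T p \<Longrightarrow> snd (update p s y) v = snd s v"
  unfolding update_def by (auto simp: swap_image_iff)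

lemma update_agree_off: "agree_off (boundary_edges T p) (corners T p) s (update p s y)"
  unfolding agree_off_def by (metis Diff_iff update_off)

lemma local_data_update: "y \<in> extensional (sides T p) \<Longrightarrow> local_data p (update p s y) = y"
  by (auto simp: local_data_def fun_eq_iff extensional_def prod_eq_iff)

lemma update_local_data:
  assumes s: "s \<in> prestates \<Phi>" and t: "t \<in> prestates \<Phi>'"
    and agree: "agree_off (boundary_edges T p) (corners T p) s t"
  shows "update p s (local_data p t) = t"
proof (rule prod_eqI; rule ext)
  fix e
  consider "e \<in> sides T p" | e' where "e = prod.swap e'" "e' \<in> sides T p"
    | "e \<notin> boundary_edges T p" "e \<in> oriented_edges T" | "e \<notin> boundary_edges T p" "e \<notin> oriented_edges T"
    by blast
  then show "fst (update p s (local_data p t)) e = fst t e"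
  proof cases
    case 2
    then show ?thesis
      using prestate_label(3)[OF t sides_oriented] by (simp add: local_data_def)
  next
    case 4
    then show ?thesis by (simp add: prestate_outside[OF s] prestate_outside[OF t])
  qed (use agree in \<open>simp_all add: local_data_def agree_off_def\<close>)
next
  fix v
  consider e where "v = target T e" "e \<in> sides T p" | "v \<notin> corners T p" "v \<in> T" | "v \<notin> corners T p" "v \<notin> T"
    unfolding corners_def by blast
  then show "snd (update p s (local_data p t)) v = snd t v"
    by cases (use agree in \<open>auto simp: local_data_def agree_off_def
        prestate_outside[OF s] prestate_outside[OF t]\<close>)
qed

lemma homog_dual: "i \<in> I g \<Longrightarrow> i\<^sup>\<star> \<in> I (- g)"
  by (simp add: homog_def dual_closed deg_dual)

lemma update_prestates:
  assumes s: "s \<in> prestates \<Phi>" and \<Phi>: "coloring \<Phi>" and y: "\<And>e. e \<in> sides T p \<Longrightarrow> fst (y e) \<in> I (\<Phi> e - g)"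
  shows "update p s y \<in> prestates (shift p g \<Phi>)"
proof -
  have lab: "fst (update p s y) e \<in> I (shift p g \<Phi> e) \<and>
      fst (update p s y) (prod.swap e) = (fst (update p s y) e)\<^sup>\<star>" if e: "e \<in> oriented_edges T" for e
  proof -
    consider "e \<in> sides T p" | e' where "e = prod.swap e'" "e' \<in> sides T p" | "e \<notin> boundary_edges T p" by blast
    then show ?thesis
    proof cases
      case 1
      then show ?thesis using y by simp
    next
      case 2
      have "fst (y e') \<in> \<A>" "\<Phi> (prod.swap e') = - \<Phi> e'"
        using y[OF 2(2)] \<Phi> sides_oriented[OF 2(2)] by (auto simp: homog_def coloring_def)
      then show ?thesis using 2 homog_dual[OF y[OF 2(2)]] by (simp add: dual_dual)
    next
      case 3
      then have "prod.swap e \<notin> boundary_edges T p" by (auto simp: swap_image_iff)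
      then show ?thesis using 3 prestate_label[OF s e] by simp
    qed
  qed
  have "fst (update p s y) e = undefined" if "e \<notin> oriented_edges T" for e
  proof -
    have "e \<notin> boundary_edges T p" using that unfolding boundary_edges_iff by auto
    then show ?thesis using prestate_outside(1)[OF s that] by simp
  qed
  moreover have "snd (update p s y) v = undefined" if "v \<notin> T" for v
  proof -
    have "v \<notin> corners T p" using that corners_subset by auto
    then show ?thesis using prestate_outside(2)[OF s that] by simp
  qed
  ultimately show ?thesis
    using lab unfolding prestates_def by (cases "update p s y") (auto simp: PiE_iff extensional_def)
qed



section \<open>Matrix entries of the plaquette operators\<close>

definition corner_coeff ::
  "'j \<Rightarrow> ('v, 'j) state \<Rightarrow> ('v, 'j) state \<Rightarrow> ('v \<times> 'v \<Rightarrow> nat) \<Rightarrow> 'v \<times> 'v \<Rightarrow> complex" where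
  "corner_coeff l s t A e =
     \<d> (fst t e) *
     \<N> (fst t e) l (fst s e)
       ((fst s (next_side T e))\<^sup>\<star>) (fst s (leg T e)) ((fst t (next_side T e))\<^sup>\<star>)
       (A e) (snd s (target T e)) (snd t (target T e)) (A (next_side T e))"

text \<open>
  The matrix entry of the operator for \<open>l\<close>, without the requirement that \<open>t\<close> be a state that agrees
  with \<open>s\<close> away from \<open>p\<close>: a function of the local data of both states and of the labels on the legs.
\<close>

definition amplitude :: "'v \<Rightarrow> 'j \<Rightarrow> ('v, 'j) state \<Rightarrow> ('v, 'j) state \<Rightarrow> complex" where
  "amplitude p l s t = (\<Sum>A \<in> (\<Pi>\<^sub>E e \<in> sides T p. {1..\<delta> (fst t e) l ((fst s e)\<^sup>\<star>)}).
     \<Prod>e \<in> sides T p. corner_coeff l s t A e)"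

lemma plaq_coeff_alt: "plaq_coeff \<Phi> p l s t =
  (if t \<in> states (shift p (deg l) \<Phi>) \<and> agree_off (boundary_edges T p) (corners T p) s t
   then amplitude p l s t else 0)"
  unfolding plaq_coeff_def amplitude_def corner_coeff_def by simp

lemma corner_coeff_range:
  assumes "corner_coeff l s t A e \<noteq> 0"
  shows "A e \<in> {1..\<delta> (fst t e) l ((fst s e)\<^sup>\<star>)}"
  using assms sixj_range(1) unfolding corner_coeff_def by (metis mult_eq_0_iff)

text \<open>
  The symbols vanish for indices out of range, so the ranges, which depend on the states, may be
  replaced by a common one.
\<close>

lemma amplitude_extend:
  assumes "\<And>e. e \<in> sides T p \<Longrightarrow> finite (C e) \<and> {1..\<delta> (fst t e) l ((fst s e)\<^sup>\<star>)} \<subseteq> C e"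
  shows "amplitude p l s t = (\<Sum>A \<in> PiE (sides T p) C. \<Prod>e \<in> sides T p. corner_coeff l s t A e)"
  unfolding amplitude_def
proof (rule sum.mono_neutral_left)
  show "finite (PiE (sides T p) C)" using assms finite_sides by (intro finite_PiE) auto
  show "(\<Pi>\<^sub>E e \<in> sides T p. {1..\<delta> (fst t e) l ((fst s e)\<^sup>\<star>)}) \<subseteq> PiE (sides T p) C"
    using assms by (intro PiE_mono) auto
  show "\<forall>A\<in>PiE (sides T p) C - (\<Pi>\<^sub>E e \<in> sides T p. {1..\<delta> (fst t e) l ((fst s e)\<^sup>\<star>)}).
      (\<Prod>e \<in> sides T p. corner_coeff l s t A e) = 0"
  proof
    fix A assume A: "A \<in> PiE (sides T p) C - (\<Pi>\<^sub>E e \<in> sides T p. {1..\<delta> (fst t e) l ((fst s e)\<^sup>\<star>)})"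
    then obtain e where "e \<in> sides T p" "A e \<notin> {1..\<delta> (fst t e) l ((fst s e)\<^sup>\<star>)}"
      by (auto simp: PiE_iff)
    then show "(\<Prod>e \<in> sides T p. corner_coeff l s t A e) = 0"
      using corner_coeff_range finite_sides by (intro prod_zero) blast+
  qed
qed

lemma amplitude_mult_nonzero:
  assumes "amplitude p l s t \<noteq> 0" "e \<in> sides T p"
  shows "\<delta> (fst t e) l ((fst s e)\<^sup>\<star>) \<noteq> 0"
proof
  assume "\<delta> (fst t e) l ((fst s e)\<^sup>\<star>) = 0"
  then have "(\<Pi>\<^sub>E e \<in> sides T p. {1..\<delta> (fst t e) l ((fst s e)\<^sup>\<star>)}) = {}"
    using assms(2) by (auto simp: PiE_eq_empty_iff)
  then show False using assms(1) by (simp add: amplitude_def)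
qed

lemma vertex_mult_state:
  assumes "t \<in> prestates \<Phi>" "e \<in> sides T p"
  shows "vertex_mult (fst t) (target T e)
    = \<delta> (fst t (leg T e)) (fst t (next_side T e)) ((fst t e)\<^sup>\<star>)"
proof -
  note * = prestate_label[OF assms(1) sides_oriented[OF assms(2)]]
    prestate_label[OF assms(1) sides_oriented[OF next_side_in[OF assms(2)]]]
    prestate_label[OF assms(1) leg_oriented[OF assms(2)]]
  have "\<delta> (fst t e) ((fst t (next_side T e))\<^sup>\<star>) ((fst t (leg T e))\<^sup>\<star>)
    = \<delta> (fst t (leg T e)) (fst t (next_side T e)) ((fst t e)\<^sup>\<star>)"
    using * by (subst mult_dual) (auto simp: dual_closed dual_dual)
  then show ?thesis using * by (simp add: vertex_mult_side[OF assms(2)])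
qed

text \<open>
  The multiplicity indices of both states are indices of a nonvanishing 6j-symbol.
\<close>

lemma amplitude_vertex_range:
  assumes "amplitude p l s t \<noteq> 0" "e \<in> sides T p" "s \<in> prestates \<Phi>" "t \<in> prestates \<Phi>'"
    and leg: "fst t (leg T e) = fst s (leg T e)"
  shows "1 \<le> snd s (target T e)" "snd s (target T e) \<le> vertex_mult (fst s) (target T e)"
    "1 \<le> snd t (target T e)" "snd t (target T e) \<le> vertex_mult (fst t) (target T e)"
proof -
  obtain A where "(\<Prod>e \<in> sides T p. corner_coeff l s t A e) \<noteq> 0"
    using assms(1) unfolding amplitude_def by (meson sum.not_neutral_contains_not_neutral)
  then have "corner_coeff l s t A e \<noteq> 0" using assms(2) finite_sides by (auto simp: prod_zero_iff)
  then have nz: "\<N> (fst t e) l (fst s e)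
       ((fst s (next_side T e))\<^sup>\<star>) (fst s (leg T e)) ((fst t (next_side T e))\<^sup>\<star>)
       (A e) (snd s (target T e)) (snd t (target T e)) (A (next_side T e)) \<noteq> 0"
    unfolding corner_coeff_def by auto
  note * = prestate_label[OF assms(3) sides_oriented[OF assms(2)]]
    prestate_label[OF assms(3) sides_oriented[OF next_side_in[OF assms(2)]]]
    prestate_label[OF assms(3) leg_oriented[OF assms(2)]]
    prestate_label[OF assms(4) sides_oriented[OF next_side_in[OF assms(2)]]]
  have "snd s (target T e) \<in> {1..vertex_mult (fst s) (target T e)}"
    using sixj_range(2)[OF nz] * by (simp add: vertex_mult_side[OF assms(2)])
  moreover have "snd t (target T e) \<in> {1..vertex_mult (fst t) (target T e)}"
    using sixj_range(3)[OF nz] * leg by (simp add: vertex_mult_state[OF assms(4,2)] dual_dual)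
  ultimately show "1 \<le> snd s (target T e)" "snd s (target T e) \<le> vertex_mult (fst s) (target T e)"
    "1 \<le> snd t (target T e)" "snd t (target T e) \<le> vertex_mult (fst t) (target T e)" by auto
qed

lemma agree_off_leg:
  assumes "agree_off (boundary_edges T p) (corners T p) s t" "e \<in> sides T p"
  shows "fst t (leg T e) = fst s (leg T e)"
  using assms leg_notin[of e p] leg_oriented[of e p] unfolding agree_off_def by auto

lemma plaq_coeff_amplitude:
  assumes s: "s \<in> states \<Phi>" and t: "t \<in> prestates (shift p (deg l) \<Phi>)"
    and agree: "agree_off (boundary_edges T p) (corners T p) s t"
  shows "plaq_coeff \<Phi> p l s t = amplitude p l s t"
proof (cases "amplitude p l s t = 0")
  case False
  have "t \<in> states (shift p (deg l) \<Phi>)"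
    by (rule states_of_agree_off[OF s t agree])
      (rule amplitude_vertex_range(4)[OF False _ states_prestates[OF s] t agree_off_leg[OF agree]])
  then show ?thesis using agree by (simp add: plaq_coeff_alt)
qed (simp add: plaq_coeff_alt)

lemma plaq_coeff_nonzero:
  assumes "plaq_coeff \<Phi> p l s t \<noteq> 0"
  shows "t \<in> states (shift p (deg l) \<Phi>)" "agree_off (boundary_edges T p) (corners T p) s t"
    "amplitude p l s t \<noteq> 0"
  using assms unfolding plaq_coeff_alt by (auto split: if_splits)

lemma X_minus: "- x \<in> \<X> \<longleftrightarrow> x \<in> \<X>"
proof
  assume "- x \<in> \<X>"
  then have "- (- x) \<in> uminus ` \<X>" by (rule imageI)
  then show "x \<in> \<X>" using X_symmetric by simp
next
  assume "x \<in> \<X>"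
  then show "- x \<in> \<X>" using X_symmetric by blast
qed

lemma admissible_coloring: "admissible \<Phi> \<Longrightarrow> coloring \<Phi>"
  by (simp add: admissible_def)

lemma admissible_generic: "admissible \<Phi> \<Longrightarrow> e \<in> oriented_edges T \<Longrightarrow> \<Phi> e \<notin> \<X>"
  by (simp add: admissible_def)

lemma admissible_shift_side:
  "admissible (shift p g \<Phi>) \<Longrightarrow> e \<in> sides T p \<Longrightarrow> \<Phi> e - g \<notin> \<X>"
  using admissible_generic[OF _ sides_oriented] by fastforce

lemma finite_new_labels:
  assumes s: "s \<in> prestates \<Phi>" and g: "g \<notin> \<X>" and adm: "admissible (shift p g \<Phi>)" and e: "e \<in> sides T p"
  shows "finite {(j, l). l \<in> I g \<and> \<delta> j l ((fst s e)\<^sup>\<star>) \<noteq> 0}"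
proof -
  note * = prestate_label[OF s sides_oriented[OF e]]
  have "finite {(j, l). deg j = \<Phi> e - g \<and> \<delta> ((fst s e)\<^sup>\<star>) j l \<noteq> 0}"
    using * g admissible_shift_side[OF adm e] X_minus
    by (intro finite_fusion_pairs) (auto simp: dual_closed deg_dual)
  moreover have "{(j, l). l \<in> I g \<and> \<delta> j l ((fst s e)\<^sup>\<star>) \<noteq> 0}
      \<subseteq> {(j, l). deg j = \<Phi> e - g \<and> \<delta> ((fst s e)\<^sup>\<star>) j l \<noteq> 0}"
  proof clarify
    fix j l assume l: "l \<in> I g" "0 < \<delta> j l ((fst s e)\<^sup>\<star>)"
    then have "deg j + deg l + deg ((fst s e)\<^sup>\<star>) = 0" using mult_deg by blast
    then have "deg j = \<Phi> e - g" using l * by (simp add: homog_def deg_dual algebra_simps)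
    then show "deg j = \<Phi> e - g \<and> \<delta> ((fst s e)\<^sup>\<star>) j l \<noteq> 0"
      using l mult_rotate[of "(fst s e)\<^sup>\<star>" j l] by simp
  qed
  ultimately show ?thesis by (rule rev_finite_subset)
qed

lemma new_label_deg:
  assumes s: "s \<in> prestates \<Phi>" and e: "e \<in> sides T p" and \<delta>: "\<delta> j l ((fst s e)\<^sup>\<star>) \<noteq> 0"
  shows "j \<in> I (\<Phi> e - deg l)"
proof -
  note * = prestate_label[OF s sides_oriented[OF e]]
  have "deg j + deg l + deg ((fst s e)\<^sup>\<star>) = 0" "j \<in> \<A>" using mult_deg mult_labels \<delta> by blast+
  then show ?thesis using * by (simp add: homog_def deg_dual algebra_simps)
qed

text \<open>
  Given the old label of a side and the degree of \<open>l\<close>, fusion is finite, so there are finitely many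
  possible new labels; together they bound the multiplicity indices.
\<close>

lemma finite_transitions:
  assumes s: "s \<in> states \<Phi>" and g: "g \<notin> \<X>" and adm: "admissible (shift p g \<Phi>)"
  shows "finite {t. \<exists>l\<in>I g. plaq_coeff \<Phi> p l s t \<noteq> 0}"
proof -
  note s' = states_prestates[OF s]
  define F where "F e = fst ` {(j, l). l \<in> I g \<and> \<delta> j l ((fst s e)\<^sup>\<star>) \<noteq> 0}" for e
  have F: "finite (F e)" if "e \<in> sides T p" for e
    unfolding F_def using finite_new_labels[OF s' g adm that] by simp
  define Lab where "Lab = (\<Union>e\<in>sides T p. F e) \<union> dual L ` (\<Union>e\<in>sides T p. F e) \<union> fst s ` oriented_edges T"
  have finLab: "finite Lab" unfolding Lab_def
    by (intro finite_UnI finite_UN_I finite_imageI F finite_sides finite_oriented_edges)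
  obtain M where M: "\<delta> i j k \<le> M" if "i \<in> Lab" "j \<in> Lab" "k \<in> Lab" for i j k
    using mult_bound[OF finLab] by auto
  have "{t. \<exists>l\<in>I g. plaq_coeff \<Phi> p l s t \<noteq> 0} \<subseteq> update p s ` PiE (sides T p) (\<lambda>e. F e \<times> {..M})"
  proof clarify
    fix \<sigma> \<sigma>0 l assume l: "l \<in> I g" and nz: "plaq_coeff \<Phi> p l s (\<sigma>, \<sigma>0) \<noteq> 0"
    define t where "t = (\<sigma>, \<sigma>0)"
    note t = plaq_coeff_nonzero[OF nz[folded t_def]]
    have Fe: "fst t e \<in> F e" if "e \<in> sides T p" for e
      using amplitude_mult_nonzero[OF t(3) that] l unfolding F_def
      by (intro image_eqI[where x = "(fst t e, l)"]) simp_all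
    have "snd t (target T e) \<le> M" if e: "e \<in> sides T p" for e
    proof -
      have "snd t (target T e) \<le> vertex_mult (fst t) (target T e)"
        using amplitude_vertex_range(4)[OF t(3) e s' states_prestates[OF t(1)]] agree_off_leg[OF t(2) e] by simp
      also have "\<dots> = \<delta> (fst s (leg T e)) (fst t (next_side T e)) ((fst t e)\<^sup>\<star>)"
        using vertex_mult_state[OF states_prestates[OF t(1)] e] agree_off_leg[OF t(2) e] by simp
      also have "\<dots> \<le> M"
      proof (rule M)
        show "fst s (leg T e) \<in> Lab" using leg_oriented[OF e] unfolding Lab_def by simp
        show "fst t (next_side T e) \<in> Lab"
          using Fe[OF next_side_in[OF e]] next_side_in[OF e] unfolding Lab_def by (intro UnI1 UN_I)
        show "(fst t e)\<^sup>\<star> \<in> Lab"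
          using Fe[OF e] e unfolding Lab_def by (intro UnI1 UnI2 imageI UN_I)
      qed
      finally show ?thesis .
    qed
    with Fe have "local_data p t \<in> PiE (sides T p) (\<lambda>e. F e \<times> {..M})"
      unfolding local_data_def by (intro restrict_PiE_iff[THEN iffD2] ballI) simp
    moreover have "update p s (local_data p t) = t"
      using update_local_data[OF s' states_prestates[OF t(1)] t(2)] .
    ultimately have "t \<in> update p s ` PiE (sides T p) (\<lambda>e. F e \<times> {..M})" by (metis imageI)
    then show "(\<sigma>, \<sigma>0) \<in> update p s ` PiE (sides T p) (\<lambda>e. F e \<times> {..M})" by (simp add: t_def)
  qed
  moreover have "finite (PiE (sides T p) (\<lambda>e. F e \<times> {..M}))"
    using F finite_sides by (intro finite_PiE) auto
  ultimately show ?thesis by (meson finite_imageI finite_subset)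
qed

text \<open>
  Any finite set \<open>Y\<close> of local data that contains those of all relevant intermediate states will do,
  because the amplitude vanishes on the prestates in \<open>Y\<close> that are not states.
\<close>

lemma sum_over_updates:
  assumes s: "s \<in> states \<Phi>" and \<Phi>: "coloring \<Phi>" and l: "l \<in> \<A>"
    and adm: "admissible (shift p (deg l) \<Phi>)"
    and Y: "finite Y" "Y \<subseteq> extensional (sides T p)"
      "\<And>y e. y \<in> Y \<Longrightarrow> e \<in> sides T p \<Longrightarrow> fst (y e) \<in> I (\<Phi> e - deg l)"
    and supp: "\<And>t. plaq_coeff \<Phi> p l s t \<noteq> 0 \<Longrightarrow> h t \<noteq> 0 \<Longrightarrow> local_data p t \<in> Y"
  shows "(\<Sum>t | plaq_coeff \<Phi> p l s t \<noteq> 0. plaq_coeff \<Phi> p l s t * h t)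
    = (\<Sum>y\<in>Y. amplitude p l s (update p s y) * h (update p s y))"
proof -
  note s' = states_prestates[OF s]
  have "finite {t. \<exists>l'\<in>I (deg l). plaq_coeff \<Phi> p l' s t \<noteq> 0}"
    using finite_transitions[OF s _ adm] deg_generic[OF l] by blast
  then have fin: "finite {t. plaq_coeff \<Phi> p l s t \<noteq> 0}"
    by (rule rev_finite_subset) (use l in \<open>auto simp: homog_def\<close>)
  have "(\<Sum>t | plaq_coeff \<Phi> p l s t \<noteq> 0. plaq_coeff \<Phi> p l s t * h t)
    = (\<Sum>t\<in>update p s ` Y. plaq_coeff \<Phi> p l s t * h t)"
  proof (rule sum.mono_neutral_cong[OF _ fin])
    show "plaq_coeff \<Phi> p l s t * h t = 0" if "t \<in> {t. plaq_coeff \<Phi> p l s t \<noteq> 0} - update p s ` Y" for t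
    proof (rule ccontr)
      assume "plaq_coeff \<Phi> p l s t * h t \<noteq> 0"
      then have nz: "plaq_coeff \<Phi> p l s t \<noteq> 0" "h t \<noteq> 0" by auto
      note t = plaq_coeff_nonzero[OF nz(1)]
      have "t = update p s (local_data p t)"
        using update_local_data[OF s' states_prestates[OF t(1)] t(2)] by simp
      then show False using supp[OF nz] that by blast
    qed
  qed (use Y in auto)
  also have "\<dots> = (\<Sum>y\<in>Y. plaq_coeff \<Phi> p l s (update p s y) * h (update p s y))"
  proof (rule sum.reindex_cong[OF _ refl refl])
    show "inj_on (update p s) Y"
      by (rule inj_on_inverseI[where g = "local_data p"]) (rule local_data_update, use Y(2) in blast)
  qed
  also have "\<dots> = (\<Sum>y\<in>Y. amplitude p l s (update p s y) * h (update p s y))"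
    using Y(3) by (intro sum.cong refl)
      (simp add: plaq_coeff_amplitude[OF s update_prestates[OF s' \<Phi>] update_agree_off])
  finally show ?thesis .
qed



section \<open>Composition of two operators on the same plaquette\<close>

lemma agree_off_trans: "agree_off E V s t \<Longrightarrow> agree_off E V t r \<Longrightarrow> agree_off E V s r"
  unfolding agree_off_def by auto

lemma agree_off_sym: "agree_off E V s t \<Longrightarrow> agree_off E V t s"
  unfolding agree_off_def by auto

text \<open>
  The intermediate multiplicity indices are summed at each corner with the pentagon relation, which
  attaches a 6j-symbol with labels \<open>m\<close>, \<open>l\<close>, \<open>u\<close> to either end of each side. The sum over
  the intermediate label of a side then cancels the two symbols attached to it and forces the fusion
  channels at its ends to coincide. As the sides of \<open>p\<close> form one cycle, a single channel remains.
\<close>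

lemma amplitude_compose:
  assumes p: "p \<in> plaquettes T"
    and s: "s \<in> states \<Phi>" and t: "t \<in> states (shift p (deg m) (shift p (deg l) \<Phi>))"
    and l: "l \<in> \<A>" and m: "m \<in> \<A>" and gen: "deg m + deg l \<notin> \<X>"
    and \<Phi>: "admissible \<Phi>" "admissible (shift p (deg l) \<Phi>)" "admissible (shift p (deg m) (shift p (deg l) \<Phi>))"
    and agree: "agree_off (boundary_edges T p) (corners T p) s t"
  shows "(\<Sum>r | plaq_coeff \<Phi> p l s r \<noteq> 0. plaq_coeff \<Phi> p l s r * plaq_coeff (shift p (deg l) \<Phi>) p m r t)
    = (\<Sum>u \<in> {u \<in> \<A>. \<delta> m l (u\<^sup>\<star>) \<noteq> 0}. of_nat (\<delta> m l (u\<^sup>\<star>)) * amplitude p u s t)"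
proof -
  note s' = states_prestates[OF s] and t' = states_prestates[OF t]
  let ?S = "sides T p" and ?nx = "next_side T"
  define j where "j e = fst s e" for e
  define j2 where "j2 e = fst t e" for e
  define k where "k e = fst s (leg T e)" for e
  define c0 where "c0 e = snd s (target T e)" for e
  define c2 where "c2 e = snd t (target T e)" for e
  have lab: "j e \<in> \<A>" "j2 e \<in> \<A>" "k e \<in> \<A>" "deg (j e) = \<Phi> e" "deg (j2 e) = \<Phi> e - deg l - deg m"
    if "e \<in> ?S" for e
    using that prestate_label[OF s' sides_oriented[OF that]] prestate_label[OF t' sides_oriented[OF that]]
      prestate_label[OF s' leg_oriented[OF that]] by (auto simp: j_def j2_def k_def)
  have nx: "?nx e \<in> ?S" if "e \<in> ?S" for e using next_side_in[OF that] .
  define F where "F e = {n. \<delta> n l ((j e)\<^sup>\<star>) \<noteq> 0}" for e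
  have finF: "finite (F e)" if "e \<in> ?S" for e
  proof -
    have "finite (fst ` {(n, l'). l' \<in> I (deg l) \<and> \<delta> n l' ((fst s e)\<^sup>\<star>) \<noteq> 0})"
      using finite_new_labels[OF s' deg_generic[OF l] \<Phi>(2) that] by simp
    then show ?thesis by (rule rev_finite_subset) (use l in \<open>force simp: F_def j_def homog_def\<close>)
  qed
  have Fdeg: "n \<in> I (\<Phi> e - deg l)" if "e \<in> ?S" "n \<in> F e" for e n
    using new_label_deg[OF s' that(1)] that(2) by (simp add: F_def j_def)
  have FA: "n \<in> \<A>" if "e \<in> ?S" "n \<in> F e" for e n using Fdeg[OF that] by (simp add: homog_def)
  \<comment> \<open>Finitely many labels can occur, so there is a common range \<open>C\<close> for all multiplicity indices.\<close>
  define Lab where "Lab = (\<Union>e\<in>?S. F e) \<union> dual L ` (\<Union>e\<in>?S. F e) \<union> j ` ?S \<union> j2 ` ?S \<union> k ` ?S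
    \<union> (\<lambda>e. (j e)\<^sup>\<star>) ` ?S \<union> {l, m}"
  have finLab: "finite Lab" unfolding Lab_def
    by (intro finite_UnI finite_UN_I finite_imageI finF finite_sides finite.intros)
  obtain M where M: "\<delta> x y z \<le> M" if "x \<in> Lab" "y \<in> Lab" "z \<in> Lab" for x y z
    using mult_bound[OF finLab] by auto
  define C where "C = {1..M}"
  have C: "finite C" unfolding C_def by simp
  have inLab: "n \<in> Lab" "n\<^sup>\<star> \<in> Lab" if "e \<in> ?S" "n \<in> F e" for e n
    using UN_I[of e ?S n F, OF that] imageI[OF UN_I[of e ?S n F, OF that], of "dual L"]
    unfolding Lab_def by simp_all
  have inLab': "j e \<in> Lab" "j2 e \<in> Lab" "k e \<in> Lab" "(j e)\<^sup>\<star> \<in> Lab" if "e \<in> ?S" for e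
    using imageI[OF that, of j] imageI[OF that, of j2] imageI[OF that, of k]
      imageI[OF that, of "\<lambda>e. (j e)\<^sup>\<star>"] unfolding Lab_def by simp_all
  have lm: "l \<in> Lab" "m \<in> Lab" unfolding Lab_def by simp_all
  have Csub: "{1..\<delta> x y z} \<subseteq> C" if "x \<in> Lab" "y \<in> Lab" "z \<in> Lab" for x y z
    using M[OF that] unfolding C_def by auto
  define Y where "Y = PiE ?S (\<lambda>e. F e \<times> C)"
  have finY: "finite Y" unfolding Y_def using finite_sides finF C by (intro finite_PiE) auto

  define K where "K e x x' = (case x of (n, A, B) \<Rightarrow> case x' of (n', A', B') \<Rightarrow>
      \<d> n * (\<Sum>c\<in>C. \<N> n l (j e) ((j (?nx e))\<^sup>\<star>) (k e) (n'\<^sup>\<star>) A (c0 e) c A'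
        * \<N> (j2 e) m n (n'\<^sup>\<star>) (k e) ((j2 (?nx e))\<^sup>\<star>) B c (c2 e) B'))" for e x x'
  define P where "P e x y = (case x of (n, A, B) \<Rightarrow> case y of ((u, c), D) \<Rightarrow>
      \<d> n * \<N> (j2 e) m n l (j e) u B A D c)" for e x y
  define R where "R e z x = (case z of ((u, c), D) \<Rightarrow> case x of (n, A, B) \<Rightarrow>
      \<d> u * \<N> m l u ((j (?nx e))\<^sup>\<star>) ((j2 (?nx e))\<^sup>\<star>) (n\<^sup>\<star>) c D B A)" for e z x
  define G where "G e w D D' = \<N> (j2 e) (fst w) (j e) ((j (?nx e))\<^sup>\<star>) (k e) ((j2 (?nx e))\<^sup>\<star>)
      D (c0 e) (c2 e) D'" for e and w :: "'j \<times> nat" and D D'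
  define Z where "Z e y z = (if fst y = fst z then G e (fst y) (snd y) (snd z) else 0)"
    for e and y z :: "('j \<times> nat) \<times> nat"

  \<comment> \<open>The intermediate states are parametrized by the intermediate labels and multiplicity indices.\<close>
  have "(\<Sum>r | plaq_coeff \<Phi> p l s r \<noteq> 0. plaq_coeff \<Phi> p l s r * plaq_coeff (shift p (deg l) \<Phi>) p m r t)
    = (\<Sum>y\<in>Y. amplitude p l s (update p s y) * plaq_coeff (shift p (deg l) \<Phi>) p m (update p s y) t)"
  proof (rule sum_over_updates[OF s admissible_coloring[OF \<Phi>(1)] l \<Phi>(2) finY])
    show "Y \<subseteq> extensional ?S" by (simp add: Y_def PiE_def)
    show "fst (y e) \<in> I (\<Phi> e - deg l)" if "y \<in> Y" "e \<in> ?S" for y e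
    proof (rule Fdeg[OF that(2)])
      show "fst (y e) \<in> F e" using PiE_mem[OF that(1)[unfolded Y_def] that(2)] by auto
    qed
    fix r assume nz: "plaq_coeff \<Phi> p l s r \<noteq> 0"
    note r = plaq_coeff_nonzero[OF nz]
    have rF: "fst r e \<in> F e" if "e \<in> ?S" for e
      using amplitude_mult_nonzero[OF r(3) that] by (simp add: F_def j_def)
    have rC: "snd r (target T e) \<in> C" if e: "e \<in> ?S" for e
    proof -
      from rF[OF e] rF[OF nx[OF e]] show ?thesis
        using amplitude_vertex_range(3,4)[OF r(3) e s' states_prestates[OF r(1)] agree_off_leg[OF r(2) e]]
          vertex_mult_state[OF states_prestates[OF r(1)] e] agree_off_leg[OF r(2) e]
          Csub[of "k e" "fst r (?nx e)" "(fst r e)\<^sup>\<star>"] inLab[OF e] inLab[OF nx[OF e]] inLab'[OF e]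
        by (auto simp: k_def)
    qed
    show "local_data p r \<in> Y" unfolding Y_def local_data_def by (auto simp: PiE_iff rF rC)
  qed
  also have "\<dots> = (\<Sum>y\<in>Y. amplitude p l s (update p s y) * amplitude p m (update p s y) t)"
    using t agree_off_trans[OF agree_off_sym[OF update_agree_off] agree]
    by (simp add: plaq_coeff_alt)
  also have "\<dots> = (\<Sum>y\<in>Y.
      (\<Sum>A\<in>PiE ?S (\<lambda>_. C). \<Prod>e\<in>?S. \<d> (fst (y e)) * \<N> (fst (y e)) l (j e) ((j (?nx e))\<^sup>\<star>) (k e)
         ((fst (y (?nx e)))\<^sup>\<star>) (A e) (c0 e) (snd (y e)) (A (?nx e)))
      * (\<Sum>B\<in>PiE ?S (\<lambda>_. C). \<Prod>e\<in>?S. \<d> (j2 e) * \<N> (j2 e) m (fst (y e)) ((fst (y (?nx e)))\<^sup>\<star>) (k e)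
         ((j2 (?nx e))\<^sup>\<star>) (B e) (snd (y e)) (c2 e) (B (?nx e))))"
  proof (intro sum.cong refl arg_cong2[where f = "(*)"])
    fix y assume y: "y \<in> Y"
    have yF: "fst (y e) \<in> F e" if "e \<in> ?S" for e using PiE_mem[OF y[unfolded Y_def] that] by auto
    have "amplitude p l s (update p s y)
        = (\<Sum>A\<in>PiE ?S (\<lambda>_. C). \<Prod>e\<in>?S. corner_coeff l s (update p s y) A e)"
      using C Csub inLab[OF _ yF] inLab' lm by (intro amplitude_extend) (auto simp: j_def)
    then show "amplitude p l s (update p s y) = (\<Sum>A\<in>PiE ?S (\<lambda>_. C). \<Prod>e\<in>?S.
        \<d> (fst (y e)) * \<N> (fst (y e)) l (j e) ((j (?nx e))\<^sup>\<star>) (k e)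
         ((fst (y (?nx e)))\<^sup>\<star>) (A e) (c0 e) (snd (y e)) (A (?nx e)))"
      by (simp add: corner_coeff_def j_def k_def c0_def nx)
    have "amplitude p m (update p s y) t
        = (\<Sum>B\<in>PiE ?S (\<lambda>_. C). \<Prod>e\<in>?S. corner_coeff m (update p s y) t B e)"
      using C Csub[OF inLab'(2) lm(2) inLab(2)[OF _ yF]] by (intro amplitude_extend) (auto simp: j2_def)
    then show "amplitude p m (update p s y) t = (\<Sum>B\<in>PiE ?S (\<lambda>_. C). \<Prod>e\<in>?S.
        \<d> (j2 e) * \<N> (j2 e) m (fst (y e)) ((fst (y (?nx e)))\<^sup>\<star>) (k e)
         ((j2 (?nx e))\<^sup>\<star>) (B e) (snd (y e)) (c2 e) (B (?nx e)))"
      using leg_notin by (simp add: corner_coeff_def j2_def k_def c2_def nx)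
  qed

  \<comment> \<open>Summation over the intermediate multiplicity index at each corner gives a trace around the plaquette.\<close>
  also have "\<dots> = (\<Prod>e\<in>?S. \<d> (j2 e)) * (\<Sum>x\<in>PiE ?S (\<lambda>e. F e \<times> C \<times> C). \<Prod>e\<in>?S. K e (x e) (x (?nx e)))"
    (is "?lhs = _")
  proof -
    let ?a = "\<lambda>f c A e. \<N> (f e) l (j e) ((j (?nx e))\<^sup>\<star>) (k e) ((f (?nx e))\<^sup>\<star>) (A e) (c0 e) (c e) (A (?nx e))"
    let ?b = "\<lambda>f c B e. \<N> (j2 e) m (f e) ((f (?nx e))\<^sup>\<star>) (k e) ((j2 (?nx e))\<^sup>\<star>) (B e) (c e) (c2 e) (B (?nx e))"
    have "?lhs = (\<Sum>f\<in>PiE ?S F. \<Sum>c\<in>PiE ?S (\<lambda>_. C).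
        (\<Sum>A\<in>PiE ?S (\<lambda>_. C). \<Prod>e\<in>?S. \<d> (f e) * ?a f c A e)
        * (\<Sum>B\<in>PiE ?S (\<lambda>_. C). \<Prod>e\<in>?S. \<d> (j2 e) * ?b f c B e))"
      unfolding Y_def sum_PiE_Times by (simp add: nx cong: prod.cong)
    also have "\<dots> = (\<Sum>f\<in>PiE ?S F. \<Sum>c\<in>PiE ?S (\<lambda>_. C). \<Sum>A\<in>PiE ?S (\<lambda>_. C). \<Sum>B\<in>PiE ?S (\<lambda>_. C).
        (\<Prod>e\<in>?S. \<d> (j2 e)) * (\<Prod>e\<in>?S. \<d> (f e) * (?a f c A e * ?b f c B e)))"
      unfolding sum_product by (intro sum.cong refl) (simp add: prod.distrib[symmetric] mult_ac)
    also have "\<dots> = (\<Prod>e\<in>?S. \<d> (j2 e)) * (\<Sum>f\<in>PiE ?S F. \<Sum>c\<in>PiE ?S (\<lambda>_. C). \<Sum>A\<in>PiE ?S (\<lambda>_. C).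
        \<Sum>B\<in>PiE ?S (\<lambda>_. C). \<Prod>e\<in>?S. \<d> (f e) * (?a f c A e * ?b f c B e))"
      by (simp only: sum_distrib_left)
    also have "(\<Sum>f\<in>PiE ?S F. \<Sum>c\<in>PiE ?S (\<lambda>_. C). \<Sum>A\<in>PiE ?S (\<lambda>_. C).
        \<Sum>B\<in>PiE ?S (\<lambda>_. C). \<Prod>e\<in>?S. \<d> (f e) * (?a f c A e * ?b f c B e))
      = (\<Sum>f\<in>PiE ?S F. \<Sum>A\<in>PiE ?S (\<lambda>_. C). \<Sum>B\<in>PiE ?S (\<lambda>_. C). \<Sum>c\<in>PiE ?S (\<lambda>_. C).
        \<Prod>e\<in>?S. \<d> (f e) * (?a f c A e * ?b f c B e))"
    proof (rule sum.cong[OF refl])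
      fix f
      show "(\<Sum>c\<in>PiE ?S (\<lambda>_. C). \<Sum>A\<in>PiE ?S (\<lambda>_. C).
          \<Sum>B\<in>PiE ?S (\<lambda>_. C). \<Prod>e\<in>?S. \<d> (f e) * (?a f c A e * ?b f c B e))
        = (\<Sum>A\<in>PiE ?S (\<lambda>_. C). \<Sum>B\<in>PiE ?S (\<lambda>_. C). \<Sum>c\<in>PiE ?S (\<lambda>_. C).
          \<Prod>e\<in>?S. \<d> (f e) * (?a f c A e * ?b f c B e))"
        by (subst sum.swap, rule sum.cong[OF refl], rule sum.swap)
    qed
    also have "\<dots> = (\<Sum>f\<in>PiE ?S F. \<Sum>A\<in>PiE ?S (\<lambda>_. C). \<Sum>B\<in>PiE ?S (\<lambda>_. C).
        \<Prod>e\<in>?S. K e (f e, A e, B e) (f (?nx e), A (?nx e), B (?nx e)))"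
    proof (intro sum.cong refl)
      fix f A B
      have "(\<Prod>e\<in>?S. K e (f e, A e, B e) (f (?nx e), A (?nx e), B (?nx e)))
        = (\<Prod>e\<in>?S. \<Sum>c\<in>C. \<d> (f e) * (?a f (\<lambda>_. c) A e * ?b f (\<lambda>_. c) B e))"
        unfolding K_def by (simp add: sum_distrib_left)
      also have "\<dots> = (\<Sum>c\<in>PiE ?S (\<lambda>_. C). \<Prod>e\<in>?S. \<d> (f e) * (?a f c A e * ?b f c B e))"
        using finite_sides C by (subst prod_sum_PiE) auto
      finally show "(\<Sum>c\<in>PiE ?S (\<lambda>_. C). \<Prod>e\<in>?S. \<d> (f e) * (?a f c A e * ?b f c B e))
        = (\<Prod>e\<in>?S. K e (f e, A e, B e) (f (?nx e), A (?nx e), B (?nx e)))" by (rule sym)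
    qed
    also have "\<dots> = (\<Sum>x\<in>PiE ?S (\<lambda>e. F e \<times> C \<times> C). \<Prod>e\<in>?S. K e (x e) (x (?nx e)))"
      unfolding sum_PiE_Times by (simp add: nx cong: prod.cong)
    finally show ?thesis .
  qed
  \<comment> \<open>By orthogonality the symbols attached to the sides cancel.\<close>
  also have "(\<Sum>x\<in>PiE ?S (\<lambda>e. F e \<times> C \<times> C). \<Prod>e\<in>?S. K e (x e) (x (?nx e)))
    = (\<Sum>y\<in>PiE ?S (\<lambda>e. side_channels m l (j2 e) (j e)). \<Prod>e\<in>?S. Z e (y e) (y (?nx e)))"
  proof (rule cyclic_trace_conjugation[where P = P and R = R])
    fix e x x' assume e: "e \<in> ?S" and x: "x \<in> F e \<times> C \<times> C" and x': "x' \<in> F (?nx e) \<times> C \<times> C"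
    obtain n A B n' A' B' where xx: "x = (n, A, B)" "x' = (n', A', B')" by (cases x; cases x') auto
    have n: "n \<in> F e" "n' \<in> F (?nx e)" using x x' xx by auto
    have L: "{l, m, j e, j (?nx e), n, n', j2 e, j2 (?nx e), k e} \<subseteq> \<A>"
      using lab[OF e] lab[OF nx[OF e]] FA[OF e n(1)] FA[OF nx[OF e] n(2)] l m by auto
    have sub: "{1..\<delta> (k e) n' (n\<^sup>\<star>)} \<subseteq> C"
      by (rule Csub[OF inLab'(3)[OF e] inLab(1)[OF nx[OF e] n(2)] inLab(2)[OF e n(1)]])
    show "K e x x' = (\<Sum>y\<in>side_channels m l (j2 e) (j e). \<Sum>z\<in>side_channels m l (j2 (?nx e)) (j (?nx e)).
        P e x y * Z e y z * R e z x')"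
      unfolding K_def xx prod.case corner_composition[OF L gen C sub]
      by (simp add: P_def Z_def R_def G_def sum_distrib_left case_prod_unfold mult.assoc prod_eq_iff cong: if_cong)
  next
    fix e y z assume e: "e \<in> ?S" and y: "y \<in> side_channels m l (j2 (?nx e)) (j (?nx e))"
      and z: "z \<in> side_channels m l (j2 (?nx e)) (j (?nx e))"
    obtain u c D u' c' D' where yz: "y = ((u', c'), D')" "z = ((u, c), D)" by (cases y; cases z) auto
    note e' = nx[OF e]
    have "(\<Sum>(n, A, B)\<in>F (?nx e) \<times> C \<times> C.
        (\<d> u * \<N> m l u ((j (?nx e))\<^sup>\<star>) ((j2 (?nx e))\<^sup>\<star>) (n\<^sup>\<star>) c D B A)
          * (\<d> n * \<N> (j2 (?nx e)) m n l (j (?nx e)) u' B A D' c'))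
      = (if ((u, c), D) = ((u', c'), D') then 1 else 0)"
    proof (rule side_orthogonality)
      show "deg (j2 (?nx e)) + deg m \<notin> \<X>"
        using admissible_shift_side[OF \<Phi>(2) e'] lab(5)[OF e'] by simp
      show "{n. \<delta> (j2 (?nx e)) m (n\<^sup>\<star>) \<noteq> 0 \<and> \<delta> n l ((j (?nx e))\<^sup>\<star>) \<noteq> 0} \<subseteq> F (?nx e)"
        by (auto simp: F_def)
      show "{1..\<delta> n l ((j (?nx e))\<^sup>\<star>)} \<subseteq> C \<and> {1..\<delta> (j2 (?nx e)) m (n\<^sup>\<star>)} \<subseteq> C" if "n \<in> F (?nx e)" for n
        using Csub inLab[OF e' that] inLab'[OF e'] lm by blast
    qed (use lab[OF e'] l m y z yz finF[OF e'] C in auto)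
    then show "(\<Sum>x\<in>F (?nx e) \<times> C \<times> C. R e z x * P (?nx e) x y) = (if z = y then 1 else 0)"
      unfolding yz P_def R_def by (simp add: case_prod_unfold)
  qed (use finite_sides next_side_bij finF C finite_side_channels[OF m l gen] in auto)
  also have "\<dots> = (\<Sum>w\<in>channels m l. \<Sum>D\<in>PiE ?S (\<lambda>e. {1..\<delta> (j2 e) (fst w) ((j e)\<^sup>\<star>)}).
      \<Prod>e\<in>?S. G e w (D e) (D (?nx e)))"
  proof -
    obtain e0 where e0: "e0 \<in> ?S" using sides_nonempty[OF p] by blast
    show ?thesis
      unfolding side_channels_def Z_def
      by (rule cyclic_trace_block_diagonal[OF finite_sides e0 nx])
        (use next_side_transitive e0 finite_channels[OF m l gen] in blast)+
  qed
  also have "(\<Prod>e\<in>?S. \<d> (j2 e)) * \<dots> = (\<Sum>w\<in>channels m l. amplitude p (fst w) s t)"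
    unfolding amplitude_def sum_distrib_left
    by (simp add: corner_coeff_def G_def prod.distrib j_def j2_def k_def c0_def c2_def)
  also have "\<dots> = (\<Sum>u \<in> {u \<in> \<A>. \<delta> m l (u\<^sup>\<star>) \<noteq> 0}. of_nat (\<delta> m l (u\<^sup>\<star>)) * amplitude p u s t)"
    unfolding channels_def using finite_fusion_channels[OF m l gen]
    by (subst sum.Sigma[symmetric, where g = "\<lambda>u c. amplitude p u s t", unfolded case_prod_unfold]) simp_all
  finally show ?thesis .
qed

end


section \<open>Operators given by matrices with finite rows\<close>

lemma lin_ext_superset:
  "finite S \<Longrightarrow> {s. f s \<noteq> 0} \<subseteq> S \<Longrightarrow> lin_ext M f t = (\<Sum>s\<in>S. f s * M s t)"
  unfolding lin_ext_def by (intro sum.mono_neutral_left) auto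

lemma lin_ext_support: "lin_ext M f t \<noteq> 0 \<Longrightarrow> \<exists>s. f s \<noteq> 0 \<and> M s t \<noteq> 0"
  unfolding lin_ext_def by (metis (mono_tags, lifting) mem_Collect_eq mult_zero_right sum.neutral)

lemma lin_ext_cong: "(\<And>s. f s \<noteq> 0 \<Longrightarrow> M s t = M' s t) \<Longrightarrow> lin_ext M f t = lin_ext M' f t"
  unfolding lin_ext_def by (intro sum.cong) auto

lemma lin_ext_basis: "lin_ext M (basis_vec s) = M s"
proof
  fix t
  have "lin_ext M (basis_vec s) t = (\<Sum>r\<in>{s}. basis_vec s r * M r t)"
    by (rule lin_ext_superset) (auto simp: basis_vec_def)
  then show "lin_ext M (basis_vec s) t = M s t" by (simp add: basis_vec_def)
qed

lemma lin_ext_linear: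
  assumes "finite {s. x s \<noteq> 0}" "finite {s. y s \<noteq> 0}"
  shows "lin_ext M (\<lambda>s. c * x s + d * y s) t = c * lin_ext M x t + d * lin_ext M y t"
proof -
  let ?S = "{s. x s \<noteq> 0} \<union> {s. y s \<noteq> 0}"
  have "lin_ext M (\<lambda>s. c * x s + d * y s) t = (\<Sum>s\<in>?S. (c * x s + d * y s) * M s t)"
    "lin_ext M x t = (\<Sum>s\<in>?S. x s * M s t)" "lin_ext M y t = (\<Sum>s\<in>?S. y s * M s t)"
    by (rule lin_ext_superset; use assms in auto)+
  then show ?thesis by (simp add: sum_distrib_left sum.distrib[symmetric] algebra_simps)
qed

text \<open>
  The product of matrices whose rows have finite support; the columns may be infinite.
\<close>

definition mat_comp :: "('s \<Rightarrow> 's \<Rightarrow> complex) \<Rightarrow> ('s \<Rightarrow> 's \<Rightarrow> complex) \<Rightarrow> 's \<Rightarrow> 's \<Rightarrow> complex" where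
  "mat_comp M M' s t = (\<Sum>r | M s r \<noteq> 0. M s r * M' r t)"

lemma mat_comp_superset:
  "finite R \<Longrightarrow> {r. M s r \<noteq> 0} \<subseteq> R \<Longrightarrow> mat_comp M M' s t = (\<Sum>r\<in>R. M s r * M' r t)"
  unfolding mat_comp_def by (intro sum.mono_neutral_left) auto

lemma lin_ext_comp:
  assumes f: "finite {s. f s \<noteq> 0}" and M: "\<And>s. f s \<noteq> 0 \<Longrightarrow> finite {t. M s t \<noteq> 0}"
  shows "lin_ext M' (lin_ext M f) = lin_ext (mat_comp M M') f"
proof
  fix t
  define R where "R = (\<Union>s\<in>{s. f s \<noteq> 0}. {t. M s t \<noteq> 0})"
  have R: "finite R" unfolding R_def using assms by simp
  have "lin_ext M' (lin_ext M f) t = (\<Sum>r\<in>R. lin_ext M f r * M' r t)"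
    by (rule lin_ext_superset[OF R]) (use lin_ext_support in \<open>force simp: R_def\<close>)
  also have "\<dots> = (\<Sum>r\<in>R. \<Sum>s | f s \<noteq> 0. f s * (M s r * M' r t))"
    by (simp add: lin_ext_def sum_distrib_right mult.assoc)
  also have "\<dots> = (\<Sum>s | f s \<noteq> 0. \<Sum>r\<in>R. f s * (M s r * M' r t))"
    by (rule sum.swap)
  also have "\<dots> = (\<Sum>s | f s \<noteq> 0. f s * mat_comp M M' s t)"
  proof (intro sum.cong refl)
    fix s assume "s \<in> {s. f s \<noteq> 0}"
    then have "mat_comp M M' s t = (\<Sum>r\<in>R. M s r * M' r t)"
      by (intro mat_comp_superset R) (auto simp: R_def)
    then show "(\<Sum>r\<in>R. f s * (M s r * M' r t)) = f s * mat_comp M M' s t"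
      by (simp add: sum_distrib_left)
  qed
  finally show "lin_ext M' (lin_ext M f) t = lin_ext (mat_comp M M') f t" by (simp add: lin_ext_def)
qed

context LW_surface
begin

lemma state_spaceD:
  assumes "f \<in> state_space \<Phi>"
  shows "finite {s. f s \<noteq> 0}" "f s \<noteq> 0 \<Longrightarrow> s \<in> states \<Phi>"
  using assms by (auto simp: state_space_def)

lemma basis_vec_state_space: "s \<in> states \<Phi> \<Longrightarrow> basis_vec s \<in> state_space \<Phi>"
proof -
  assume "s \<in> states \<Phi>"
  moreover have "{t. basis_vec s t \<noteq> 0} = {s}" by (auto simp: basis_vec_def)
  ultimately show ?thesis unfolding state_space_def by simp
qed

lemma lin_ext_state_space:
  assumes f: "f \<in> state_space \<Phi>"
    and M: "\<And>s. s \<in> states \<Phi> \<Longrightarrow> finite {t. M s t \<noteq> 0} \<and> {t. M s t \<noteq> 0} \<subseteq> states \<Phi>'"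
  shows "lin_ext M f \<in> state_space \<Phi>'"
proof -
  let ?R = "\<Union>s\<in>{s. f s \<noteq> 0}. {t. M s t \<noteq> 0}"
  have "{t. lin_ext M f t \<noteq> 0} \<subseteq> ?R" using lin_ext_support by fastforce
  moreover have "finite ?R" "?R \<subseteq> states \<Phi>'" using state_spaceD[OF f] M by blast+
  ultimately show ?thesis unfolding state_space_def using finite_subset by blast
qed

definition plaq_kernel where
  "plaq_kernel \<Phi> p g s t = Sum_any (\<lambda>l. if l \<in> I g then \<b> l * plaq_coeff \<Phi> p l s t else 0)"

lemma plaq_kernel_sum:
  assumes "finite D" "D \<subseteq> I g" "{l \<in> I g. plaq_coeff \<Phi> p l s t \<noteq> 0} \<subseteq> D"
  shows "plaq_kernel \<Phi> p g s t = (\<Sum>l\<in>D. \<b> l * plaq_coeff \<Phi> p l s t)"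
proof -
  have "plaq_kernel \<Phi> p g s t = (\<Sum>l\<in>D. if l \<in> I g then \<b> l * plaq_coeff \<Phi> p l s t else 0)"
    unfolding plaq_kernel_def using assms by (intro Sum_any.expand_superset) auto
  also have "\<dots> = (\<Sum>l\<in>D. \<b> l * plaq_coeff \<Phi> p l s t)"
    using assms by (intro sum.cong) auto
  finally show ?thesis .
qed

text \<open>
  On a side \<open>e\<close>, the label \<open>l\<close> has to fuse with the new label into the old one. As the degree of the new
  label is prescribed, there are finitely many such pairs.
\<close>

lemma finite_active_labels:
  assumes p: "p \<in> plaquettes T" and s: "s \<in> states \<Phi>" and g: "g \<notin> \<X>" and adm: "admissible (shift p g \<Phi>)"
  shows "finite {l \<in> I g. \<exists>t. plaq_coeff \<Phi> p l s t \<noteq> 0}"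
proof -
  obtain e where e: "e \<in> sides T p" using sides_nonempty[OF p] by blast
  have "finite (snd ` {(j, l). l \<in> I g \<and> \<delta> j l ((fst s e)\<^sup>\<star>) \<noteq> 0})"
    using finite_new_labels[OF states_prestates[OF s] g adm e] by simp
  moreover have "{l \<in> I g. \<exists>t. plaq_coeff \<Phi> p l s t \<noteq> 0}
      \<subseteq> snd ` {(j, l). l \<in> I g \<and> \<delta> j l ((fst s e)\<^sup>\<star>) \<noteq> 0}"
  proof (intro subsetI, elim CollectE conjE exE)
    fix l t assume l: "l \<in> I g" and nz: "plaq_coeff \<Phi> p l s t \<noteq> 0"
    show "l \<in> snd ` {(j, l). l \<in> I g \<and> \<delta> j l ((fst s e)\<^sup>\<star>) \<noteq> 0}"
      using amplitude_mult_nonzero[OF plaq_coeff_nonzero(3)[OF nz] e] l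
      by (intro image_eqI[where x = "(fst t e, l)"]) simp_all
  qed
  ultimately show ?thesis by (rule rev_finite_subset)
qed

lemma finite_active_labels_target:
  assumes p: "p \<in> plaquettes T" and t: "t \<in> states (shift p g \<Phi>)" and g: "g \<notin> \<X>" and adm: "admissible \<Phi>"
  shows "finite {l \<in> I g. \<exists>s\<in>states \<Phi>. plaq_coeff \<Phi> p l s t \<noteq> 0}"
proof -
  obtain e where e: "e \<in> sides T p" using sides_nonempty[OF p] by blast
  note te = prestate_label[OF states_prestates[OF t] sides_oriented[OF e]]
  have "finite (fst ` {(l, k). deg l = g \<and> \<delta> (fst t e) l k \<noteq> 0})"
    using te g e admissible_generic[OF adm sides_oriented[OF e]]
    by (intro finite_imageI finite_fusion_pairs) auto
  moreover have "{l \<in> I g. \<exists>s\<in>states \<Phi>. plaq_coeff \<Phi> p l s t \<noteq> 0}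
      \<subseteq> fst ` {(l, k). deg l = g \<and> \<delta> (fst t e) l k \<noteq> 0}"
  proof (intro subsetI, elim CollectE conjE bexE)
    fix l s assume l: "l \<in> I g" and nz: "plaq_coeff \<Phi> p l s t \<noteq> 0"
    show "l \<in> fst ` {(l, k). deg l = g \<and> \<delta> (fst t e) l k \<noteq> 0}"
      using amplitude_mult_nonzero[OF plaq_coeff_nonzero(3)[OF nz] e] l
      by (intro image_eqI[where x = "(l, (fst s e)\<^sup>\<star>)"]) (simp_all add: homog_def)
  qed
  ultimately show ?thesis by (rule rev_finite_subset)
qed

lemma plaq_kernel_nonzero:
  assumes "plaq_kernel \<Phi> p g s t \<noteq> 0"
  obtains l where "l \<in> I g" "plaq_coeff \<Phi> p l s t \<noteq> 0"
proof -
  have "\<exists>l. (if l \<in> I g then \<b> l * plaq_coeff \<Phi> p l s t else 0) \<noteq> 0"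
  proof (rule ccontr)
    assume "\<nexists>l. (if l \<in> I g then \<b> l * plaq_coeff \<Phi> p l s t else 0) \<noteq> 0"
    then have "(\<lambda>l. if l \<in> I g then \<b> l * plaq_coeff \<Phi> p l s t else 0) = (\<lambda>_. 0)" by auto
    from arg_cong[OF this, of Sum_any] show False using assms unfolding plaq_kernel_def by simp
  qed
  then show ?thesis using that by (auto split: if_splits)
qed

lemma plaq_kernel_row:
  assumes s: "s \<in> states \<Phi>" and g: "g \<notin> \<X>" and adm: "admissible (shift p g \<Phi>)"
  shows "finite {t. plaq_kernel \<Phi> p g s t \<noteq> 0}" "{t. plaq_kernel \<Phi> p g s t \<noteq> 0} \<subseteq> states (shift p g \<Phi>)"
proof -
  have "{t. plaq_kernel \<Phi> p g s t \<noteq> 0} \<subseteq> {t. \<exists>l\<in>I g. plaq_coeff \<Phi> p l s t \<noteq> 0}"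
    using plaq_kernel_nonzero by blast
  then show "finite {t. plaq_kernel \<Phi> p g s t \<noteq> 0}"
    using finite_transitions[OF assms] by (rule finite_subset)
  show "{t. plaq_kernel \<Phi> p g s t \<noteq> 0} \<subseteq> states (shift p g \<Phi>)"
  proof (intro subsetI, elim CollectE)
    fix t assume "plaq_kernel \<Phi> p g s t \<noteq> 0"
    then obtain l where l: "l \<in> I g" "plaq_coeff \<Phi> p l s t \<noteq> 0" by (rule plaq_kernel_nonzero)
    show "t \<in> states (shift p g \<Phi>)"
      using plaq_coeff_nonzero(1)[OF l(2)] l(1) by (simp add: homog_def)
  qed
qed

lemma mat_comp_plaq_kernel:
  assumes s: "s \<in> states \<Phi>" and g: "g \<notin> \<X>" and adm: "admissible (shift p g \<Phi>)"
    and D1: "finite D1" "D1 \<subseteq> I g" "{l \<in> I g. \<exists>t. plaq_coeff \<Phi> p l s t \<noteq> 0} \<subseteq> D1"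
    and D2: "finite D2" "D2 \<subseteq> I h"
      "{m \<in> I h. \<exists>r\<in>states (shift p g \<Phi>). plaq_coeff \<Phi>' q m r t \<noteq> 0} \<subseteq> D2"
  shows "mat_comp (plaq_kernel \<Phi> p g) (plaq_kernel \<Phi>' q h) s t
    = (\<Sum>l\<in>D1. \<Sum>m\<in>D2. \<b> l * \<b> m *
        (\<Sum>r | plaq_coeff \<Phi> p l s r \<noteq> 0. plaq_coeff \<Phi> p l s r * plaq_coeff \<Phi>' q m r t))"
proof -
  define R where "R = {t. \<exists>l\<in>I g. plaq_coeff \<Phi> p l s t \<noteq> 0}"
  have R: "finite R" unfolding R_def by (rule finite_transitions[OF s g adm])
  have Rst: "r \<in> states (shift p g \<Phi>)" if "r \<in> R" for r
  proof -
    from that obtain l where l: "l \<in> I g" "plaq_coeff \<Phi> p l s r \<noteq> 0" unfolding R_def by blast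
    show ?thesis using plaq_coeff_nonzero(1)[OF l(2)] l(1) by (simp add: homog_def)
  qed
  have "mat_comp (plaq_kernel \<Phi> p g) (plaq_kernel \<Phi>' q h) s t
    = (\<Sum>r\<in>R. plaq_kernel \<Phi> p g s r * plaq_kernel \<Phi>' q h r t)"
    by (rule mat_comp_superset[OF R], unfold R_def) (blast elim: plaq_kernel_nonzero)
  also have "\<dots> = (\<Sum>r\<in>R. (\<Sum>l\<in>D1. \<b> l * plaq_coeff \<Phi> p l s r) * (\<Sum>m\<in>D2. \<b> m * plaq_coeff \<Phi>' q m r t))"
  proof (intro sum.cong refl arg_cong2[where f = "(*)"])
    fix r assume "r \<in> R"
    show "plaq_kernel \<Phi> p g s r = (\<Sum>l\<in>D1. \<b> l * plaq_coeff \<Phi> p l s r)"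
      by (rule plaq_kernel_sum[OF D1(1,2)]) (use D1(3) in blast)
    show "plaq_kernel \<Phi>' q h r t = (\<Sum>m\<in>D2. \<b> m * plaq_coeff \<Phi>' q m r t)"
      by (rule plaq_kernel_sum[OF D2(1,2)]) (use D2(3) Rst[OF \<open>r \<in> R\<close>] in blast)
  qed
  also have "\<dots> = (\<Sum>r\<in>R. \<Sum>l\<in>D1. \<Sum>m\<in>D2. \<b> l * \<b> m * (plaq_coeff \<Phi> p l s r * plaq_coeff \<Phi>' q m r t))"
    by (simp add: sum_product mult_ac)
  also have "\<dots> = (\<Sum>l\<in>D1. \<Sum>m\<in>D2. \<Sum>r\<in>R. \<b> l * \<b> m * (plaq_coeff \<Phi> p l s r * plaq_coeff \<Phi>' q m r t))"
    by (subst sum.swap, rule sum.cong[OF refl], rule sum.swap)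
  also have "\<dots> = (\<Sum>l\<in>D1. \<Sum>m\<in>D2. \<b> l * \<b> m *
        (\<Sum>r | plaq_coeff \<Phi> p l s r \<noteq> 0. plaq_coeff \<Phi> p l s r * plaq_coeff \<Phi>' q m r t))"
  proof (intro sum.cong refl)
    fix l m assume "l \<in> D1"
    then have "{r. plaq_coeff \<Phi> p l s r \<noteq> 0} \<subseteq> R" using D1 unfolding R_def by blast
    then have "(\<Sum>r\<in>R. plaq_coeff \<Phi> p l s r * plaq_coeff \<Phi>' q m r t)
      = (\<Sum>r | plaq_coeff \<Phi> p l s r \<noteq> 0. plaq_coeff \<Phi> p l s r * plaq_coeff \<Phi>' q m r t)"
      using R by (intro sum.mono_neutral_right) auto
    then show "(\<Sum>r\<in>R. \<b> l * \<b> m * (plaq_coeff \<Phi> p l s r * plaq_coeff \<Phi>' q m r t)) = \<b> l * \<b> m *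
        (\<Sum>r | plaq_coeff \<Phi> p l s r \<noteq> 0. plaq_coeff \<Phi> p l s r * plaq_coeff \<Phi>' q m r t)"
      by (simp only: sum_distrib_left[symmetric])
  qed
  finally show ?thesis .
qed



lemma plaq_coeff_compose:
  assumes p: "p \<in> plaquettes T"
    and s: "s \<in> states \<Phi>" and t: "t \<in> states (shift p (deg m) (shift p (deg l) \<Phi>))"
    and l: "l \<in> \<A>" and m: "m \<in> \<A>" and gen: "deg m + deg l \<notin> \<X>"
    and \<Phi>: "admissible \<Phi>" "admissible (shift p (deg l) \<Phi>)" "admissible (shift p (deg m) (shift p (deg l) \<Phi>))"
  shows "(\<Sum>r | plaq_coeff \<Phi> p l s r \<noteq> 0. plaq_coeff \<Phi> p l s r * plaq_coeff (shift p (deg l) \<Phi>) p m r t)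
    = (\<Sum>u \<in> {u \<in> \<A>. \<delta> m l (u\<^sup>\<star>) \<noteq> 0}. of_nat (\<delta> m l (u\<^sup>\<star>)) * plaq_coeff \<Phi> p u s t)"
proof (cases "agree_off (boundary_edges T p) (corners T p) s t")
  case True
  have "plaq_coeff \<Phi> p u s t = amplitude p u s t" if u: "u \<in> \<A>" "\<delta> m l (u\<^sup>\<star>) \<noteq> 0" for u
  proof -
    have "deg m + deg l + deg (u\<^sup>\<star>) = 0" using mult_deg[OF u(2)] .
    then have "deg u = deg m + deg l" using u by (simp add: deg_dual)
    then show ?thesis using True t by (simp add: plaq_coeff_alt shift_shift)
  qed
  then show ?thesis unfolding amplitude_compose[OF assms True] by (intro sum.cong refl) simp
next
  case False
  have "plaq_coeff \<Phi> p l s r * plaq_coeff (shift p (deg l) \<Phi>) p m r t = 0" for r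
  proof (rule ccontr)
    assume "plaq_coeff \<Phi> p l s r * plaq_coeff (shift p (deg l) \<Phi>) p m r t \<noteq> 0"
    then have "plaq_coeff \<Phi> p l s r \<noteq> 0" "plaq_coeff (shift p (deg l) \<Phi>) p m r t \<noteq> 0" by auto
    from agree_off_trans[OF this[THEN plaq_coeff_nonzero(2)]] False show False by simp
  qed
  moreover have "plaq_coeff \<Phi> p u s t = 0" for u using False by (simp add: plaq_coeff_alt)
  ultimately show ?thesis by (simp only: mult_zero_right sum.neutral_const)
qed

lemma mat_comp_nonzero:
  assumes "mat_comp M M' s t \<noteq> 0"
  obtains r where "M s r \<noteq> 0" "M' r t \<noteq> 0"
proof -
  have "\<exists>r. M s r \<noteq> 0 \<and> M' r t \<noteq> 0"
  proof (rule ccontr)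
    assume "\<nexists>r. M s r \<noteq> 0 \<and> M' r t \<noteq> 0"
    then have "mat_comp M M' s t = 0" unfolding mat_comp_def by (intro sum.neutral) auto
    then show False using assms by simp
  qed
  then show ?thesis using that by blast
qed

text \<open>
  The fusion rule of the coefficients \<open>\<b>\<close> turns the product formula for single labels into
  additivity in the degree.
\<close>

lemma plaq_kernel_compose:
  assumes p: "p \<in> plaquettes T" and s: "s \<in> states \<Phi>"
    and g: "g \<notin> \<X>" and h: "h \<notin> \<X>" and gh: "g + h \<notin> \<X>"
    and \<Phi>: "admissible \<Phi>" "admissible (shift p h \<Phi>)" "admissible (shift p (g + h) \<Phi>)"
  shows "mat_comp (plaq_kernel \<Phi> p h) (plaq_kernel (shift p h \<Phi>) p g) s t = plaq_kernel \<Phi> p (g + h) s t"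
proof (cases "t \<in> states (shift p (g + h) \<Phi>)")
  case False
  have "mat_comp (plaq_kernel \<Phi> p h) (plaq_kernel (shift p h \<Phi>) p g) s t = 0"
  proof (rule ccontr)
    assume "mat_comp (plaq_kernel \<Phi> p h) (plaq_kernel (shift p h \<Phi>) p g) s t \<noteq> 0"
    then obtain r where r: "plaq_kernel \<Phi> p h s r \<noteq> 0" "plaq_kernel (shift p h \<Phi>) p g r t \<noteq> 0"
      by (rule mat_comp_nonzero)
    have "r \<in> states (shift p h \<Phi>)" using plaq_kernel_row(2)[OF s h \<Phi>(2)] r(1) by blast
    from plaq_kernel_row(2)[OF this g, of p] r(2) \<Phi>(3) False show False
      by (auto simp: shift_shift)
  qed
  moreover have "plaq_kernel \<Phi> p (g + h) s t = 0"
    using plaq_kernel_row(2)[OF s gh \<Phi>(3)] False by blast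
  ultimately show ?thesis by simp
next
  case True
  define Du where "Du = {u \<in> I (g + h). \<exists>t. plaq_coeff \<Phi> p u s t \<noteq> 0}"
  define FP where "FP u = {(m, l). m \<in> I g \<and> l \<in> I h \<and> \<delta> (u\<^sup>\<star>) m l \<noteq> 0}" for u
  have fDu: "finite Du" unfolding Du_def by (rule finite_active_labels[OF p s gh \<Phi>(3)])
  have fFP: "finite (FP u)" if "u \<in> Du" for u
    unfolding FP_def using that by (intro fusion_finite[OF gh g h refl]) (simp add: Du_def)
  \<comment> \<open>Besides the labels that act nontrivially, these sets contain all labels that fuse into some \<open>u \<in> Du\<close>,
    because the fusion rule for \<open>\<b> u\<close> involves all of them.\<close>
  define D1 where "D1 = {l \<in> I h. \<exists>t. plaq_coeff \<Phi> p l s t \<noteq> 0} \<union> (\<Union>u\<in>Du. snd ` FP u)"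
  define D2 where "D2 = {m \<in> I g. \<exists>r\<in>states (shift p h \<Phi>). plaq_coeff (shift p h \<Phi>) p m r t \<noteq> 0}
    \<union> (\<Union>u\<in>Du. fst ` FP u)"
  have D1: "finite D1" "D1 \<subseteq> I h"
    unfolding D1_def using finite_active_labels[OF p s h \<Phi>(2)] fDu fFP by (auto simp: FP_def)
  have "t \<in> states (shift p g (shift p h \<Phi>))" using True by (simp add: shift_shift)
  then have D2: "finite D2" "D2 \<subseteq> I g"
    unfolding D2_def using finite_active_labels_target[OF p _ g \<Phi>(2)] fDu fFP by (auto simp: FP_def)
  have "mat_comp (plaq_kernel \<Phi> p h) (plaq_kernel (shift p h \<Phi>) p g) s t
    = (\<Sum>l\<in>D1. \<Sum>m\<in>D2. \<b> l * \<b> m *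
        (\<Sum>r | plaq_coeff \<Phi> p l s r \<noteq> 0. plaq_coeff \<Phi> p l s r * plaq_coeff (shift p h \<Phi>) p m r t))"
    by (rule mat_comp_plaq_kernel[OF s h \<Phi>(2) D1 _ D2], unfold D1_def D2_def) (rule Un_upper1)+
  also have "\<dots> = (\<Sum>l\<in>D1. \<Sum>m\<in>D2. \<b> l * \<b> m * (\<Sum>u\<in>Du. of_nat (\<delta> m l (u\<^sup>\<star>)) * plaq_coeff \<Phi> p u s t))"
  proof (intro sum.cong refl arg_cong2[where f = "(*)"])
    fix l m assume lm: "l \<in> D1" "m \<in> D2"
    have l: "l \<in> \<A>" "deg l = h" and m: "m \<in> \<A>" "deg m = g"
      using lm D1 D2 by (auto simp: homog_def)
    have "(\<Sum>r | plaq_coeff \<Phi> p l s r \<noteq> 0. plaq_coeff \<Phi> p l s r * plaq_coeff (shift p h \<Phi>) p m r t)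
      = (\<Sum>u \<in> {u \<in> \<A>. \<delta> m l (u\<^sup>\<star>) \<noteq> 0}. of_nat (\<delta> m l (u\<^sup>\<star>)) * plaq_coeff \<Phi> p u s t)"
      using plaq_coeff_compose[OF p s _ l(1) m(1), of t] True \<Phi> gh l m by (simp add: shift_shift)
    also have "\<dots> = (\<Sum>u\<in>Du. of_nat (\<delta> m l (u\<^sup>\<star>)) * plaq_coeff \<Phi> p u s t)"
    proof (rule sum.mono_neutral_cong)
      show "finite {u \<in> \<A>. \<delta> m l (u\<^sup>\<star>) \<noteq> 0}" using finite_fusion_channels[OF m(1) l(1)] gh l m by simp
      show "of_nat (\<delta> m l (u\<^sup>\<star>)) * plaq_coeff \<Phi> p u s t = 0"
        if "u \<in> Du - {u \<in> \<A>. \<delta> m l (u\<^sup>\<star>) \<noteq> 0}" for u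
        using that by (auto simp: Du_def homog_def)
      show "of_nat (\<delta> m l (u\<^sup>\<star>)) * plaq_coeff \<Phi> p u s t = 0"
        if u: "u \<in> {u \<in> \<A>. \<delta> m l (u\<^sup>\<star>) \<noteq> 0} - Du" for u
      proof -
        have "deg m + deg l + deg (u\<^sup>\<star>) = 0" "u \<in> \<A>" using u mult_deg by blast+
        then have "u \<in> I (g + h)" using l m by (simp add: homog_def deg_dual)
        then have "plaq_coeff \<Phi> p u s t = 0" using u unfolding Du_def by blast
        then show ?thesis by simp
      qed
    qed (use fDu in auto)
    finally show "(\<Sum>r | plaq_coeff \<Phi> p l s r \<noteq> 0. plaq_coeff \<Phi> p l s r * plaq_coeff (shift p h \<Phi>) p m r t)
      = (\<Sum>u\<in>Du. of_nat (\<delta> m l (u\<^sup>\<star>)) * plaq_coeff \<Phi> p u s t)" .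
  qed
  also have "\<dots> = (\<Sum>l\<in>D1. \<Sum>m\<in>D2. \<Sum>u\<in>Du. (\<b> m * \<b> l * of_nat (\<delta> m l (u\<^sup>\<star>))) * plaq_coeff \<Phi> p u s t)"
    by (simp add: sum_distrib_left mult_ac)
  also have "\<dots> = (\<Sum>u\<in>Du. \<Sum>l\<in>D1. \<Sum>m\<in>D2. (\<b> m * \<b> l * of_nat (\<delta> m l (u\<^sup>\<star>))) * plaq_coeff \<Phi> p u s t)"
    by (rule trans[OF sum.cong[OF refl sum.swap] sum.swap])
  also have "\<dots> = (\<Sum>u\<in>Du. \<b> u * plaq_coeff \<Phi> p u s t)"
  proof (intro sum.cong refl)
    fix u assume u: "u \<in> Du"
    have "\<b> u = (\<Sum>(m, l)\<in>FP u. \<b> m * \<b> l * of_nat (\<delta> (u\<^sup>\<star>) m l))"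
      unfolding FP_def using u by (intro bcoef_fusion[OF gh g h refl]) (simp add: Du_def)
    also have "\<dots> = (\<Sum>(m, l)\<in>D2 \<times> D1. \<b> m * \<b> l * of_nat (\<delta> (u\<^sup>\<star>) m l))"
    proof (rule sum.mono_neutral_left)
      show "FP u \<subseteq> D2 \<times> D1"
      proof
        fix x assume x: "x \<in> FP u"
        have "fst x \<in> D2" unfolding D2_def using UN_I[where B = "\<lambda>u. fst ` FP u", OF u imageI[OF x]] by simp
        moreover have "snd x \<in> D1" unfolding D1_def using UN_I[where B = "\<lambda>u. snd ` FP u", OF u imageI[OF x]] by simp
        ultimately show "x \<in> D2 \<times> D1" by (simp add: mem_Times_iff)
      qed
    qed (use D1 D2 in \<open>auto simp: FP_def\<close>)
    also have "\<dots> = (\<Sum>l\<in>D1. \<Sum>m\<in>D2. \<b> m * \<b> l * of_nat (\<delta> m l (u\<^sup>\<star>)))"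
      unfolding sum.cartesian_product[symmetric] mult_rotate[of "u\<^sup>\<star>"] by (rule sum.swap)
    finally show "(\<Sum>l\<in>D1. \<Sum>m\<in>D2. (\<b> m * \<b> l * of_nat (\<delta> m l (u\<^sup>\<star>))) * plaq_coeff \<Phi> p u s t)
      = \<b> u * plaq_coeff \<Phi> p u s t"
      by (simp add: sum_distrib_right)
  qed
  also have "\<dots> = plaq_kernel \<Phi> p (g + h) s t"
    by (rule plaq_kernel_sum[symmetric, OF fDu]) (unfold Du_def, blast+)
  finally show ?thesis .
qed

section \<open>Operators for a degree\<close>

text \<open>
  Only finitely many labels act nontrivially on a vector of finite support, so the sum over
  the labels may be moved into the matrix.
\<close>

lemma B_deg_lin_ext:
  assumes p: "p \<in> plaquettes T" and f: "f \<in> state_space \<Phi>" and g: "g \<notin> \<X>" and adm: "admissible (shift p g \<Phi>)"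
  shows "B_deg \<Phi> p g f = lin_ext (plaq_kernel \<Phi> p g) f"
proof
  fix t
  define D where "D = (\<Union>s\<in>{s. f s \<noteq> 0}. {l \<in> I g. \<exists>t. plaq_coeff \<Phi> p l s t \<noteq> 0})"
  have D: "finite D" "D \<subseteq> I g"
    unfolding D_def using state_spaceD[OF f] finite_active_labels[OF p _ g adm] by auto
  have "B_deg \<Phi> p g f t = (\<Sum>l\<in>D. if l \<in> I g then \<b> l * B_label \<Phi> p l f t else 0)"
    unfolding B_deg_def
  proof (rule Sum_any.expand_superset[OF D(1)], intro subsetI, elim CollectE)
    fix l assume nz: "(if l \<in> I g then \<b> l * B_label \<Phi> p l f t else 0) \<noteq> 0"
    then have "lin_ext (plaq_coeff \<Phi> p l) f t \<noteq> 0" "l \<in> I g" by (auto simp: B_label_def split: if_splits)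
    then show "l \<in> D" using lin_ext_support unfolding D_def by fast
  qed
  also have "\<dots> = (\<Sum>l\<in>D. \<Sum>s | f s \<noteq> 0. f s * (\<b> l * plaq_coeff \<Phi> p l s t))"
    using D by (intro sum.cong refl) (auto simp: B_label_def lin_ext_def sum_distrib_left mult_ac)
  also have "\<dots> = (\<Sum>s | f s \<noteq> 0. f s * (\<Sum>l\<in>D. \<b> l * plaq_coeff \<Phi> p l s t))"
    by (subst sum.swap) (simp add: sum_distrib_left)
  also have "\<dots> = lin_ext (plaq_kernel \<Phi> p g) f t"
    unfolding lin_ext_def
  proof (intro sum.cong refl arg_cong2[where f = "(*)"])
    fix s assume "s \<in> {s. f s \<noteq> 0}"
    then show "(\<Sum>l\<in>D. \<b> l * plaq_coeff \<Phi> p l s t) = plaq_kernel \<Phi> p g s t"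
      by (intro plaq_kernel_sum[symmetric] D) (unfold D_def, blast)
  qed
  finally show "B_deg \<Phi> p g f t = lin_ext (plaq_kernel \<Phi> p g) f t" .
qed

lemma B_deg_state_space:
  assumes "p \<in> plaquettes T" "f \<in> state_space \<Phi>" "g \<notin> \<X>" "admissible (shift p g \<Phi>)"
  shows "B_deg \<Phi> p g f \<in> state_space (shift p g \<Phi>)"
  unfolding B_deg_lin_ext[OF assms]
  using plaq_kernel_row[OF _ assms(3,4)] by (intro lin_ext_state_space[OF assms(2)]) auto

lemma B_deg_B_deg:
  assumes p: "p \<in> plaquettes T" and q: "q \<in> plaquettes T" and f: "f \<in> state_space \<Phi>"
    and g: "g \<notin> \<X>" and h: "h \<notin> \<X>"
    and \<Phi>: "admissible (shift p h \<Phi>)" "admissible (shift q g (shift p h \<Phi>))"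
  shows "B_deg (shift p h \<Phi>) q g (B_deg \<Phi> p h f)
    = lin_ext (mat_comp (plaq_kernel \<Phi> p h) (plaq_kernel (shift p h \<Phi>) q g)) f"
  unfolding B_deg_lin_ext[OF q B_deg_state_space[OF p f h \<Phi>(1)] g \<Phi>(2)]
  unfolding B_deg_lin_ext[OF p f h \<Phi>(1)]
  using state_spaceD[OF f] plaq_kernel_row(1)[OF _ h \<Phi>(1)] by (intro lin_ext_comp) auto

lemma B_deg_compose:
  assumes p: "p \<in> plaquettes T" and f: "f \<in> state_space \<Phi>"
    and g: "g \<notin> \<X>" and h: "h \<notin> \<X>" and gh: "g + h \<notin> \<X>"
    and \<Phi>: "admissible \<Phi>" "admissible (shift p h \<Phi>)" "admissible (shift p (g + h) \<Phi>)"
  shows "B_deg (shift p h \<Phi>) p g (B_deg \<Phi> p h f) = B_deg \<Phi> p (g + h) f"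
proof -
  have "B_deg (shift p h \<Phi>) p g (B_deg \<Phi> p h f)
    = lin_ext (mat_comp (plaq_kernel \<Phi> p h) (plaq_kernel (shift p h \<Phi>) p g)) f"
    using \<Phi> by (intro B_deg_B_deg p f g h) (simp_all add: shift_shift)
  also have "\<dots> = lin_ext (plaq_kernel \<Phi> p (g + h)) f"
    using state_spaceD[OF f] plaq_kernel_compose[OF p _ g h gh \<Phi>] by (intro ext lin_ext_cong) auto
  also have "\<dots> = B_deg \<Phi> p (g + h) f" using B_deg_lin_ext[OF p f gh \<Phi>(3)] by simp
  finally show ?thesis .
qed

end


section \<open>Adjoints of plaquette operators\<close>

context LW_data
begin

lemma gamma_rotations_of_sixj1:
  assumes nz: "\<N> j1 j2 j3 j4 j5 j6 a1 a2 a3 a4 \<noteq> 0"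
  shows "\<gamma> a1 j2 (j3\<^sup>\<star>) j1 = \<gamma> a1 j1 j2 (j3\<^sup>\<star>)" "\<gamma> a1 (j3\<^sup>\<star>) j1 j2 = \<gamma> a1 j1 j2 (j3\<^sup>\<star>)"
proof -
  show 1: "\<gamma> a1 j2 (j3\<^sup>\<star>) j1 = \<gamma> a1 j1 j2 (j3\<^sup>\<star>)"
    using gamma_rotate_of_sixj1[OF nz] by simp
  have "j1 \<in> \<A>" using sixj_labels[OF nz] by auto
  moreover have "\<N> j2 (j3\<^sup>\<star>) (j1\<^sup>\<star>) j5 j6 j4 a1 a3 a4 a2 \<noteq> 0"
    using nz sixj_sym1[OF sixj_labels[OF nz]] by simp
  ultimately have "\<gamma> a1 j2 (j3\<^sup>\<star>) j1 = \<gamma> a1 (j3\<^sup>\<star>) j1 j2"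
    using gamma_rotate_of_sixj1[of j2 "j3\<^sup>\<star>" "j1\<^sup>\<star>"] by (simp add: dual_dual)
  then show "\<gamma> a1 (j3\<^sup>\<star>) j1 j2 = \<gamma> a1 j1 j2 (j3\<^sup>\<star>)" using 1 by simp
qed

lemma gamma_rotations_of_sixj2:
  assumes nz: "\<N> j1 j2 j3 j4 j5 j6 a1 a2 a3 a4 \<noteq> 0"
  shows "\<gamma> a2 j4 (j5\<^sup>\<star>) j3 = \<gamma> a2 j3 j4 (j5\<^sup>\<star>)" "\<gamma> a2 (j5\<^sup>\<star>) j3 j4 = \<gamma> a2 j3 j4 (j5\<^sup>\<star>)"
proof -
  have "\<N> j3 j4 j5 (j6\<^sup>\<star>) j1 (j2\<^sup>\<star>) a2 a3 a1 a4 \<noteq> 0"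
    using nz sixj_sym2[OF sixj_labels[OF nz]] by simp
  from gamma_rotations_of_sixj1[OF this]
  show "\<gamma> a2 j4 (j5\<^sup>\<star>) j3 = \<gamma> a2 j3 j4 (j5\<^sup>\<star>)" "\<gamma> a2 (j5\<^sup>\<star>) j3 j4 = \<gamma> a2 j3 j4 (j5\<^sup>\<star>)" .
qed

lemma sixj_adjoint_nonzero:
  assumes nz: "\<N> j' l j (jn\<^sup>\<star>) k (jn'\<^sup>\<star>) A C C' An \<noteq> 0" and n: "jn \<in> \<A>" "jn' \<in> \<A>"
  shows "\<N> j (l\<^sup>\<star>) j' (jn'\<^sup>\<star>) k (jn\<^sup>\<star>) A C' C An \<noteq> 0"
  using sixj_cnj_corner[of j' l j jn k jn' A C C' An] sixj_labels[OF nz] nz n by auto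

text \<open>
  Up to the scalars \<open>\<beta>\<close>, the scalars \<open>\<gamma>\<close> produced by complex conjugation of a nonzero 6j-symbol are
  inverse to those of the dual triangles.
\<close>

lemma sixj_gamma_inverse:
  assumes nz: "\<N> j' l j (jn\<^sup>\<star>) k (jn'\<^sup>\<star>) A C C' An \<noteq> 0" and n: "jn \<in> \<A>" "jn' \<in> \<A>"
  shows "\<gamma> A j' l (j\<^sup>\<star>) * \<gamma> A (l\<^sup>\<star>) (j'\<^sup>\<star>) j * (\<beta> l * \<beta> j' * \<beta> j) = 1"
    "\<gamma> C' (j'\<^sup>\<star>) k jn' * \<gamma> C' j' (jn'\<^sup>\<star>) (k\<^sup>\<star>) * (\<beta> j' * \<beta> k * \<beta> jn') = 1"
proof -
  have L: "j' \<in> \<A>" "l \<in> \<A>" "j \<in> \<A>" "k \<in> \<A>" using sixj_labels[OF nz] by auto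
  have "\<delta> j' l (j\<^sup>\<star>) = \<delta> (l\<^sup>\<star>) (j'\<^sup>\<star>) j"
    using mult_dual[of j' l "j\<^sup>\<star>"] mult_rotate[of j "l\<^sup>\<star>" "j'\<^sup>\<star>"] L by (simp add: dual_closed dual_dual)
  then have "1 \<le> A" "A \<le> \<delta> (l\<^sup>\<star>) (j'\<^sup>\<star>) j" using sixj_range(1)[OF nz] by auto
  from gamma_dual[OF _ _ _ this] L
  show "\<gamma> A j' l (j\<^sup>\<star>) * \<gamma> A (l\<^sup>\<star>) (j'\<^sup>\<star>) j * (\<beta> l * \<beta> j' * \<beta> j) = 1"
    using gamma_rotations_of_sixj1(2)[OF nz] by (simp add: dual_closed dual_dual beta_dual mult_ac)
  have "\<delta> k jn' (j'\<^sup>\<star>) = \<delta> (j'\<^sup>\<star>) k jn'" using mult_rotate[of "j'\<^sup>\<star>" k jn'] by simp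
  then have "1 \<le> C'" "C' \<le> \<delta> (j'\<^sup>\<star>) k jn'" using sixj_range(3)[OF nz] n by (auto simp: dual_dual)
  from gamma_dual[OF _ _ _ this] L n
  show "\<gamma> C' (j'\<^sup>\<star>) k jn' * \<gamma> C' j' (jn'\<^sup>\<star>) (k\<^sup>\<star>) * (\<beta> j' * \<beta> k * \<beta> jn') = 1"
    using gamma_rotations_of_sixj2(1)[OF sixj_adjoint_nonzero[OF nz n]]
    by (simp add: dual_closed dual_dual beta_dual mult_ac)
qed

end

context LW_surface
begin

text \<open>
  The linear order of the edges at a corner depends on how its triangle is listed, while the 6j-symbols see
  them in the order given by the plaquette. Cyclic invariance of \<open>\<gamma>\<close> bridges the gap.
\<close>

lemma vertex_gamma_side:
  assumes s: "s \<in> prestates \<Phi>" and e: "e \<in> sides T p"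
    and rot: "\<gamma> C ((fst s (next_side T e))\<^sup>\<star>) ((fst s (leg T e))\<^sup>\<star>) (fst s e)
        = \<gamma> C (fst s e) ((fst s (next_side T e))\<^sup>\<star>) ((fst s (leg T e))\<^sup>\<star>)"
      "\<gamma> C ((fst s (leg T e))\<^sup>\<star>) (fst s e) ((fst s (next_side T e))\<^sup>\<star>)
        = \<gamma> C (fst s e) ((fst s (next_side T e))\<^sup>\<star>) ((fst s (leg T e))\<^sup>\<star>)"
    and C: "C = snd s (target T e)"
  shows "vertex_gamma s (target T e) = \<gamma> C (fst s e) ((fst s (next_side T e))\<^sup>\<star>) ((fst s (leg T e))\<^sup>\<star>)"
proof -
  obtain x y where x: "e = (p, x)" "ccw T p x y" "next_side T e = (p, y)" "leg T e = (y, x)"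
    using e by (rule side_cases)
  have dual: "(fst s (next_side T e))\<^sup>\<star> = fst s (y, p)" "(fst s (leg T e))\<^sup>\<star> = fst s (x, y)"
    using prestate_label(3)[OF s sides_oriented[OF next_side_in[OF e]]]
      prestate_label(3)[OF s leg_oriented[OF e]] x by simp_all
  note rot' = rot[unfolded dual C, unfolded x(1)]
  show ?thesis unfolding dual C unfolding x(1)
    by (rule target_cases[OF x(2)]) (use rot' in \<open>simp_all add: vertex_gamma_def\<close>)
qed

lemma finite_edges: "finite (edges T)"
  unfolding edges_def using finite_oriented_edges by simp

lemma prod_edges_split:
  fixes f :: "'j \<Rightarrow> complex"
  assumes s: "s \<in> prestates \<Phi>" and f: "\<And>i. i \<in> \<A> \<Longrightarrow> f (i\<^sup>\<star>) = f i"
  shows "(\<Prod>E\<in>edges T. f (fst s (SOME e. e \<in> E)))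
    = (\<Prod>e\<in>sides T p. f (fst s e))
      * (\<Prod>E\<in>edges T - (\<lambda>e. {e, prod.swap e}) ` sides T p. f (fst s (SOME e. e \<in> E)))"
proof -
  let ?E = "\<lambda>e. {e, prod.swap e}"
  have sub: "?E ` sides T p \<subseteq> edges T" unfolding edges_def using sides_oriented by (intro image_mono) blast
  have inj: "inj_on ?E (sides T p)"
  proof (rule inj_onI)
    fix e e' assume e: "e \<in> sides T p" "e' \<in> sides T p" "?E e = ?E e'"
    then have "e \<in> ?E e'" by blast
    then show "e = e'" using e(1) swap_side_notin[OF e(2)] by auto
  qed
  have "f (fst s (SOME e'. e' \<in> ?E e)) = f (fst s e)" if e: "e \<in> sides T p" for e
  proof -
    have "(SOME e'. e' \<in> ?E e) \<in> ?E e" by (rule someI[of _ e]) simp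
    then show ?thesis
      using prestate_label(1,3)[OF s sides_oriented[OF e]] f by auto
  qed
  then have "(\<Prod>E\<in>?E ` sides T p. f (fst s (SOME e. e \<in> E))) = (\<Prod>e\<in>sides T p. f (fst s e))"
    by (simp add: prod.reindex[OF inj])
  then show ?thesis
    using prod.subset_diff[OF sub finite_edges, of "\<lambda>E. f (fst s (SOME e. e \<in> E))"] by (simp add: mult.commute)
qed

lemma prod_edges_off:
  assumes "agree_off (boundary_edges T p) (corners T p) s t"
  shows "(\<Prod>E\<in>edges T - (\<lambda>e. {e, prod.swap e}) ` sides T p. f (fst t (SOME e. e \<in> E)))
    = (\<Prod>E\<in>edges T - (\<lambda>e. {e, prod.swap e}) ` sides T p. f (fst s (SOME e. e \<in> E)))"
proof (intro prod.cong refl arg_cong[where f = f])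
  fix E assume E: "E \<in> edges T - (\<lambda>e. {e, prod.swap e}) ` sides T p"
  then obtain e where e: "E = {e, prod.swap e}" "e \<in> oriented_edges T" unfolding edges_def by blast
  define e' where "e' = (SOME e. e \<in> E)"
  have "e' \<in> E" unfolding e'_def by (rule someI[of _ e]) (simp add: e)
  then have e': "E = {e', prod.swap e'}" "e' \<in> oriented_edges T"
    using e oriented_edges_swap[OF e(2)] by auto
  have "e' \<notin> boundary_edges T p"
  proof
    assume "e' \<in> boundary_edges T p"
    then have "e' \<in> sides T p \<or> prod.swap e' \<in> sides T p" by (simp add: swap_image_iff)
    then have "E \<in> (\<lambda>e. {e, prod.swap e}) ` sides T p"
    proof
      assume "prod.swap e' \<in> sides T p"
      then show ?thesis unfolding e'(1) by (intro image_eqI[where x = "prod.swap e'"]) auto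
    qed (unfold e'(1), rule imageI)
    then show False using E by simp
  qed
  then show "fst t (SOME e. e \<in> E) = fst s (SOME e. e \<in> E)"
    using assms e' unfolding agree_off_def e'_def by auto
qed

lemma prod_vertices_split:
  fixes f :: "'v triangle \<Rightarrow> complex"
  shows "(\<Prod>v\<in>T. f v) = (\<Prod>e\<in>sides T p. f (target T e)) * (\<Prod>v\<in>T - corners T p. f v)"
proof -
  have "(\<Prod>v\<in>corners T p. f v) = (\<Prod>e\<in>sides T p. f (target T e))"
    unfolding corners_def by (simp add: prod.reindex[OF target_inj])
  then show ?thesis using prod.subset_diff[OF corners_subset finite_T, of f p] by (simp add: mult.commute)
qed

lemma prod_vertices_off:
  assumes agree: "agree_off (boundary_edges T p) (corners T p) s t"
  shows "(\<Prod>v\<in>T - corners T p. vertex_gamma t v) = (\<Prod>v\<in>T - corners T p. vertex_gamma s v)"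
proof (intro prod.cong refl)
  fix v assume v: "v \<in> T - corners T p"
  obtain a b c where abc: "v = (a, b, c)" by (cases v)
  have ccw: "ccw T a b c" using v abc by (simp add: ccw_def)
  have "fst t e = fst s e" if "e \<in> {(a, b), (b, c), (c, a)}" for e
  proof -
    have "e \<in> oriented_edges T" "target T e = v"
      using that oriented_edges_ccw[OF ccw] target_triangle[of a b c] v abc by auto
    then show ?thesis using target_off_corner[of e p] v agree unfolding agree_off_def by auto
  qed
  moreover have "snd t v = snd s v" using v agree unfolding agree_off_def by auto
  ultimately show "vertex_gamma t v = vertex_gamma s v" by (simp add: abc vertex_gamma_def)
qed

text \<open>
  The scalars \<open>\<gamma>\<close> for the triangles of the auxiliary label \<open>l\<close> cancel between adjacent corners,
  those for the vertices of the graph pass from one weight to the other, and the scalars \<open>\<beta>\<close> are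
  shifted by one side around the plaquette.
\<close>

lemma prod_corner_coeff_adjoint:
  assumes l: "l \<in> \<A>" and s: "s \<in> prestates \<Phi>" and t: "t \<in> prestates \<Phi>'"
    and agree: "agree_off (boundary_edges T p) (corners T p) s t"
  shows "cnj (\<Prod>e\<in>sides T p. corner_coeff l s t A e) * (\<Prod>e\<in>sides T p. vertex_gamma t (target T e))
      * (\<Prod>e\<in>sides T p. \<beta> (fst t e)) / (\<Prod>e\<in>sides T p. \<d> (fst t e))
    = (\<Prod>e\<in>sides T p. corner_coeff (l\<^sup>\<star>) t s A e) * (\<Prod>e\<in>sides T p. vertex_gamma s (target T e))
      * (\<Prod>e\<in>sides T p. \<beta> (fst s e)) / (\<Prod>e\<in>sides T p. \<d> (fst s e))"
proof -
  let ?S = "sides T p" and ?nx = "next_side T"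
  define N where "N e = \<N> (fst t e) l (fst s e) ((fst s (?nx e))\<^sup>\<star>) (fst s (leg T e)) ((fst t (?nx e))\<^sup>\<star>)
       (A e) (snd s (target T e)) (snd t (target T e)) (A (?nx e))" for e
  define N' where "N' e = \<N> (fst s e) (l\<^sup>\<star>) (fst t e) ((fst t (?nx e))\<^sup>\<star>) (fst s (leg T e)) ((fst s (?nx e))\<^sup>\<star>)
       (A e) (snd t (target T e)) (snd s (target T e)) (A (?nx e))" for e
  have leg: "fst t (leg T e) = fst s (leg T e)" if "e \<in> ?S" for e using agree_off_leg[OF agree that] .
  have corner: "corner_coeff l s t A e = \<d> (fst t e) * N e"
    "corner_coeff (l\<^sup>\<star>) t s A e = \<d> (fst s e) * N' e" if "e \<in> ?S" for e
    using leg[OF that] by (simp_all add: corner_coeff_def N_def N'_def)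
  have lab: "fst s e \<in> \<A>" "fst t e \<in> \<A>" "fst s (leg T e) \<in> \<A>" if "e \<in> ?S" for e
    using prestate_label(1)[OF s sides_oriented[OF that]] prestate_label(1)[OF t sides_oriented[OF that]]
      prestate_label(1)[OF s leg_oriented[OF that]] by auto
  have dt: "(\<Prod>e\<in>?S. \<d> (fst t e)) \<noteq> 0" and ds: "(\<Prod>e\<in>?S. \<d> (fst s e)) \<noteq> 0"
    using finite_sides lab qdim_nonzero by (simp_all add: prod_zero_iff)
  have "cnj (\<Prod>e\<in>?S. N e) * (\<Prod>e\<in>?S. vertex_gamma t (target T e)) * (\<Prod>e\<in>?S. \<beta> (fst t e))
      = (\<Prod>e\<in>?S. N' e) * (\<Prod>e\<in>?S. vertex_gamma s (target T e)) * (\<Prod>e\<in>?S. \<beta> (fst s e))"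
    \<comment> \<open>If one symbol vanishes, so does its conjugate. Otherwise all multiplicity indices are in range, and
      the relations between the values of \<open>\<gamma>\<close> hold.\<close>
  proof (cases "\<exists>e\<in>?S. N e = 0")
    case True
    then obtain e where e: "e \<in> ?S" "N e = 0" by blast
    note e' = next_side_in[OF e(1)]
    have "N' e = 0"
    proof (rule ccontr)
      assume nz: "N' e \<noteq> 0"

      show False
        using sixj_adjoint_nonzero[OF nz[unfolded N'_def] lab(2)[OF e'] lab(1)[OF e']] e(2) l
        by (simp add: N_def dual_dual)
    qed
    then have "(\<Prod>e\<in>?S. N e) = 0" "(\<Prod>e\<in>?S. N' e) = 0" using e finite_sides by (auto simp: prod_zero_iff)
    then show ?thesis by simp
  next
    case False
    then have nz: "N e \<noteq> 0" if "e \<in> ?S" for e using that by blast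
    define a where "a e = \<gamma> (A e) (fst t e) l ((fst s e)\<^sup>\<star>)" for e
    define b where "b e = \<gamma> (A e) (l\<^sup>\<star>) ((fst t e)\<^sup>\<star>) (fst s e)" for e
    have *: "cnj (N e) * vertex_gamma t (target T e) * \<beta> (fst t e)
        = N' e * vertex_gamma s (target T e) * (a e * (\<beta> l * \<beta> (fst t e) * \<beta> (fst s e)))
          * b (?nx e) * \<beta> (fst s (?nx e))"
      and ab: "a e * (\<beta> l * \<beta> (fst t e) * \<beta> (fst s e)) * b e = 1" if e: "e \<in> ?S" for e
    proof -
      note e' = next_side_in[OF e] and nz' = nz[OF e, unfolded N_def]
      note n = lab(1)[OF e'] lab(2)[OF e']

      note inv = sixj_gamma_inverse[OF nz' n]
      show "a e * (\<beta> l * \<beta> (fst t e) * \<beta> (fst s e)) * b e = 1"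
        using inv(1) by (simp add: a_def b_def mult_ac)
      have vs: "vertex_gamma s (target T e)
        = \<gamma> (snd s (target T e)) (fst s e) ((fst s (?nx e))\<^sup>\<star>) ((fst s (leg T e))\<^sup>\<star>)"
        by (rule vertex_gamma_side[OF s e gamma_rotations_of_sixj2[OF nz'] refl])
      have vt: "vertex_gamma t (target T e)
        = \<gamma> (snd t (target T e)) (fst t e) ((fst t (?nx e))\<^sup>\<star>) ((fst s (leg T e))\<^sup>\<star>)"
        using vertex_gamma_side[OF t e _ _ refl]
          gamma_rotations_of_sixj2[OF sixj_adjoint_nonzero[OF nz' n]] leg[OF e] by simp
      have "cnj (N e) = N' e * (a e * vertex_gamma s (target T e)
          * \<gamma> (snd t (target T e)) ((fst t e)\<^sup>\<star>) (fst s (leg T e)) (fst t (?nx e)) * b (?nx e))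
          * (\<beta> (fst t e) * \<beta> l * \<beta> (fst s e) * \<beta> (fst s (?nx e)) * \<beta> (fst s (leg T e)) * \<beta> (fst t (?nx e)))"
        unfolding N_def N'_def vs a_def b_def using lab[OF e] n l by (intro sixj_cnj_corner) auto
      then have "cnj (N e) * vertex_gamma t (target T e) * \<beta> (fst t e)
        = N' e * vertex_gamma s (target T e) * (a e * (\<beta> l * \<beta> (fst t e) * \<beta> (fst s e)))
          * b (?nx e) * \<beta> (fst s (?nx e))
          * (\<gamma> (snd t (target T e)) ((fst t e)\<^sup>\<star>) (fst s (leg T e)) (fst t (?nx e))
            * \<gamma> (snd t (target T e)) (fst t e) ((fst t (?nx e))\<^sup>\<star>) ((fst s (leg T e))\<^sup>\<star>)
            * (\<beta> (fst t e) * \<beta> (fst s (leg T e)) * \<beta> (fst t (?nx e))))"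
        unfolding vt by (simp add: mult_ac)
      then show "cnj (N e) * vertex_gamma t (target T e) * \<beta> (fst t e)
        = N' e * vertex_gamma s (target T e) * (a e * (\<beta> l * \<beta> (fst t e) * \<beta> (fst s e)))
          * b (?nx e) * \<beta> (fst s (?nx e))"
        unfolding inv(2) by simp
    qed
    have "(\<Prod>e\<in>?S. cnj (N e) * vertex_gamma t (target T e) * \<beta> (fst t e))
      = (\<Prod>e\<in>?S. N' e * vertex_gamma s (target T e) * (a e * (\<beta> l * \<beta> (fst t e) * \<beta> (fst s e)))
          * b (?nx e) * \<beta> (fst s (?nx e)))"
      by (intro prod.cong refl *)
    also have "\<dots> = (\<Prod>e\<in>?S. N' e * vertex_gamma s (target T e))
        * (\<Prod>e\<in>?S. a e * (\<beta> l * \<beta> (fst t e) * \<beta> (fst s e)))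
        * (\<Prod>e\<in>?S. b (?nx e)) * (\<Prod>e\<in>?S. \<beta> (fst s (?nx e)))"
      by (simp only: prod.distrib)
    also have "\<dots> = (\<Prod>e\<in>?S. N' e * vertex_gamma s (target T e))
        * (\<Prod>e\<in>?S. a e * (\<beta> l * \<beta> (fst t e) * \<beta> (fst s e)) * b e) * (\<Prod>e\<in>?S. \<beta> (fst s e))"
      using prod.reindex_bij_betw[OF next_side_bij, of b p]
        prod.reindex_bij_betw[OF next_side_bij, of "\<lambda>e. \<beta> (fst s e)" p]
      by (simp add: prod.distrib mult_ac)
    also have "(\<Prod>e\<in>?S. a e * (\<beta> l * \<beta> (fst t e) * \<beta> (fst s e)) * b e) = 1"
      by (intro prod.neutral ballI ab)
    finally show ?thesis by (simp add: prod.distrib)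
  qed
  then show ?thesis
    using dt ds qdim_real lab by (simp add: corner prod.distrib field_simps)
qed


text \<open>
  Vertices and edges away from \<open>p\<close> contribute equally to the weights of \<open>s\<close> and \<open>t\<close>, so the claim
  reduces to a product over the sides of \<open>p\<close>.
\<close>

lemma plaq_coeff_adjoint:
  assumes l: "l \<in> \<A>" and s: "s \<in> states \<Phi>" and t: "t \<in> states (shift p (deg l) \<Phi>)"
  shows "cnj (plaq_coeff \<Phi> p l s t) * weight t = plaq_coeff (shift p (deg l) \<Phi>) p (l\<^sup>\<star>) t s * weight s"
proof (cases "agree_off (boundary_edges T p) (corners T p) s t")
  case False
  then have "plaq_coeff \<Phi> p l s t = 0" "plaq_coeff (shift p (deg l) \<Phi>) p (l\<^sup>\<star>) t s = 0"
    using agree_off_sym plaq_coeff_nonzero(2) by blast+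
  then show ?thesis by simp
next
  case agree: True
  note s' = states_prestates[OF s] and t' = states_prestates[OF t]
  let ?S = "sides T p"
  define g where "g = (\<Prod>v\<in>T - corners T p. vertex_gamma s v)"
  define b where "b = (\<Prod>E\<in>edges T - (\<lambda>e. {e, prod.swap e}) ` ?S. \<beta> (fst s (SOME e. e \<in> E)))"
  define d where "d = (\<Prod>E\<in>edges T - (\<lambda>e. {e, prod.swap e}) ` ?S. \<d> (fst s (SOME e. e \<in> E)))"
  note splits = prod_edges_split[of s \<Phi> "beta L" p, OF s' beta_dual, simplified]
    prod_edges_split[of s \<Phi> "qdim L" p, OF s' qdim_dual, simplified]
  note splitt = prod_edges_split[of t "shift p (deg l) \<Phi>" "beta L" p, OF t' beta_dual, simplified]
    prod_edges_split[of t "shift p (deg l) \<Phi>" "qdim L" p, OF t' qdim_dual, simplified]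
  have ws: "weight s = ((\<Prod>e\<in>?S. vertex_gamma s (target T e)) * (\<Prod>e\<in>?S. \<beta> (fst s e))
      / (\<Prod>e\<in>?S. \<d> (fst s e))) * (g * b / d)"
    unfolding weight_def splits prod_vertices_split[of _ p] g_def b_def d_def by simp
  have wt: "weight t = ((\<Prod>e\<in>?S. vertex_gamma t (target T e)) * (\<Prod>e\<in>?S. \<beta> (fst t e))
      / (\<Prod>e\<in>?S. \<d> (fst t e))) * (g * b / d)"
    unfolding weight_def splitt prod_vertices_split[of _ p]
      prod_vertices_off[OF agree] prod_edges_off[OF agree] g_def b_def d_def by simp
  have A: "(\<Pi>\<^sub>E e \<in> ?S. {1..\<delta> (fst t e) l ((fst s e)\<^sup>\<star>)}) = (\<Pi>\<^sub>E e \<in> ?S. {1..\<delta> (fst s e) (l\<^sup>\<star>) ((fst t e)\<^sup>\<star>)})"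
  proof (rule PiE_cong)
    fix e assume e: "e \<in> ?S"
    show "{1..\<delta> (fst t e) l ((fst s e)\<^sup>\<star>)} = {1..\<delta> (fst s e) (l\<^sup>\<star>) ((fst t e)\<^sup>\<star>)}"
      using prestate_label(1)[OF s' sides_oriented[OF e]] prestate_label(1)[OF t' sides_oriented[OF e]] l
        mult_dual[of "fst t e" l "(fst s e)\<^sup>\<star>"] by (simp add: dual_closed dual_dual)
  qed
  have "cnj (amplitude p l s t) * weight t
    = (\<Sum>A \<in> (\<Pi>\<^sub>E e \<in> ?S. {1..\<delta> (fst t e) l ((fst s e)\<^sup>\<star>)}).
      (cnj (\<Prod>e\<in>?S. corner_coeff l s t A e) * (\<Prod>e\<in>?S. vertex_gamma t (target T e))
      * (\<Prod>e\<in>?S. \<beta> (fst t e)) / (\<Prod>e\<in>?S. \<d> (fst t e))) * (g * b / d))"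
    unfolding amplitude_def wt by (simp add: sum_distrib_left sum_distrib_right sum_divide_distrib mult_ac)
  also have "\<dots> = (\<Sum>A \<in> (\<Pi>\<^sub>E e \<in> ?S. {1..\<delta> (fst s e) (l\<^sup>\<star>) ((fst t e)\<^sup>\<star>)}).
      ((\<Prod>e\<in>?S. corner_coeff (l\<^sup>\<star>) t s A e) * (\<Prod>e\<in>?S. vertex_gamma s (target T e))
      * (\<Prod>e\<in>?S. \<beta> (fst s e)) / (\<Prod>e\<in>?S. \<d> (fst s e))) * (g * b / d))"
    unfolding A prod_corner_coeff_adjoint[OF l s' t' agree] ..
  also have "\<dots> = amplitude p (l\<^sup>\<star>) t s * weight s"
    unfolding amplitude_def ws by (simp add: sum_distrib_left sum_distrib_right sum_divide_distrib mult_ac)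
  moreover have "shift p (deg (l\<^sup>\<star>)) (shift p (deg l) \<Phi>) = \<Phi>"
    unfolding shift_shift using l by (simp add: deg_dual delta_color_def fun_eq_iff)
  ultimately show ?thesis
    using agree agree_off_sym[OF agree] s t by (simp add: plaq_coeff_alt)
qed

lemma shift_zero: "shift p 0 \<Phi> = \<Phi>"
  by (simp add: delta_color_def fun_eq_iff)

lemma plaq_kernel_adjoint:
  assumes p: "p \<in> plaquettes T" and g: "g \<notin> \<X>" and \<Phi>: "admissible (shift p g \<Phi>)"
    and s: "s \<in> states \<Phi>" and t: "t \<in> states (shift p g \<Phi>)"
  shows "cnj (plaq_kernel \<Phi> p g s t) * weight t = plaq_kernel (shift p g \<Phi>) p (- g) t s * weight s"
proof -
  define D where "D = {l \<in> I g. \<exists>t. plaq_coeff \<Phi> p l s t \<noteq> 0}"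
  have D: "finite D" "D \<subseteq> I g" unfolding D_def using finite_active_labels[OF p s g \<Phi>] by auto
  have dual_inj: "inj_on (dual L) (I h)" for h
    by (rule inj_on_inverseI[where g = "dual L"]) (simp add: homog_def dual_dual)
  have adj: "cnj (plaq_coeff \<Phi> p l s t) * weight t = plaq_coeff (shift p g \<Phi>) p (l\<^sup>\<star>) t s * weight s"
    if "l \<in> I g" for l
    using plaq_coeff_adjoint[of l s \<Phi> t p] s t that by (simp add: homog_def)
  have "cnj (plaq_kernel \<Phi> p g s t) * weight t = (\<Sum>l\<in>D. \<b> l * (cnj (plaq_coeff \<Phi> p l s t) * weight t))"
  proof -
    have "plaq_kernel \<Phi> p g s t = (\<Sum>l\<in>D. \<b> l * plaq_coeff \<Phi> p l s t)"
      by (rule plaq_kernel_sum[OF D]) (unfold D_def, blast)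
    then show ?thesis using D bcoef_real
      by (auto simp: sum_distrib_left sum_distrib_right homog_def mult_ac intro!: sum.cong)
  qed
  also have "\<dots> = (\<Sum>l\<in>D. \<b> (l\<^sup>\<star>) * (plaq_coeff (shift p g \<Phi>) p (l\<^sup>\<star>) t s * weight s))"
    using D adj bcoef_dual by (intro sum.cong refl) (auto simp: homog_def)
  also have "\<dots> = (\<Sum>l\<in>D. \<b> (l\<^sup>\<star>) * plaq_coeff (shift p g \<Phi>) p (l\<^sup>\<star>) t s) * weight s"
    by (simp only: sum_distrib_right mult.assoc)
  also have "(\<Sum>l\<in>D. \<b> (l\<^sup>\<star>) * plaq_coeff (shift p g \<Phi>) p (l\<^sup>\<star>) t s)
      = (\<Sum>l\<in>dual L ` D. \<b> l * plaq_coeff (shift p g \<Phi>) p l t s)"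
    using inj_on_subset[OF dual_inj D(2)] by (simp add: sum.reindex)
  also have "\<dots> * weight s = plaq_kernel (shift p g \<Phi>) p (- g) t s * weight s"
  proof (cases "weight s = 0")
    case False
    have "plaq_kernel (shift p g \<Phi>) p (- g) t s = (\<Sum>l\<in>dual L ` D. \<b> l * plaq_coeff (shift p g \<Phi>) p l t s)"
    proof (rule plaq_kernel_sum)
      show "dual L ` D \<subseteq> I (- g)" using D homog_dual by blast
      show "{l \<in> I (- g). plaq_coeff (shift p g \<Phi>) p l t s \<noteq> 0} \<subseteq> dual L ` D"
      proof (intro subsetI, elim CollectE conjE)
        fix l assume l: "l \<in> I (- g)" "plaq_coeff (shift p g \<Phi>) p l t s \<noteq> 0"
        then have l': "l\<^sup>\<star> \<in> I g" "(l\<^sup>\<star>)\<^sup>\<star> = l" using homog_dual[OF l(1)] by (auto simp: homog_def dual_dual)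
        then have "plaq_coeff \<Phi> p (l\<^sup>\<star>) s t \<noteq> 0" using adj[OF l'(1)] l(2) False by auto
        then have "l\<^sup>\<star> \<in> D" using l' unfolding D_def by blast
        then show "l \<in> dual L ` D" using l'(2) by (metis imageI)
      qed
    qed (use D in simp)
    then show ?thesis by simp
  qed simp
  finally show ?thesis .
qed

lemma inner_prod_superset:
  assumes "finite S" "{s. x s \<noteq> 0 \<and> y s \<noteq> 0} \<subseteq> S"
  shows "inner_prod x y = (\<Sum>s\<in>S. cnj (x s) * y s * weight s)"
  unfolding inner_prod_def using assms by (intro sum.mono_neutral_left) auto

lemma inner_prod_lin_ext:
  assumes x: "x \<in> state_space \<Phi>" and y: "y \<in> state_space \<Phi>'"
    and adj: "\<And>s t. s \<in> states \<Phi> \<Longrightarrow> t \<in> states \<Phi>' \<Longrightarrow> cnj (M s t) * weight t = M' t s * weight s"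
  shows "inner_prod (lin_ext M x) y = inner_prod x (lin_ext M' y)"
proof -
  let ?X = "{s. x s \<noteq> 0}" and ?Y = "{t. y t \<noteq> 0}"
  have fin: "finite ?X" "finite ?Y" using state_spaceD(1) x y by blast+
  have "inner_prod (lin_ext M x) y = (\<Sum>t\<in>?Y. cnj (lin_ext M x t) * y t * weight t)"
    by (rule inner_prod_superset[OF fin(2)]) blast
  also have "\<dots> = (\<Sum>t\<in>?Y. \<Sum>s\<in>?X. cnj (x s) * y t * (cnj (M s t) * weight t))"
    by (simp add: lin_ext_def sum_distrib_left sum_distrib_right mult_ac)
  also have "\<dots> = (\<Sum>t\<in>?Y. \<Sum>s\<in>?X. cnj (x s) * y t * (M' t s * weight s))"
  proof (intro sum.cong refl)
    fix t s assume "t \<in> ?Y" "s \<in> ?X"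
    then have "s \<in> states \<Phi>" "t \<in> states \<Phi>'" using state_spaceD(2) x y by blast+
    then show "cnj (x s) * y t * (cnj (M s t) * weight t) = cnj (x s) * y t * (M' t s * weight s)"
      by (simp only: adj)
  qed
  also have "\<dots> = (\<Sum>s\<in>?X. \<Sum>t\<in>?Y. cnj (x s) * y t * (M' t s * weight s))" by (rule sum.swap)
  also have "\<dots> = (\<Sum>s\<in>?X. cnj (x s) * lin_ext M' y s * weight s)"
    by (simp add: lin_ext_def sum_distrib_left sum_distrib_right mult_ac)
  also have "\<dots> = inner_prod x (lin_ext M' y)"
    by (rule inner_prod_superset[OF fin(1), symmetric]) blast
  finally show ?thesis .
qed

lemma B_deg_adjoint:
  assumes p: "p \<in> plaquettes T" and g: "g \<notin> \<X>" and \<Phi>: "admissible \<Phi>" "admissible (shift p g \<Phi>)"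
    and x: "x \<in> state_space \<Phi>" and y: "y \<in> state_space (shift p g \<Phi>)"
  shows "inner_prod (B_deg \<Phi> p g x) y = inner_prod x (B_deg (shift p g \<Phi>) p (- g) y)"
proof -
  have "- g \<notin> \<X>" using g X_minus by blast
  moreover have "admissible (shift p (- g) (shift p g \<Phi>))"
    unfolding shift_shift using \<Phi>(1) by (simp add: shift_zero)
  ultimately have "B_deg (shift p g \<Phi>) p (- g) y = lin_ext (plaq_kernel (shift p g \<Phi>) p (- g)) y"
    by (intro B_deg_lin_ext p y)
  then show ?thesis unfolding B_deg_lin_ext[OF p x g \<Phi>(2)]
    using inner_prod_lin_ext[OF x y plaq_kernel_adjoint[OF p g \<Phi>(2)]] by simp
qed

end


section \<open>Exchange of operators on different plaquettes\<close>

lemma sum_Times5: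
  "(\<Sum>(n, c, d, x, y)\<in>F \<times> C \<times> C \<times> C \<times> C. f n c d x y)
    = (\<Sum>(n, x, y)\<in>F \<times> C \<times> C. \<Sum>c\<in>C. \<Sum>d\<in>C. f n c d x y)"
proof -
  have "(\<Sum>(n, c, d, x, y)\<in>F \<times> C \<times> C \<times> C \<times> C. f n c d x y)
    = (\<Sum>((n, x, y), c, d)\<in>(F \<times> C \<times> C) \<times> C \<times> C. f n c d x y)"
    by (rule sum.reindex_bij_witness[where j = "\<lambda>(n, c, d, x, y). ((n, x, y), c, d)"
          and i = "\<lambda>((n, x, y), c, d). (n, c, d, x, y)"]) auto
  then show ?thesis by (simp add: sum.cartesian_product case_prod_unfold)
qed

context LW_data
begin

text \<open>
  Both sides are the contributions of the two corners at the ends of the common side of two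
  plaquettes, for the two orders of the operators. The 6j-symbols produced by \<open>shared_corner\<close> at the
  two corners coincide, so that applying it at one end for one order and at the other
  end for the other order gives the same double sum.
\<close>

lemma shared_side_exchange:
  fixes Lab :: "'j set"
  assumes Lab: "Lab \<subseteq> \<A>" "\<And>i. i \<in> Lab \<Longrightarrow> i\<^sup>\<star> \<in> Lab"
      "{l, m, j, j'', a, a', b0, b', c0, c', d0, d'} \<subseteq> Lab"
    and gen: "deg j'' + deg l \<notin> \<X>" "deg m - deg j'' \<notin> \<X>"
    and F: "finite F" "F \<subseteq> Lab" "{n. \<delta> n l (j\<^sup>\<star>) \<noteq> 0} \<subseteq> F"
    and G: "finite G" "G \<subseteq> Lab" "{k. \<delta> k m j \<noteq> 0} \<subseteq> G"
    and C: "finite C" "\<And>x y z. x \<in> Lab \<Longrightarrow> y \<in> Lab \<Longrightarrow> z \<in> Lab \<Longrightarrow> {1..\<delta> x y z} \<subseteq> C"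
  shows "(\<Sum>(n, c, d, \<alpha>, \<kappa>)\<in>F \<times> C \<times> C \<times> C \<times> C. \<d> n *
        (\<N> n l j (a\<^sup>\<star>) (d0\<^sup>\<star>) (a'\<^sup>\<star>) \<alpha> Cv c Aa * \<N> b' l b0 (j\<^sup>\<star>) c0 (n\<^sup>\<star>) Ab Cw d \<alpha>)
      * (\<N> (j''\<^sup>\<star>) m (n\<^sup>\<star>) (c0\<^sup>\<star>) (b'\<^sup>\<star>) (c'\<^sup>\<star>) \<kappa> d Cw2 Bc * \<N> d' m d0 n a' j'' Bd c Cv2 \<kappa>))
    = (\<Sum>(k, d, c, \<kappa>, \<alpha>)\<in>G \<times> C \<times> C \<times> C \<times> C. \<d> k *
        (\<N> k m (j\<^sup>\<star>) (c0\<^sup>\<star>) (b0\<^sup>\<star>) (c'\<^sup>\<star>) \<kappa> Cw d Bc * \<N> d' m d0 j a (k\<^sup>\<star>) Bd Cv c \<kappa>)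
      * (\<N> j'' l (k\<^sup>\<star>) (a\<^sup>\<star>) (d'\<^sup>\<star>) (a'\<^sup>\<star>) \<alpha> c Cv2 Aa * \<N> b' l b0 k c' (j''\<^sup>\<star>) Ab d Cw2 \<alpha>))"
proof -
  have inL: "l \<in> Lab" "m \<in> Lab" "j \<in> Lab" "j'' \<in> Lab" "a \<in> Lab" "a' \<in> Lab" "b0 \<in> Lab" "b' \<in> Lab"
    "c0 \<in> Lab" "c' \<in> Lab" "d0 \<in> Lab" "d' \<in> Lab"
    using Lab(3) by auto
  have inA: "i \<in> \<A>" if "i \<in> Lab" for i using Lab(1) that by blast
  note LA = inL[THEN inA]
  have FL: "n \<in> Lab" "n \<in> \<A>" if "n \<in> F" for n using F(2) Lab(1) that by blast+
  have GL: "k \<in> Lab" "k \<in> \<A>" if "k \<in> G" for k using G(2) Lab(1) that by blast+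
  have inj: "inj_on (dual L) S" if "S \<subseteq> \<A>" for S
    by (rule inj_on_inverseI[where g = "dual L"]) (use that dual_dual in blast)
  define t where "t = (\<lambda>(n, \<alpha>, \<kappa>) (k, \<kappa>', \<alpha>'). \<N> (l\<^sup>\<star>) (j''\<^sup>\<star>) k m (j\<^sup>\<star>) (n\<^sup>\<star>) \<alpha>' \<kappa>' \<alpha> \<kappa>)"
  define x where "x = (\<lambda>(k, \<kappa>', \<alpha>'). \<Sum>c\<in>C. \<N> d' m d0 j a (k\<^sup>\<star>) Bd Cv c \<kappa>'
      * \<N> j'' l (k\<^sup>\<star>) (a\<^sup>\<star>) (d'\<^sup>\<star>) (a'\<^sup>\<star>) \<alpha>' c Cv2 Aa)"
  define y where "y = (\<lambda>(n, \<alpha>, \<kappa>). \<Sum>d\<in>C. \<N> b' l b0 (j\<^sup>\<star>) c0 (n\<^sup>\<star>) Ab Cw d \<alpha>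
      * \<N> (j''\<^sup>\<star>) m (n\<^sup>\<star>) (c0\<^sup>\<star>) (b'\<^sup>\<star>) (c'\<^sup>\<star>) \<kappa> d Cw2 Bc)"
  have H1: "(\<Sum>c\<in>C. \<N> n l j (a\<^sup>\<star>) (d0\<^sup>\<star>) (a'\<^sup>\<star>) \<alpha> Cv c Aa * \<N> d' m d0 n a' j'' Bd c Cv2 \<kappa>)
      = (\<Sum>w\<in>G \<times> C \<times> C. \<d> (fst w) * t (n, \<alpha>, \<kappa>) w * x w)" if n: "n \<in> F" for n \<alpha> \<kappa>
  proof -
    have "(\<Sum>c\<in>C. \<N> n l j (a\<^sup>\<star>) (d0\<^sup>\<star>) (a'\<^sup>\<star>) \<alpha> Cv c Aa * \<N> d' m d0 n a' j'' Bd c Cv2 \<kappa>)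
      = (\<Sum>(u, \<kappa>', \<alpha>', c)\<in>dual L ` G \<times> C \<times> C \<times> C. \<d> u * \<N> (m\<^sup>\<star>) j'' n l j u \<kappa> \<alpha> \<kappa>' \<alpha>'
          * (\<N> d' m d0 j a u Bd Cv c \<kappa>' * \<N> j'' l u (a\<^sup>\<star>) (d'\<^sup>\<star>) (a'\<^sup>\<star>) \<alpha>' c Cv2 Aa))"
    proof (rule shared_corner)
      show "{l, m, j, n, j'', a, a', d0, d'} \<subseteq> \<A>" using LA FL[OF n] by auto
      show "{1..\<delta> (d0\<^sup>\<star>) a' (n\<^sup>\<star>)} \<subseteq> C" by (intro C(2) Lab(2) inL FL[OF n])
      show "{u. \<delta> j'' l (u\<^sup>\<star>) \<noteq> 0 \<and> \<delta> (m\<^sup>\<star>) u (j\<^sup>\<star>) \<noteq> 0} \<subseteq> dual L ` G"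
      proof (intro subsetI, elim CollectE conjE)
        fix u assume u: "\<delta> (m\<^sup>\<star>) u (j\<^sup>\<star>) \<noteq> 0"
        then have uA: "u \<in> \<A>" using mult_labels by blast
        have "\<delta> (m\<^sup>\<star>) u (j\<^sup>\<star>) = \<delta> (u\<^sup>\<star>) m j"
          using mult_dual[of "m\<^sup>\<star>" u "j\<^sup>\<star>"] mult_rotate[of j "u\<^sup>\<star>" m] LA uA
          by (simp add: dual_closed dual_dual)
        then have "u\<^sup>\<star> \<in> G" using u G(3) by auto
        then show "u \<in> dual L ` G" using dual_dual[OF uA] by (metis imageI)
      qed
      fix u assume "u \<in> dual L ` G"
      then have u: "u \<in> Lab" using GL(1) Lab(2) by auto
      show "{1..\<delta> j'' l (u\<^sup>\<star>)} \<subseteq> C \<and> {1..\<delta> (m\<^sup>\<star>) u (j\<^sup>\<star>)} \<subseteq> C \<and> {1..\<delta> u (a\<^sup>\<star>) d'} \<subseteq> C"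
        by (intro conjI C(2) Lab(2) inL u)
    qed (use gen C G in auto)
    also have "\<dots> = (\<Sum>u\<in>dual L ` G. \<Sum>\<kappa>'\<in>C. \<Sum>\<alpha>'\<in>C. \<Sum>c\<in>C. \<d> u * \<N> (m\<^sup>\<star>) j'' n l j u \<kappa> \<alpha> \<kappa>' \<alpha>'
          * (\<N> d' m d0 j a u Bd Cv c \<kappa>' * \<N> j'' l u (a\<^sup>\<star>) (d'\<^sup>\<star>) (a'\<^sup>\<star>) \<alpha>' c Cv2 Aa))"
      by (simp add: sum.cartesian_product)
    also have "\<dots> = (\<Sum>k\<in>G. \<Sum>\<kappa>'\<in>C. \<Sum>\<alpha>'\<in>C. \<Sum>c\<in>C. \<d> (k\<^sup>\<star>) * \<N> (m\<^sup>\<star>) j'' n l j (k\<^sup>\<star>) \<kappa> \<alpha> \<kappa>' \<alpha>'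
          * (\<N> d' m d0 j a (k\<^sup>\<star>) Bd Cv c \<kappa>' * \<N> j'' l (k\<^sup>\<star>) (a\<^sup>\<star>) (d'\<^sup>\<star>) (a'\<^sup>\<star>) \<alpha>' c Cv2 Aa))"
      using GL by (subst sum.reindex[OF inj]) auto
    also have "\<dots> = (\<Sum>k\<in>G. \<Sum>\<kappa>'\<in>C. \<Sum>\<alpha>'\<in>C. \<d> k * t (n, \<alpha>, \<kappa>) (k, \<kappa>', \<alpha>') * x (k, \<kappa>', \<alpha>'))"
    proof (intro sum.cong refl)
      fix k \<kappa>' \<alpha>' assume k: "k \<in> G"
      have "\<N> (m\<^sup>\<star>) j'' n l j (k\<^sup>\<star>) \<kappa> \<alpha> \<kappa>' \<alpha>' = t (n, \<alpha>, \<kappa>) (k, \<kappa>', \<alpha>')"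
        unfolding t_def prod.case using LA FL[OF n] GL[OF k]
        by (subst sixj_sym_exchange) (auto simp: dual_closed dual_dual)
      then show "(\<Sum>c\<in>C. \<d> (k\<^sup>\<star>) * \<N> (m\<^sup>\<star>) j'' n l j (k\<^sup>\<star>) \<kappa> \<alpha> \<kappa>' \<alpha>'
          * (\<N> d' m d0 j a (k\<^sup>\<star>) Bd Cv c \<kappa>' * \<N> j'' l (k\<^sup>\<star>) (a\<^sup>\<star>) (d'\<^sup>\<star>) (a'\<^sup>\<star>) \<alpha>' c Cv2 Aa))
        = \<d> k * t (n, \<alpha>, \<kappa>) (k, \<kappa>', \<alpha>') * x (k, \<kappa>', \<alpha>')"
        by (simp add: x_def sum_distrib_left qdim_dual[OF GL(2)[OF k]])
    qed
    finally show ?thesis by (simp add: sum.cartesian_product case_prod_unfold)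
  qed
  have H2: "(\<Sum>d\<in>C. \<N> k m (j\<^sup>\<star>) (c0\<^sup>\<star>) (b0\<^sup>\<star>) (c'\<^sup>\<star>) \<kappa>' Cw d Bc * \<N> b' l b0 k c' (j''\<^sup>\<star>) Ab d Cw2 \<alpha>')
      = (\<Sum>z\<in>F \<times> C \<times> C. \<d> (fst z) * t z (k, \<kappa>', \<alpha>') * y z)" if k: "k \<in> G" for k \<kappa>' \<alpha>'
  proof -
    have "(\<Sum>d\<in>C. \<N> k m (j\<^sup>\<star>) (c0\<^sup>\<star>) (b0\<^sup>\<star>) (c'\<^sup>\<star>) \<kappa>' Cw d Bc * \<N> b' l b0 k c' (j''\<^sup>\<star>) Ab d Cw2 \<alpha>')
      = (\<Sum>(v, \<alpha>, \<kappa>, d)\<in>dual L ` F \<times> C \<times> C \<times> C. \<d> v * \<N> (l\<^sup>\<star>) (j''\<^sup>\<star>) k m (j\<^sup>\<star>) v \<alpha>' \<kappa>' \<alpha> \<kappa>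
          * (\<N> b' l b0 (j\<^sup>\<star>) c0 v Ab Cw d \<alpha> * \<N> (j''\<^sup>\<star>) m v (c0\<^sup>\<star>) (b'\<^sup>\<star>) (c'\<^sup>\<star>) \<kappa> d Cw2 Bc))"
    proof (rule shared_corner)
      show "{m, l, j\<^sup>\<star>, k, j''\<^sup>\<star>, c0, c', b0, b'} \<subseteq> \<A>" using LA GL[OF k] dual_closed by auto
      show "deg (j''\<^sup>\<star>) + deg m \<notin> \<X>" using gen(2) LA by (simp add: deg_dual)
      show "{1..\<delta> (b0\<^sup>\<star>) c' (k\<^sup>\<star>)} \<subseteq> C" by (intro C(2) Lab(2) inL GL[OF k])
      show "{v. \<delta> (j''\<^sup>\<star>) m (v\<^sup>\<star>) \<noteq> 0 \<and> \<delta> (l\<^sup>\<star>) v ((j\<^sup>\<star>)\<^sup>\<star>) \<noteq> 0} \<subseteq> dual L ` F"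
      proof (intro subsetI, elim CollectE conjE)
        fix v assume v: "\<delta> (l\<^sup>\<star>) v ((j\<^sup>\<star>)\<^sup>\<star>) \<noteq> 0"
        then have vA: "v \<in> \<A>" using mult_labels by blast
        have "\<delta> (l\<^sup>\<star>) v ((j\<^sup>\<star>)\<^sup>\<star>) = \<delta> (v\<^sup>\<star>) l (j\<^sup>\<star>)"
          using mult_dual[of "l\<^sup>\<star>" v j] mult_rotate[of "j\<^sup>\<star>" "v\<^sup>\<star>" l] LA vA
          by (simp add: dual_closed dual_dual)
        then have "v\<^sup>\<star> \<in> F" using v F(3) by auto
        then show "v \<in> dual L ` F" using dual_dual[OF vA] by (metis imageI)
      qed
      fix v assume "v \<in> dual L ` F"
      then have v: "v \<in> Lab" using FL(1) Lab(2) by auto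
      show "{1..\<delta> (j''\<^sup>\<star>) m (v\<^sup>\<star>)} \<subseteq> C \<and> {1..\<delta> (l\<^sup>\<star>) v ((j\<^sup>\<star>)\<^sup>\<star>)} \<subseteq> C \<and> {1..\<delta> v (c0\<^sup>\<star>) b'} \<subseteq> C"
        by (intro conjI C(2) Lab(2) inL v)
    qed (use C F in auto)
    also have "\<dots> = (\<Sum>v\<in>dual L ` F. \<Sum>\<alpha>\<in>C. \<Sum>\<kappa>\<in>C. \<Sum>d\<in>C. \<d> v * \<N> (l\<^sup>\<star>) (j''\<^sup>\<star>) k m (j\<^sup>\<star>) v \<alpha>' \<kappa>' \<alpha> \<kappa>
          * (\<N> b' l b0 (j\<^sup>\<star>) c0 v Ab Cw d \<alpha> * \<N> (j''\<^sup>\<star>) m v (c0\<^sup>\<star>) (b'\<^sup>\<star>) (c'\<^sup>\<star>) \<kappa> d Cw2 Bc))"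
      by (simp add: sum.cartesian_product)
    also have "\<dots> = (\<Sum>n\<in>F. \<Sum>\<alpha>\<in>C. \<Sum>\<kappa>\<in>C. \<Sum>d\<in>C. \<d> (n\<^sup>\<star>) * \<N> (l\<^sup>\<star>) (j''\<^sup>\<star>) k m (j\<^sup>\<star>) (n\<^sup>\<star>) \<alpha>' \<kappa>' \<alpha> \<kappa>
          * (\<N> b' l b0 (j\<^sup>\<star>) c0 (n\<^sup>\<star>) Ab Cw d \<alpha>
            * \<N> (j''\<^sup>\<star>) m (n\<^sup>\<star>) (c0\<^sup>\<star>) (b'\<^sup>\<star>) (c'\<^sup>\<star>) \<kappa> d Cw2 Bc))"
      using FL by (subst sum.reindex[OF inj]) auto
    also have "\<dots> = (\<Sum>n\<in>F. \<Sum>\<alpha>\<in>C. \<Sum>\<kappa>\<in>C. \<d> n * t (n, \<alpha>, \<kappa>) (k, \<kappa>', \<alpha>') * y (n, \<alpha>, \<kappa>))"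
      using FL by (intro sum.cong refl) (simp add: t_def y_def sum_distrib_left qdim_dual)
    finally show ?thesis by (simp add: sum.cartesian_product case_prod_unfold)
  qed
  have "(\<Sum>(n, c, d, \<alpha>, \<kappa>)\<in>F \<times> C \<times> C \<times> C \<times> C. \<d> n *
        (\<N> n l j (a\<^sup>\<star>) (d0\<^sup>\<star>) (a'\<^sup>\<star>) \<alpha> Cv c Aa * \<N> b' l b0 (j\<^sup>\<star>) c0 (n\<^sup>\<star>) Ab Cw d \<alpha>)
      * (\<N> (j''\<^sup>\<star>) m (n\<^sup>\<star>) (c0\<^sup>\<star>) (b'\<^sup>\<star>) (c'\<^sup>\<star>) \<kappa> d Cw2 Bc * \<N> d' m d0 n a' j'' Bd c Cv2 \<kappa>))
    = (\<Sum>(n, \<alpha>, \<kappa>)\<in>F \<times> C \<times> C. \<d> n *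
        ((\<Sum>c\<in>C. \<N> n l j (a\<^sup>\<star>) (d0\<^sup>\<star>) (a'\<^sup>\<star>) \<alpha> Cv c Aa * \<N> d' m d0 n a' j'' Bd c Cv2 \<kappa>)
          * y (n, \<alpha>, \<kappa>)))"
    unfolding sum_Times5 y_def prod.case sum_product
    by (intro sum.cong refl) (auto simp: sum_distrib_left mult_ac intro!: sum.cong)
  also have "\<dots> = (\<Sum>z\<in>F \<times> C \<times> C. \<d> (fst z) * ((\<Sum>w\<in>G \<times> C \<times> C. \<d> (fst w) * t z w * x w) * y z))"
    by (intro sum.cong refl) (auto simp: H1)
  also have "\<dots> = (\<Sum>z\<in>F \<times> C \<times> C. \<Sum>w\<in>G \<times> C \<times> C. \<d> (fst w) * x w * (\<d> (fst z) * t z w * y z))"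
    by (simp add: sum_distrib_left sum_distrib_right mult_ac)
  also have "\<dots> = (\<Sum>w\<in>G \<times> C \<times> C. \<Sum>z\<in>F \<times> C \<times> C. \<d> (fst w) * x w * (\<d> (fst z) * t z w * y z))"
    by (rule sum.swap)
  also have "\<dots> = (\<Sum>w\<in>G \<times> C \<times> C. \<d> (fst w) * ((\<Sum>z\<in>F \<times> C \<times> C. \<d> (fst z) * t z w * y z) * x w))"
    by (intro sum.cong refl) (simp add: sum_distrib_left sum_distrib_right mult_ac)
  also have "\<dots> = (\<Sum>(k, \<kappa>, \<alpha>)\<in>G \<times> C \<times> C. \<d> k *
        ((\<Sum>d\<in>C. \<N> k m (j\<^sup>\<star>) (c0\<^sup>\<star>) (b0\<^sup>\<star>) (c'\<^sup>\<star>) \<kappa> Cw d Bc * \<N> b' l b0 k c' (j''\<^sup>\<star>) Ab d Cw2 \<alpha>)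
          * x (k, \<kappa>, \<alpha>)))"
    by (intro sum.cong refl) (auto simp: H2)
  also have "\<dots> = (\<Sum>(k, d, c, \<kappa>, \<alpha>)\<in>G \<times> C \<times> C \<times> C \<times> C. \<d> k *
        (\<N> k m (j\<^sup>\<star>) (c0\<^sup>\<star>) (b0\<^sup>\<star>) (c'\<^sup>\<star>) \<kappa> Cw d Bc * \<N> d' m d0 j a (k\<^sup>\<star>) Bd Cv c \<kappa>)
      * (\<N> j'' l (k\<^sup>\<star>) (a\<^sup>\<star>) (d'\<^sup>\<star>) (a'\<^sup>\<star>) \<alpha> c Cv2 Aa * \<N> b' l b0 k c' (j''\<^sup>\<star>) Ab d Cw2 \<alpha>))"
    unfolding sum_Times5 x_def prod.case sum_product
    by (intro sum.cong refl) (auto simp: sum_distrib_left mult_ac intro!: sum.cong)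
  finally show ?thesis .
qed

end


lemma sum_factor_rearrange:
  fixes f g :: "'a \<Rightarrow> 'b \<Rightarrow> 'c \<Rightarrow> 'd \<Rightarrow> 'e \<Rightarrow> 'r::comm_semiring_0"
  shows "(\<Sum>(n, c, d)\<in>F \<times> C \<times> D. (\<Sum>A\<in>PA. \<Sum>\<alpha>\<in>X. f n c d A \<alpha> * u A) * (\<Sum>B\<in>PB. \<Sum>\<kappa>\<in>Y. g n c d B \<kappa> * v B))
    = (\<Sum>A\<in>PA. \<Sum>B\<in>PB. u A * v B * (\<Sum>(n, c, d, \<alpha>, \<kappa>)\<in>F \<times> C \<times> D \<times> X \<times> Y. f n c d A \<alpha> * g n c d B \<kappa>))"
proof -
  have "(\<Sum>(n, c, d)\<in>F \<times> C \<times> D. (\<Sum>A\<in>PA. \<Sum>\<alpha>\<in>X. f n c d A \<alpha> * u A) * (\<Sum>B\<in>PB. \<Sum>\<kappa>\<in>Y. g n c d B \<kappa> * v B))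
    = (\<Sum>z\<in>F \<times> C \<times> D. \<Sum>A\<in>PA. \<Sum>B\<in>PB. u A * v B * (case z of (n, c, d) \<Rightarrow> \<Sum>\<alpha>\<in>X. \<Sum>\<kappa>\<in>Y. f n c d A \<alpha> * g n c d B \<kappa>))"
  proof (intro sum.cong refl, clarify)
    fix n c d
    have "(\<Sum>A\<in>PA. \<Sum>\<alpha>\<in>X. f n c d A \<alpha> * u A) * (\<Sum>B\<in>PB. \<Sum>\<kappa>\<in>Y. g n c d B \<kappa> * v B)
      = (\<Sum>A\<in>PA. (\<Sum>\<alpha>\<in>X. f n c d A \<alpha>) * u A) * (\<Sum>B\<in>PB. (\<Sum>\<kappa>\<in>Y. g n c d B \<kappa>) * v B)"
      by (simp only: sum_distrib_right)
    also have "\<dots> = (\<Sum>A\<in>PA. \<Sum>B\<in>PB. u A * v B * ((\<Sum>\<alpha>\<in>X. f n c d A \<alpha>) * (\<Sum>\<kappa>\<in>Y. g n c d B \<kappa>)))"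
      unfolding sum_product[of "\<lambda>A. (\<Sum>\<alpha>\<in>X. f n c d A \<alpha>) * u A"] by (simp only: mult_ac)
    also have "\<dots> = (\<Sum>A\<in>PA. \<Sum>B\<in>PB. u A * v B * (\<Sum>\<alpha>\<in>X. \<Sum>\<kappa>\<in>Y. f n c d A \<alpha> * g n c d B \<kappa>))"
      by (simp only: sum_product)
    finally show "(\<Sum>A\<in>PA. \<Sum>\<alpha>\<in>X. f n c d A \<alpha> * u A) * (\<Sum>B\<in>PB. \<Sum>\<kappa>\<in>Y. g n c d B \<kappa> * v B)
      = (\<Sum>A\<in>PA. \<Sum>B\<in>PB. u A * v B * (\<Sum>\<alpha>\<in>X. \<Sum>\<kappa>\<in>Y. f n c d A \<alpha> * g n c d B \<kappa>))" .
  qed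
  also have "\<dots> = (\<Sum>A\<in>PA. \<Sum>z\<in>F \<times> C \<times> D. \<Sum>B\<in>PB. u A * v B * (case z of (n, c, d) \<Rightarrow> \<Sum>\<alpha>\<in>X. \<Sum>\<kappa>\<in>Y. f n c d A \<alpha> * g n c d B \<kappa>))"
    by (rule sum.swap)
  also have "\<dots> = (\<Sum>A\<in>PA. \<Sum>B\<in>PB. \<Sum>z\<in>F \<times> C \<times> D. u A * v B * (case z of (n, c, d) \<Rightarrow> \<Sum>\<alpha>\<in>X. \<Sum>\<kappa>\<in>Y. f n c d A \<alpha> * g n c d B \<kappa>))"
    by (intro sum.cong refl sum.swap)
  also have "\<dots> = (\<Sum>A\<in>PA. \<Sum>B\<in>PB. u A * v B * (\<Sum>(n, c, d)\<in>F \<times> C \<times> D. \<Sum>\<alpha>\<in>X. \<Sum>\<kappa>\<in>Y. f n c d A \<alpha> * g n c d B \<kappa>))"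
    by (simp only: sum_distrib_left)
  finally show ?thesis by (simp add: sum.cartesian_product[symmetric])
qed

context LW_surface
begin

text \<open>
  Away from the plaquette \<open>q\<close>, the factor of the operator for \<open>p\<close> at a corner is not affected by
  the operator for \<open>q\<close>, whichever of them is applied first.
\<close>

lemma far_corner:
  assumes e: "e \<in> sides T p" and pq: "p \<noteq> q" and far: "e \<noteq> (p, q)" "next_side T e \<noteq> (p, q)"
    and agree: "agree_off (boundary_edges T q) (corners T q) s r"
  shows "corner_coeff l r t A e = corner_coeff l s t A e" "corner_coeff l t r A e = corner_coeff l t s A e"
proof -
  obtain x y where x: "e = (p, x)" "ccw T p x y" "next_side T e = (p, y)" "leg T e = (y, x)"
    using e by (rule side_cases)
  have xy: "x \<noteq> q" "y \<noteq> q" using far x by auto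
  have "e \<notin> boundary_edges T q" "next_side T e \<notin> boundary_edges T q" "leg T e \<notin> boundary_edges T q"
    unfolding boundary_edges_iff using x xy pq by auto
  moreover have "target T e \<notin> corners T q" "target T e \<in> T"
    using target_vertices[OF x(2)] x(1) xy pq unfolding corners_iff by auto
  ultimately have "fst r e = fst s e" "fst r (next_side T e) = fst s (next_side T e)"
    "fst r (leg T e) = fst s (leg T e)" "snd r (target T e) = snd s (target T e)"
    using agree sides_oriented[OF e] sides_oriented[OF next_side_in[OF e]] leg_oriented[OF e]
    unfolding agree_off_def by auto
  then show "corner_coeff l r t A e = corner_coeff l s t A e" "corner_coeff l t r A e = corner_coeff l t s A e"
    by (simp_all add: corner_coeff_def)
qed

text \<open>
  Applied to \<open>s\<close>, the operator for \<open>p\<close> has to produce the labels of \<open>t\<close> on \<open>p\<close>, except on the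
  side shared with \<open>q\<close> and at its two ends, where the operator for \<open>q\<close> acts later. The ends of the
  side \<open>(p, q)\<close> are the corner at which it ends and the one at which the preceding side ends.
\<close>

lemma update_agree_off_target:
  assumes t: "t \<in> prestates \<Phi>'" and pq: "p \<noteq> q"
    and agree: "agree_off (boundary_edges T p \<union> boundary_edges T q) (corners T p \<union> corners T q) s t"
    and y1: "\<And>e. e \<in> sides T p \<Longrightarrow> e \<noteq> (p, q) \<Longrightarrow> fst (y e) = fst t e"
    and y2: "\<And>e. e \<in> sides T p \<Longrightarrow> e \<noteq> (p, q) \<Longrightarrow> next_side T e \<noteq> (p, q) \<Longrightarrow> snd (y e) = snd t (target T e)"
  shows "agree_off (boundary_edges T q) (corners T q) (update p s y) t"
  unfolding agree_off_def
proof (intro conjI ballI)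
  fix e assume e: "e \<in> oriented_edges T - boundary_edges T q"
  then have eq: "fst e \<noteq> q" "snd e \<noteq> q" using boundary_edges_iff[of e q] by blast+
  consider "e \<in> sides T p" | "prod.swap e \<in> sides T p" | "e \<notin> boundary_edges T p"
    by (auto simp: swap_image_iff)
  then show "fst (update p s y) e = fst t e"
  proof cases
    case 1
    have "e \<noteq> (p, q)" using eq by auto
    then show ?thesis using y1[OF 1] 1 by simp
  next
    case 2
    have "fst (update p s y) e = (fst (y (prod.swap e)))\<^sup>\<star>" using update_side(2)[OF 2] by simp
    also have "\<dots> = (fst t (prod.swap e))\<^sup>\<star>" using y1[OF 2] eq by (cases e) auto
    also have "\<dots> = fst t e" using prestate_label(3)[OF t sides_oriented[OF 2]] by simp
    finally show ?thesis .
  next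
    case 3
    then show ?thesis using agree e unfolding agree_off_def by auto
  qed
next
  fix v assume v: "v \<in> T - corners T q"
  show "snd (update p s y) v = snd t v"
  proof (cases "v \<in> corners T p")
    case True
    then obtain e where e: "e \<in> sides T p" "v = target T e" unfolding corners_def by blast
    obtain x z where x: "e = (p, x)" "ccw T p x z" "next_side T e = (p, z)" using e(1) by (rule side_cases)
    have "x \<noteq> q" "z \<noteq> q" using v target_vertices[OF x(2)] e(2) x(1) by (auto simp: corners_iff)
    then show ?thesis using y2[OF e(1)] x e by simp
  next
    case False
    then show ?thesis using agree v unfolding agree_off_def by auto
  qed
qed

lemma agree_off_mono: "agree_off E V s t \<Longrightarrow> E \<subseteq> E' \<Longrightarrow> V \<subseteq> V' \<Longrightarrow> agree_off E' V' s t"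
  unfolding agree_off_def by blast

lemma agree_off_two:
  assumes "agree_off (boundary_edges T p) (corners T p) s r" "agree_off (boundary_edges T q) (corners T q) r t"
  shows "agree_off (boundary_edges T p \<union> boundary_edges T q) (corners T p \<union> corners T q) s t"
  by (rule agree_off_trans[OF agree_off_mono[OF assms(1)] agree_off_mono[OF assms(2)]]) auto

text \<open>
  Here \<open>Y\<close> need only cover the intermediate states from which the operator for \<open>q\<close> can reach \<open>t\<close>,
  and by \<open>update_agree_off_target\<close> every element of \<open>Y\<close> gives a prestate that agrees with \<open>t\<close> away from \<open>q\<close>.
\<close>

lemma sum_two_plaquettes:
  assumes s: "s \<in> states \<Phi>" and t: "t \<in> states (shift q (deg m) (shift p (deg l) \<Phi>))" and pq: "p \<noteq> q"
    and l: "l \<in> \<A>" and \<Phi>: "admissible \<Phi>" "admissible (shift p (deg l) \<Phi>)"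
    and agree: "agree_off (boundary_edges T p \<union> boundary_edges T q) (corners T p \<union> corners T q) s t"
    and Y: "finite Y" "Y \<subseteq> extensional (sides T p)"
    and y1: "\<And>y e. y \<in> Y \<Longrightarrow> e \<in> sides T p \<Longrightarrow> e \<noteq> (p, q) \<Longrightarrow> fst (y e) = fst t e"
    and y0: "\<And>y. y \<in> Y \<Longrightarrow> (p, q) \<in> oriented_edges T \<Longrightarrow> fst (y (p, q)) \<in> I (\<Phi> (p, q) - deg l)"
    and y2: "\<And>y e. y \<in> Y \<Longrightarrow> e \<in> sides T p \<Longrightarrow> e \<noteq> (p, q) \<Longrightarrow> next_side T e \<noteq> (p, q) \<Longrightarrow>
      snd (y e) = snd t (target T e)"
    and supp: "\<And>r. plaq_coeff \<Phi> p l s r \<noteq> 0 \<Longrightarrow> agree_off (boundary_edges T q) (corners T q) r t \<Longrightarrow>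
      local_data p r \<in> Y"
  shows "(\<Sum>r | plaq_coeff \<Phi> p l s r \<noteq> 0. plaq_coeff \<Phi> p l s r * plaq_coeff (shift p (deg l) \<Phi>) q m r t)
    = (\<Sum>y\<in>Y. amplitude p l s (update p s y) * amplitude q m (update p s y) t)"
proof -
  have "(\<Sum>r | plaq_coeff \<Phi> p l s r \<noteq> 0. plaq_coeff \<Phi> p l s r * plaq_coeff (shift p (deg l) \<Phi>) q m r t)
    = (\<Sum>y\<in>Y. amplitude p l s (update p s y) * plaq_coeff (shift p (deg l) \<Phi>) q m (update p s y) t)"
  proof (rule sum_over_updates[OF s admissible_coloring[OF \<Phi>(1)] l \<Phi>(2) Y])
    fix y e assume y: "y \<in> Y" and e: "e \<in> sides T p"
    show "fst (y e) \<in> I (\<Phi> e - deg l)"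
    proof (cases "e = (p, q)")
      case True
      then show ?thesis using y0[OF y] sides_oriented[OF e] by simp
    next
      case False
      have "fst e = p" using e by (simp add: sides_def)
      then have "e \<notin> boundary_edges T q" unfolding boundary_edges_iff using pq False by (cases e) auto
      then show ?thesis
        using y1[OF y e False] prestate_label(4)[OF states_prestates[OF t] sides_oriented[OF e]] e by simp
    qed
  next
    fix r assume "plaq_coeff \<Phi> p l s r \<noteq> 0" "plaq_coeff (shift p (deg l) \<Phi>) q m r t \<noteq> 0"
    then show "local_data p r \<in> Y" using supp plaq_coeff_nonzero(2) by blast
  qed
  also have "\<dots> = (\<Sum>y\<in>Y. amplitude p l s (update p s y) * amplitude q m (update p s y) t)"
  proof (intro sum.cong refl arg_cong2[where f = "(*)"])
    fix y assume y: "y \<in> Y"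
    have "agree_off (boundary_edges T q) (corners T q) (update p s y) t"
      by (rule update_agree_off_target[OF states_prestates[OF t] pq agree y1[OF y] y2[OF y]])
    then show "plaq_coeff (shift p (deg l) \<Phi>) q m (update p s y) t = amplitude q m (update p s y) t"
      using t by (simp add: plaq_coeff_alt)
  qed
  finally show ?thesis .
qed

lemma sides_other:
  assumes "e \<in> sides T p" "p \<noteq> q" "e \<noteq> (p, q)"
  shows "e \<notin> boundary_edges T q"
  using assms unfolding boundary_edges_iff by (cases e) (auto simp: sides_def)

text \<open>
  There is only one intermediate state, and the value is symmetric in the two plaquettes.
\<close>

lemma nonadjacent_sum:
  assumes s: "s \<in> states \<Phi>" and t: "t \<in> states (shift q (deg m) (shift p (deg l) \<Phi>))" and pq: "p \<noteq> q"
    and nonadj: "(p, q) \<notin> oriented_edges T"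
    and l: "l \<in> \<A>" and \<Phi>: "admissible \<Phi>" "admissible (shift p (deg l) \<Phi>)"
    and agree: "agree_off (boundary_edges T p \<union> boundary_edges T q) (corners T p \<union> corners T q) s t"
  shows "(\<Sum>r | plaq_coeff \<Phi> p l s r \<noteq> 0. plaq_coeff \<Phi> p l s r * plaq_coeff (shift p (deg l) \<Phi>) q m r t)
    = amplitude p l s t * amplitude q m s t"
proof -
  note t' = states_prestates[OF t]
  have nonadj': "(q, p) \<notin> oriented_edges T" using nonadj oriented_edges_swap_iff[of "(q, p)"] by simp
  have far: "e \<noteq> (p, q)" "next_side T e \<noteq> (p, q)" if "e \<in> sides T p" for e
    using nonadj sides_oriented[OF that] sides_oriented[OF next_side_in[OF that]] by auto
  have far': "e \<noteq> (q, p)" "next_side T e \<noteq> (q, p)" if "e \<in> sides T q" for e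
    using nonadj' sides_oriented[OF that] sides_oriented[OF next_side_in[OF that]] by auto
  have "(\<Sum>r | plaq_coeff \<Phi> p l s r \<noteq> 0. plaq_coeff \<Phi> p l s r * plaq_coeff (shift p (deg l) \<Phi>) q m r t)
    = (\<Sum>y\<in>{local_data p t}. amplitude p l s (update p s y) * amplitude q m (update p s y) t)"
  proof (rule sum_two_plaquettes[OF s t pq l \<Phi> agree])
    show "{local_data p t} \<subseteq> extensional (sides T p)" by (simp add: local_data_def)
    fix r assume r: "agree_off (boundary_edges T q) (corners T q) r t"
    have "fst r e = fst t e \<and> snd r (target T e) = snd t (target T e)" if e: "e \<in> sides T p" for e
    proof -
      obtain x z where x: "e = (p, x)" "ccw T p x z" "next_side T e = (p, z)" using e by (rule side_cases)
      have "target T e \<notin> corners T q" "target T e \<in> T"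
        using target_vertices[OF x(2)] x far[OF e] pq unfolding corners_iff by auto
      then show ?thesis using r sides_other[OF e pq far(1)[OF e]] sides_oriented[OF e]
        unfolding agree_off_def by auto
    qed
    then show "local_data p r \<in> {local_data p t}" by (simp add: local_data_def fun_eq_iff restrict_def)
  qed (use nonadj in \<open>auto simp: local_data_def\<close>)
  also have "\<dots> = amplitude p l s t * amplitude q m s t"
  proof -
    define r where "r = update p s (local_data p t)"
    have sr: "agree_off (boundary_edges T p) (corners T p) s r" unfolding r_def by (rule update_agree_off)
    have rt: "agree_off (boundary_edges T q) (corners T q) t r"
      unfolding r_def by (rule agree_off_sym[OF update_agree_off_target[OF t' pq agree]]) (auto simp: local_data_def)
    have "amplitude p l s r = amplitude p l s t"
      unfolding amplitude_def
    proof (intro sum.cong prod.cong PiE_cong refl)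
      show "{1..\<delta> (fst r e) l ((fst s e)\<^sup>\<star>)} = {1..\<delta> (fst t e) l ((fst s e)\<^sup>\<star>)}" if "e \<in> sides T p" for e
        using that by (simp add: r_def local_data_def)
      show "corner_coeff l s r A e = corner_coeff l s t A e" if "e \<in> sides T p" for A e
        using far_corner(2)[OF that pq far[OF that] rt] .
    qed
    moreover have "amplitude q m r t = amplitude q m s t"
      unfolding amplitude_def
    proof (intro sum.cong prod.cong PiE_cong refl)
      show "{1..\<delta> (fst t e) m ((fst r e)\<^sup>\<star>)} = {1..\<delta> (fst t e) m ((fst s e)\<^sup>\<star>)}" if "e \<in> sides T q" for e
        using sr sides_other[OF that pq[symmetric] far'(1)[OF that]] sides_oriented[OF that]
        unfolding agree_off_def by auto
      show "corner_coeff m r t A e = corner_coeff m s t A e" if "e \<in> sides T q" for A e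
        using far_corner(1)[OF that pq[symmetric] far'[OF that] sr] .
    qed
    ultimately show ?thesis by (simp add: r_def)
  qed
  finally show ?thesis .
qed



text \<open>
  Let \<open>pqx\<close> and \<open>qpy\<close> be the two triangles at the common edge of the triangulation. The intermediate
  state is free only in the label \<open>n\<close> of the side \<open>(p, q)\<close> and in the indices \<open>c\<close> and \<open>d\<close> at
  these triangles, and four corner factors involve them: for \<open>p\<close> those of \<open>(p, q)\<close> and of the preceding
  side \<open>(p, y)\<close>, for \<open>q\<close> those of \<open>(q, p)\<close> and \<open>(q, x)\<close>. The other factors depend on \<open>s\<close>
  and \<open>t\<close> alone. Of the multiplicity indices of sides, only \<open>\<alpha>\<close> and \<open>\<kappa>\<close> on the common side
  belong to the inner sum.
\<close>

lemma adjacent_sum: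
  assumes x: "ccw T p q x" and y: "ccw T q p y"
    and s: "s \<in> states \<Phi>" and t: "t \<in> states (shift q (deg m) (shift p (deg l) \<Phi>))"
    and l: "l \<in> \<A>" and \<Phi>: "admissible \<Phi>" "admissible (shift p (deg l) \<Phi>)"
    and agree: "agree_off (boundary_edges T p \<union> boundary_edges T q) (corners T p \<union> corners T q) s t"
    and F: "finite F" "F = {n. \<delta> n l ((fst s (p, q))\<^sup>\<star>) \<noteq> 0}"
    and Lab: "F \<subseteq> Lab" "fst s ` oriented_edges T \<subseteq> Lab" "fst t ` oriented_edges T \<subseteq> Lab" "{l, m} \<subseteq> Lab"
      "dual L ` Lab \<subseteq> Lab"
    and C: "finite C" "\<forall>i\<in>Lab. \<forall>j\<in>Lab. \<forall>k\<in>Lab. {1..\<delta> i j k} \<subseteq> C"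
  shows "(\<Sum>r | plaq_coeff \<Phi> p l s r \<noteq> 0. plaq_coeff \<Phi> p l s r * plaq_coeff (shift p (deg l) \<Phi>) q m r t)
    = (\<Sum>A\<in>PiE (sides T p - {(p, q)}) (\<lambda>_. C). \<Sum>B\<in>PiE (sides T q - {(q, p)}) (\<lambda>_. C).
        (\<Prod>e\<in>sides T p - {(p, q)} - {(p, y)}. corner_coeff l s t A e)
        * (\<Prod>e\<in>sides T q - {(q, p)} - {(q, x)}. corner_coeff m s t B e)
        * (\<Sum>(n, c, d, \<alpha>, \<kappa>)\<in>F \<times> C \<times> C \<times> C \<times> C.
            \<d> (fst t (p, y)) * \<d> (fst t (q, p)) * \<d> (fst t (q, x)) * (\<d> n *
            (\<N> n l (fst s (p, q)) ((fst s (p, x))\<^sup>\<star>) (fst s (x, q)) ((fst t (p, x))\<^sup>\<star>)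
               \<alpha> (snd s (target T (p, q))) c (A (p, x))
             * \<N> (fst t (p, y)) l (fst s (p, y)) ((fst s (p, q))\<^sup>\<star>) (fst s (q, y)) (n\<^sup>\<star>)
               (A (p, y)) (snd s (target T (q, p))) d \<alpha>)
            * (\<N> (fst t (q, p)) m (n\<^sup>\<star>) ((fst s (q, y))\<^sup>\<star>) ((fst t (p, y))\<^sup>\<star>) ((fst t (q, y))\<^sup>\<star>)
               \<kappa> d (snd t (target T (q, p))) (B (q, y))
             * \<N> (fst t (q, x)) m (fst s (q, x)) n (fst t (p, x)) ((fst t (q, p))\<^sup>\<star>)
               (B (q, x)) c (snd t (target T (p, q))) \<kappa>))))"
    (is "?lhs = ?rhs")
proof -
  note s' = states_prestates[OF s] and t' = states_prestates[OF t]
  let ?e0 = "(p, q)" and ?e1 = "(p, y)" and ?f0 = "(q, p)" and ?f1 = "(q, x)"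
  have ccw: "ccw T p y q" "ccw T q x p" using ccw_rotate x y by blast+
  have dist: "p \<noteq> q" "x \<noteq> p" "x \<noteq> q" "y \<noteq> p" "y \<noteq> q" using ccw_distinct[OF x] ccw_distinct[OF y] by auto
  have xy: "x \<noteq> y" using one_orientation[OF x] ccw(1) by blast
  have sides: "?e0 \<in> sides T p" "?e1 \<in> sides T p" "?f0 \<in> sides T q" "?f1 \<in> sides T q"
    using sideI x y ccw by blast+
  note nx = next_side_ccw[OF x] next_side_ccw[OF y] next_side_ccw[OF ccw(1)] next_side_ccw[OF ccw(2)]
  note lg = leg_ccw[OF x] leg_ccw[OF y] leg_ccw[OF ccw(1)] leg_ccw[OF ccw(2)]
  have px: "(p, x) \<in> sides T p" "(q, y) \<in> sides T q"
    using next_side_in[OF sides(1)] next_side_in[OF sides(3)] nx by simp_all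
  have tg: "target T ?f0 = target T ?e1" "target T ?f1 = target T ?e0"
    using target_rotate[OF y] target_rotate[OF x] by simp_all
  have nx_inj: "e = ?e1" if "e \<in> sides T p" "next_side T e = ?e0" for e
    using inj_onD[OF bij_betw_imp_inj_on[OF next_side_bij] _ that(1) sides(2)] that(2) nx by simp
  have nx_inj': "e = ?f1" if "e \<in> sides T q" "next_side T e = ?f0" for e
    using inj_onD[OF bij_betw_imp_inj_on[OF next_side_bij] _ that(1) sides(4)] that(2) nx by simp
  have Lab_dual: "i\<^sup>\<star> \<in> Lab" if "i \<in> Lab" for i using Lab(5) that by blast
  have C_range: "{1..\<delta> i j k} \<subseteq> C" if "i \<in> Lab" "j \<in> Lab" "k \<in> Lab" for i j k
    using C(2) that by blast
  have labs: "fst s e \<in> Lab" "fst t e \<in> Lab" if "e \<in> oriented_edges T" for e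
    using that Lab(2,3) by blast+
  have lm: "l \<in> Lab" "m \<in> Lab" using Lab(4) by auto
  define yy where "yy n c d = (\<lambda>e\<in>sides T p. if e = ?e0 then (n, c) else if e = ?e1 then (fst t e, d)
      else (fst t e, snd t (target T e)))" for n :: 'j and c d :: nat
  have yy1: "fst (yy n c d e) = fst t e" if "e \<in> sides T p" "e \<noteq> ?e0" for n c d e
    using that by (simp add: yy_def)
  have yy2: "snd (yy n c d e) = snd t (target T e)"
    if "e \<in> sides T p" "e \<noteq> ?e0" "next_side T e \<noteq> ?e0" for n c d e
  proof -
    have "e \<noteq> ?e1" using that(3) nx by auto
    then show ?thesis using that by (simp add: yy_def)
  qed
  define Y where "Y = (\<lambda>(n, c, d). yy n c d) ` (F \<times> C \<times> C)"
  have yy_inj: "inj_on (\<lambda>(n, c, d). yy n c d) (F \<times> C \<times> C)"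
  proof (rule inj_onI)
    fix a b assume eq: "(\<lambda>(n, c, d). yy n c d) a = (\<lambda>(n, c, d). yy n c d) b"
    obtain n c d n' c' d' where ab: "a = (n, c, d)" "b = (n', c', d')" by (cases a; cases b) auto
    have "yy n c d ?e0 = yy n' c' d' ?e0" "yy n c d ?e1 = yy n' c' d' ?e1" using eq ab by simp_all
    then show "a = b" using sides dist ab by (simp add: yy_def)
  qed

  have "?lhs = (\<Sum>z\<in>Y. amplitude p l s (update p s z) * amplitude q m (update p s z) t)"
  proof (rule sum_two_plaquettes[OF s t dist(1) l \<Phi> agree])
    show "finite Y" unfolding Y_def using F C by simp
    show "Y \<subseteq> extensional (sides T p)" by (auto simp: Y_def yy_def)
  next
    fix z e assume "z \<in> Y" and e: "e \<in> sides T p" "e \<noteq> ?e0"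
    then obtain n c d where z: "z = yy n c d" unfolding Y_def by auto
    show "fst (z e) = fst t e" unfolding z using yy1 e by blast
    show "snd (z e) = snd t (target T e)" if "next_side T e \<noteq> ?e0" unfolding z using yy2 e that by blast
  next
    fix z assume "z \<in> Y"
    then obtain n c d where z: "z = yy n c d" "n \<in> F" unfolding Y_def by auto
    show "fst (z ?e0) \<in> I (\<Phi> ?e0 - deg l)"
      using z sides(1) F(2) new_label_deg[OF s' sides(1), of n l] by (simp add: yy_def)
  next
    fix r assume r0: "plaq_coeff \<Phi> p l s r \<noteq> 0" and rt: "agree_off (boundary_edges T q) (corners T q) r t"
    note r = plaq_coeff_nonzero[OF r0]
    have rl: "fst r e = fst t e" if "e \<in> sides T p" "e \<noteq> ?e0" for e
      using rt sides_other[OF that(1) dist(1) that(2)] sides_oriented[OF that(1)] unfolding agree_off_def by auto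
    have rv: "snd r (target T e) = snd t (target T e)" if e: "e \<in> sides T p" "e \<noteq> ?e0" "e \<noteq> ?e1" for e
    proof -
      obtain u v where u: "e = (p, u)" "ccw T p u v" "next_side T e = (p, v)" using e(1) by (rule side_cases)
      have "u \<noteq> q" "v \<noteq> q" using u e nx_inj[OF e(1)] by auto
      then have "target T e \<notin> corners T q" "target T e \<in> T"
        using target_vertices[OF u(2)] u(1) dist(1) unfolding corners_iff by auto
      then show ?thesis using rt unfolding agree_off_def by auto
    qed
    have rF: "fst r ?e0 \<in> F" using amplitude_mult_nonzero[OF r(3) sides(1)] by (simp add: F(2))
    have rLab: "fst r e \<in> Lab" if "e \<in> sides T p" for e
      using that rl rF Lab(1) labs(2)[OF sides_oriented] by (cases "e = ?e0") auto
    have rC: "snd r (target T e) \<in> C" if e: "e \<in> sides T p" for e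
    proof -
      have "{1..\<delta> (fst s (leg T e)) (fst r (next_side T e)) ((fst r e)\<^sup>\<star>)} \<subseteq> C"
        by (intro C_range Lab_dual rLab e next_side_in[OF e] labs leg_oriented[OF e])
      then show ?thesis
        using amplitude_vertex_range(3,4)[OF r(3) e s' states_prestates[OF r(1)] agree_off_leg[OF r(2) e]]
          vertex_mult_state[OF states_prestates[OF r(1)] e] agree_off_leg[OF r(2) e] by auto
    qed
    have "local_data p r = yy (fst r ?e0) (snd r (target T ?e0)) (snd r (target T ?e1))"
      using rl rv by (auto simp: local_data_def yy_def fun_eq_iff prod_eq_iff)
    then show "local_data p r \<in> Y"
      unfolding Y_def using rF rC sides by (intro image_eqI[where x = "(fst r ?e0, snd r (target T ?e0), snd r (target T ?e1))"]) auto
  qed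
  also have "\<dots> = (\<Sum>(n, c, d)\<in>F \<times> C \<times> C. amplitude p l s (update p s (yy n c d)) * amplitude q m (update p s (yy n c d)) t)"
    unfolding Y_def by (subst sum.reindex[OF yy_inj]) (simp add: case_prod_unfold)
  also have "\<dots> = (\<Sum>(n, c, d)\<in>F \<times> C \<times> C.
     (\<Sum>A\<in>PiE (sides T p - {?e0}) (\<lambda>_. C). \<Sum>\<alpha>\<in>C.
        (\<d> n * \<N> n l (fst s ?e0) ((fst s (p, x))\<^sup>\<star>) (fst s (x, q)) ((fst t (p, x))\<^sup>\<star>)
               \<alpha> (snd s (target T ?e0)) c (A (p, x))
         * (\<d> (fst t ?e1) * \<N> (fst t ?e1) l (fst s ?e1) ((fst s ?e0)\<^sup>\<star>) (fst s (q, y)) (n\<^sup>\<star>)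
               (A ?e1) (snd s (target T ?f0)) d \<alpha>))
        * (\<Prod>e\<in>sides T p - {?e0} - {?e1}. corner_coeff l s t A e))
     * (\<Sum>B\<in>PiE (sides T q - {?f0}) (\<lambda>_. C). \<Sum>\<kappa>\<in>C.
        (\<d> (fst t ?f0) * \<N> (fst t ?f0) m (n\<^sup>\<star>) ((fst s (q, y))\<^sup>\<star>) ((fst t ?e1)\<^sup>\<star>) ((fst t (q, y))\<^sup>\<star>)
               \<kappa> d (snd t (target T ?f0)) (B (q, y))
         * (\<d> (fst t ?f1) * \<N> (fst t ?f1) m (fst s ?f1) n (fst t (p, x)) ((fst t ?f0)\<^sup>\<star>)
               (B ?f1) c (snd t (target T ?e0)) \<kappa>))
        * (\<Prod>e\<in>sides T q - {?f0} - {?f1}. corner_coeff m s t B e)))"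
  proof (rule sum.cong[OF refl], clarify)
    fix n c d assume n: "n \<in> F" and cd: "c \<in> C" "d \<in> C"
    define r where "r = update p s (yy n c d)"
    have nLab: "n \<in> Lab" using n Lab(1) by blast
    have nA: "n \<in> \<A>" using n mult_labels unfolding F(2) by blast
    have r_side: "fst r e = (if e = ?e0 then n else fst t e)"
      "fst r (prod.swap e) = (if e = ?e0 then n\<^sup>\<star> else (fst t e)\<^sup>\<star>)" if "e \<in> sides T p" for e
      using that unfolding r_def by (auto simp: yy_def)
    have r_corner: "snd r (target T ?e0) = c" "snd r (target T ?e1) = d"
      using sides dist unfolding r_def by (simp_all add: yy_def)
    have sr: "agree_off (boundary_edges T p) (corners T p) s r" unfolding r_def by (rule update_agree_off)
    have tr: "agree_off (boundary_edges T q) (corners T q) t r"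
      unfolding r_def by (rule agree_off_sym[OF update_agree_off_target[OF t' dist(1) agree]])
        (use yy1 yy2 in blast)+
    have r_off: "fst r e = fst s e" if "fst e \<noteq> p" "snd e \<noteq> p" for e
    proof -
      have "e \<notin> boundary_edges T p" using that boundary_edges_iff[of e p] by blast
      then show ?thesis unfolding r_def by simp
    qed
    have rvals: "fst r ?e0 = n" "fst r (p, x) = fst t (p, x)" "fst r ?e1 = fst t ?e1"
      "fst r ?f0 = n\<^sup>\<star>" "fst r (y, p) = (fst t ?e1)\<^sup>\<star>" "fst r (q, y) = fst s (q, y)" "fst r ?f1 = fst s ?f1"
      using r_side[OF sides(1)] r_side[OF sides(2)] r_side[OF px(1)] r_off dist by auto
    have rLab: "fst r e \<in> Lab" if "e \<in> oriented_edges T" for e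
    proof -
      consider "e \<in> sides T p" | "prod.swap e \<in> sides T p" | "e \<notin> boundary_edges T p"
        by (auto simp: swap_image_iff)
      then show ?thesis
      proof cases
        case 1
        then show ?thesis using r_side(1)[OF 1] nLab labs(2)[OF that] by simp
      next
        case 2
        then show ?thesis
          using r_side(2)[OF 2] nLab labs(2)[OF sides_oriented[OF 2]] Lab_dual by (auto split: if_splits)
      next
        case 3
        then show ?thesis using labs(1)[OF that] unfolding r_def by simp
      qed
    qed
    have insp: "insert ?e0 (sides T p - {?e0}) = sides T p" and insq: "insert ?f0 (sides T q - {?f0}) = sides T q"
      using sides by auto
    have "amplitude p l s r = (\<Sum>A\<in>PiE (sides T p) (\<lambda>_. C). \<Prod>e\<in>sides T p. corner_coeff l s r A e)"
    proof (rule amplitude_extend, intro conjI C(1))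
      fix e assume e: "e \<in> sides T p"
      show "{1..\<delta> (fst r e) l ((fst s e)\<^sup>\<star>)} \<subseteq> C"
        by (intro C_range Lab_dual lm rLab labs sides_oriented[OF e])
    qed
    also have "\<dots> = (\<Sum>A\<in>PiE (sides T p - {?e0}) (\<lambda>_. C). \<Sum>\<alpha>\<in>C.
        \<Prod>e\<in>sides T p. corner_coeff l s r (A(?e0 := \<alpha>)) e)"
      using sum_PiE_insert[of ?e0 "sides T p - {?e0}" _ "\<lambda>_. C"] unfolding insp by simp
    also have "\<dots> = (\<Sum>A\<in>PiE (sides T p - {?e0}) (\<lambda>_. C). \<Sum>\<alpha>\<in>C.
        (\<d> n * \<N> n l (fst s ?e0) ((fst s (p, x))\<^sup>\<star>) (fst s (x, q)) ((fst t (p, x))\<^sup>\<star>)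
               \<alpha> (snd s (target T ?e0)) c (A (p, x))
         * (\<d> (fst t ?e1) * \<N> (fst t ?e1) l (fst s ?e1) ((fst s ?e0)\<^sup>\<star>) (fst s (q, y)) (n\<^sup>\<star>)
               (A ?e1) (snd s (target T ?f0)) d \<alpha>))
        * (\<Prod>e\<in>sides T p - {?e0} - {?e1}. corner_coeff l s t A e))" (is "_ = ?ap")
    proof (intro sum.cong refl)
      fix A :: "'v \<times> 'v \<Rightarrow> nat" and \<alpha> :: nat
      let ?A = "A(?e0 := \<alpha>)"
      have "(\<Prod>e\<in>sides T p. corner_coeff l s r ?A e) = corner_coeff l s r ?A ?e0 * corner_coeff l s r ?A ?e1
          * (\<Prod>e\<in>sides T p - {?e0} - {?e1}. corner_coeff l s r ?A e)"
        using sides dist finite_sides[of p]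
        by (subst prod.remove[of _ ?e0], simp, simp, subst prod.remove[of _ ?e1]) (auto simp: mult.assoc)
      also have "(\<Prod>e\<in>sides T p - {?e0} - {?e1}. corner_coeff l s r ?A e)
          = (\<Prod>e\<in>sides T p - {?e0} - {?e1}. corner_coeff l s t A e)"
      proof (intro prod.cong refl)
        fix e assume e: "e \<in> sides T p - {?e0} - {?e1}"
        then have "next_side T e \<noteq> ?e0" using nx_inj by blast
        moreover from this have "corner_coeff l s r ?A e = corner_coeff l s t ?A e"
          using e by (intro far_corner(2)[OF _ dist(1) _ _ tr]) auto
        ultimately show "corner_coeff l s r ?A e = corner_coeff l s t A e" using e by (simp add: corner_coeff_def)
      qed
      finally show "(\<Prod>e\<in>sides T p. corner_coeff l s r ?A e) =
        (\<d> n * \<N> n l (fst s ?e0) ((fst s (p, x))\<^sup>\<star>) (fst s (x, q)) ((fst t (p, x))\<^sup>\<star>)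
               \<alpha> (snd s (target T ?e0)) c (A (p, x))
         * (\<d> (fst t ?e1) * \<N> (fst t ?e1) l (fst s ?e1) ((fst s ?e0)\<^sup>\<star>) (fst s (q, y)) (n\<^sup>\<star>)
               (A ?e1) (snd s (target T ?f0)) d \<alpha>))
        * (\<Prod>e\<in>sides T p - {?e0} - {?e1}. corner_coeff l s t A e)"
        using dist xy by (simp add: corner_coeff_def nx lg rvals r_corner tg)
    qed
    finally have amp_p: "amplitude p l s r = ?ap" .
    have "amplitude q m r t = (\<Sum>B\<in>PiE (sides T q) (\<lambda>_. C). \<Prod>e\<in>sides T q. corner_coeff m r t B e)"
    proof (rule amplitude_extend, intro conjI C(1))
      fix e assume e: "e \<in> sides T q"
      show "{1..\<delta> (fst t e) m ((fst r e)\<^sup>\<star>)} \<subseteq> C"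
        by (intro C_range Lab_dual lm rLab labs sides_oriented[OF e])
    qed
    also have "\<dots> = (\<Sum>B\<in>PiE (sides T q - {?f0}) (\<lambda>_. C). \<Sum>\<kappa>\<in>C.
        \<Prod>e\<in>sides T q. corner_coeff m r t (B(?f0 := \<kappa>)) e)"
      using sum_PiE_insert[of ?f0 "sides T q - {?f0}" _ "\<lambda>_. C"] unfolding insq by simp
    also have "\<dots> = (\<Sum>B\<in>PiE (sides T q - {?f0}) (\<lambda>_. C). \<Sum>\<kappa>\<in>C.
        (\<d> (fst t ?f0) * \<N> (fst t ?f0) m (n\<^sup>\<star>) ((fst s (q, y))\<^sup>\<star>) ((fst t ?e1)\<^sup>\<star>) ((fst t (q, y))\<^sup>\<star>)
               \<kappa> d (snd t (target T ?f0)) (B (q, y))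
         * (\<d> (fst t ?f1) * \<N> (fst t ?f1) m (fst s ?f1) n (fst t (p, x)) ((fst t ?f0)\<^sup>\<star>)
               (B ?f1) c (snd t (target T ?e0)) \<kappa>))
        * (\<Prod>e\<in>sides T q - {?f0} - {?f1}. corner_coeff m s t B e))" (is "_ = ?aq")
    proof (intro sum.cong refl)
      fix B :: "'v \<times> 'v \<Rightarrow> nat" and \<kappa> :: nat
      let ?B = "B(?f0 := \<kappa>)"
      have "(\<Prod>e\<in>sides T q. corner_coeff m r t ?B e) = corner_coeff m r t ?B ?f0 * corner_coeff m r t ?B ?f1
          * (\<Prod>e\<in>sides T q - {?f0} - {?f1}. corner_coeff m r t ?B e)"
        using sides dist finite_sides[of q]
        by (subst prod.remove[of _ ?f0], simp, simp, subst prod.remove[of _ ?f1]) (auto simp: mult.assoc)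
      also have "(\<Prod>e\<in>sides T q - {?f0} - {?f1}. corner_coeff m r t ?B e)
          = (\<Prod>e\<in>sides T q - {?f0} - {?f1}. corner_coeff m s t B e)"
      proof (intro prod.cong refl)
        fix e assume e: "e \<in> sides T q - {?f0} - {?f1}"
        then have "next_side T e \<noteq> ?f0" using nx_inj' by blast
        moreover from this have "corner_coeff m r t ?B e = corner_coeff m s t ?B e"
          using e dist by (intro far_corner(1)[OF _ dist(1)[symmetric] _ _ sr]) auto
        ultimately show "corner_coeff m r t ?B e = corner_coeff m s t B e" using e by (simp add: corner_coeff_def)
      qed
      finally show "(\<Prod>e\<in>sides T q. corner_coeff m r t ?B e) =
        (\<d> (fst t ?f0) * \<N> (fst t ?f0) m (n\<^sup>\<star>) ((fst s (q, y))\<^sup>\<star>) ((fst t ?e1)\<^sup>\<star>) ((fst t (q, y))\<^sup>\<star>)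
               \<kappa> d (snd t (target T ?f0)) (B (q, y))
         * (\<d> (fst t ?f1) * \<N> (fst t ?f1) m (fst s ?f1) n (fst t (p, x)) ((fst t ?f0)\<^sup>\<star>)
               (B ?f1) c (snd t (target T ?e0)) \<kappa>))
        * (\<Prod>e\<in>sides T q - {?f0} - {?f1}. corner_coeff m s t B e)"
        using dist xy nA by (simp add: corner_coeff_def nx lg rvals r_corner tg dual_dual)
    qed
    finally have amp_q: "amplitude q m r t = ?aq" .
    show "amplitude p l s (update p s (yy n c d)) * amplitude q m (update p s (yy n c d)) t = ?ap * ?aq"
      unfolding r_def[symmetric] amp_p amp_q ..
  qed
  also have "\<dots> = ?rhs"
    unfolding sum_factor_rearrange
    by (intro sum.cong refl arg_cong2[where f = "(*)"]) (auto simp: mult_ac)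
  finally show ?thesis .
qed



lemma finite_new_label_set:
  assumes s: "s \<in> prestates \<Phi>" and l: "l \<in> \<A>" and adm: "admissible (shift p (deg l) \<Phi>)" and e: "e \<in> sides T p"
  shows "finite {n. \<delta> n l ((fst s e)\<^sup>\<star>) \<noteq> 0}"
proof -
  have "finite (fst ` {(n, l'). l' \<in> I (deg l) \<and> \<delta> n l' ((fst s e)\<^sup>\<star>) \<noteq> 0})"
    using finite_new_labels[OF s deg_generic[OF l] adm e] by simp
  then show ?thesis by (rule rev_finite_subset) (use l in \<open>force simp: homog_def\<close>)
qed

text \<open>
  For adjacent plaquettes, both sides are written as in \<open>adjacent_sum\<close>, with the roles of the two
  plaquettes interchanged; the factors that do not involve the intermediate state are the same, and
  the inner sums are equal by \<open>shared_side_exchange\<close>.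
\<close>

lemma plaq_coeff_exchange:
  assumes pq: "p \<noteq> q" and s: "s \<in> states \<Phi>" and t: "t \<in> states (shift q (deg m) (shift p (deg l) \<Phi>))"
    and l: "l \<in> \<A>" and m: "m \<in> \<A>"
    and \<Phi>: "admissible \<Phi>" "admissible (shift p (deg l) \<Phi>)" "admissible (shift q (deg m) \<Phi>)"
  shows "(\<Sum>r | plaq_coeff \<Phi> p l s r \<noteq> 0. plaq_coeff \<Phi> p l s r * plaq_coeff (shift p (deg l) \<Phi>) q m r t)
    = (\<Sum>r | plaq_coeff \<Phi> q m s r \<noteq> 0. plaq_coeff \<Phi> q m s r * plaq_coeff (shift q (deg m) \<Phi>) p l r t)"
proof -
  note s' = states_prestates[OF s] and t' = states_prestates[OF t]
  have t2: "t \<in> states (shift p (deg l) (shift q (deg m) \<Phi>))" using t by (simp only: shift_commute)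
  show ?thesis
  proof (cases "agree_off (boundary_edges T p \<union> boundary_edges T q) (corners T p \<union> corners T q) s t")
    case False
    have "plaq_coeff \<Phi> p l s r * plaq_coeff (shift p (deg l) \<Phi>) q m r t = 0" for r
    proof (rule ccontr)
      assume "plaq_coeff \<Phi> p l s r * plaq_coeff (shift p (deg l) \<Phi>) q m r t \<noteq> 0"
      then have "plaq_coeff \<Phi> p l s r \<noteq> 0" "plaq_coeff (shift p (deg l) \<Phi>) q m r t \<noteq> 0" by auto
      from agree_off_two[OF this[THEN plaq_coeff_nonzero(2)]] False show False by simp
    qed
    moreover have "plaq_coeff \<Phi> q m s r * plaq_coeff (shift q (deg m) \<Phi>) p l r t = 0" for r
    proof (rule ccontr)
      assume "plaq_coeff \<Phi> q m s r * plaq_coeff (shift q (deg m) \<Phi>) p l r t \<noteq> 0"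
      then have "plaq_coeff \<Phi> q m s r \<noteq> 0" "plaq_coeff (shift q (deg m) \<Phi>) p l r t \<noteq> 0" by auto
      from agree_off_two[OF this[THEN plaq_coeff_nonzero(2)]] False show False by (simp only: Un_commute)
    qed
    ultimately show ?thesis by (simp only: sum.neutral_const)
  next
    case agree: True
    then have agree2: "agree_off (boundary_edges T q \<union> boundary_edges T p) (corners T q \<union> corners T p) s t"
      by (simp only: Un_commute)
    show ?thesis
    proof (cases "(p, q) \<in> oriented_edges T")
      case False
      then have "(q, p) \<notin> oriented_edges T" using oriented_edges_swap_iff[of "(q, p)"] by simp
      from nonadjacent_sum[OF s t2 pq[symmetric] this m \<Phi>(1,3) agree2]
        nonadjacent_sum[OF s t pq False l \<Phi>(1,2) agree]
      show ?thesis by (simp only: mult.commute)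
    next
      case True
      then obtain x where x: "ccw T p q x" by (auto simp: oriented_edges_iff)
      have "(q, p) \<in> oriented_edges T" using oriented_edges_swap[OF True] by simp
      then obtain y where y: "ccw T q p y" by (auto simp: oriented_edges_iff)
      note sides = sideI[OF x] sideI[OF y]
      have oe: "(p, q) \<in> oriented_edges T" "(q, p) \<in> oriented_edges T" "(p, x) \<in> oriented_edges T"
        "(p, y) \<in> oriented_edges T" "(q, x) \<in> oriented_edges T" "(q, y) \<in> oriented_edges T"
        using oriented_edges_ccw[OF x] oriented_edges_ccw[OF y]
          oriented_edges_swap_iff[of "(p, x)"] oriented_edges_swap_iff[of "(q, y)"] by simp_all
      have dual_s: "fst s (q, p) = (fst s (p, q))\<^sup>\<star>" "fst s (x, q) = (fst s (q, x))\<^sup>\<star>"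
          "fst s (y, p) = (fst s (p, y))\<^sup>\<star>" "((fst s (p, q))\<^sup>\<star>)\<^sup>\<star> = fst s (p, q)"
        using prestate_label(3)[OF s' oe(1)] prestate_label(3)[OF s' oe(5)] prestate_label(3)[OF s' oe(4)]
          dual_dual[OF prestate_label(1)[OF s' oe(1)]] by simp_all
      have dual_t: "fst t (q, p) = (fst t (p, q))\<^sup>\<star>" "((fst t (p, q))\<^sup>\<star>)\<^sup>\<star> = fst t (p, q)"
        using prestate_label(3)[OF t' oe(1)] dual_dual[OF prestate_label(1)[OF t' oe(1)]] by simp_all
      define F where "F = {n. \<delta> n l ((fst s (p, q))\<^sup>\<star>) \<noteq> 0}"
      define G where "G = {k. \<delta> k m ((fst s (q, p))\<^sup>\<star>) \<noteq> 0}"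
      have F: "finite F" unfolding F_def by (rule finite_new_label_set[OF s' l \<Phi>(2) sides(1)])
      have G: "finite G" unfolding G_def by (rule finite_new_label_set[OF s' m \<Phi>(3) sides(2)])
      have FGA: "F \<subseteq> \<A>" "G \<subseteq> \<A>" unfolding F_def G_def using mult_labels by blast+
      \<comment> \<open>A finite set of labels closed under duality contains all labels that can occur, so there is a common
        range \<open>C\<close> for all multiplicity indices.\<close>
      define Lab0 where "Lab0 = F \<union> G \<union> fst s ` oriented_edges T \<union> fst t ` oriented_edges T \<union> {l, m}"
      define Lab where "Lab = Lab0 \<union> dual L ` Lab0"
      have Lab0: "finite Lab0" "Lab0 \<subseteq> \<A>"
      proof -
        show "finite Lab0" unfolding Lab0_def using F G finite_oriented_edges by simp
        have "fst s ` oriented_edges T \<subseteq> \<A>" "fst t ` oriented_edges T \<subseteq> \<A>"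
          using prestate_label(1)[OF s'] prestate_label(1)[OF t'] by (simp_all add: image_subset_iff)
        then show "Lab0 \<subseteq> \<A>" unfolding Lab0_def using FGA l m by simp
      qed
      have LabA: "Lab \<subseteq> \<A>" unfolding Lab_def using Lab0(2) dual_closed by auto
      have Lab_dual: "i\<^sup>\<star> \<in> Lab" if "i \<in> Lab" for i
        using that Lab0(2) dual_dual unfolding Lab_def by force
      have sub: "F \<subseteq> Lab" "G \<subseteq> Lab" "fst s ` oriented_edges T \<subseteq> Lab" "fst t ` oriented_edges T \<subseteq> Lab"
        "{l, m} \<subseteq> Lab" "{m, l} \<subseteq> Lab"
        unfolding Lab_def Lab0_def by auto
      have finLab: "finite Lab" unfolding Lab_def using Lab0 by simp
      obtain M where M: "\<delta> i j k \<le> M" if "i \<in> Lab" "j \<in> Lab" "k \<in> Lab" for i j k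
        using mult_bound[OF finLab] by auto
      define C where "C = {1..M}"
      have C: "finite C" "\<And>i j k. i \<in> Lab \<Longrightarrow> j \<in> Lab \<Longrightarrow> k \<in> Lab \<Longrightarrow> {1..\<delta> i j k} \<subseteq> C"
        unfolding C_def using M by (auto intro: order_trans)
      have labs: "fst s e \<in> Lab" "fst t e \<in> Lab" if "e \<in> oriented_edges T" for e
        using sub(3,4) that by (auto simp: image_subset_iff)
      have degt: "deg (fst t (p, q)) = \<Phi> (p, q) - deg l + deg m"
        using prestate_label(2)[OF t' oe(1)] delta_color_side(1)[OF sides(1)] delta_color_side(2)[OF sides(2)]
        by simp
      have gen1: "deg (fst t (p, q)) + deg l \<notin> \<X>"
        using admissible_generic[OF \<Phi>(3) oe(1)] delta_color_side(2)[OF sides(2)] by (simp add: degt)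
      have "\<Phi> (p, q) - deg l \<notin> \<X>" using admissible_shift_side[OF \<Phi>(2) sides(1)] .
      moreover have "deg m - deg (fst t (p, q)) = - (\<Phi> (p, q) - deg l)" unfolding degt by simp
      ultimately have gen2: "deg m - deg (fst t (p, q)) \<notin> \<X>" using X_minus[of "\<Phi> (p, q) - deg l"] by simp
      have G': "G = {k. \<delta> k m (fst s (p, q)) \<noteq> 0}" unfolding G_def dual_s ..
      note exchange = shared_side_exchange[of Lab l m "fst s (p, q)" "fst t (p, q)" "fst s (p, x)" "fst t (p, x)"
          "fst s (p, y)" "fst t (p, y)" "fst s (q, y)" "fst t (q, y)" "fst s (q, x)" "fst t (q, x)" F G C,
          OF LabA Lab_dual _ gen1 gen2 F sub(1) _ G sub(2) _ C]
      have Lab_dual': "dual L ` Lab \<subseteq> Lab" using Lab_dual by (simp add: image_subset_iff)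
      have C': "\<forall>i\<in>Lab. \<forall>j\<in>Lab. \<forall>k\<in>Lab. {1..\<delta> i j k} \<subseteq> C" using C(2) by (intro ballI)
      note S1 = adjacent_sum[OF x y s t l \<Phi>(1,2) agree F F_def sub(1,3,4,5) Lab_dual' C(1) C']
      note S2 = adjacent_sum[OF y x s t2 m \<Phi>(1,3) agree2 G G_def sub(2,3,4,6) Lab_dual' C(1) C']
      show ?thesis
        unfolding S1 S2
      proof (rule trans[OF sum.swap], intro sum.cong refl)
        fix A B :: "'v \<times> 'v \<Rightarrow> nat"
        let ?K = "\<d> (fst t (p, y)) * \<d> (fst t (p, q)) * \<d> (fst t (q, x))"
        show "(\<Prod>e\<in>sides T p - {(p, q)} - {(p, y)}. corner_coeff l s t A e)
          * (\<Prod>e\<in>sides T q - {(q, p)} - {(q, x)}. corner_coeff m s t B e)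
          * (\<Sum>(n, c, d, \<alpha>, \<kappa>)\<in>F \<times> C \<times> C \<times> C \<times> C.
              \<d> (fst t (p, y)) * \<d> (fst t (q, p)) * \<d> (fst t (q, x)) * (\<d> n *
              (\<N> n l (fst s (p, q)) ((fst s (p, x))\<^sup>\<star>) (fst s (x, q)) ((fst t (p, x))\<^sup>\<star>)
                 \<alpha> (snd s (target T (p, q))) c (A (p, x))
               * \<N> (fst t (p, y)) l (fst s (p, y)) ((fst s (p, q))\<^sup>\<star>) (fst s (q, y)) (n\<^sup>\<star>)
                 (A (p, y)) (snd s (target T (q, p))) d \<alpha>)
              * (\<N> (fst t (q, p)) m (n\<^sup>\<star>) ((fst s (q, y))\<^sup>\<star>) ((fst t (p, y))\<^sup>\<star>) ((fst t (q, y))\<^sup>\<star>)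
                 \<kappa> d (snd t (target T (q, p))) (B (q, y))
               * \<N> (fst t (q, x)) m (fst s (q, x)) n (fst t (p, x)) ((fst t (q, p))\<^sup>\<star>)
                 (B (q, x)) c (snd t (target T (p, q))) \<kappa>)))
          = (\<Prod>e\<in>sides T q - {(q, p)} - {(q, x)}. corner_coeff m s t B e)
          * (\<Prod>e\<in>sides T p - {(p, q)} - {(p, y)}. corner_coeff l s t A e)
          * (\<Sum>(k, d, c, \<kappa>, \<alpha>)\<in>G \<times> C \<times> C \<times> C \<times> C.
              \<d> (fst t (q, x)) * \<d> (fst t (p, q)) * \<d> (fst t (p, y)) * (\<d> k *
              (\<N> k m (fst s (q, p)) ((fst s (q, y))\<^sup>\<star>) (fst s (y, p)) ((fst t (q, y))\<^sup>\<star>)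
                 \<kappa> (snd s (target T (q, p))) d (B (q, y))
               * \<N> (fst t (q, x)) m (fst s (q, x)) ((fst s (q, p))\<^sup>\<star>) (fst s (p, x)) (k\<^sup>\<star>)
                 (B (q, x)) (snd s (target T (p, q))) c \<kappa>)
              * (\<N> (fst t (p, q)) l (k\<^sup>\<star>) ((fst s (p, x))\<^sup>\<star>) ((fst t (q, x))\<^sup>\<star>) ((fst t (p, x))\<^sup>\<star>)
                 \<alpha> c (snd t (target T (p, q))) (A (p, x))
               * \<N> (fst t (p, y)) l (fst s (p, y)) k (fst t (q, y)) ((fst t (p, q))\<^sup>\<star>)
                 (A (p, y)) d (snd t (target T (q, p))) \<alpha>)))"
          (is "?P * ?Q * ?L = ?Q * ?P * ?R")
        proof -
          have "?L = ?K * (\<Sum>(n, c, d, \<alpha>, \<kappa>)\<in>F \<times> C \<times> C \<times> C \<times> C. \<d> n *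
              (\<N> n l (fst s (p, q)) ((fst s (p, x))\<^sup>\<star>) ((fst s (q, x))\<^sup>\<star>) ((fst t (p, x))\<^sup>\<star>)
                 \<alpha> (snd s (target T (p, q))) c (A (p, x))
               * \<N> (fst t (p, y)) l (fst s (p, y)) ((fst s (p, q))\<^sup>\<star>) (fst s (q, y)) (n\<^sup>\<star>)
                 (A (p, y)) (snd s (target T (q, p))) d \<alpha>)
              * (\<N> ((fst t (p, q))\<^sup>\<star>) m (n\<^sup>\<star>) ((fst s (q, y))\<^sup>\<star>) ((fst t (p, y))\<^sup>\<star>) ((fst t (q, y))\<^sup>\<star>)
                 \<kappa> d (snd t (target T (q, p))) (B (q, y))
               * \<N> (fst t (q, x)) m (fst s (q, x)) n (fst t (p, x)) (fst t (p, q))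
                 (B (q, x)) c (snd t (target T (p, q))) \<kappa>))"
            unfolding dual_s dual_t qdim_dual[OF prestate_label(1)[OF t' oe(1)]] sum_distrib_left
            by (intro sum.cong refl) (auto simp: mult_ac)
          also have "\<dots> = ?K * (\<Sum>(k, d, c, \<kappa>, \<alpha>)\<in>G \<times> C \<times> C \<times> C \<times> C. \<d> k *
              (\<N> k m ((fst s (p, q))\<^sup>\<star>) ((fst s (q, y))\<^sup>\<star>) ((fst s (p, y))\<^sup>\<star>) ((fst t (q, y))\<^sup>\<star>)
                 \<kappa> (snd s (target T (q, p))) d (B (q, y))
               * \<N> (fst t (q, x)) m (fst s (q, x)) (fst s (p, q)) (fst s (p, x)) (k\<^sup>\<star>)
                 (B (q, x)) (snd s (target T (p, q))) c \<kappa>)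
              * (\<N> (fst t (p, q)) l (k\<^sup>\<star>) ((fst s (p, x))\<^sup>\<star>) ((fst t (q, x))\<^sup>\<star>) ((fst t (p, x))\<^sup>\<star>)
                 \<alpha> c (snd t (target T (p, q))) (A (p, x))
               * \<N> (fst t (p, y)) l (fst s (p, y)) k (fst t (q, y)) ((fst t (p, q))\<^sup>\<star>)
                 (A (p, y)) d (snd t (target T (q, p))) \<alpha>))"
            by (subst exchange) (use labs oe sub in \<open>simp_all add: F_def G'\<close>)
          also have "\<dots> = ?R"
            unfolding dual_s sum_distrib_left
            by (intro sum.cong refl) (auto simp: mult_ac)
          finally show ?thesis by simp
        qed
      qed
    qed
  qed
qed

lemma mat_comp_kernel_target:
  assumes s: "s \<in> states \<Phi>" and g: "g \<notin> \<X>" and h: "h \<notin> \<X>"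
    and \<Phi>: "admissible (shift p g \<Phi>)" "admissible (shift q h (shift p g \<Phi>))"
    and nz: "mat_comp (plaq_kernel \<Phi> p g) (plaq_kernel (shift p g \<Phi>) q h) s t \<noteq> 0"
  shows "t \<in> states (shift q h (shift p g \<Phi>))"
proof -
  obtain r where r: "plaq_kernel \<Phi> p g s r \<noteq> 0" "plaq_kernel (shift p g \<Phi>) q h r t \<noteq> 0"
    using nz by (rule mat_comp_nonzero)
  have "r \<in> states (shift p g \<Phi>)" using plaq_kernel_row(2)[OF s g \<Phi>(1)] r(1) by blast
  then show ?thesis using plaq_kernel_row(2)[OF _ h \<Phi>(2)] r(2) by blast
qed

lemma plaq_kernel_commute:
  assumes p: "p \<in> plaquettes T" and q: "q \<in> plaquettes T" and pq: "p \<noteq> q" and s: "s \<in> states \<Phi>"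
    and g: "g \<notin> \<X>" and h: "h \<notin> \<X>"
    and \<Phi>: "admissible \<Phi>" "admissible (shift p g \<Phi>)" "admissible (shift q h \<Phi>)"
      "admissible (shift q h (shift p g \<Phi>))"
  shows "mat_comp (plaq_kernel \<Phi> p g) (plaq_kernel (shift p g \<Phi>) q h) s t
    = mat_comp (plaq_kernel \<Phi> q h) (plaq_kernel (shift q h \<Phi>) p g) s t"
proof (cases "t \<in> states (shift q h (shift p g \<Phi>))")
  case False
  have \<Phi>': "admissible (shift p g (shift q h \<Phi>))" using \<Phi>(4) by (simp only: shift_commute)
  have "t \<notin> states (shift p g (shift q h \<Phi>))"
    unfolding shift_commute[where p = p and g = g and q = q and h = h] by (rule False)
  then have "mat_comp (plaq_kernel \<Phi> q h) (plaq_kernel (shift q h \<Phi>) p g) s t = 0"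
    using mat_comp_kernel_target[OF s h g \<Phi>(3) \<Phi>', of t] by blast
  moreover have "mat_comp (plaq_kernel \<Phi> p g) (plaq_kernel (shift p g \<Phi>) q h) s t = 0"
    using mat_comp_kernel_target[OF s g h \<Phi>(2,4), of t] False by blast
  ultimately show ?thesis by (simp only:)
next
  case t: True
  then have t2: "t \<in> states (shift p g (shift q h \<Phi>))" by (simp only: shift_commute)
  define D1 where "D1 = {l \<in> I g. \<exists>t. plaq_coeff \<Phi> p l s t \<noteq> 0}
    \<union> {l \<in> I g. \<exists>r\<in>states (shift q h \<Phi>). plaq_coeff (shift q h \<Phi>) p l r t \<noteq> 0}"
  define D2 where "D2 = {m \<in> I h. \<exists>t. plaq_coeff \<Phi> q m s t \<noteq> 0}
    \<union> {m \<in> I h. \<exists>r\<in>states (shift p g \<Phi>). plaq_coeff (shift p g \<Phi>) q m r t \<noteq> 0}"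
  have D1: "finite D1" "D1 \<subseteq> I g"
    unfolding D1_def using finite_active_labels[OF p s g \<Phi>(2)] finite_active_labels_target[OF p t2 g \<Phi>(3)]
    by auto
  have D2: "finite D2" "D2 \<subseteq> I h"
    unfolding D2_def using finite_active_labels[OF q s h \<Phi>(3)] finite_active_labels_target[OF q t h \<Phi>(2)]
    by auto
  have "mat_comp (plaq_kernel \<Phi> p g) (plaq_kernel (shift p g \<Phi>) q h) s t
    = (\<Sum>l\<in>D1. \<Sum>m\<in>D2. \<b> l * \<b> m *
        (\<Sum>r | plaq_coeff \<Phi> p l s r \<noteq> 0. plaq_coeff \<Phi> p l s r * plaq_coeff (shift p g \<Phi>) q m r t))"
    by (rule mat_comp_plaq_kernel[OF s g \<Phi>(2) D1 _ D2]; unfold D1_def D2_def; rule Un_upper1 Un_upper2)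
  also have "\<dots> = (\<Sum>l\<in>D1. \<Sum>m\<in>D2. \<b> m * \<b> l *
        (\<Sum>r | plaq_coeff \<Phi> q m s r \<noteq> 0. plaq_coeff \<Phi> q m s r * plaq_coeff (shift q h \<Phi>) p l r t))"
  proof (intro sum.cong refl)
    fix l m assume "l \<in> D1" "m \<in> D2"
    then have "l \<in> I g" "m \<in> I h" using D1(2) D2(2) by blast+
    then have "l \<in> \<A>" "deg l = g" "m \<in> \<A>" "deg m = h" by (simp_all add: homog_def)
    with plaq_coeff_exchange[where t = t and l = l and m = m, OF pq s] t \<Phi>
    show "\<b> l * \<b> m * (\<Sum>r | plaq_coeff \<Phi> p l s r \<noteq> 0. plaq_coeff \<Phi> p l s r * plaq_coeff (shift p g \<Phi>) q m r t)
      = \<b> m * \<b> l * (\<Sum>r | plaq_coeff \<Phi> q m s r \<noteq> 0. plaq_coeff \<Phi> q m s r * plaq_coeff (shift q h \<Phi>) p l r t)"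
      by simp
  qed
  also have "\<dots> = (\<Sum>m\<in>D2. \<Sum>l\<in>D1. \<b> m * \<b> l *
        (\<Sum>r | plaq_coeff \<Phi> q m s r \<noteq> 0. plaq_coeff \<Phi> q m s r * plaq_coeff (shift q h \<Phi>) p l r t))"
    by (rule sum.swap)
  also have "\<dots> = mat_comp (plaq_kernel \<Phi> q h) (plaq_kernel (shift q h \<Phi>) p g) s t"
    by (rule mat_comp_plaq_kernel[OF s h \<Phi>(3) D2 _ D1, symmetric]; unfold D1_def D2_def; rule Un_upper1 Un_upper2)
  finally show ?thesis .
qed

lemma B_deg_commute:
  assumes p: "p \<in> plaquettes T" and q: "q \<in> plaquettes T" and pq: "p \<noteq> q" and f: "f \<in> state_space \<Phi>"
    and g: "g \<notin> \<X>" and h: "h \<notin> \<X>"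
    and \<Phi>: "admissible \<Phi>" "admissible (shift p g \<Phi>)" "admissible (shift q h \<Phi>)"
      "admissible (shift q h (shift p g \<Phi>))"
  shows "B_deg (shift p g \<Phi>) q h (B_deg \<Phi> p g f) = B_deg (shift q h \<Phi>) p g (B_deg \<Phi> q h f)"
proof -
  have \<Phi>': "admissible (shift p g (shift q h \<Phi>))" using \<Phi>(4) by (simp only: shift_commute)
  show ?thesis
    unfolding B_deg_B_deg[OF p q f h g \<Phi>(2,4)] B_deg_B_deg[OF q p f g h \<Phi>(3) \<Phi>']
    using state_spaceD(2)[OF f] plaq_kernel_commute[OF p q pq _ g h \<Phi>] by (intro ext lin_ext_cong) auto
qed



section \<open>Plaquette projections\<close>

text \<open>
  This is how smallness of \<open>\<X>\<close> is used: finitely many genericity conditions can be met simultaneously.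
\<close>

lemma generic_avoiding:
  assumes "finite Z"
  shows "\<exists>g. \<forall>z\<in>Z. g - z \<notin> \<X>"
proof -
  obtain g where "g \<notin> {y + x | y x. y \<in> Z \<and> x \<in> \<X>}" using X_small[OF assms] by blast
  moreover have "g \<in> {y + x | y x. y \<in> Z \<and> x \<in> \<X>}" if "z \<in> Z" "g - z \<in> \<X>" for z
  proof -
    have "g = z + (g - z)" by simp
    then show ?thesis using that by blast
  qed
  ultimately show ?thesis by blast
qed

lemma coloring_shift: "coloring \<Phi> \<Longrightarrow> coloring (shift p g \<Phi>)"
proof -
  assume \<Phi>: "coloring \<Phi>"
  have swap: "delta_color g p (prod.swap e) = - delta_color g p e" for e
  proof -
    consider "e \<in> sides T p" | "prod.swap e \<in> sides T p" | "e \<notin> boundary_edges T p"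
      by (auto simp: swap_image_iff)
    then show ?thesis
    proof cases
      case 2
      from delta_color_side(1,2)[OF 2] show ?thesis by simp
    next
      case 3
      then have "prod.swap e \<notin> boundary_edges T p" by (auto simp: swap_image_iff)
      then show ?thesis using 3 by simp
    qed simp
  qed
  have edge: "delta_color g p (a, b) = (if a = p then - g else if b = p then g else 0)"
    if "(a, b) \<in> oriented_edges T" for a b
  proof -
    have "prod.swap (a, b) \<in> oriented_edges T" by (rule oriented_edges_swap[OF that])
    moreover have "a \<noteq> b" using that ccw_distinct by (auto simp: oriented_edges_iff)
    ultimately show ?thesis using that by (auto simp: delta_color_def sides_def)
  qed
  have sum0: "delta_color g p (a, b) + delta_color g p (b, c) + delta_color g p (c, a) = 0"
    if "(a, b, c) \<in> T" for a b c
  proof -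
    have ccw: "ccw T a b c" using that by (simp add: ccw_def)
    show ?thesis
      unfolding edge[OF oriented_edges_ccw(1)[OF ccw]] edge[OF oriented_edges_ccw(2)[OF ccw]]
        edge[OF oriented_edges_ccw(3)[OF ccw]]
      using ccw_distinct[OF ccw] by auto
  qed
  have \<Phi>T: "\<Phi> (a, b) + \<Phi> (b, c) + \<Phi> (c, a) = 0" if "(a, b, c) \<in> T" for a b c
    using \<Phi> that unfolding coloring_def by fast
  have "\<Phi> (a, b) + delta_color g p (a, b) + (\<Phi> (b, c) + delta_color g p (b, c))
      + (\<Phi> (c, a) + delta_color g p (c, a)) = 0" if "(a, b, c) \<in> T" for a b c
  proof -
    have "\<Phi> (a, b) + delta_color g p (a, b) + (\<Phi> (b, c) + delta_color g p (b, c))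
      + (\<Phi> (c, a) + delta_color g p (c, a)) = (\<Phi> (a, b) + \<Phi> (b, c) + \<Phi> (c, a))
      + (delta_color g p (a, b) + delta_color g p (b, c) + delta_color g p (c, a))" by (simp only: add_ac)
    then show ?thesis
      using sum0[OF that] \<Phi>T[OF that] by simp
  qed
  moreover have "\<Phi> (prod.swap e) + delta_color g p (prod.swap e) = - (\<Phi> e + delta_color g p e)"
    if "e \<in> oriented_edges T" for e
    using \<Phi> that unfolding coloring_def by (simp add: swap)
  ultimately show ?thesis unfolding coloring_def by fast
qed

lemma admissible_shift:
  assumes \<Phi>: "admissible \<Phi>" and g: "\<And>e. e \<in> sides T p \<Longrightarrow> \<Phi> e - g \<notin> \<X>"
  shows "admissible (shift p g \<Phi>)"
  unfolding admissible_def
proof (intro conjI ballI)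
  show "coloring (shift p g \<Phi>)" by (rule coloring_shift[OF admissible_coloring[OF \<Phi>]])
  fix e assume e: "e \<in> oriented_edges T"
  consider "e \<in> sides T p" | e' where "e = prod.swap e'" "e' \<in> sides T p" | "e \<notin> boundary_edges T p" by blast
  then show "\<Phi> e + delta_color g p e \<notin> \<X>"
  proof cases
    case 1
    then show ?thesis using g[OF 1] by simp
  next
    case 2
    have "\<Phi> (prod.swap e') = - \<Phi> e'"
      using admissible_coloring[OF \<Phi>] sides_oriented[OF 2(2)] unfolding coloring_def by blast
    then have "\<Phi> e + delta_color g p e = - (\<Phi> e' - g)" using 2 by simp
    then show ?thesis using g[OF 2(2)] X_minus[of "\<Phi> e' - g"] by simp
  next
    case 3
    then show ?thesis using admissible_generic[OF \<Phi> e] by simp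
  qed
qed

text \<open>The degrees \<open>g\<close> for which the operators in \<open>B\<^sub>p = B\<^sub>p\<^sup>g B\<^sub>p\<^sup>-\<^sup>g\<close> are defined.\<close>

definition usable :: "('v \<times> 'v \<Rightarrow> 'g) \<Rightarrow> 'v \<Rightarrow> 'g \<Rightarrow> bool" where
  "usable \<Phi> p g \<longleftrightarrow> g \<notin> \<X> \<and> admissible (shift p (- g) \<Phi>)"

definition plaq_op :: "('v \<times> 'v \<Rightarrow> 'g) \<Rightarrow> 'v \<Rightarrow> 'g \<Rightarrow> ('v, 'j) vec \<Rightarrow> ('v, 'j) vec" where
  "plaq_op \<Phi> p g f = B_deg (shift p (- g) \<Phi>) p g (B_deg \<Phi> p (- g) f)"

lemma usable_exists:
  assumes \<Phi>: "admissible \<Phi>" "admissible \<Phi>'" and Z: "finite Z"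
  shows "\<exists>g. usable \<Phi> p g \<and> usable \<Phi>' p g \<and> (\<forall>z\<in>Z. g - z \<notin> \<X>)"
proof -
  let ?Y = "{0} \<union> (\<lambda>e. - \<Phi> e) ` sides T p \<union> (\<lambda>e. - \<Phi>' e) ` sides T p \<union> Z"
  have "finite ?Y" by (intro finite_UnI finite_imageI finite_sides Z finite.intros)
  from generic_avoiding[OF this] obtain g where g: "\<forall>z\<in>?Y. g - z \<notin> \<X>" ..
  have "g \<notin> \<X>" using bspec[OF g, of 0] by simp
  moreover have "\<Phi> e - (- g) \<notin> \<X>" "\<Phi>' e - (- g) \<notin> \<X>" if "e \<in> sides T p" for e
  proof -
    have "g - (- \<Phi> e) \<notin> \<X>" by (rule bspec[OF g]) (simp add: that)
    moreover have "g - (- \<Phi>' e) \<notin> \<X>" by (rule bspec[OF g]) (simp add: that)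
    ultimately
    show "\<Phi> e - (- g) \<notin> \<X>" "\<Phi>' e - (- g) \<notin> \<X>" by (simp_all add: add.commute)
  qed
  moreover have "\<forall>z\<in>Z. g - z \<notin> \<X>" by (intro ballI bspec[OF g]) (rule UnI2)
  ultimately have "usable \<Phi> p g" "usable \<Phi>' p g" "\<forall>z\<in>Z. g - z \<notin> \<X>"
    unfolding usable_def using admissible_shift[OF \<Phi>(1), of p "- g"] admissible_shift[OF \<Phi>(2), of p "- g"] by simp_all
  then show ?thesis by (intro exI conjI)
qed

lemma usableD:
  assumes "usable \<Phi> p g"
  shows "g \<notin> \<X>" "- g \<notin> \<X>" "admissible (shift p (- g) \<Phi>)"
  using assms X_minus by (auto simp: usable_def)

lemma shift_cancel: "shift p g (shift p (- g) \<Phi>) = \<Phi>" "shift p (- g) (shift p g \<Phi>) = \<Phi>"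
  unfolding shift_shift by (simp_all add: shift_zero)

lemma B_op_plaq_op: "B_op \<Phi> p = plaq_op \<Phi> p (SOME g. usable \<Phi> p g)"
  unfolding B_op_def plaq_op_def usable_def Let_def by (simp add: fun_eq_iff)

text \<open>
  Composition gives \<open>B\<^sup>g B\<^sup>-\<^sup>g = B\<^sup>g B\<^sup>k\<^sup>-\<^sup>g B\<^sup>-\<^sup>k = B\<^sup>k B\<^sup>-\<^sup>k\<close>, provided that \<open>k - g\<close> is generic.
\<close>

lemma plaq_op_independent1:
  assumes \<Phi>: "admissible \<Phi>" and p: "p \<in> plaquettes T" and f: "f \<in> state_space \<Phi>"
    and g: "usable \<Phi> p g" and k: "usable \<Phi> p k" and kg: "k - g \<notin> \<X>"
  shows "plaq_op \<Phi> p g f = plaq_op \<Phi> p k f"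
    and "w \<in> state_space (shift p (- k) \<Phi>) \<Longrightarrow>
      B_deg (shift p (- g) \<Phi>) p g (B_deg (shift p (- k) \<Phi>) p (k - g) w) = B_deg (shift p (- k) \<Phi>) p k w"
proof -
  note g = usableD[OF g] and k = usableD[OF k]
  have sh: "shift p (k - g) (shift p (- k) \<Phi>) = shift p (- g) \<Phi>" by (simp add: shift_shift)
  have sum: "(k - g) + - k = - g" "g + (k - g) = k" by (simp_all add: algebra_simps)
  have 1: "B_deg (shift p (- g) \<Phi>) p g (B_deg (shift p (- k) \<Phi>) p (k - g) w) = B_deg (shift p (- k) \<Phi>) p k w"
    if w: "w \<in> state_space (shift p (- k) \<Phi>)" for w
    using B_deg_compose[OF p w g(1) kg] k g \<Phi> by (simp only: sh sum shift_cancel simp_thms)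
  then show "w \<in> state_space (shift p (- k) \<Phi>) \<Longrightarrow>
      B_deg (shift p (- g) \<Phi>) p g (B_deg (shift p (- k) \<Phi>) p (k - g) w) = B_deg (shift p (- k) \<Phi>) p k w" .
  have 2: "B_deg (shift p (- k) \<Phi>) p (k - g) (B_deg \<Phi> p (- k) f) = B_deg \<Phi> p (- g) f"
    using B_deg_compose[OF p f kg k(2)] g(2,3) k(3) \<Phi> by (simp only: sum simp_thms)
  show "plaq_op \<Phi> p g f = plaq_op \<Phi> p k f"
    unfolding plaq_op_def 2[symmetric] by (rule 1) (rule B_deg_state_space[OF p f k(2,3)])
qed

text \<open>
  Two degrees need not have a generic difference, but there is a third one whose differences with
  both are generic.
\<close>

lemma B_op_eq:
  assumes \<Phi>: "admissible \<Phi>" and p: "p \<in> plaquettes T" and f: "f \<in> state_space \<Phi>" and g: "usable \<Phi> p g"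
  shows "B_op \<Phi> p f = plaq_op \<Phi> p g f"
proof -
  define h where "h = (SOME g. usable \<Phi> p g)"
  have h: "usable \<Phi> p h" unfolding h_def using g by (rule someI)
  obtain k where k: "usable \<Phi> p k" "k - g \<notin> \<X>" "k - h \<notin> \<X>"
    using usable_exists[OF \<Phi> \<Phi>, of "{g, h}" p] by auto
  show ?thesis
    unfolding B_op_plaq_op h_def[symmetric]
    using plaq_op_independent1(1)[OF \<Phi> p f h k(1,3)] plaq_op_independent1(1)[OF \<Phi> p f g k(1,2)] by simp
qed

lemma plaq_op_state_space:
  assumes \<Phi>: "admissible \<Phi>" and p: "p \<in> plaquettes T" and f: "f \<in> state_space \<Phi>" and g: "usable \<Phi> p g"
  shows "plaq_op \<Phi> p g f \<in> state_space \<Phi>"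
  unfolding plaq_op_def
  using B_deg_state_space[OF p B_deg_state_space[OF p f usableD(2,3)[OF g]] usableD(1)[OF g]] \<Phi>
  by (simp only: shift_cancel)

lemma B_op_state_space:
  assumes \<Phi>: "admissible \<Phi>" and p: "p \<in> plaquettes T" and f: "f \<in> state_space \<Phi>"
  shows "B_op \<Phi> p f \<in> state_space \<Phi>"
proof -
  obtain g where g: "usable \<Phi> p g" using usable_exists[OF \<Phi> \<Phi>, of "{}" p] by auto
  show ?thesis unfolding B_op_eq[OF \<Phi> p f g] by (rule plaq_op_state_space[OF \<Phi> p f g])
qed

text \<open>
  With different degrees for the two factors,
  \<open>B\<^sup>g B\<^sup>-\<^sup>g B\<^sup>k B\<^sup>-\<^sup>k = B\<^sup>g B\<^sup>k\<^sup>-\<^sup>g B\<^sup>-\<^sup>k = B\<^sup>k B\<^sup>-\<^sup>k\<close>.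
\<close>

lemma B_op_idempotent:
  assumes \<Phi>: "admissible \<Phi>" and p: "p \<in> plaquettes T" and f: "f \<in> state_space \<Phi>"
  shows "B_op \<Phi> p (B_op \<Phi> p f) = B_op \<Phi> p f"
proof -
  obtain g where g: "usable \<Phi> p g" using usable_exists[OF \<Phi> \<Phi>, of "{}" p] by auto
  obtain k where k: "usable \<Phi> p k" and kg: "k - g \<notin> \<X>" using usable_exists[OF \<Phi> \<Phi>, of "{g}" p] by auto
  note g' = usableD[OF g] and k' = usableD[OF k]
  let ?w = "B_deg \<Phi> p (- k) f"
  have w: "?w \<in> state_space (shift p (- k) \<Phi>)" by (rule B_deg_state_space[OF p f k'(2,3)])
  have "B_op \<Phi> p (B_op \<Phi> p f) = plaq_op \<Phi> p g (plaq_op \<Phi> p k f)"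
    using B_op_eq[OF \<Phi> p f k] B_op_eq[OF \<Phi> p plaq_op_state_space[OF \<Phi> p f k] g] by simp
  also have "\<dots> = B_deg (shift p (- g) \<Phi>) p g (B_deg (shift p (- k) \<Phi>) p (k - g) ?w)"
  proof -
    have sum: "- g + k = k - g" and sh: "shift p (k - g) (shift p (- k) \<Phi>) = shift p (- g) \<Phi>"
      by (simp_all add: shift_shift)
    have "B_deg \<Phi> p (- g) (B_deg (shift p (- k) \<Phi>) p k ?w) = B_deg (shift p (- k) \<Phi>) p (k - g) ?w"
      using B_deg_compose[OF p w g'(2) k'(1)] kg k'(3) g'(3) \<Phi> by (simp only: sum sh shift_cancel simp_thms)
    then show ?thesis by (simp add: plaq_op_def)
  qed
  also have "\<dots> = plaq_op \<Phi> p k f"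
    unfolding plaq_op_independent1(2)[OF \<Phi> p f g k kg w] plaq_op_def ..
  finally show ?thesis using B_op_eq[OF \<Phi> p f k] by simp
qed

text \<open>
  The colorings are named by variables here, so that equalities between iterated shifts are
  discharged once, when the lemma is applied.
\<close>

lemma B_deg_commute_at:
  assumes p: "p \<in> plaquettes T" and q: "q \<in> plaquettes T" and pq: "p \<noteq> q" and f: "f \<in> state_space \<Phi>"
    and g: "g \<notin> \<X>" and h: "h \<notin> \<X>"
    and eq: "shift p g \<Phi> = \<Phi>1" "shift q h \<Phi> = \<Phi>2" "shift q h \<Phi>1 = \<Phi>3"
    and \<Phi>: "admissible \<Phi>" "admissible \<Phi>1" "admissible \<Phi>2" "admissible \<Phi>3"
  shows "B_deg \<Phi>1 q h (B_deg \<Phi> p g f) = B_deg \<Phi>2 p g (B_deg \<Phi> q h f)"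
  using B_deg_commute[OF p q pq f g h \<Phi>(1)] \<Phi>(2-4)
  unfolding eq(3)[symmetric] unfolding eq(1,2)[symmetric] by blast

text \<open>
  The degree for \<open>q\<close> is chosen after that for \<open>p\<close> such that shifting \<open>\<Phi>\<close> on either plaquette and on
  both gives admissible colorings; then the operators can be exchanged one by one.
\<close>

lemma B_op_commute:
  assumes \<Phi>: "admissible \<Phi>" and p: "p \<in> plaquettes T" and q: "q \<in> plaquettes T" and f: "f \<in> state_space \<Phi>"
  shows "B_op \<Phi> p (B_op \<Phi> q f) = B_op \<Phi> q (B_op \<Phi> p f)"
proof (cases "p = q")
  case pq: False
  obtain g where g: "usable \<Phi> p g" using usable_exists[OF \<Phi> \<Phi>, of "{}" p] by auto
  note g' = usableD[OF g]
  let ?g = "shift p (- g) \<Phi>"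
  obtain h where h: "usable \<Phi> q h" "usable ?g q h" using usable_exists[OF \<Phi> g'(3), of "{}" q] by auto
  note h' = usableD[OF h(1)] and gh = usableD(3)[OF h(2)]
  let ?h = "shift q (- h) \<Phi>"
  let ?gh = "shift q (- h) ?g"
  have sh: "shift p (- g) ?h = ?gh" "shift q h ?gh = ?g" "shift p g ?gh = ?h" "shift q h ?h = \<Phi>" "shift p g ?g = \<Phi>"
    by (auto simp: delta_color_def fun_eq_iff)
  have space: "B_deg \<Phi> p (- g) x \<in> state_space ?g" "B_deg \<Phi> q (- h) x \<in> state_space ?h"
    if "x \<in> state_space \<Phi>" for x
    using B_deg_state_space[OF p that g'(2,3)] B_deg_state_space[OF q that h'(2,3)] .
  note pf = space(1)[OF f] and qf = space(2)[OF f]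
  have Bg: "B_deg ?g p g x \<in> state_space \<Phi>" if "x \<in> state_space ?g" for x
    using B_deg_state_space[OF p that g'(1)] \<Phi> by (simp only: shift_cancel)
  have 1: "B_deg \<Phi> p (- g) (B_deg ?h q h x) = B_deg ?gh q h (B_deg ?h p (- g) x)" if "x \<in> state_space ?h" for x
    by (rule B_deg_commute_at[OF q p pq[symmetric] that h'(1) g'(2) sh(4) sh(1) refl h'(3) \<Phi> gh g'(3)])
  have 2: "B_deg ?h p (- g) (B_deg \<Phi> q (- h) x) = B_deg ?g q (- h) (B_deg \<Phi> p (- g) x)" if "x \<in> state_space \<Phi>" for x
    by (rule B_deg_commute_at[OF q p pq[symmetric] that h'(2) g'(2) refl refl sh(1) \<Phi> h'(3) g'(3) gh])
  have 3: "B_deg ?g p g (B_deg ?gh q h x) = B_deg ?h q h (B_deg ?gh p g x)" if "x \<in> state_space ?gh" for x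
    by (rule B_deg_commute_at[OF q p pq[symmetric] that h'(1) g'(1) sh(2) sh(3) sh(5) gh g'(3) h'(3) \<Phi>])
  have 4: "B_deg ?gh p g (B_deg ?g q (- h) x) = B_deg \<Phi> q (- h) (B_deg ?g p g x)" if "x \<in> state_space ?g" for x
    by (rule B_deg_commute_at[OF q p pq[symmetric] that h'(2) g'(1) refl sh(5) sh(3) g'(3) gh \<Phi> h'(3)])
  have "B_op \<Phi> p (B_op \<Phi> q f) = plaq_op \<Phi> p g (plaq_op \<Phi> q h f)"
    using B_op_eq[OF \<Phi> q f h(1)] B_op_eq[OF \<Phi> p plaq_op_state_space[OF \<Phi> q f h(1)] g] by simp
  also have "\<dots> = B_deg ?g p g (B_deg ?gh q h (B_deg ?g q (- h) (B_deg \<Phi> p (- g) f)))"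
    unfolding plaq_op_def 1[OF qf] 2[OF f] ..
  also have "\<dots> = B_deg ?h q h (B_deg \<Phi> q (- h) (B_deg ?g p g (B_deg \<Phi> p (- g) f)))"
    unfolding 3[OF B_deg_state_space[OF q pf h'(2) gh]] 4[OF pf] ..
  also have "\<dots> = plaq_op \<Phi> q h (plaq_op \<Phi> p g f)" by (simp only: plaq_op_def)
  also have "\<dots> = B_op \<Phi> q (B_op \<Phi> p f)"
    using B_op_eq[OF \<Phi> p f g] B_op_eq[OF \<Phi> q plaq_op_state_space[OF \<Phi> p f g] h(1)] by simp
  finally show ?thesis .
qed simp

text \<open>
  The two factors of \<open>B\<^sub>p = B\<^sub>p\<^sup>g B\<^sub>p\<^sup>-\<^sup>g\<close> are adjoint to each other.
\<close>

lemma B_op_hermitian: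
  assumes \<Phi>: "admissible \<Phi>" and p: "p \<in> plaquettes T" and x: "x \<in> state_space \<Phi>" and y: "y \<in> state_space \<Phi>"
  shows "inner_prod (B_op \<Phi> p x) y = inner_prod x (B_op \<Phi> p y)"
proof -
  obtain g where g: "usable \<Phi> p g" using usable_exists[OF \<Phi> \<Phi>, of "{}" p] by auto
  note g' = usableD[OF g]
  note px = B_deg_state_space[OF p x g'(2,3)] and py = B_deg_state_space[OF p y g'(2,3)]
  have "inner_prod (plaq_op \<Phi> p g x) y = inner_prod (B_deg \<Phi> p (- g) x) (B_deg \<Phi> p (- g) y)"
    unfolding plaq_op_def using B_deg_adjoint[OF p g'(1,3) _ px, of y] y \<Phi> by (simp only: shift_cancel)
  also have "\<dots> = inner_prod x (plaq_op \<Phi> p g y)"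
    unfolding plaq_op_def using B_deg_adjoint[OF p g'(2) \<Phi> g'(3) x py] by simp
  finally show ?thesis using B_op_eq[OF \<Phi> p x g] B_op_eq[OF \<Phi> p y g] by simp
qed

lemma B_op_kernel:
  assumes \<Phi>: "admissible \<Phi>" and p: "p \<in> plaquettes T" and g: "usable \<Phi> p g" and f: "f \<in> state_space \<Phi>"
  shows "B_op \<Phi> p f = lin_ext (mat_comp (plaq_kernel \<Phi> p (- g)) (plaq_kernel (shift p (- g) \<Phi>) p g)) f"
  unfolding B_op_eq[OF \<Phi> p f g] plaq_op_def
  using \<Phi> by (intro B_deg_B_deg p f usableD[OF g]) (simp only: shift_cancel)



section \<open>Vertex projections\<close>

definition occupied :: "'v triangle \<Rightarrow> ('v, 'j) state \<Rightarrow> bool" where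
  "occupied v s \<longleftrightarrow> 1 \<le> snd s v \<and> snd s v \<le> vertex_mult (fst s) v"

lemma Q_op_apply:
  assumes "finite {s. f s \<noteq> 0}"
  shows "Q_op v f t = (if occupied v t then f t else 0)"
proof -
  have "Q_op v f t = (\<Sum>s\<in>insert t {s. f s \<noteq> 0}. f s * (if occupied v s then basis_vec s t else 0))"
    unfolding Q_op_def occupied_def[symmetric] by (rule lin_ext_superset) (use assms in auto)
  also have "\<dots> = (\<Sum>s\<in>insert t {s. f s \<noteq> 0}. if s = t then (if occupied v t then f t else 0) else 0)"
    by (intro sum.cong refl) (auto simp: basis_vec_def)
  also have "\<dots> = (if occupied v t then f t else 0)" using assms by simp
  finally show ?thesis .
qed

lemma Q_op_state:
  assumes "f \<in> state_space \<Phi>"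
  shows "Q_op v f = (\<lambda>t. if occupied v t then f t else 0)"
  using Q_op_apply[OF state_spaceD(1)[OF assms]] by (simp add: fun_eq_iff)

lemma Q_op_state_space:
  assumes "f \<in> state_space \<Phi>"
  shows "Q_op v f \<in> state_space \<Phi>"
proof -
  have "{t. Q_op v f t \<noteq> 0} \<subseteq> {t. f t \<noteq> 0}" unfolding Q_op_state[OF assms] by auto
  then show ?thesis using assms finite_subset unfolding state_space_def by blast
qed

text \<open>
  The matrix entries of a plaquette operator vanish unless the multiplicity indices at its corners
  are in range, before and after.
\<close>

lemma plaq_kernel_occupied:
  assumes s: "s \<in> states \<Phi>" and v: "v \<in> T" and nz: "plaq_kernel \<Phi> p g s t \<noteq> 0"
  shows "occupied v s \<longleftrightarrow> occupied v t"
proof -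
  obtain l where l: "plaq_coeff \<Phi> p l s t \<noteq> 0" using nz by (rule plaq_kernel_nonzero)
  note c = plaq_coeff_nonzero[OF l]
  show ?thesis
  proof (cases "v \<in> corners T p")
    case True
    then obtain e where e: "e \<in> sides T p" "v = target T e" unfolding corners_def by blast
    show ?thesis
      using amplitude_vertex_range[OF c(3) e(1) states_prestates[OF s] states_prestates[OF c(1)]
          agree_off_leg[OF c(2) e(1)]] by (simp add: e(2) occupied_def)
  next
    case False
    have "vertex_mult (fst t) v = vertex_mult (fst s) v"
      using v c(2) target_off_corner False unfolding agree_off_def by (intro vertex_mult_cong) auto
    then show ?thesis using c(2) v False unfolding agree_off_def occupied_def by auto
  qed
qed

lemma B_op_Q_op_commute:
  assumes \<Phi>: "admissible \<Phi>" and p: "p \<in> plaquettes T" and v: "v \<in> T" and f: "f \<in> state_space \<Phi>"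
  shows "B_op \<Phi> p (Q_op v f) = Q_op v (B_op \<Phi> p f)"
proof
  fix t
  obtain g where g: "usable \<Phi> p g" using usable_exists[OF \<Phi> \<Phi>, of "{}" p] by auto
  note g' = usableD[OF g]
  define M where "M = mat_comp (plaq_kernel \<Phi> p (- g)) (plaq_kernel (shift p (- g) \<Phi>) p g)"
  have M: "occupied v s \<longleftrightarrow> occupied v t" if s: "s \<in> states \<Phi>" and nz: "M s t \<noteq> 0" for s
  proof -
    obtain r where r: "plaq_kernel \<Phi> p (- g) s r \<noteq> 0" "plaq_kernel (shift p (- g) \<Phi>) p g r t \<noteq> 0"
      using nz unfolding M_def by (rule mat_comp_nonzero)
    have "r \<in> states (shift p (- g) \<Phi>)" using plaq_kernel_row(2)[OF s g'(2,3)] r(1) by blast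
    then show ?thesis using plaq_kernel_occupied[OF s v r(1)] plaq_kernel_occupied[OF _ v r(2)] by blast
  qed
  note fin = state_spaceD(1)[OF f]
  have "B_op \<Phi> p (Q_op v f) t = lin_ext M (Q_op v f) t"
    unfolding B_op_kernel[OF \<Phi> p g Q_op_state_space[OF f]] M_def ..
  also have "\<dots> = (\<Sum>s | f s \<noteq> 0. Q_op v f s * M s t)"
    by (rule lin_ext_superset[OF fin]) (auto simp: Q_op_state[OF f])
  also have "\<dots> = (\<Sum>s | f s \<noteq> 0. if occupied v t then f s * M s t else 0)"
  proof (intro sum.cong refl)
    fix s assume "s \<in> {s. f s \<noteq> 0}"
    then have "s \<in> states \<Phi>" using state_spaceD(2)[OF f] by simp
    then show "Q_op v f s * M s t = (if occupied v t then f s * M s t else 0)"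
      using M[of s] by (cases "M s t = 0") (simp_all add: Q_op_state[OF f])
  qed
  also have "\<dots> = (if occupied v t then lin_ext M f t else 0)" by (simp add: lin_ext_def)
  also have "\<dots> = Q_op v (B_op \<Phi> p f) t"
    using Q_op_state[OF B_op_state_space[OF \<Phi> p f], of v] B_op_kernel[OF \<Phi> p g f] by (simp add: M_def)
  finally show "B_op \<Phi> p (Q_op v f) t = Q_op v (B_op \<Phi> p f) t" .
qed

lemma Q_op_hermitian:
  assumes x: "x \<in> state_space \<Phi>" and y: "y \<in> state_space \<Phi>"
  shows "inner_prod (Q_op v x) y = inner_prod x (Q_op v y)"
proof -
  let ?S = "{s. x s \<noteq> 0}"
  have fin: "finite ?S" using state_spaceD(1)[OF x] .
  have "inner_prod (Q_op v x) y = (\<Sum>s\<in>?S. cnj (Q_op v x s) * y s * weight s)"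
    by (rule inner_prod_superset[OF fin]) (auto simp: Q_op_state[OF x])
  also have "\<dots> = (\<Sum>s\<in>?S. cnj (x s) * Q_op v y s * weight s)"
    by (intro sum.cong refl) (simp add: Q_op_state[OF x] Q_op_state[OF y])
  also have "\<dots> = inner_prod x (Q_op v y)"
    by (rule inner_prod_superset[OF fin, symmetric]) auto
  finally show ?thesis .
qed

section \<open>Locality\<close>

lemma state_space_closed: "lin_closed (state_space \<Phi>)" "(\<lambda>_. 0) \<in> state_space \<Phi>"
proof -
  show "lin_closed (state_space \<Phi>)"
    unfolding lin_closed_def
  proof (intro ballI allI)
    fix x y c d assume x: "x \<in> state_space \<Phi>" and y: "y \<in> state_space \<Phi>"
    have "{s. c * x s + d * y s \<noteq> 0} \<subseteq> {s. x s \<noteq> 0} \<union> {s. y s \<noteq> 0}" by auto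
    moreover have "finite ({s. x s \<noteq> 0} \<union> {s. y s \<noteq> 0})" using state_spaceD(1) x y by blast
    moreover have "{s. x s \<noteq> 0} \<union> {s. y s \<noteq> 0} \<subseteq> states \<Phi>" using state_spaceD(2) x y by blast
    ultimately show "(\<lambda>s. c * x s + d * y s) \<in> state_space \<Phi>"
      unfolding state_space_def using finite_subset by blast
  qed
qed (simp add: state_space_def)

lemma linear_operator_iff: "linear_operator \<Phi> F \<longleftrightarrow> linear_on (state_space \<Phi>) F"
  by (simp add: linear_operator_def linear_on_def)

lemma linear_on_complement:
  assumes "linear_on (state_space \<Phi>) F"
  shows "linear_on (state_space \<Phi>) (\<lambda>x s. x s - F x s)"
proof -
  have "linear_on (state_space \<Phi>) (\<lambda>x. x)" by (rule linear_onI) simp_all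
  from linear_on_comb[OF state_space_closed(1) this assms, of 1 "- 1"] show ?thesis by simp
qed

lemma B_op_linear:
  assumes \<Phi>: "admissible \<Phi>" and p: "p \<in> plaquettes T"
  shows "linear_on (state_space \<Phi>) (B_op \<Phi> p)"
proof (rule linear_onI)
  show "B_op \<Phi> p x \<in> state_space \<Phi>" if "x \<in> state_space \<Phi>" for x by (rule B_op_state_space[OF \<Phi> p that])
  fix x y c d s assume x: "x \<in> state_space \<Phi>" and y: "y \<in> state_space \<Phi>"
  obtain g where g: "usable \<Phi> p g" using usable_exists[OF \<Phi> \<Phi>, of "{}" p] by auto
  note xy = lin_closedD[OF state_space_closed(1) x y, of c d]
  show "B_op \<Phi> p (\<lambda>s. c * x s + d * y s) s = c * B_op \<Phi> p x s + d * B_op \<Phi> p y s"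
    unfolding B_op_kernel[OF \<Phi> p g x] B_op_kernel[OF \<Phi> p g y] B_op_kernel[OF \<Phi> p g xy]
    by (rule lin_ext_linear[OF state_spaceD(1)[OF x] state_spaceD(1)[OF y]])
qed

lemma Q_op_linear: "linear_on (state_space \<Phi>) (Q_op v)"
proof (rule linear_onI)
  show "Q_op v x \<in> state_space \<Phi>" if "x \<in> state_space \<Phi>" for x by (rule Q_op_state_space[OF that])
  fix x y c d s assume x: "x \<in> state_space \<Phi>" and y: "y \<in> state_space \<Phi>"
  show "Q_op v (\<lambda>s. c * x s + d * y s) s = c * Q_op v x s + d * Q_op v y s"
    unfolding Q_op_state[OF x] Q_op_state[OF y] Q_op_state[OF lin_closedD[OF state_space_closed(1) x y]] by simp
qed

lemma prestates_eqI:
  assumes "s \<in> prestates \<Phi>" "t \<in> prestates \<Phi>'"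
    and "\<And>e. e \<in> oriented_edges T \<Longrightarrow> fst s e = fst t e" "\<And>v. v \<in> T \<Longrightarrow> snd s v = snd t v"
  shows "s = t"
proof (rule prod_eqI; rule ext)
  show "fst s e = fst t e" for e
    using assms(3)[of e] prestate_outside(1)[OF assms(1)] prestate_outside(1)[OF assms(2)] by (cases "e \<in> oriented_edges T") auto
  show "snd s v = snd t v" for v
    using assms(4)[of v] prestate_outside(2)[OF assms(1)] prestate_outside(2)[OF assms(2)] by (cases "v \<in> T") auto
qed

text \<open>
  The identity operator is local: whether two states are equal is decided on \<open>E\<close> and \<open>V\<close> if they
  agree elsewhere.
\<close>

lemma basis_vec_local:
  assumes "s \<in> states \<Phi>" "t \<in> states \<Phi>" "s' \<in> states \<Phi>" "t' \<in> states \<Phi>"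
    and "agree_off E V s t" "agree_off E V s' t'" "agree_on E V s s'" "agree_on E V t t'"
  shows "basis_vec s t = (basis_vec s' t' :: complex)"
proof -
  have "t = s" if "t' = s'" "s \<in> states \<Phi>" "t \<in> states \<Phi>"
    "agree_off E V s t" "agree_on E V s s'" "agree_on E V t t'" for s t s' t' :: "('v, 'j) state"
  proof (rule prestates_eqI[OF states_prestates[OF that(3)] states_prestates[OF that(2)]])
    show "fst t e = fst s e" if "e \<in> oriented_edges T" for e
      using that \<open>t' = s'\<close> \<open>agree_off E V s t\<close> \<open>agree_on E V s s'\<close> \<open>agree_on E V t t'\<close>
      unfolding agree_off_def agree_on_def by (cases "e \<in> E") auto
    show "snd t v = snd s v" if "v \<in> T" for v
      using that \<open>t' = s'\<close> \<open>agree_off E V s t\<close> \<open>agree_on E V s s'\<close> \<open>agree_on E V t t'\<close>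
      unfolding agree_off_def agree_on_def by (cases "v \<in> V") auto
  qed
  moreover have "agree_on E V s' s" "agree_on E V t' t" using assms(7,8) unfolding agree_on_def by auto
  ultimately have "t = s \<longleftrightarrow> t' = s'" using assms by metis
  then show ?thesis by (simp add: basis_vec_def)
qed

lemma agree_on_vertex_mult:
  assumes "v \<in> V" "v \<in> T" "agree_on (incident V) V s s'"
  shows "vertex_mult (fst s) v = vertex_mult (fst s') v" "snd s v = snd s' v"
proof -
  show "vertex_mult (fst s) v = vertex_mult (fst s') v"
    using assms unfolding agree_on_def incident_def by (intro vertex_mult_cong) auto
  show "snd s v = snd s' v" using assms unfolding agree_on_def by auto
qed

lemma Q_op_supported:
  assumes v: "v \<in> T"
  shows "supported_on \<Phi> {v} (\<lambda>x s. x s - Q_op v x s)"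
  unfolding supported_on_def
proof (intro conjI ballI impI)
  show "linear_operator \<Phi> (\<lambda>x s. x s - Q_op v x s)"
    unfolding linear_operator_iff by (rule linear_on_complement[OF Q_op_linear])
  have Q: "basis_vec s t - Q_op v (basis_vec s) t = (if occupied v t then 0 else basis_vec s t)" for s t
  proof -
    have "finite {t. basis_vec s t \<noteq> (0 :: complex)}" by (rule finite_subset[of _ "{s}"]) (auto simp: basis_vec_def)
    then show ?thesis using Q_op_apply[of "basis_vec s"] by simp
  qed
  fix s t assume s: "s \<in> states \<Phi>" and t: "t \<in> states \<Phi>"
  show "agree_off (incident {v}) {v} s t" if "basis_vec s t - Q_op v (basis_vec s) t \<noteq> 0"
    using that unfolding Q by (auto simp: basis_vec_def agree_off_def split: if_splits)
  fix s' t' assume s': "s' \<in> states \<Phi>" and t': "t' \<in> states \<Phi>"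
    and a: "agree_off (incident {v}) {v} s t \<and> agree_off (incident {v}) {v} s' t' \<and>
      agree_on (incident {v}) {v} s s' \<and> agree_on (incident {v}) {v} t t'"
  have "basis_vec s t = (basis_vec s' t' :: complex)"
    using basis_vec_local[OF s t s' t'] a by blast
  moreover have "occupied v t = occupied v t'"
    using agree_on_vertex_mult[OF _ v, of "{v}" t t'] a by (simp add: occupied_def)
  ultimately show "basis_vec s t - Q_op v (basis_vec s) t = basis_vec s' t' - Q_op v (basis_vec s') t'"
    unfolding Q by simp
qed

definition same_local :: "'v \<Rightarrow> ('v, 'j) state \<Rightarrow> ('v, 'j) state \<Rightarrow> bool" where
  "same_local p s s' \<longleftrightarrow> local_data p s = local_data p s' \<and> (\<forall>e\<in>sides T p. fst s (leg T e) = fst s' (leg T e))"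

lemma same_localD:
  assumes "same_local p s s'" "e \<in> sides T p"
  shows "fst s e = fst s' e" "snd s (target T e) = snd s' (target T e)" "fst s (leg T e) = fst s' (leg T e)"
proof -
  have "local_data p s e = local_data p s' e" using assms by (simp add: same_local_def)
  then show "fst s e = fst s' e" "snd s (target T e) = snd s' (target T e)"
    using assms(2) by (simp_all add: local_data_def)
  show "fst s (leg T e) = fst s' (leg T e)" using assms by (simp add: same_local_def)
qed

lemma amplitude_local:
  assumes s: "same_local p s s'" and r: "same_local p r r'"
  shows "amplitude p l s r = amplitude p l s' r'"
  unfolding amplitude_def
proof (intro sum.cong prod.cong PiE_cong refl)
  fix e assume e: "e \<in> sides T p"
  show "{1..\<delta> (fst r e) l ((fst s e)\<^sup>\<star>)} = {1..\<delta> (fst r' e) l ((fst s' e)\<^sup>\<star>)}"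
    using same_localD[OF s e] same_localD[OF r e] by simp
  show "corner_coeff l s r A e = corner_coeff l s' r' A e" for A
    using same_localD[OF s e] same_localD[OF r e] same_localD[OF s next_side_in[OF e]]
      same_localD[OF r next_side_in[OF e]] by (simp add: corner_coeff_def)
qed

lemma plaq_kernel_local:
  assumes "same_local p s s'" "same_local p r r'"
    and "r \<in> states (shift p g \<Phi>)" "r' \<in> states (shift p g \<Phi>)"
    and "agree_off (boundary_edges T p) (corners T p) s r" "agree_off (boundary_edges T p) (corners T p) s' r'"
  shows "plaq_kernel \<Phi> p g s r = plaq_kernel \<Phi> p g s' r'"
proof -
  have "(\<lambda>l. if l \<in> I g then \<b> l * plaq_coeff \<Phi> p l s r else 0)
    = (\<lambda>l. if l \<in> I g then \<b> l * plaq_coeff \<Phi> p l s' r' else 0)"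
    using assms(3-6) amplitude_local[OF assms(1,2)] by (auto simp: fun_eq_iff plaq_coeff_alt homog_def)
  then show ?thesis unfolding plaq_kernel_def by (rule arg_cong)
qed

lemma plaq_kernel_agree_off:
  "plaq_kernel \<Phi> p g s r \<noteq> 0 \<Longrightarrow> agree_off (boundary_edges T p) (corners T p) s r"
  by (erule plaq_kernel_nonzero) (rule plaq_coeff_nonzero(2))

text \<open>A transition of a state can be transported to every state that looks the same around the plaquette.\<close>

lemma transport_transition:
  assumes s: "s \<in> states \<Phi>" and s': "s' \<in> states \<Phi>" and loc: "same_local p s s'" and \<Phi>: "coloring \<Phi>"
    and r: "r \<in> states (shift p g \<Phi>)" and agree: "agree_off (boundary_edges T p) (corners T p) s r"
  defines "r' \<equiv> update p s' (local_data p r)"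
  shows "r' \<in> states (shift p g \<Phi>)" "agree_off (boundary_edges T p) (corners T p) s' r'" "same_local p r r'"
    "update p s (local_data p r') = r"
proof -
  have ext: "local_data p r \<in> extensional (sides T p)" by (simp add: local_data_def)
  have ld: "local_data p r' = local_data p r" unfolding r'_def by (rule local_data_update[OF ext])
  show a: "agree_off (boundary_edges T p) (corners T p) s' r'" unfolding r'_def by (rule update_agree_off)
  show sl: "same_local p r r'"
    unfolding same_local_def ld using agree_off_leg[OF agree] agree_off_leg[OF a] same_localD(3)[OF loc] by simp
  have pre: "r' \<in> prestates (shift p g \<Phi>)"
    unfolding r'_def
  proof (rule update_prestates[OF states_prestates[OF s'] \<Phi>])
    fix e assume e: "e \<in> sides T p"
    show "fst (local_data p r e) \<in> I (\<Phi> e - g)"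
      using prestate_label(4)[OF states_prestates[OF r] sides_oriented[OF e]] e by (simp add: local_data_def)
  qed
  show "r' \<in> states (shift p g \<Phi>)"
  proof (rule states_of_agree_off[OF s' pre a])
    fix e assume e: "e \<in> sides T p"
    have "snd r (target T e) \<le> vertex_mult (fst r) (target T e)"
      using r corner_target[OF e] corners_subset unfolding states_iff by blast
    then show "snd r' (target T e) \<le> vertex_mult (fst r') (target T e)"
      using same_localD[OF sl e] same_localD[OF sl next_side_in[OF e]]
      by (simp add: vertex_mult_state[OF states_prestates[OF r] e] vertex_mult_state[OF pre e])
  qed
  show "update p s (local_data p r') = r"
    unfolding ld by (rule update_local_data[OF states_prestates[OF s] states_prestates[OF r] agree])
qed

lemma same_local_sym: "same_local p s s' \<Longrightarrow> same_local p s' s"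
  by (simp add: same_local_def)

text \<open>
  The intermediate states for one pair of states are in bijection with those for the other pair, by
  transport of the local data.
\<close>

lemma mat_comp_local:
  assumes \<Phi>: "admissible \<Phi>" and g: "usable \<Phi> p g"
    and s: "s \<in> states \<Phi>" and t: "t \<in> states \<Phi>" and s': "s' \<in> states \<Phi>" and t': "t' \<in> states \<Phi>"
    and loc: "same_local p s s'" "same_local p t t'"
    and agree: "agree_off (boundary_edges T p) (corners T p) s t" "agree_off (boundary_edges T p) (corners T p) s' t'"
  shows "mat_comp (plaq_kernel \<Phi> p (- g)) (plaq_kernel (shift p (- g) \<Phi>) p g) s t
    = mat_comp (plaq_kernel \<Phi> p (- g)) (plaq_kernel (shift p (- g) \<Phi>) p g) s' t'"
proof -
  note g' = usableD[OF g] and col = admissible_coloring[OF \<Phi>]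
  let ?K = "plaq_kernel \<Phi> p (- g)" and ?K' = "plaq_kernel (shift p (- g) \<Phi>) p g"
  \<comment> \<open>The statement is symmetric in the two pairs of states, so that one direction suffices.\<close>
  have one: "update p s' (local_data p r) \<in> {r. ?K s' r \<noteq> 0} \<and> update p s (local_data p (update p s' (local_data p r))) = r
      \<and> ?K s' (update p s' (local_data p r)) * ?K' (update p s' (local_data p r)) t' = ?K s r * ?K' r t"
    if s: "s \<in> states \<Phi>" and s': "s' \<in> states \<Phi>" and t: "t \<in> states \<Phi>" and t': "t' \<in> states \<Phi>"
      and loc: "same_local p s s'" "same_local p t t'"
      and agree: "agree_off (boundary_edges T p) (corners T p) s t" "agree_off (boundary_edges T p) (corners T p) s' t'"
      and nz: "?K s r \<noteq> 0" for s s' t t' r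
  proof -
    have r: "r \<in> states (shift p (- g) \<Phi>)" using plaq_kernel_row(2)[OF s g'(2,3)] nz by blast
    note sr = plaq_kernel_agree_off[OF nz]
    note tr = transport_transition[OF s s' loc(1) col r sr]
    let ?r = "update p s' (local_data p r)"
    have "?K s' ?r = ?K s r" using plaq_kernel_local[OF loc(1) tr(3) r tr(1) sr tr(2)] by simp
    moreover have "?K' ?r t' = ?K' r t"
      using plaq_kernel_local[where g = g and \<Phi> = "shift p (- g) \<Phi>", OF tr(3) loc(2)] t t'
        agree_off_trans[OF agree_off_sym[OF sr] agree(1)] agree_off_trans[OF agree_off_sym[OF tr(2)] agree(2)]
      by (simp only: shift_cancel)
    ultimately show ?thesis using nz tr(4) by simp
  qed
  note fwd = one[OF s s' t t' loc agree]
    and bwd = one[OF s' s t' t same_local_sym[OF loc(1)] same_local_sym[OF loc(2)] agree(2,1)]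
  show ?thesis
    unfolding mat_comp_def
    by (rule sum.reindex_bij_witness[where i = "\<lambda>r. update p s (local_data p r)"
          and j = "\<lambda>r. update p s' (local_data p r)"]) (use fwd bwd in simp_all)
qed

lemma boundary_incident: "boundary_edges T p \<subseteq> incident (corners T p)"
proof
  fix e assume "e \<in> boundary_edges T p"
  then show "e \<in> incident (corners T p)"
    using corner_target[of e p] corner_target[of "prod.swap e" p] sides_oriented[of e p]
      sides_oriented[of "prod.swap e" p] oriented_edges_swap_iff[of e]
    by (auto simp: incident_def swap_image_iff)
qed

lemma leg_incident:
  assumes "e \<in> sides T p"
  shows "leg T e \<in> incident (corners T p)"
proof -
  obtain x y where x: "e = (p, x)" "ccw T p x y" "leg T e = (y, x)" using assms by (rule side_cases)
  have "target T (prod.swap (leg T e)) \<in> corners T p"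
    using target_rotate[OF x(2)] corner_target[OF assms] x by simp
  then show ?thesis using leg_oriented[OF assms] by (simp add: incident_def)
qed

lemma agree_on_same_local:
  assumes "agree_on (incident (corners T p)) (corners T p) s s'"
  shows "same_local p s s'"
proof -
  have "fst s e = fst s' e \<and> snd s (target T e) = snd s' (target T e) \<and> fst s (leg T e) = fst s' (leg T e)"
    if e: "e \<in> sides T p" for e
  proof -
    have "e \<in> incident (corners T p)" using boundary_incident e by blast
    moreover have "target T e \<in> T" using corner_target[OF e] corners_subset by blast
    ultimately show ?thesis
      using assms e sides_oriented[OF e] leg_oriented[OF e] leg_incident[OF e] corner_target[OF e]
      unfolding agree_on_def by blast
  qed
  then show ?thesis by (simp add: same_local_def local_data_def fun_eq_iff restrict_def)
qed

lemma agree_off_boundary_transfer: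
  assumes "agree_off (boundary_edges T p) (corners T p) s t"
    and "agree_off (incident (corners T p)) (corners T p) s' t'"
    and "agree_on (incident (corners T p)) (corners T p) s s'" "agree_on (incident (corners T p)) (corners T p) t t'"
  shows "agree_off (boundary_edges T p) (corners T p) s' t'"
  unfolding agree_off_def
proof (intro conjI ballI)
  fix e assume e: "e \<in> oriented_edges T - boundary_edges T p"
  show "fst s' e = fst t' e"
  proof (cases "e \<in> incident (corners T p)")
    case True
    then have "fst s e = fst s' e" "fst t e = fst t' e" "fst s e = fst t e"
      using e assms(1,3,4) unfolding agree_off_def agree_on_def by blast+
    then show ?thesis by simp
  next
    case False
    then show ?thesis using e assms(2) unfolding agree_off_def by blast
  qed
next
  fix v assume "v \<in> T - corners T p"
  then show "snd s' v = snd t' v" using assms(2) unfolding agree_off_def by blast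
qed

lemma B_op_supported:
  assumes \<Phi>: "admissible \<Phi>" and p: "p \<in> plaquettes T"
  shows "supported_on \<Phi> (corners T p) (\<lambda>x s. x s - B_op \<Phi> p x s)"
proof -
  obtain g where g: "usable \<Phi> p g" using usable_exists[OF \<Phi> \<Phi>, of "{}" p] by auto
  note g' = usableD[OF g]
  let ?V = "corners T p" and ?E = "incident (corners T p)"
  define M where "M = mat_comp (plaq_kernel \<Phi> p (- g)) (plaq_kernel (shift p (- g) \<Phi>) p g)"
  have B: "B_op \<Phi> p (basis_vec s) = M s" if "s \<in> states \<Phi>" for s
    unfolding B_op_kernel[OF \<Phi> p g basis_vec_state_space[OF that]] M_def by (rule lin_ext_basis)
  have agree: "agree_off (boundary_edges T p) ?V s t" if nz: "M s t \<noteq> 0" for s t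
  proof -
    obtain r where "plaq_kernel \<Phi> p (- g) s r \<noteq> 0" "plaq_kernel (shift p (- g) \<Phi>) p g r t \<noteq> 0"
      using nz unfolding M_def by (rule mat_comp_nonzero)
    from agree_off_trans[OF this[THEN plaq_kernel_agree_off]] show ?thesis .
  qed
  show ?thesis
    unfolding supported_on_def
  proof (intro conjI ballI impI)
    show "linear_operator \<Phi> (\<lambda>x s. x s - B_op \<Phi> p x s)"
      unfolding linear_operator_iff by (rule linear_on_complement[OF B_op_linear[OF \<Phi> p]])
    fix s t assume s: "s \<in> states \<Phi>" and t: "t \<in> states \<Phi>"
    show "agree_off ?E ?V s t" if nz: "basis_vec s t - B_op \<Phi> p (basis_vec s) t \<noteq> 0"
    proof (cases "s = t")
      case True
      then show ?thesis by (simp add: agree_off_def)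
    next
      case False
      then have "basis_vec s t = (0 :: complex)" by (simp add: basis_vec_def)
      then have "M s t \<noteq> 0" using nz unfolding B[OF s] by simp
      from agree_off_mono[OF agree[OF this] boundary_incident subset_refl] show ?thesis .
    qed
    fix s' t' assume s': "s' \<in> states \<Phi>" and t': "t' \<in> states \<Phi>"
      and a: "agree_off ?E ?V s t \<and> agree_off ?E ?V s' t' \<and> agree_on ?E ?V s s' \<and> agree_on ?E ?V t t'"
    have a': "agree_on ?E ?V s' s" "agree_on ?E ?V t' t" using a unfolding agree_on_def by auto
    have "M s t = M s' t'"
    proof (cases "agree_off (boundary_edges T p) ?V s t")
      case True
      have "agree_off (boundary_edges T p) ?V s' t'" using agree_off_boundary_transfer[OF True] a by blast
      then show ?thesis
        unfolding M_def using agree_on_same_local a by (intro mat_comp_local[OF \<Phi> g s t s' t'] True) auto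
    next
      case False
      have "\<not> agree_off (boundary_edges T p) ?V s' t'"
        using agree_off_boundary_transfer[of p s' t' s t] a a' False by blast
      then show ?thesis using agree False by metis
    qed
    then show "basis_vec s t - B_op \<Phi> p (basis_vec s) t = basis_vec s' t' - B_op \<Phi> p (basis_vec s') t'"
      using basis_vec_local[OF s t s' t', of ?E ?V] a by (simp add: B[OF s] B[OF s'])
  qed
qed

section \<open>The Hamiltonian\<close>

definition penalty :: "('v \<times> 'v \<Rightarrow> 'g) \<Rightarrow> 'v + 'v triangle \<Rightarrow> ('v, 'j) vec \<Rightarrow> ('v, 'j) vec" where
  "penalty \<Phi> i x = (\<lambda>s. x s - (case i of Inl p \<Rightarrow> B_op \<Phi> p x s | Inr v \<Rightarrow> Q_op v x s))"

lemma hamiltonian_penalty: "hamiltonian \<Phi> x = (\<lambda>s. \<Sum>i\<in>plaquettes T <+> T. penalty \<Phi> i x s)"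
  unfolding hamiltonian_def penalty_def
  by (subst sum.Plus[OF finite_plaquettes finite_T]) simp

lemma penalty_linear:
  assumes "admissible \<Phi>" "i \<in> plaquettes T <+> T"
  shows "linear_on (state_space \<Phi>) (penalty \<Phi> i)"
  using assms(2)
proof (elim PlusE)
  fix p assume "i = Inl p" "p \<in> plaquettes T"
  then show ?thesis using linear_on_complement[OF B_op_linear[OF assms(1), of p]] by (simp add: penalty_def[abs_def])
next
  fix v assume "i = Inr v"
  then show ?thesis using linear_on_complement[OF Q_op_linear, of \<Phi> v] by (simp add: penalty_def[abs_def])
qed

lemma complement_commute:
  assumes F: "linear_on W F" and G: "linear_on W G" and x: "x \<in> W" and FG: "F (G x) = G (F x)"
  shows "(\<lambda>s. (x s - G x s) - F (\<lambda>s. x s - G x s) s) = (\<lambda>s. (x s - F x s) - G (\<lambda>s. x s - F x s) s)"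
  unfolding linear_on_diff[OF F x linear_on_mem[OF G x]] linear_on_diff[OF G x linear_on_mem[OF F x]] FG
  by (simp add: algebra_simps)

lemma penalty_commute:
  assumes \<Phi>: "admissible \<Phi>" and i: "i \<in> plaquettes T <+> T" and j: "j \<in> plaquettes T <+> T"
    and x: "x \<in> state_space \<Phi>"
  shows "penalty \<Phi> i (penalty \<Phi> j x) = penalty \<Phi> j (penalty \<Phi> i x)"
proof -
  define F where "F i = (case i of Inl p \<Rightarrow> B_op \<Phi> p | Inr v \<Rightarrow> Q_op v)" for i
  have pen: "penalty \<Phi> i y = (\<lambda>s. y s - F i y s)" for i y
    unfolding penalty_def F_def by (cases i) simp_all
  have lin: "linear_on (state_space \<Phi>) (F i)" if "i \<in> plaquettes T <+> T" for i
    using that B_op_linear[OF \<Phi>] Q_op_linear unfolding F_def by auto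
  have "Q_op v (Q_op w x) = Q_op w (Q_op v x)" for v w
    unfolding Q_op_state[OF Q_op_state_space[OF x]] unfolding Q_op_state[OF x] by auto
  then have "F i (F j x) = F j (F i x)"
    using i j B_op_commute[OF \<Phi> _ _ x] B_op_Q_op_commute[OF \<Phi> _ _ x] unfolding F_def by (elim PlusE) simp_all
  from complement_commute[OF lin[OF i] lin[OF j] x this] show ?thesis unfolding pen .
qed

lemma penalty_idempotent:
  assumes \<Phi>: "admissible \<Phi>" and i: "i \<in> plaquettes T <+> T" and x: "x \<in> state_space \<Phi>"
  shows "penalty \<Phi> i (penalty \<Phi> i x) = penalty \<Phi> i x"
proof -
  have *: "(\<lambda>s. (x s - F x s) - F (\<lambda>s. x s - F x s) s) = (\<lambda>s. x s - F x s)"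
    if "linear_on (state_space \<Phi>) F" "F (F x) = F x" for F
    unfolding linear_on_diff[OF that(1) x linear_on_mem[OF that(1) x]] that(2) by simp
  have "Q_op v (Q_op v x) = Q_op v x" for v
    unfolding Q_op_state[OF Q_op_state_space[OF x]] unfolding Q_op_state[OF x] by auto
  then show ?thesis
    using i *[OF B_op_linear[OF \<Phi>] B_op_idempotent[OF \<Phi> _ x]] *[OF Q_op_linear]
    unfolding penalty_def by (elim PlusE) simp_all
qed

lemma hamiltonian_linear:
  assumes "admissible \<Phi>"
  shows "linear_operator \<Phi> (hamiltonian \<Phi>)"
  unfolding linear_operator_iff hamiltonian_penalty[abs_def]
  by (rule linear_on_sum[OF state_space_closed penalty_linear[OF assms]])

lemma spectrum_hamiltonian:
  assumes \<Phi>: "admissible \<Phi>"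
  shows "spectrum \<Phi> (hamiltonian \<Phi>) \<subseteq> \<nat>"
proof
  fix z assume z: "z \<in> spectrum \<Phi> (hamiltonian \<Phi>)"
  show "z \<in> \<nat>"
  proof (rule ccontr)
    assume "z \<notin> \<nat>"
    have "bij_betw (\<lambda>x s. (\<Sum>i\<in>plaquettes T <+> T. penalty \<Phi> i x s) - z * x s) (state_space \<Phi>) (state_space \<Phi>)"
      by (rule sum_of_commuting_projections_bij[OF _ state_space_closed penalty_linear[OF \<Phi>]
            penalty_idempotent[OF \<Phi>] penalty_commute[OF \<Phi>] \<open>z \<notin> \<nat>\<close>])
        (simp_all add: finite_plaquettes finite_T)
    then show False using z by (simp add: spectrum_def hamiltonian_penalty)
  qed
qed

lemma ground_states:
  assumes \<Phi>: "admissible \<Phi>" and x: "x \<in> state_space \<Phi>"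
  shows "hamiltonian \<Phi> x = (\<lambda>_. 0) \<longleftrightarrow> (\<forall>p\<in>plaquettes T. B_op \<Phi> p x = x) \<and> (\<forall>v\<in>T. Q_op v x = x)"
proof
  assume 0: "hamiltonian \<Phi> x = (\<lambda>_. 0)"
  have pen: "penalty \<Phi> i x = (\<lambda>_. 0)" if "i \<in> plaquettes T <+> T" for i
    by (rule sum_of_commuting_projections_kernel[OF _ state_space_closed penalty_linear[OF \<Phi>]
            penalty_idempotent[OF \<Phi>] penalty_commute[OF \<Phi>] x 0[unfolded hamiltonian_penalty] that])
      (simp_all add: finite_plaquettes finite_T)
  have "B_op \<Phi> p x = x" if "p \<in> plaquettes T" for p
    using pen[OF InlI[OF that]] by (simp add: penalty_def fun_eq_iff)
  moreover have "Q_op v x = x" if "v \<in> T" for v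
    using pen[OF InrI[OF that]] by (simp add: penalty_def fun_eq_iff)
  ultimately show "(\<forall>p\<in>plaquettes T. B_op \<Phi> p x = x) \<and> (\<forall>v\<in>T. Q_op v x = x)" by blast
qed (simp add: hamiltonian_def)

lemma hamiltonian_hermitian:
  assumes \<Phi>: "admissible \<Phi>"
  shows "hermitian \<Phi> (hamiltonian \<Phi>)"
  unfolding hermitian_def
proof (intro ballI)
  fix x y assume x: "x \<in> state_space \<Phi>" and y: "y \<in> state_space \<Phi>"
  let ?I = "plaquettes T <+> T"
  let ?F = "\<lambda>i. case i of Inl p \<Rightarrow> B_op \<Phi> p | Inr v \<Rightarrow> Q_op v"
  have sym: "inner_prod (?F i x) y = inner_prod x (?F i y)" if "i \<in> ?I" for i
    using that B_op_hermitian[OF \<Phi> _ x y] Q_op_hermitian[OF x y] by auto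
  have Ham: "hamiltonian \<Phi> z = (\<lambda>s. \<Sum>i\<in>?I. z s - ?F i z s)" for z
    unfolding hamiltonian_penalty penalty_def by (intro ext sum.cong refl) (auto split: sum.splits)
  have finX: "finite {s. x s \<noteq> 0}" and finY: "finite {s. y s \<noteq> 0}" using state_spaceD(1) x y by blast+
  have "inner_prod (hamiltonian \<Phi> x) y = (\<Sum>s | y s \<noteq> 0. cnj (hamiltonian \<Phi> x s) * y s * weight s)"
    by (rule inner_prod_superset[OF finY]) blast
  also have "\<dots> = (\<Sum>s | y s \<noteq> 0. \<Sum>i\<in>?I. cnj (x s) * y s * weight s - cnj (?F i x s) * y s * weight s)"
    unfolding Ham by (simp add: sum_distrib_left sum_distrib_right algebra_simps)
  also have "\<dots> = (\<Sum>i\<in>?I. \<Sum>s | y s \<noteq> 0. cnj (x s) * y s * weight s - cnj (?F i x s) * y s * weight s)"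
    by (rule sum.swap)
  also have "\<dots> = (\<Sum>i\<in>?I. inner_prod x y - inner_prod (?F i x) y)"
  proof (intro sum.cong refl)
    fix i
    have "inner_prod z y = (\<Sum>s | y s \<noteq> 0. cnj (z s) * y s * weight s)" for z
      by (rule inner_prod_superset[OF finY]) blast
    then show "(\<Sum>s | y s \<noteq> 0. cnj (x s) * y s * weight s - cnj (?F i x s) * y s * weight s)
      = inner_prod x y - inner_prod (?F i x) y" by (simp add: sum_subtractf)
  qed
  also have "\<dots> = (\<Sum>i\<in>?I. inner_prod x y - inner_prod x (?F i y))"
    by (intro sum.cong refl) (simp only: sym)
  also have "\<dots> = (\<Sum>i\<in>?I. \<Sum>s | x s \<noteq> 0. cnj (x s) * y s * weight s - cnj (x s) * ?F i y s * weight s)"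
  proof (intro sum.cong refl)
    fix i
    have "inner_prod x z = (\<Sum>s | x s \<noteq> 0. cnj (x s) * z s * weight s)" for z
      by (rule inner_prod_superset[OF finX]) blast
    then show "inner_prod x y - inner_prod x (?F i y)
      = (\<Sum>s | x s \<noteq> 0. cnj (x s) * y s * weight s - cnj (x s) * ?F i y s * weight s)" by (simp add: sum_subtractf)
  qed
  also have "\<dots> = (\<Sum>s | x s \<noteq> 0. \<Sum>i\<in>?I. cnj (x s) * y s * weight s - cnj (x s) * ?F i y s * weight s)"
    by (rule sum.swap)
  also have "\<dots> = (\<Sum>s | x s \<noteq> 0. cnj (x s) * hamiltonian \<Phi> y s * weight s)"
    unfolding Ham by (simp add: sum_distrib_left sum_distrib_right algebra_simps)
  also have "\<dots> = inner_prod x (hamiltonian \<Phi> y)"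
    by (rule inner_prod_superset[OF finX, symmetric]) blast
  finally show "inner_prod (hamiltonian \<Phi> x) y = inner_prod x (hamiltonian \<Phi> y)" .
qed

lemma hamiltonian_local:
  assumes \<Phi>: "admissible \<Phi>"
  shows "local_operator \<Phi> (hamiltonian \<Phi>)"
  unfolding local_operator_def
  by (rule exI[of _ "\<lambda>p x s. x s - B_op \<Phi> p x s"], rule exI[of _ "\<lambda>v x s. x s - Q_op v x s"])
    (simp add: B_op_supported[OF \<Phi>] Q_op_supported hamiltonian_def)

text \<open>
  Distinct natural numbers have distance at least 1.
\<close>

lemma gapped_of_nat_spectrum:
  assumes "spectrum \<Phi> F \<subseteq> \<nat>"
  shows "gapped \<Phi> F"
proof -
  have "1 \<le> dist z w" if "z \<in> \<nat>" "w \<in> \<nat>" "z \<noteq> w" for z w :: complex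
  proof -
    obtain m n where "z = of_nat m" "w = of_nat n" using \<open>z \<in> \<nat>\<close> \<open>w \<in> \<nat>\<close> by (auto elim!: Nats_cases)
    moreover from this have "m \<noteq> n" using that(3) by auto
    ultimately show ?thesis by (simp add: dist_of_nat)
  qed
  then show ?thesis unfolding gapped_def using assms by (intro exI[of _ 1]) auto
qed

end

theorem theorem2p6:
  fixes L :: "('g::ab_group_add, 'j) LW"
    and T :: "'v triangle set"
    and \<Phi> :: "'v \<times> 'v \<Rightarrow> 'g"
  defines "H \<equiv> LW_model.hamiltonian L T \<Phi>"
  assumes "LW_data L"
    and "triangulated_surface T"
    and "LW_model.admissible L T \<Phi>"
  shows "LW_model.linear_operator L T \<Phi> H \<and>
    LW_model.hermitian L T \<Phi> H \<and>
    LW_model.gapped L T \<Phi> H \<and>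
    LW_model.local_operator L T \<Phi> H \<and>
    LW_model.spectrum L T \<Phi> H \<subseteq> \<nat> \<and>
    {x \<in> LW_model.state_space L T \<Phi>. H x = (\<lambda>_. 0)} =
      {x \<in> LW_model.state_space L T \<Phi>.
        (\<forall>p \<in> plaquettes T. LW_model.B_op L T \<Phi> p x = x) \<and>
        (\<forall>v \<in> T. LW_model.Q_op L v x = x)}"
proof -
  interpret LW_surface L T
    using assms by (simp add: LW_surface_def)
  note \<Phi> = assms(4)
  show ?thesis
    unfolding H_def
    using hamiltonian_linear[OF \<Phi>] hamiltonian_hermitian[OF \<Phi>] hamiltonian_local[OF \<Phi>]
      gapped_of_nat_spectrum[OF spectrum_hamiltonian[OF \<Phi>]] spectrum_hamiltonian[OF \<Phi>]
      ground_states[OF \<Phi>]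
    by auto
qed

end
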